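(* Let $n\ge1$ be an integer, $\nu>n/2$ real, and $m\in\{0,1,\dots,[\nu-n/2]\}$, where $[x]$ denotes the greatest integer not exceeding $x$. The Berezin transform $\mathfrak{B}_m^{\nu,n}$ on $L^2(\mathbb{B}^n,(1-|\xi|^2)^{-n-1}d\mu)$, given by $$\mathfrak{B}_m^{\nu,n}[\varphi](z)=\frac{\Gamma(n)\,m!\,(2(\nu-m)-n)\,\Gamma(2\nu-m)}{n!\,\Gamma(n+m)\,\Gamma(2\nu-m-n+1)}\int_{\mathbb{B}^n}\frac{\Big(P_m^{(n-1,\,2(\nu-m)-n)}\big(1-2\tanh^2 d(z,\xi)\big)\Big)^2}{(\cosh d(z,\xi))^{4(\nu-m)}}\,\varphi(\xi)\,\frac{d\mu(\xi)}{(1-|\xi|^2)^{n+1}},$$ can be expressed as a function of the Laplace-Beltrami operator $\Delta_{\mathbb{B}^n}$ as $$\mathfrak{B}_m^{\nu,n}=\left|\Gamma\Big(2(\nu-m)-\tfrac n2+\tfrac i2\sqrt{-\Delta_{\mathbb{B}^n}-n^2}\Big)\right|^2\sum_{k=0}^{2m}\gamma_k^{\nu,n,m}\,W_k\Big(-\tfrac14\Delta_{\mathbb{B}^n}-\tfrac{n^2}{4};\,2(\nu-m)-\tfrac n2,\,1+\tfrac n2,\,\tfrac n2,\,\tfrac n2\Big),$$ where $W_k$ are the Wilson polynomials, $$\gamma_k^{\nu,n,m}=\frac{2\,m!\,\Gamma(n)\,(2(\nu-m)-n)\,\Gamma(2\nu-m)\,(-1)^k}{\Gamma(n+m)\,\Gamma(2\nu-m-n+1)\,k!\,\Gamma(2(\nu-m)+k)^2}\,A_k^{\nu,n,m},$$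 and $$A_k^{\nu,n,m}=\frac{(2(\nu-m)+n)_k\,(n)_{2m}\,(2k+2(\nu-m)+n)\,(-1)^k\,(2m)!\,\big((2(\nu-m))_{2m}\big)^2}{(n)_k\,(2(\nu-m)+n)_{2m+k+1}\,(m!)^2\,(2m-k)!\,\big((2(\nu-m))_m\big)^2}\;S_k^{\nu,n,m},$$ where $S_k^{\nu,n,m}$ is the terminating Kamp\'e de F\'eriet double hypergeometric sum (at arguments $1,1$) $$S_k^{\nu,n,m}=\sum_{\substack{0\le q,s\le m\\ q+s\le 2m-k}}\frac{(-2m+k)_{q+s}\,(-2\nu-k-n)_{q+s}}{(-2m)_{q+s}\,(-2m-n+1)_{q+s}}\cdot\frac{(-m)_q\,(-n-m+1)_q}{(1-2\nu)_q\,q!}\cdot\frac{(-m)_s\,(-n-m+1)_s}{(1-2\nu)_s\,s!}.$$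
   Context: $\mathbb{B}^n=\{z\in\mathbb{C}^n:|z|<1\}$, $\langle z,w\rangle=\sum_j z_j\overline{w_j}$, and $\mu$ is Lebesgue measure on $\mathbb{C}^n$ normalized so that $\mu(\mathbb{B}^n)=1$. The Bergman distance $d(z,w)\ge0$ is given by $$\cosh^2 d(z,w)=\frac{|1-\langle z,w\rangle|^2}{(1-|z|^2)(1-|w|^2)}.$$ The Laplace-Beltrami operator of the Bergman ball is $$\Delta_{\mathbb{B}^n}=4(1-|z|^2)\sum_{i,j=1}^n(\delta_{ij}-z_i\overline{z_j})\frac{\partial^2}{\partial z_i\partial\overline z_j},$$ regarded as a self-adjoint operator on $L^2(\mathbb{B}^n,(1-|z|^2)^{-n-1}d\mu)$; its spectrum is $(-\infty,-n^2]$. The identity between operators is in the sense of the spectral functional calculus: the right-hand side is $f(\Delta_{\mathbb{B}^n})$, where $f(-\lambda^2-n^2)$, $\lambda\ge0$, is obtained by replacing $\sqrt{-\Delta_{\mathbb{B}^n}-n^2}$ by $\lambda$ and $-\frac14\Delta_{\mathbb{B}^n}-\frac{n^2}4$ by $\frac14\lambda^2$. $P_k^{(\alpha,\beta)}$ are the Jacobi polynomials, with $P_k^{(\alpha,\beta)}(1)=\frac{\Gamma(k+\alpha+1)}{k!\,\Gamma(\alpha+1)}$. $(x)_s=x(x+1)\cdots(x+s-1)$ is the Pochhammer symbol, $(x)_0=1$. The Wilson polynomials are $$W_k(x^2;a,b,c,d)=(a+b)_k(a+c)_k(a+d)_k\;{}_4F_3\left(\begin{array}{c}-k,\;k+a+b+c+d-1,\;a+ix,\;a-ix\\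 a+b,\;a+c,\;a+d\end{array}\Big|\,1\right).$$
   Formalization: The leading factor 2 in γ_k^{ν,n,m} is dropped: with it the identity fails, e.g. for n=1, m=0, ν=1 the transform is a contraction, while the printed right-hand side takes the value π/2>1 at the spectral point −1. *)

theory Defs
  imports "HOL-Analysis.Analysis"
begin

subsection \<open>Unbounded operators on \<open>L\<^sup>2\<close> and their spectral calculus\<close>

text \<open>
  Elements of \<open>L\<^sup>2(M)\<close> are represented by functions, without forming the quotient by almost
  everywhere equality; operators are graphs, and all graphs below are saturated under almost
  everywhere equality. The inner product is linear in the first argument.
\<close>

definition L2 :: "'a measure \<Rightarrow> ('a \<Rightarrow> complex) set" where
  "L2 M = {\<phi>. \<phi> \<in> borel_measurable M \<and> integrable M (\<lambda>x. (cmod (\<phi> x))\<^sup>2)}"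

definition L2_inner :: "'a measure \<Rightarrow> ('a \<Rightarrow> complex) \<Rightarrow> ('a \<Rightarrow> complex) \<Rightarrow> complex" where
  "L2_inner M \<phi> \<psi> = (LINT x|M. \<phi> x * cnj (\<psi> x))"

definition L2_dist :: "'a measure \<Rightarrow> ('a \<Rightarrow> complex) \<Rightarrow> ('a \<Rightarrow> complex) \<Rightarrow> real" where
  "L2_dist M \<phi> \<psi> = sqrt (LINT x|M. (cmod (\<phi> x - \<psi> x))\<^sup>2)"

type_synonym 'a op_graph = "(('a \<Rightarrow> complex) \<times> ('a \<Rightarrow> complex)) set"

definition op_closure :: "'a measure \<Rightarrow> 'a op_graph \<Rightarrow> 'a op_graph" where
  "op_closure M G = {(\<phi>, \<psi>). \<phi> \<in> L2 M \<and> \<psi> \<in> L2 M \<and>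
     (\<exists>u v. (\<forall>k::nat. (u k, v k) \<in> G) \<and>
        (\<lambda>k. L2_dist M (u k) \<phi>) \<longlonglongrightarrow> 0 \<and> (\<lambda>k. L2_dist M (v k) \<psi>) \<longlonglongrightarrow> 0)}"

definition orth_projection :: "'a measure \<Rightarrow> (('a \<Rightarrow> complex) \<Rightarrow> ('a \<Rightarrow> complex)) \<Rightarrow> bool" where
  "orth_projection M P \<longleftrightarrow>
     (\<forall>\<phi>\<in>L2 M. P \<phi> \<in> L2 M \<and> (AE x in M. P (P \<phi>) x = P \<phi> x)) \<and>
     (\<forall>\<phi>\<in>L2 M. \<forall>\<psi>\<in>L2 M. L2_inner M (P \<phi>) \<psi> = L2_inner M \<phi> (P \<psi>))"

definition projection_valued_measure ::
    "'a measure \<Rightarrow> (real set \<Rightarrow> ('a \<Rightarrow> complex) \<Rightarrow> ('a \<Rightarrow> complex)) \<Rightarrow> bool" where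
  "projection_valued_measure M E \<longleftrightarrow>
     (\<forall>A\<in>sets borel. orth_projection M (E A)) \<and>
     (\<forall>\<phi>\<in>L2 M. (AE x in M. E {} \<phi> x = 0) \<and> (AE x in M. E UNIV \<phi> x = \<phi> x)) \<and>
     (\<forall>A\<in>sets borel. \<forall>B\<in>sets borel. \<forall>\<phi>\<in>L2 M. AE x in M. E A (E B \<phi>) x = E (A \<inter> B) \<phi> x) \<and>
     (\<forall>A::nat \<Rightarrow> real set. range A \<subseteq> sets borel \<longrightarrow> disjoint_family A \<longrightarrow>
        (\<forall>\<phi>\<in>L2 M. (\<lambda>N. L2_dist M (\<lambda>x. \<Sum>i<N. E (A i) \<phi> x) (E (\<Union>i. A i) \<phi>)) \<longlonglongrightarrow> 0))"

definition spectral_density ::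
    "'a measure \<Rightarrow> (real set \<Rightarrow> ('a \<Rightarrow> complex) \<Rightarrow> ('a \<Rightarrow> complex)) \<Rightarrow> ('a \<Rightarrow> complex) \<Rightarrow> real measure"
  where
  "spectral_density M E \<phi> = measure_of UNIV (sets borel) (\<lambda>A. ennreal (Re (L2_inner M (E A \<phi>) \<phi>)))"

definition spectral_domain ::
    "'a measure \<Rightarrow> (real set \<Rightarrow> ('a \<Rightarrow> complex) \<Rightarrow> ('a \<Rightarrow> complex)) \<Rightarrow> (real \<Rightarrow> complex)
      \<Rightarrow> ('a \<Rightarrow> complex) set" where
  "spectral_domain M E f =
     {\<phi> \<in> L2 M. integrable (spectral_density M E \<phi>) (\<lambda>t. (cmod (f t))\<^sup>2)}"

text \<open>
  The operator \<open>\<integral> f dE\<close>: it maps \<open>\<phi>\<close> in its domain to the \<open>\<psi>\<close> with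
  \<open>\<langle>\<psi>, \<eta>\<rangle> = \<integral> f(t) d\<langle>E(t) \<phi>, \<eta>\<rangle>\<close>, the complex measure on the right being obtained by
  polarization. It suffices to test against \<open>\<eta>\<close> in the (dense) domain; there all four
  integrals converge.
\<close>

definition spectral_integral ::
    "'a measure \<Rightarrow> (real set \<Rightarrow> ('a \<Rightarrow> complex) \<Rightarrow> ('a \<Rightarrow> complex)) \<Rightarrow> (real \<Rightarrow> complex) \<Rightarrow> 'a op_graph"
  where
  "spectral_integral M E f =
     {(\<phi>, \<psi>). \<phi> \<in> spectral_domain M E f \<and> \<psi> \<in> L2 M \<and>
        (\<forall>\<eta>\<in>spectral_domain M E f.
           L2_inner M \<psi> \<eta> =
             (\<Sum>k<(4::nat). \<i> ^ k * integral\<^sup>L (spectral_density M E (\<lambda>x. \<phi> x + \<i> ^ k * \<eta> x)) f) / 4)}"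

definition spectral_resolution ::
    "'a measure \<Rightarrow> 'a op_graph \<Rightarrow> (real set \<Rightarrow> ('a \<Rightarrow> complex) \<Rightarrow> ('a \<Rightarrow> complex)) \<Rightarrow> bool" where
  "spectral_resolution M T E \<longleftrightarrow>
     projection_valued_measure M E \<and> T = spectral_integral M E complex_of_real"


subsection \<open>The Bergman ball\<close>

definition herm :: "complex ^ 'n \<Rightarrow> complex ^ 'n \<Rightarrow> complex" where
  "herm z w = (\<Sum>j\<in>UNIV. z $ j * cnj (w $ j))"

definition mu :: "(complex ^ 'n) measure" where
  "mu = scale_measure (1 / emeasure lborel (ball (0 :: complex ^ 'n) 1)) lborel"

definition bergman_measure :: "(complex ^ 'n) measure" where
  "bergman_measure = density (restrict_space mu (ball 0 1))
     (\<lambda>z. ennreal (1 / (1 - (norm z)\<^sup>2) ^ (CARD('n) + 1)))"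

definition bergman_dist :: "complex ^ 'n \<Rightarrow> complex ^ 'n \<Rightarrow> real" where
  "bergman_dist z w =
     arcosh (sqrt ((cmod (1 - herm z w))\<^sup>2 / ((1 - (norm z)\<^sup>2) * (1 - (norm w)\<^sup>2))))"

definition dir_deriv :: "complex ^ 'n \<Rightarrow> (complex ^ 'n \<Rightarrow> complex) \<Rightarrow> complex ^ 'n \<Rightarrow> complex" where
  "dir_deriv v f z = frechet_derivative f (at z) v"

definition wirtinger :: "'n \<Rightarrow> (complex ^ 'n \<Rightarrow> complex) \<Rightarrow> complex ^ 'n \<Rightarrow> complex" where
  "wirtinger j f z = (dir_deriv (axis j 1) f z - \<i> * dir_deriv (axis j \<i>) f z) / 2"

definition wirtinger_bar :: "'n \<Rightarrow> (complex ^ 'n \<Rightarrow> complex) \<Rightarrow> complex ^ 'n \<Rightarrow> complex" where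
  "wirtinger_bar j f z = (dir_deriv (axis j 1) f z + \<i> * dir_deriv (axis j \<i>) f z) / 2"

definition laplace_beltrami :: "(complex ^ 'n \<Rightarrow> complex) \<Rightarrow> complex ^ 'n \<Rightarrow> complex" where
  "laplace_beltrami f z = 4 * (1 - (norm z)\<^sup>2) *
     (\<Sum>i\<in>UNIV. \<Sum>j\<in>UNIV. (of_bool (i = j) - z $ i * cnj (z $ j)) * wirtinger i (wirtinger_bar j f) z)"

text \<open>
  Compactly supported smooth functions on the ball, extended by zero. Smoothness (in the real
  sense) means that every iterated directional derivative is again differentiable.
\<close>

definition test_fun :: "(complex ^ 'n \<Rightarrow> complex) \<Rightarrow> bool" where
  "test_fun f \<longleftrightarrow> (\<forall>vs. foldr dir_deriv vs f differentiable_on UNIV) \<and>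
     closure {z. f z \<noteq> 0} \<subseteq> ball 0 1"

text \<open>
  The self-adjoint Laplace-Beltrami operator: the closure of its restriction to test functions
  (which is essentially self-adjoint, the Bergman metric being complete).
\<close>

definition laplace_beltrami_op :: "(complex ^ 'n) op_graph" where
  "laplace_beltrami_op = op_closure bergman_measure {(f, laplace_beltrami f) | f. test_fun f}"


subsection \<open>Special functions\<close>

definition jacobi :: "nat \<Rightarrow> real \<Rightarrow> real \<Rightarrow> real \<Rightarrow> real" where
  "jacobi k \<alpha> \<beta> x = Gamma (real k + \<alpha> + 1) / (fact k * Gamma (\<alpha> + 1)) *
     eval_fps (fps_hypergeo [- real k, real k + \<alpha> + \<beta> + 1] [\<alpha> + 1] 1) ((1 - x) / 2)"

text \<open>
  Here \<open>X\<close> plays the role of the variable \<open>x\<^sup>2\<close>; the value does not depend on the choice of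
  the square root of \<open>X\<close>.
\<close>

definition wilson :: "nat \<Rightarrow> complex \<Rightarrow> complex \<Rightarrow> complex \<Rightarrow> complex \<Rightarrow> complex \<Rightarrow> complex" where
  "wilson k X a b c d =
     pochhammer (a + b) k * pochhammer (a + c) k * pochhammer (a + d) k *
     eval_fps (fps_hypergeo
       [- of_nat k, of_nat k + a + b + c + d - 1, a + \<i> * csqrt X, a - \<i> * csqrt X]
       [a + b, a + c, a + d] 1) 1"


subsection \<open>The Berezin transform and its coefficients\<close>

definition berezin_const :: "real \<Rightarrow> nat \<Rightarrow> nat \<Rightarrow> real" where
  "berezin_const \<nu> n m =
     Gamma (real n) * fact m * (2 * (\<nu> - real m) - real n) * Gamma (2 * \<nu> - real m) /
     (fact n * Gamma (real n + real m) * Gamma (2 * \<nu> - real m - real n + 1))"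

definition berezin_integrand ::
    "real \<Rightarrow> nat \<Rightarrow> (complex ^ 'n \<Rightarrow> complex) \<Rightarrow> complex ^ 'n \<Rightarrow> complex ^ 'n \<Rightarrow> complex" where
  "berezin_integrand \<nu> m \<phi> z \<xi> =
     of_real ((jacobi m (real CARD('n) - 1) (2 * (\<nu> - real m) - real CARD('n))
                 (1 - 2 * (tanh (bergman_dist z \<xi>))\<^sup>2))\<^sup>2 /
              cosh (bergman_dist z \<xi>) powr (4 * (\<nu> - real m))) * \<phi> \<xi>"

definition berezin ::
    "real \<Rightarrow> nat \<Rightarrow> (complex ^ 'n \<Rightarrow> complex) \<Rightarrow> complex ^ 'n \<Rightarrow> complex" where
  "berezin \<nu> m \<phi> z =
     of_real (berezin_const \<nu> CARD('n) m) * (LINT \<xi>|bergman_measure. berezin_integrand \<nu> m \<phi> z \<xi>)"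

definition berezin_op :: "real \<Rightarrow> nat \<Rightarrow> (complex ^ 'n) op_graph" where
  "berezin_op \<nu> m = {(\<phi>, \<psi>). \<phi> \<in> L2 bergman_measure \<and> \<psi> \<in> L2 bergman_measure \<and>
     (AE z in bergman_measure.
        integrable bergman_measure (berezin_integrand \<nu> m \<phi> z) \<and> \<psi> z = berezin \<nu> m \<phi> z)}"

definition S_coeff :: "real \<Rightarrow> nat \<Rightarrow> nat \<Rightarrow> nat \<Rightarrow> real" where
  "S_coeff \<nu> n m k =
     (\<Sum>(q, s) \<in> {(q, s). q \<le> m \<and> s \<le> m \<and> q + s + k \<le> 2 * m}.
        (pochhammer (- 2 * real m + real k) (q + s) * pochhammer (- 2 * \<nu> - real k - real n) (q + s)) /
        (pochhammer (- 2 * real m) (q + s) * pochhammer (- 2 * real m - real n + 1) (q + s)) *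
        ((pochhammer (- real m) q * pochhammer (- real n - real m + 1) q) /
         (pochhammer (1 - 2 * \<nu>) q * fact q)) *
        ((pochhammer (- real m) s * pochhammer (- real n - real m + 1) s) /
         (pochhammer (1 - 2 * \<nu>) s * fact s)))"

definition A_coeff :: "real \<Rightarrow> nat \<Rightarrow> nat \<Rightarrow> nat \<Rightarrow> real" where
  "A_coeff \<nu> n m k =
     (pochhammer (2 * (\<nu> - real m) + real n) k * pochhammer (real n) (2 * m) *
      (2 * real k + 2 * (\<nu> - real m) + real n) * (-1) ^ k * fact (2 * m) *
      (pochhammer (2 * (\<nu> - real m)) (2 * m))\<^sup>2) /
     (pochhammer (real n) k * pochhammer (2 * (\<nu> - real m) + real n) (2 * m + k + 1) *
      (fact m)\<^sup>2 * fact (2 * m - k) * (pochhammer (2 * (\<nu> - real m)) m)\<^sup>2) *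
     S_coeff \<nu> n m k"

text \<open>
  In the literature this coefficient is printed with an additional factor \<open>2\<close>, which is an error: for
  \<open>n = 1\<close>, \<open>m = 0\<close>, \<open>\<nu> = 1\<close> the symmetric, nonnegative Berezin kernel has total mass \<open>1\<close>, so
  the transform is a contraction, while with the factor \<open>2\<close> the right-hand side of the theorem
  would be a continuous function of the Laplacian with value \<open>2 \<Gamma>(3/2)\<^sup>2 = \<pi>/2 > 1\<close> at the point
  \<open>-1\<close> of the spectrum.
\<close>

definition gamma_coeff :: "real \<Rightarrow> nat \<Rightarrow> nat \<Rightarrow> nat \<Rightarrow> real" where
  "gamma_coeff \<nu> n m k =
     (fact m * Gamma (real n) * (2 * (\<nu> - real m) - real n) * Gamma (2 * \<nu> - real m) * (-1) ^ k) /
     (Gamma (real n + real m) * Gamma (2 * \<nu> - real m - real n + 1) * fact k *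
      (Gamma (2 * (\<nu> - real m) + real k))\<^sup>2) *
     A_coeff \<nu> n m k"

end

theory Submission
  imports Defs
begin

text \<open>
  Let \<open>K\<^sub>s\<close> be the integral operator with kernel \<open>cosh\<^sup>-\<^sup>2\<^sup>s d(z, \<xi>)\<close>. The squared Jacobi polynomial is a
  polynomial in \<open>cosh\<^sup>-\<^sup>2 d\<close>, hence the Berezin transform is a linear combination of the operators
  \<open>K\<^sub>s\<close> with \<open>s = 2(\<nu> - m) + j\<close>, and the Wilson polynomials arise from
  \<open>\<bar>\<Gamma>(a + i x)\<bar>\<^sup>2 \<Prod>\<^sub>l\<^sub><\<^sub>j ((a + l)\<^sup>2 + x\<^sup>2) = \<bar>\<Gamma>(a + j + i x)\<bar>\<^sup>2\<close> once it is known that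
  \<open>K\<^sub>s = n! \<bar>\<Gamma>(s - n/2 + i \<lambda>/2)\<bar>\<^sup>2 / \<Gamma>(s)\<^sup>2\<close> with \<open>\<lambda>\<^sup>2 = - \<Delta> - n\<^sup>2\<close>.

  No harmonic analysis is needed for the latter. The kernel satisfies
  \<open>\<Delta> cosh\<^sup>-\<^sup>2\<^sup>s d = 4 s (s - n) cosh\<^sup>-\<^sup>2\<^sup>s d - 4 s\<^sup>2 cosh\<^sup>-\<^sup>2\<^sup>s\<^sup>-\<^sup>2 d\<close>, and so \<open>K\<^sub>s\<^sub>+\<^sub>1\<close> is \<open>K\<^sub>s\<close> times
  \<open>(4 s (s - n) - \<Delta>) / 4 s\<^sup>2\<close> in the functional calculus. Iterating, \<open>M\<^sup>n K\<^sub>s\<^sub>+\<^sub>M\<close> is \<open>K\<^sub>s\<close> times a product which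
  converges to \<open>\<Gamma>(s)\<^sup>2 / \<bar>\<Gamma>(s - n/2 + i \<lambda>/2)\<bar>\<^sup>2\<close>, whereas \<open>M\<^sup>n K\<^sub>s\<^sub>+\<^sub>M\<close> is an approximate identity with
  limit \<open>n!\<close>.
\<close>

section \<open>Hilbert space preliminaries\<close>

text \<open>Three obstacles shape the proof. First, \<open>K_s \<theta>\<close> is not shown to lie
  in the domain of the Laplacian, and \<open>K_s\<close> is not known beforehand to preserve
  square-integrability. So the relation between \<open>K_s\<close> and \<open>K_(s+1)\<close> is
  proved weakly, for \<theta> of compact support, and projected to bounded spectral windows, on
  which the Laplacian acts as a bounded function of itself; symmetry of the kernel extends the
  result to all \<phi> at the end. Second, the limit argument gives
  \<open>g_s(\<Delta>) K_s \<theta> = c \<theta>\<close> with the reciprocal symbol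
  \<open>g_s\<close>, and solving for \<open>K_s \<theta>\<close> requires \<open>g_s\<close> to be
  bounded away from zero on the spectrum. This holds on (-\<infinity>, -n^2], and that the spectrum
  lies there is itself a consequence: for \<tau> > -n^2 some \<open>g_s\<close> vanishes at \<tau>,
  while c \<theta> does not depend on s. Third, c is at first a function of the point, known to be
  n! only at the origin, because the argument never moves points by automorphisms of the ball; it is
  constant because multiplication by c commutes with \<open>K_s\<close>.\<close>

definition L2_norm :: "'a measure \<Rightarrow> ('a \<Rightarrow> complex) \<Rightarrow> real" where
  "L2_norm M \<phi> = sqrt (LINT x|M. (cmod (\<phi> x))\<^sup>2)"

lemma L2_dist_eq: "L2_dist M \<phi> \<psi> = L2_norm M (\<lambda>x. \<phi> x - \<psi> x)"
  by (simp add: L2_dist_def L2_norm_def)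

lemma L2_measurable: "\<phi> \<in> L2 M \<Longrightarrow> \<phi> \<in> borel_measurable M"
  by (simp add: L2_def)

lemma L2_integrable: "\<phi> \<in> L2 M \<Longrightarrow> integrable M (\<lambda>x. (cmod (\<phi> x))\<^sup>2)"
  by (simp add: L2_def)

lemma L2_norm_nonneg [simp]: "0 \<le> L2_norm M \<phi>"
  by (simp add: L2_norm_def)

lemma L2_norm_sq: "(L2_norm M \<phi>)\<^sup>2 = (LINT x|M. (cmod (\<phi> x))\<^sup>2)"
  by (simp add: L2_norm_def)

lemma cmod_add_sq_le: "(cmod (a + b))\<^sup>2 \<le> 2 * (cmod a)\<^sup>2 + 2 * (cmod b)\<^sup>2"
proof -
  have "(cmod (a + b))\<^sup>2 \<le> (cmod a + cmod b)\<^sup>2"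
    by (intro power_mono norm_triangle_ineq) auto
  also have "\<dots> \<le> 2 * (cmod a)\<^sup>2 + 2 * (cmod b)\<^sup>2"
    using zero_le_power2[of "cmod a - cmod b"] by (simp add: power2_eq_square algebra_simps)
  finally show ?thesis .
qed

lemma L2_zero [simp]: "(\<lambda>x. 0) \<in> L2 M"
  by (simp add: L2_def)

lemma L2_add:
  assumes "\<phi> \<in> L2 M" "\<psi> \<in> L2 M"
  shows "(\<lambda>x. \<phi> x + \<psi> x) \<in> L2 M"
proof -
  have [measurable]: "\<phi> \<in> borel_measurable M" "\<psi> \<in> borel_measurable M"
    using assms by (simp_all add: L2_def)
  have "integrable M (\<lambda>x. (cmod (\<phi> x + \<psi> x))\<^sup>2)"
  proof (rule Bochner_Integration.integrable_bound)
    show "integrable M (\<lambda>x. 2 * (cmod (\<phi> x))\<^sup>2 + 2 * (cmod (\<psi> x))\<^sup>2)"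
      using assms by (simp add: L2_def)
  qed (auto simp: cmod_add_sq_le)
  then show ?thesis by (simp add: L2_def)
qed

lemma L2_scale: "\<phi> \<in> L2 M \<Longrightarrow> (\<lambda>x. c * \<phi> x) \<in> L2 M"
  by (auto simp: L2_def norm_mult power_mult_distrib)

lemma L2_uminus: "\<phi> \<in> L2 M \<Longrightarrow> (\<lambda>x. - \<phi> x) \<in> L2 M"
  by (auto simp: L2_def)

lemma L2_diff: "\<phi> \<in> L2 M \<Longrightarrow> \<psi> \<in> L2 M \<Longrightarrow> (\<lambda>x. \<phi> x - \<psi> x) \<in> L2 M"
  using L2_add[OF _ L2_uminus, of \<phi> M \<psi>] by simp

lemma L2_sum: "(\<And>i. i \<in> I \<Longrightarrow> f i \<in> L2 M) \<Longrightarrow> (\<lambda>x. \<Sum>i\<in>I. f i x) \<in> L2 M"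
  by (induction I rule: infinite_finite_induct) (auto intro: L2_add)

lemma L2_lin: "\<phi> \<in> L2 M \<Longrightarrow> \<psi> \<in> L2 M \<Longrightarrow> (\<lambda>x. \<phi> x + c * \<psi> x) \<in> L2 M"
  by (intro L2_add L2_scale)

lemma L2_prod_integrable:
  assumes "\<phi> \<in> L2 M" "\<psi> \<in> L2 M"
  shows "integrable M (\<lambda>x. \<phi> x * \<psi> x)"
proof (rule Bochner_Integration.integrable_bound)
  have [measurable]: "\<phi> \<in> borel_measurable M" "\<psi> \<in> borel_measurable M"
    using assms by (simp_all add: L2_def)
  show "integrable M (\<lambda>x. (cmod (\<phi> x))\<^sup>2 + (cmod (\<psi> x))\<^sup>2)"
    using assms by (simp add: L2_def)
  show "(\<lambda>x. \<phi> x * \<psi> x) \<in> borel_measurable M" by measurable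
  have "cmod a * cmod b \<le> (cmod a)\<^sup>2 + (cmod b)\<^sup>2" for a b
    using sum_squares_bound[of "cmod a" "cmod b"] mult_nonneg_nonneg[OF norm_ge_zero norm_ge_zero, of a b]
    unfolding mult.assoc by linarith
  then show "AE x in M. norm (\<phi> x * \<psi> x) \<le> norm ((cmod (\<phi> x))\<^sup>2 + (cmod (\<psi> x))\<^sup>2)"
    by (simp add: norm_mult)
qed

lemma borel_measurable_cnj [measurable (raw)]:
  "f \<in> borel_measurable M \<Longrightarrow> (\<lambda>x. cnj (f x)) \<in> borel_measurable M"
  by (rule borel_measurable_continuous_on[OF continuous_on_cnj[OF continuous_on_id]])

lemma L2_cnj: "\<phi> \<in> L2 M \<Longrightarrow> (\<lambda>x. cnj (\<phi> x)) \<in> L2 M"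
  by (auto simp: L2_def)

lemma L2_inner_integrable:
  "\<phi> \<in> L2 M \<Longrightarrow> \<psi> \<in> L2 M \<Longrightarrow> integrable M (\<lambda>x. \<phi> x * cnj (\<psi> x))"
  by (intro L2_prod_integrable L2_cnj)

lemma L2_inner_add_left:
  "\<phi> \<in> L2 M \<Longrightarrow> \<psi> \<in> L2 M \<Longrightarrow> \<eta> \<in> L2 M \<Longrightarrow>
    L2_inner M (\<lambda>x. \<phi> x + \<psi> x) \<eta> = L2_inner M \<phi> \<eta> + L2_inner M \<psi> \<eta>"
  by (simp add: L2_inner_def distrib_right L2_inner_integrable)

lemma L2_inner_diff_left:
  "\<phi> \<in> L2 M \<Longrightarrow> \<psi> \<in> L2 M \<Longrightarrow> \<eta> \<in> L2 M \<Longrightarrow>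
    L2_inner M (\<lambda>x. \<phi> x - \<psi> x) \<eta> = L2_inner M \<phi> \<eta> - L2_inner M \<psi> \<eta>"
  by (simp add: L2_inner_def left_diff_distrib L2_inner_integrable)

lemma L2_inner_scale_left: "L2_inner M (\<lambda>x. c * \<phi> x) \<eta> = c * L2_inner M \<phi> \<eta>"
  by (simp add: L2_inner_def mult.assoc)

lemma L2_inner_cnj: "L2_inner M \<psi> \<phi> = cnj (L2_inner M \<phi> \<psi>)"
proof -
  have "cnj (L2_inner M \<phi> \<psi>) = (LINT x|M. cnj (\<phi> x * cnj (\<psi> x)))"
    unfolding L2_inner_def by (rule integral_bounded_linear'[OF bounded_linear_cnj bounded_linear_cnj, symmetric]) simp
  then show ?thesis by (simp add: L2_inner_def mult.commute)
qed

lemma L2_inner_scale_right: "L2_inner M \<phi> (\<lambda>x. c * \<eta> x) = cnj c * L2_inner M \<phi> \<eta>"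
  by (subst (1 2) L2_inner_cnj) (simp add: L2_inner_scale_left)

lemma L2_inner_add_right:
  "\<phi> \<in> L2 M \<Longrightarrow> \<psi> \<in> L2 M \<Longrightarrow> \<eta> \<in> L2 M \<Longrightarrow>
    L2_inner M \<eta> (\<lambda>x. \<phi> x + \<psi> x) = L2_inner M \<eta> \<phi> + L2_inner M \<eta> \<psi>"
  by (subst (1 2 3) L2_inner_cnj) (simp add: L2_inner_add_left)

lemma L2_inner_sum_left:
  "(\<And>i. i \<in> I \<Longrightarrow> f i \<in> L2 M) \<Longrightarrow> \<eta> \<in> L2 M \<Longrightarrow>
    L2_inner M (\<lambda>x. \<Sum>i\<in>I. f i x) \<eta> = (\<Sum>i\<in>I. L2_inner M (f i) \<eta>)"
  unfolding L2_inner_def sum_distrib_right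
  by (rule Bochner_Integration.integral_sum) (rule L2_inner_integrable)

lemma L2_inner_self: "L2_inner M \<phi> \<phi> = of_real ((L2_norm M \<phi>)\<^sup>2)"
proof -
  have "L2_inner M \<phi> \<phi> = (LINT x|M. of_real ((cmod (\<phi> x))\<^sup>2))"
    by (simp only: L2_inner_def complex_norm_square)
  also have "\<dots> = of_real (LINT x|M. (cmod (\<phi> x))\<^sup>2)"
    by (rule integral_complex_of_real)
  finally show ?thesis by (simp add: L2_norm_sq)
qed

lemma L2_inner_cong_AE:
  assumes "AE x in M. \<phi> x = \<phi>' x" "AE x in M. \<psi> x = \<psi>' x"
    "\<phi> \<in> borel_measurable M" "\<phi>' \<in> borel_measurable M"
    "\<psi> \<in> borel_measurable M" "\<psi>' \<in> borel_measurable M"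
  shows "L2_inner M \<phi> \<psi> = L2_inner M \<phi>' \<psi>'"
  unfolding L2_inner_def using assms
  by (intro integral_cong_AE borel_measurable_times
      borel_measurable_cnj) auto

lemma L2_inner_le_sum:
  assumes "\<phi> \<in> L2 M" "\<psi> \<in> L2 M"
  shows "2 * cmod (L2_inner M \<phi> \<psi>) \<le> (L2_norm M \<phi>)\<^sup>2 + (L2_norm M \<psi>)\<^sup>2"
proof -
  have "cmod (L2_inner M \<phi> \<psi>) \<le> (LINT x|M. cmod (\<phi> x * cnj (\<psi> x)))"
    unfolding L2_inner_def by (rule integral_norm_bound)
  also have "\<dots> \<le> (LINT x|M. ((cmod (\<phi> x))\<^sup>2 + (cmod (\<psi> x))\<^sup>2) / 2)"
  proof (rule integral_mono)
    show "integrable M (\<lambda>x. cmod (\<phi> x * cnj (\<psi> x)))"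
      using L2_inner_integrable[OF assms] by simp
    show "integrable M (\<lambda>x. ((cmod (\<phi> x))\<^sup>2 + (cmod (\<psi> x))\<^sup>2) / 2)"
      using assms by (simp add: L2_def)
    show "cmod (\<phi> x * cnj (\<psi> x)) \<le> ((cmod (\<phi> x))\<^sup>2 + (cmod (\<psi> x))\<^sup>2) / 2" for x
      using sum_squares_bound[of "cmod (\<phi> x)" "cmod (\<psi> x)"] by (simp add: norm_mult)
  qed
  also have "\<dots> = ((L2_norm M \<phi>)\<^sup>2 + (L2_norm M \<psi>)\<^sup>2) / 2"
    using assms by (simp add: L2_norm_sq L2_def)
  finally show ?thesis by simp
qed

lemma L2_norm_scale: "L2_norm M (\<lambda>x. c * \<phi> x) = cmod c * L2_norm M \<phi>"
  by (simp add: L2_norm_def norm_mult power_mult_distrib real_sqrt_mult)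

lemma L2_norm_0_imp_AE:
  assumes "\<phi> \<in> L2 M" "L2_norm M \<phi> = 0"
  shows "AE x in M. \<phi> x = 0"
proof -
  have "(LINT x|M. (cmod (\<phi> x))\<^sup>2) = 0" using assms(2) by (simp add: L2_norm_def)
  then show ?thesis
    using integral_nonneg_eq_0_iff_AE[OF L2_integrable[OF assms(1)]] by simp
qed

lemma L2_inner_zero_left: "L2_inner M (\<lambda>x. 0) \<eta> = 0"
  by (simp add: L2_inner_def)

text \<open>After normalizing both arguments this is the arithmetic-geometric bound of
  \<open>L2_inner_le_sum\<close>. A function of norm zero need not be the zero function, so that
  case goes through equality almost everywhere.\<close>

lemma L2_Cauchy_Schwarz:
  assumes "\<phi> \<in> L2 M" "\<psi> \<in> L2 M"
  shows "cmod (L2_inner M \<phi> \<psi>) \<le> L2_norm M \<phi> * L2_norm M \<psi>"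
proof -
  have zero: "L2_inner M f g = 0" if "f \<in> L2 M" "g \<in> L2 M" "L2_norm M f = 0" for f g
  proof -
    have "L2_inner M f g = L2_inner M (\<lambda>x. 0) g"
      using that L2_norm_0_imp_AE[of f M] by (intro L2_inner_cong_AE) (auto simp: L2_measurable)
    then show ?thesis by (simp add: L2_inner_zero_left)
  qed
  consider "L2_norm M \<phi> = 0" | "L2_norm M \<psi> = 0" | "L2_norm M \<phi> > 0" "L2_norm M \<psi> > 0"
    using L2_norm_nonneg[of M \<phi>] L2_norm_nonneg[of M \<psi>] by linarith
  then show ?thesis
  proof cases
    case 1
    then show ?thesis using zero[OF assms] by simp
  next
    case 2
    then show ?thesis using zero[OF assms(2,1)] L2_inner_cnj[of M \<phi> \<psi>] by simp
  next
    case 3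
    define a where "a = L2_norm M \<phi>"
    define b where "b = L2_norm M \<psi>"
    have ab: "a > 0" "b > 0" using 3 by (auto simp: a_def b_def)
    have "L2_inner M (\<lambda>x. of_real (1 / a) * \<phi> x) (\<lambda>x. of_real (1 / b) * \<psi> x) =
        of_real (1 / (a * b)) * L2_inner M \<phi> \<psi>"
      by (simp only: L2_inner_scale_left L2_inner_scale_right) simp
    moreover have "2 * cmod (L2_inner M (\<lambda>x. of_real (1 / a) * \<phi> x) (\<lambda>x. of_real (1 / b) * \<psi> x)) \<le>
        (1 / a * a)\<^sup>2 + (1 / b * b)\<^sup>2"
      using L2_inner_le_sum[OF L2_scale[OF assms(1)] L2_scale[OF assms(2)], of "of_real (1/a)" "of_real (1/b)"] ab
      by (simp only: L2_norm_scale a_def[symmetric] b_def[symmetric] norm_of_real) simp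
    ultimately have "2 * cmod (of_real (1 / (a * b)) * L2_inner M \<phi> \<psi>) \<le> 2"
      using ab by (simp only:) simp
    then have "1 / (a * b) * cmod (L2_inner M \<phi> \<psi>) \<le> 1"
      using ab by (simp add: norm_mult norm_divide field_simps)
    then have "cmod (L2_inner M \<phi> \<psi>) \<le> a * b" using ab by (simp add: field_simps)
    then show ?thesis by (simp add: a_def b_def)
  qed
qed

lemma L2_norm_triangle:
  assumes "\<phi> \<in> L2 M" "\<psi> \<in> L2 M"
  shows "L2_norm M (\<lambda>x. \<phi> x + \<psi> x) \<le> L2_norm M \<phi> + L2_norm M \<psi>"
proof (rule power2_le_imp_le)
  have "of_real ((L2_norm M (\<lambda>x. \<phi> x + \<psi> x))\<^sup>2) =
      of_real ((L2_norm M \<phi>)\<^sup>2) + of_real ((L2_norm M \<psi>)\<^sup>2) + (L2_inner M \<phi> \<psi> + cnj (L2_inner M \<phi> \<psi>))"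
    using assms
    by (simp only: L2_inner_self[symmetric] L2_inner_add_left L2_inner_add_right L2_add
        L2_inner_cnj[of M \<psi> \<phi>]) simp
  also have "\<dots> = of_real ((L2_norm M \<phi>)\<^sup>2 + (L2_norm M \<psi>)\<^sup>2 + 2 * Re (L2_inner M \<phi> \<psi>))"
    by (simp add: complex_add_cnj)
  finally have "(L2_norm M (\<lambda>x. \<phi> x + \<psi> x))\<^sup>2 = (L2_norm M \<phi>)\<^sup>2 + (L2_norm M \<psi>)\<^sup>2 + 2 * Re (L2_inner M \<phi> \<psi>)"
    using of_real_eq_iff by blast
  also have "\<dots> \<le> (L2_norm M \<phi>)\<^sup>2 + (L2_norm M \<psi>)\<^sup>2 + 2 * (L2_norm M \<phi> * L2_norm M \<psi>)"
    using L2_Cauchy_Schwarz[OF assms] complex_Re_le_cmod[of "L2_inner M \<phi> \<psi>"] by linarith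
  finally show "(L2_norm M (\<lambda>x. \<phi> x + \<psi> x))\<^sup>2 \<le> (L2_norm M \<phi> + L2_norm M \<psi>)\<^sup>2"
    by (simp add: power2_sum)
qed simp

lemma L2_inner_tendsto_left:
  assumes "\<And>k. u k \<in> L2 M" "\<phi> \<in> L2 M" "\<eta> \<in> L2 M" "(\<lambda>k. L2_dist M (u k) \<phi>) \<longlonglongrightarrow> 0"
  shows "(\<lambda>k. L2_inner M (u k) \<eta>) \<longlonglongrightarrow> L2_inner M \<phi> \<eta>"
proof -
  have "(\<lambda>k. L2_inner M (u k) \<eta> - L2_inner M \<phi> \<eta>) \<longlonglongrightarrow> 0"
  proof (rule Lim_null_comparison)
    show "\<forall>\<^sub>F k in sequentially. norm (L2_inner M (u k) \<eta> - L2_inner M \<phi> \<eta>) \<le> L2_dist M (u k) \<phi> * L2_norm M \<eta>"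
      using assms L2_Cauchy_Schwarz[OF L2_diff, of _ M \<phi> \<eta>]
      by (auto simp: L2_inner_diff_left[symmetric] L2_dist_eq)
    show "(\<lambda>k. L2_dist M (u k) \<phi> * L2_norm M \<eta>) \<longlonglongrightarrow> 0"
      using tendsto_mult_left_zero[OF assms(4)] .
  qed
  then show ?thesis by (rule LIM_zero_cancel)
qed

lemma L2_inner_tendsto_right:
  assumes "\<And>k. u k \<in> L2 M" "\<phi> \<in> L2 M" "\<eta> \<in> L2 M" "(\<lambda>k. L2_dist M (u k) \<phi>) \<longlonglongrightarrow> 0"
  shows "(\<lambda>k. L2_inner M \<eta> (u k)) \<longlonglongrightarrow> L2_inner M \<eta> \<phi>"
  using tendsto_cnj[OF L2_inner_tendsto_left[OF assms]] by (simp add: L2_inner_cnj[symmetric])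

text \<open>Riesz-Fischer, for representatives. Along a subsequence with increments below
  \<open>(1/2)^k\<close> the sum of the absolute increments has finite norm, so the subsequence
  converges almost everywhere; Fatou then bounds the distance from every late term of the full
  sequence to the limit.\<close>

lemma L2_complete:
  assumes u: "\<And>k. u k \<in> L2 M"
    and Cauchy: "\<And>e. 0 < e \<Longrightarrow> \<exists>K. \<forall>i\<ge>K. \<forall>j\<ge>K. L2_dist M (u i) (u j) < (e::real)"
  shows "\<exists>\<phi>\<in>L2 M. (\<lambda>k. L2_dist M (u k) \<phi>) \<longlonglongrightarrow> 0"
proof -
  have um [measurable]: "u k \<in> borel_measurable M" for k using u by (rule L2_measurable)
  have "\<exists>K. \<forall>k. \<forall>i\<ge>K k. \<forall>j\<ge>K k. L2_dist M (u i) (u j) < (1 / 2) ^ k"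
    using Cauchy by (intro choice allI) simp
  then obtain K where K: "\<And>k i j. i \<ge> K k \<Longrightarrow> j \<ge> K k \<Longrightarrow> L2_dist M (u i) (u j) < (1 / 2) ^ k"
    by blast
  \<comment> \<open>Summing the indices makes the subsequence nondecreasing while keeping
    \<open>r k \<ge> K k\<close>.\<close>
  define r where "r k = (\<Sum>i\<le>k. K i)" for k
  have r: "r k \<ge> K k" for k unfolding r_def by (rule member_le_sum) auto
  have rmono: "r k \<le> r (Suc k)" for k by (simp add: r_def)
  define v where "v k = u (r k)" for k
  have v: "v k \<in> L2 M" for k by (simp add: v_def u)
  have vm [measurable]: "v k \<in> borel_measurable M" for k by (simp add: v_def)
  have vd: "L2_norm M (\<lambda>x. v (Suc k) x - v k x) \<le> (1 / 2) ^ k" for k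
    using K[of k "r (Suc k)" "r k"] r[of k] rmono[of k] by (simp add: v_def L2_dist_eq)
  define g where "g N x = (\<Sum>k<N. cmod (v (Suc k) x - v k x))" for N x
  have gm [measurable]: "g N \<in> borel_measurable M" for N unfolding g_def by measurable
  have gL: "(\<lambda>x. complex_of_real (g N x)) \<in> L2 M \<and> L2_norm M (\<lambda>x. complex_of_real (g N x)) \<le> (\<Sum>k<N. (1/2)^k)" for N
  proof (induction N)
    case 0
    then show ?case by (simp add: g_def L2_norm_def)
  next
    case (Suc N)
    let ?w = "\<lambda>x. complex_of_real (cmod (v (Suc N) x - v N x))"
    have "(\<lambda>x. v (Suc N) x - v N x) \<in> L2 M" using v by (simp add: L2_diff)
    then have w: "?w \<in> L2 M" by (simp add: L2_def)
    have "L2_norm M ?w \<le> (1/2)^N" using vd[of N] by (simp add: L2_norm_def)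
    moreover have "L2_norm M (\<lambda>x. complex_of_real (g N x) + ?w x) \<le> L2_norm M (\<lambda>x. complex_of_real (g N x)) + L2_norm M ?w"
      using Suc w by (intro L2_norm_triangle) auto
    moreover have "(\<lambda>x. complex_of_real (g N x) + ?w x) \<in> L2 M" using Suc w by (intro L2_add) auto
    ultimately show ?case using Suc by (simp add: g_def)
  qed
  have gb: "L2_norm M (\<lambda>x. complex_of_real (g N x)) \<le> 2" for N
  proof -
    have "(\<Sum>k<N. (1/2::real)^k) \<le> (\<Sum>k. (1/2)^k)"
      by (rule sum_le_suminf) (auto simp: summable_geometric)
    then show ?thesis using gL[of N] by (simp add: suminf_geometric)
  qed
  have "(\<integral>\<^sup>+x. (SUP N. ennreal ((g N x)\<^sup>2)) \<partial>M) = (SUP N. \<integral>\<^sup>+x. ennreal ((g N x)\<^sup>2) \<partial>M)"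
  proof (rule nn_integral_monotone_convergence_SUP)
    show "incseq (\<lambda>N x. ennreal ((g N x)\<^sup>2))"
      by (intro incseq_SucI le_funI ennreal_leI power_mono) (auto simp: g_def intro: sum_nonneg)
  qed measurable
  also have "\<dots> \<le> 4"
  proof (rule SUP_least)
    fix N
    have "(\<integral>\<^sup>+x. ennreal ((g N x)\<^sup>2) \<partial>M) = ennreal (LINT x|M. (g N x)\<^sup>2)"
      using gL[of N] by (intro nn_integral_eq_integral) (auto simp: L2_def)
    also have "(LINT x|M. (g N x)\<^sup>2) = (L2_norm M (\<lambda>x. complex_of_real (g N x)))\<^sup>2"
      by (simp add: L2_norm_sq)
    also have "ennreal \<dots> \<le> ennreal (2\<^sup>2)"
      using gb[of N] by (intro ennreal_leI power_mono) auto
    finally show "(\<integral>\<^sup>+x. ennreal ((g N x)\<^sup>2) \<partial>M) \<le> 4" by simp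
  qed
  finally have fin: "(\<integral>\<^sup>+x. (SUP N. ennreal ((g N x)\<^sup>2)) \<partial>M) \<le> 4" .
  have "AE x in M. (SUP N. ennreal ((g N x)\<^sup>2)) \<noteq> \<infinity>"
    using fin by (intro nn_integral_PInf_AE) (auto simp: top_unique)
  moreover have "convergent (\<lambda>k. v k x)" if "(SUP N. ennreal ((g N x)\<^sup>2)) \<noteq> \<infinity>" for x
  proof -
    from that obtain C where C: "(SUP N. ennreal ((g N x)\<^sup>2)) = ennreal C" "C \<ge> 0"
      by (metis ennreal_cases infinity_ennreal_def)
    have "(g N x)\<^sup>2 \<le> C" for N
    proof -
      have "ennreal ((g N x)\<^sup>2) \<le> ennreal C" unfolding C(1)[symmetric] by (rule SUP_upper) simp
      then show ?thesis using C(2) by simp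
    qed
    then have "g N x \<le> sqrt C" for N
      using real_le_rsqrt by blast
    then have "(\<Sum>k\<le>N. cmod (v (Suc k) x - v k x)) \<le> sqrt C" for N
      unfolding g_def lessThan_Suc_atMost[symmetric] by blast
    then have "summable (\<lambda>k. cmod (v (Suc k) x - v k x))"
      by (intro bounded_imp_summable[of _ "sqrt C"]) auto
    then have "summable (\<lambda>k. v (Suc k) x - v k x)" by (rule summable_norm_cancel)
    then have "convergent (\<lambda>N. \<Sum>k<N. v (Suc k) x - v k x)"
      by (simp add: summable_iff_convergent)
    then have "convergent (\<lambda>N. v N x - v 0 x)" by (simp only: sum_lessThan_telescope[of "\<lambda>k. v k x"])
    then have "convergent (\<lambda>N. v N x - v 0 x + v 0 x)" by (intro convergent_add convergent_const)
    then show "convergent (\<lambda>N. v N x)" by simp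
  qed
  ultimately have conv: "AE x in M. convergent (\<lambda>k. v k x)"
    by (rule eventually_mono)
  define \<phi> where "\<phi> x = lim (\<lambda>k. v k x)" for x
  have \<phi>m [measurable]: "\<phi> \<in> borel_measurable M" unfolding \<phi>_def by measurable
  have lim: "AE x in M. (\<lambda>k. v k x) \<longlonglongrightarrow> \<phi> x"
    using conv by (simp add: convergent_LIMSEQ_iff \<phi>_def)
  have fatou: "(\<integral>\<^sup>+x. ennreal ((cmod (u i x - \<phi> x))\<^sup>2) \<partial>M) \<le> ennreal (((1/2) ^ k)\<^sup>2)"
    if "i \<ge> r k" for i k
  proof -
    have "(\<integral>\<^sup>+x. ennreal ((cmod (u i x - \<phi> x))\<^sup>2) \<partial>M) =
        (\<integral>\<^sup>+x. liminf (\<lambda>j. ennreal ((cmod (u i x - v j x))\<^sup>2)) \<partial>M)"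
    proof (rule nn_integral_cong_AE, rule AE_mp[OF lim], intro AE_I2 impI)
      fix x assume "(\<lambda>k. v k x) \<longlonglongrightarrow> \<phi> x"
      then have "(\<lambda>j. ennreal ((cmod (u i x - v j x))\<^sup>2)) \<longlonglongrightarrow> ennreal ((cmod (u i x - \<phi> x))\<^sup>2)"
        by (intro tendsto_intros) auto
      then show "ennreal ((cmod (u i x - \<phi> x))\<^sup>2) = liminf (\<lambda>j. ennreal ((cmod (u i x - v j x))\<^sup>2))"
        by (rule lim_imp_Liminf[OF sequentially_bot, symmetric])
    qed
    also have "\<dots> \<le> liminf (\<lambda>j. \<integral>\<^sup>+x. ennreal ((cmod (u i x - v j x))\<^sup>2) \<partial>M)"
      by (rule nn_integral_liminf) measurable
    also have "\<dots> \<le> ennreal (((1/2) ^ k)\<^sup>2)"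
    proof (rule Liminf_le)
      show "\<forall>\<^sub>F j in sequentially. (\<integral>\<^sup>+x. ennreal ((cmod (u i x - v j x))\<^sup>2) \<partial>M) \<le> ennreal (((1/2) ^ k)\<^sup>2)"
      proof (rule eventually_sequentiallyI[of k])
        fix j assume "k \<le> j"
        then have "K k \<le> r j"
          by (intro le_trans[OF r] lift_Suc_mono_le[of r, OF rmono])
        moreover have "K k \<le> i" using r[of k] that by (rule le_trans)
        ultimately have "L2_dist M (u i) (v j) \<le> (1/2)^k"
          unfolding v_def using less_imp_le[OF K] by blast
        moreover have "(\<integral>\<^sup>+x. ennreal ((cmod (u i x - v j x))\<^sup>2) \<partial>M) = ennreal ((L2_dist M (u i) (v j))\<^sup>2)"
          unfolding L2_dist_eq L2_norm_sq using L2_integrable[OF L2_diff[OF u[of i] v[of j]]]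
          by (intro nn_integral_eq_integral) simp_all
        ultimately show "(\<integral>\<^sup>+x. ennreal ((cmod (u i x - v j x))\<^sup>2) \<partial>M) \<le> ennreal (((1/2) ^ k)\<^sup>2)"
          using L2_norm_nonneg[of M "\<lambda>x. u i x - v j x"]
          by (simp only: L2_dist_eq) (intro ennreal_leI power_mono)
      qed
    qed simp
    finally show ?thesis .
  qed
  have dL: "(\<lambda>x. u i x - \<phi> x) \<in> L2 M \<and> L2_dist M (u i) \<phi> \<le> (1/2)^k" if "i \<ge> r k" for i k
  proof
    have "integrable M (\<lambda>x. (cmod (u i x - \<phi> x))\<^sup>2)"
      using le_less_trans[OF fatou[OF that] ennreal_less_top]
      by (intro integrableI_nonneg) auto
    then show *: "(\<lambda>x. u i x - \<phi> x) \<in> L2 M" by (simp add: L2_def)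
    have "ennreal ((L2_dist M (u i) \<phi>)\<^sup>2) \<le> ennreal (((1/2) ^ k)\<^sup>2)"
      using fatou[OF that] nn_integral_eq_integral[OF L2_integrable[OF *]]
      unfolding L2_dist_eq L2_norm_sq by simp
    then show "L2_dist M (u i) \<phi> \<le> (1/2)^k"
      by (metis ennreal_le_iff power2_le_imp_le zero_le_power2 half_gt_zero_iff zero_less_one zero_le_power less_imp_le)
  qed
  have "\<phi> \<in> L2 M" using L2_diff[OF u[of "r 0"] conjunct1[OF dL[of 0 "r 0"]]] by simp
  moreover have "(\<lambda>k. L2_dist M (u k) \<phi>) \<longlonglongrightarrow> 0"
  proof (rule LIMSEQ_I)
    fix e :: real assume "e > 0"
    then obtain k where k: "(1/2::real)^k < e" using real_arch_pow_inv[of e "1/2"] by auto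
    show "\<exists>n0. \<forall>n\<ge>n0. norm (L2_dist M (u n) \<phi> - 0) < e"
      using dL[of k] k by (intro exI[of _ "r k"]) (force simp: L2_dist_eq)
  qed
  ultimately show ?thesis by blast
qed

section \<open>Bounded Borel functional calculus\<close>

definition bounded_borel :: "(real \<Rightarrow> complex) \<Rightarrow> bool" where
  "bounded_borel f \<longleftrightarrow> f \<in> borel_measurable borel \<and> (\<exists>C. \<forall>t. cmod (f t) \<le> C)"

lemma bounded_borelI: "f \<in> borel_measurable borel \<Longrightarrow> (\<And>t. cmod (f t) \<le> C) \<Longrightarrow> bounded_borel f"
  by (auto simp: bounded_borel_def)

lemma bounded_borel_measurable: "bounded_borel f \<Longrightarrow> f \<in> borel_measurable borel"
  by (simp add: bounded_borel_def)

lemma bounded_borel_indicator: "A \<in> sets borel \<Longrightarrow> bounded_borel (indicator A)"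
  by (rule bounded_borelI[of _ 1]) (auto simp: indicator_def)

lemma bounded_borel_const: "bounded_borel (\<lambda>t. c)"
  by (rule bounded_borelI[of _ "cmod c"]) auto

lemma bounded_borel_add:
  assumes "bounded_borel f" "bounded_borel g"
  shows "bounded_borel (\<lambda>t. f t + g t)"
proof -
  obtain C D where "\<And>t. cmod (f t) \<le> C" "\<And>t. cmod (g t) \<le> D"
    using assms by (auto simp: bounded_borel_def)
  then show ?thesis using assms
    by (intro bounded_borelI[of _ "C + D"])
      (auto simp: bounded_borel_def intro!: norm_triangle_le add_mono)
qed

lemma bounded_borel_mult:
  assumes "bounded_borel f" "bounded_borel g"
  shows "bounded_borel (\<lambda>t. f t * g t)"
proof -
  obtain C D where CD: "\<And>t. cmod (f t) \<le> C" "\<And>t. cmod (g t) \<le> D"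
    using assms by (auto simp: bounded_borel_def)
  have "0 \<le> C" using order_trans[OF norm_ge_zero CD(1)] .
  then show ?thesis using assms CD
    by (intro bounded_borelI[of _ "C * D"])
      (auto simp: bounded_borel_def norm_mult intro!: mult_mono)
qed

lemma bounded_borel_scale: "bounded_borel f \<Longrightarrow> bounded_borel (\<lambda>t. c * f t)"
  by (intro bounded_borel_mult bounded_borel_const)

lemma bounded_borel_cnj: "bounded_borel f \<Longrightarrow> bounded_borel (\<lambda>t. cnj (f t))"
  by (auto simp: bounded_borel_def)

lemma bounded_borel_sum: "(\<And>i. i \<in> I \<Longrightarrow> bounded_borel (f i)) \<Longrightarrow> bounded_borel (\<lambda>t. \<Sum>i\<in>I. f i t)"
  by (induction I rule: infinite_finite_induct) (auto intro: bounded_borel_add bounded_borel_const)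

text \<open>Pointwise limits under a common bound are the right closure condition because integrals
  over the finite spectral measures below are continuous along them. The case \<open>lin\<close>
  covers sums and multiples together.\<close>

lemma bounded_borel_induct [consumes 1, case_names indicator lin lim]:
  assumes f: "bounded_borel f"
    and ind: "\<And>A. A \<in> sets borel \<Longrightarrow> P (indicator A)"
    and lin: "\<And>f g c. bounded_borel f \<Longrightarrow> bounded_borel g \<Longrightarrow> P f \<Longrightarrow> P g \<Longrightarrow> P (\<lambda>t. f t + c * g t)"
    and lim: "\<And>s f C. (\<And>i::nat. bounded_borel (s i)) \<Longrightarrow> (\<And>i. P (s i)) \<Longrightarrow> (\<And>i t. cmod (s i t) \<le> C) \<Longrightarrow>
      (\<And>t. (\<lambda>i. s i t) \<longlonglongrightarrow> f t) \<Longrightarrow> bounded_borel f \<Longrightarrow> P f"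
  shows "P f"
proof -
  obtain C where C: "\<And>t. cmod (f t) \<le> C" using f by (auto simp: bounded_borel_def)
  obtain s where s: "\<And>i. simple_function borel (s i)" "\<And>x. (\<lambda>i. s i x) \<longlonglongrightarrow> f x"
    "\<And>i x. dist (s i x) 0 \<le> 2 * dist (f x) 0"
    using borel_measurable_implies_sequence_metric[OF bounded_borel_measurable[OF f], of 0] by auto
  \<comment> \<open>The factor 2 is the one in the approximation by simple functions.\<close>
  have sC: "cmod (s i t) \<le> 2 * C" for i t
    using s(3)[of i t] C[of t] by simp
  have zero: "P (\<lambda>t. 0)"
  proof -
    have "P (indicator {})" by (rule ind) simp
    moreover have "(indicator {} :: real \<Rightarrow> complex) = (\<lambda>t. 0)" by auto
    ultimately show ?thesis by simp
  qed
  have sums: "P (\<lambda>t. \<Sum>y\<in>Y. y * indicator (A y) t)" if "finite Y" "\<And>y. A y \<in> sets borel" for Y A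
    using that(1)
  proof (induction Y)
    case (insert y Y)
    have "P (\<lambda>t. (\<Sum>y\<in>Y. y * indicator (A y) t) + y * indicator (A y) t)"
      using insert that(2)
      by (intro lin ind bounded_borel_sum bounded_borel_scale bounded_borel_indicator) auto
    then show ?case by (simp only: sum.insert[OF insert.hyps] add.commute)
  qed (use zero in simp)
  show ?thesis
  proof (rule lim[of s "2 * C"])
    fix i
    show "bounded_borel (s i)"
      using s(1) sC by (intro bounded_borelI[of _ "2 * C"] borel_measurable_simple_function) auto
    have "s i = (\<lambda>t. \<Sum>y\<in>range (s i). y * indicator (s i -` {y}) t)"
    proof (rule ext)
      fix t
      have "(\<Sum>y\<in>range (s i). y * indicator (s i -` {y}) t) = (\<Sum>y\<in>{s i t}. y * indicator (s i -` {y}) t)"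
        using s(1)[of i] by (intro sum.mono_neutral_right) (auto simp: simple_function_def)
      then show "s i t = (\<Sum>y\<in>range (s i). y * indicator (s i -` {y}) t)" by simp
    qed
    moreover have "P (\<lambda>t. \<Sum>y\<in>range (s i). y * indicator (s i -` {y}) t)"
    proof (rule sums)
      show "finite (range (s i))" using s(1)[of i] by (simp add: simple_function_def)
      show "s i -` {y} \<in> sets borel" for y
        using measurable_sets[OF borel_measurable_simple_function[OF s(1)], of "{y}" i] by simp
    qed
    ultimately show "P (s i)" by (rule ssubst[where P = P])
  qed (use s sC f in auto)
qed

section \<open>Scalar spectral measures of a projection-valued measure\<close>

locale pvm =
  fixes M :: "'a measure" and E :: "real set \<Rightarrow> ('a \<Rightarrow> complex) \<Rightarrow> 'a \<Rightarrow> complex"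
  assumes pvm: "projection_valued_measure M E"
begin

lemma E_L2: "A \<in> sets borel \<Longrightarrow> \<phi> \<in> L2 M \<Longrightarrow> E A \<phi> \<in> L2 M"
  using pvm by (auto simp: projection_valued_measure_def orth_projection_def)

lemma E_sym: "A \<in> sets borel \<Longrightarrow> \<phi> \<in> L2 M \<Longrightarrow> \<psi> \<in> L2 M \<Longrightarrow>
    L2_inner M (E A \<phi>) \<psi> = L2_inner M \<phi> (E A \<psi>)"
  using pvm by (auto simp: projection_valued_measure_def orth_projection_def)

text \<open>The axioms of \<open>projection_valued_measure\<close> give equalities almost
  everywhere; they are used in weak form, as equalities of inner products.\<close>

lemma E_E:
  assumes "A \<in> sets borel" "B \<in> sets borel" "\<phi> \<in> L2 M" "\<psi> \<in> L2 M"
  shows "L2_inner M (E A (E B \<phi>)) \<psi> = L2_inner M (E (A \<inter> B) \<phi>) \<psi>"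
proof (rule L2_inner_cong_AE)
  show "AE x in M. E A (E B \<phi>) x = E (A \<inter> B) \<phi> x"
    using pvm assms by (auto simp: projection_valued_measure_def)
qed (use assms in \<open>auto intro!: L2_measurable E_L2\<close>)

lemma E_inner_E:
  assumes "A \<in> sets borel" "B \<in> sets borel" "\<phi> \<in> L2 M" "\<psi> \<in> L2 M"
  shows "L2_inner M (E A \<phi>) (E B \<psi>) = L2_inner M (E (A \<inter> B) \<phi>) \<psi>"
  using E_sym[of B "E A \<phi>" \<psi>] E_E[of B A \<phi> \<psi>] assms by (simp add: E_L2 Int_commute)

lemma E_self: "A \<in> sets borel \<Longrightarrow> \<phi> \<in> L2 M \<Longrightarrow> L2_inner M (E A \<phi>) \<phi> = of_real ((L2_norm M (E A \<phi>))\<^sup>2)"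
  using E_inner_E[of A A \<phi> \<phi>] by (simp add: L2_inner_self)

lemma E_UNIV: "\<phi> \<in> L2 M \<Longrightarrow> \<psi> \<in> L2 M \<Longrightarrow> L2_inner M (E UNIV \<phi>) \<psi> = L2_inner M \<phi> \<psi>"
  using pvm by (intro L2_inner_cong_AE)
    (auto intro!: L2_measurable E_L2 simp: projection_valued_measure_def)

lemma E_empty: "\<phi> \<in> L2 M \<Longrightarrow> \<psi> \<in> L2 M \<Longrightarrow> L2_inner M (E {} \<phi>) \<psi> = 0"
  using L2_inner_cong_AE[where M = M and \<phi> = "E {} \<phi>" and \<phi>' = "\<lambda>x. 0" and \<psi> = \<psi> and \<psi>' = \<psi>]
    pvm E_L2[of "{}" \<phi>]
  by (simp add: projection_valued_measure_def L2_inner_zero_left L2_measurable)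

lemma L2_norm_E_UNIV:
  assumes "\<phi> \<in> L2 M"
  shows "(L2_norm M (E UNIV \<phi>))\<^sup>2 = (L2_norm M \<phi>)\<^sup>2"
proof -
  have "complex_of_real ((L2_norm M (E UNIV \<phi>))\<^sup>2) = of_real ((L2_norm M \<phi>)\<^sup>2)"
    using E_self[of UNIV \<phi>] E_UNIV[of \<phi> \<phi>] L2_inner_self[of M \<phi>] assms by simp
  then show ?thesis using of_real_eq_iff by blast
qed

text \<open>Linearity of \<open>E A\<close> is not among the axioms. It follows weakly from
  symmetry, by moving the projection to the other argument.\<close>

lemma E_lin:
  assumes "A \<in> sets borel" "\<phi> \<in> L2 M" "\<psi> \<in> L2 M" "\<eta> \<in> L2 M"
  shows "L2_inner M (E A (\<lambda>x. \<phi> x + c * \<psi> x)) \<eta> = L2_inner M (E A \<phi>) \<eta> + c * L2_inner M (E A \<psi>) \<eta>"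
  using assms by (simp add: E_sym L2_lin L2_inner_add_left L2_inner_scale_left L2_scale E_L2)

abbreviation spec_density :: "('a \<Rightarrow> complex) \<Rightarrow> real measure" where
  "spec_density \<equiv> spectral_density M E"

lemma sets_spec_density [measurable_cong, simp]: "sets (spec_density \<phi>) = sets borel"
  by (simp add: spectral_density_def sigma_algebra.sigma_sets_eq[OF sets.sigma_algebra_axioms, of borel, simplified])

lemma space_spec_density [simp]: "space (spec_density \<phi>) = UNIV"
  by (simp add: spectral_density_def)

lemma borel_measurable_spec_density [simp]: "borel_measurable (spec_density \<phi>) = borel_measurable borel"
  by (rule measurable_cong_sets) simp_all

text \<open>\<open>measure_of\<close> has the intended values only if the set function is a measure.
  Countable additivity comes from the norm convergence in the axioms, through continuity of the
  inner product, and nonnegativity from \<open>E_self\<close>.\<close>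

lemma emeasure_spec_density:
  assumes \<phi>: "\<phi> \<in> L2 M" and A: "A \<in> sets borel"
  shows "emeasure (spec_density \<phi>) A = ennreal ((L2_norm M (E A \<phi>))\<^sup>2)"
proof -
  let ?m = "\<lambda>A. ennreal (Re (L2_inner M (E A \<phi>) \<phi>))"
  have "emeasure (spec_density \<phi>) A = ?m A"
  proof (rule emeasure_measure_of[OF spectral_density_def])
    show "positive (sets (spec_density \<phi>)) ?m"
      using E_empty[OF \<phi> \<phi>] by (simp add: positive_def)
    show "countably_additive (sets (spec_density \<phi>)) ?m"
    proof (rule countably_additiveI)
      fix B :: "nat \<Rightarrow> real set"
      assume B: "range B \<subseteq> sets (spec_density \<phi>)" "disjoint_family B"
      then have Bb: "B i \<in> sets borel" for i by auto
      have "(\<lambda>N. L2_dist M (\<lambda>x. \<Sum>i<N. E (B i) \<phi> x) (E (\<Union>i. B i) \<phi>)) \<longlonglongrightarrow> 0"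
        using pvm B \<phi> by (auto simp: projection_valued_measure_def)
      then have "(\<lambda>N. L2_inner M (\<lambda>x. \<Sum>i<N. E (B i) \<phi> x) \<phi>) \<longlonglongrightarrow> L2_inner M (E (\<Union>i. B i) \<phi>) \<phi>"
        using \<phi> Bb by (intro L2_inner_tendsto_left L2_sum E_L2) auto
      then have "(\<lambda>N. \<Sum>i<N. L2_inner M (E (B i) \<phi>) \<phi>) \<longlonglongrightarrow> L2_inner M (E (\<Union>i. B i) \<phi>) \<phi>"
        using \<phi> Bb by (subst (asm) L2_inner_sum_left) (auto intro: E_L2)
      then have "(\<lambda>N. Re (\<Sum>i<N. L2_inner M (E (B i) \<phi>) \<phi>)) \<longlonglongrightarrow> Re (L2_inner M (E (\<Union>i. B i) \<phi>) \<phi>)"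
        by (rule tendsto_Re)
      then have "(\<lambda>i. Re (L2_inner M (E (B i) \<phi>) \<phi>)) sums Re (L2_inner M (E (\<Union>i. B i) \<phi>) \<phi>)"
        by (simp add: sums_def)
      moreover have "0 \<le> Re (L2_inner M (E (B i) \<phi>) \<phi>)" for i
        using \<phi> Bb by (simp add: E_self)
      ultimately show "(\<Sum>i. ?m (B i)) = ?m (\<Union>i. B i)"
        by (intro suminf_ennreal_eq) auto
    qed
  qed (use A in auto)
  then show ?thesis using \<phi> A by (simp add: E_self)
qed

lemma finite_spec_density: "\<phi> \<in> L2 M \<Longrightarrow> finite_measure (spec_density \<phi>)"
  by (rule finite_measureI) (simp add: emeasure_spec_density)

lemma measure_spec_density: "\<phi> \<in> L2 M \<Longrightarrow> A \<in> sets borel \<Longrightarrow> measure (spec_density \<phi>) A = (L2_norm M (E A \<phi>))\<^sup>2"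
  by (simp add: measure_def emeasure_spec_density)

lemma integrable_spec_density:
  assumes "\<phi> \<in> L2 M" "bounded_borel f"
  shows "integrable (spec_density \<phi>) f"
proof -
  interpret finite_measure "spec_density \<phi>" using assms(1) by (rule finite_spec_density)
  obtain C where "\<And>t. cmod (f t) \<le> C" using assms by (auto simp: bounded_borel_def)
  then show ?thesis using assms(2)
    by (intro integrable_const_bound[of _ C]) (auto simp: bounded_borel_def)
qed

lemma integral_spec_density_indicator:
  assumes "\<phi> \<in> L2 M" "A \<in> sets borel"
  shows "integral\<^sup>L (spec_density \<phi>) (indicator A) = complex_of_real ((L2_norm M (E A \<phi>))\<^sup>2)"
proof -
  have "has_bochner_integral (spec_density \<phi>) (\<lambda>t. indicator A t *\<^sub>R (1::complex)) (measure (spec_density \<phi>) A *\<^sub>R 1)"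
    using assms by (intro has_bochner_integral_indicator) (auto simp: emeasure_spec_density)
  moreover have "(\<lambda>t. indicator A t *\<^sub>R (1::complex)) = indicator A" by (auto simp: indicator_def)
  ultimately show ?thesis
    using assms by (simp add: has_bochner_integral_integral_eq measure_spec_density of_real_def)
qed

text \<open>The pairing of f(T) \<phi> with \<eta>, where T is the operator resolved by E: the
  polarized expression in \<open>spectral_integral\<close>, also available for unbounded f.\<close>

definition spec_form :: "(real \<Rightarrow> complex) \<Rightarrow> ('a \<Rightarrow> complex) \<Rightarrow> ('a \<Rightarrow> complex) \<Rightarrow> complex" where
  "spec_form f \<phi> \<eta> = (\<Sum>k<(4::nat). \<i> ^ k * integral\<^sup>L (spec_density (\<lambda>x. \<phi> x + \<i> ^ k * \<eta> x)) f) / 4"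

lemma spec_form_lin:
  assumes "bounded_borel f" "bounded_borel g" "\<phi> \<in> L2 M" "\<eta> \<in> L2 M"
  shows "spec_form (\<lambda>t. f t + c * g t) \<phi> \<eta> = spec_form f \<phi> \<eta> + c * spec_form g \<phi> \<eta>"
proof -
  have "integral\<^sup>L (spec_density (\<lambda>x. \<phi> x + \<i> ^ k * \<eta> x)) (\<lambda>t. f t + c * g t) =
      integral\<^sup>L (spec_density (\<lambda>x. \<phi> x + \<i> ^ k * \<eta> x)) f + c * integral\<^sup>L (spec_density (\<lambda>x. \<phi> x + \<i> ^ k * \<eta> x)) g" for k
    using assms by (simp add: integrable_spec_density L2_lin)
  then show ?thesis
    unfolding spec_form_def sum_divide_distrib sum_distrib_left sum.distrib[symmetric]
    by (intro sum.cong refl) (simp add: field_simps)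
qed

lemma integral_spec_density_lim:
  assumes "\<And>i. bounded_borel (s i)" "bounded_borel f" "\<And>i t. cmod (s i t) \<le> C"
    "\<And>t. (\<lambda>i. s i t) \<longlonglongrightarrow> f t" "\<phi> \<in> L2 M"
  shows "(\<lambda>i. integral\<^sup>L (spec_density \<phi>) (s i)) \<longlonglongrightarrow> integral\<^sup>L (spec_density \<phi>) f"
proof (rule integral_dominated_convergence[where w = "\<lambda>t. C"])
  interpret finite_measure "spec_density \<phi>" using assms(5) by (rule finite_spec_density)
  show "integrable (spec_density \<phi>) (\<lambda>t. C)" by simp
qed (use assms in \<open>auto simp: bounded_borel_def\<close>)

lemma spec_form_lim:
  assumes "\<And>i. bounded_borel (s i)" "bounded_borel f" "\<And>i t. cmod (s i t) \<le> C"
    "\<And>t. (\<lambda>i. s i t) \<longlonglongrightarrow> f t" "\<phi> \<in> L2 M" "\<eta> \<in> L2 M"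
  shows "(\<lambda>i. spec_form (s i) \<phi> \<eta>) \<longlonglongrightarrow> spec_form f \<phi> \<eta>"
  unfolding spec_form_def using assms by (intro tendsto_intros integral_spec_density_lim[where C = C] L2_lin) auto

lemma spec_form_indicator:
  assumes A: "A \<in> sets borel" and L: "\<phi> \<in> L2 M" "\<eta> \<in> L2 M"
  shows "spec_form (indicator A) \<phi> \<eta> = L2_inner M (E A \<phi>) \<eta>"
proof -
  have "integral\<^sup>L (spec_density (\<lambda>x. \<phi> x + c * \<eta> x)) (indicator A :: real \<Rightarrow> complex) =
      L2_inner M (E A \<phi>) \<phi> + cnj c * L2_inner M (E A \<phi>) \<eta> +
      c * L2_inner M (E A \<eta>) \<phi> + c * cnj c * L2_inner M (E A \<eta>) \<eta>" for c
  proof -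
    have "integral\<^sup>L (spec_density (\<lambda>x. \<phi> x + c * \<eta> x)) (indicator A :: real \<Rightarrow> complex) =
        of_real ((L2_norm M (E A (\<lambda>x. \<phi> x + c * \<eta> x)))\<^sup>2)"
      using A L by (intro integral_spec_density_indicator L2_lin)
    also have "\<dots> = L2_inner M (E A (\<lambda>x. \<phi> x + c * \<eta> x)) (\<lambda>x. \<phi> x + c * \<eta> x)"
      using A L by (simp add: E_self L2_lin)
    also have "\<dots> = L2_inner M (E A \<phi>) \<phi> + cnj c * L2_inner M (E A \<phi>) \<eta> +
      c * L2_inner M (E A \<eta>) \<phi> + c * cnj c * L2_inner M (E A \<eta>) \<eta>"
      using A L by (simp add: E_lin L2_lin L2_inner_add_right L2_inner_scale_right E_L2 L2_scale algebra_simps)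
    finally show ?thesis .
  qed
  note * = this
  \<comment> \<open>In the sum over c = \<i>^k weighted with \<i>^k only the coefficient of
    \<open>cnj c\<close> survives, and it appears four times.\<close>
  have "{..<4::nat} = {0, 1, 2, 3}" by auto
  then show ?thesis
    unfolding spec_form_def * by (simp add: power3_eq_cube algebra_simps)
qed

lemma spec_form_add_left:
  assumes f: "bounded_borel f" and L: "\<phi> \<in> L2 M" "\<psi> \<in> L2 M" "\<eta> \<in> L2 M"
  shows "spec_form f (\<lambda>x. \<phi> x + c * \<psi> x) \<eta> = spec_form f \<phi> \<eta> + c * spec_form f \<psi> \<eta>"
  using f
proof (induction rule: bounded_borel_induct)
  case (indicator A)
  then show ?case using L by (simp add: spec_form_indicator L2_lin E_lin)
next
  case (lin f g d)
  then show ?case using L by (simp add: spec_form_lin L2_lin algebra_simps)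
next
  case (lim s f C)
  have "(\<lambda>i. spec_form (s i) (\<lambda>x. \<phi> x + c * \<psi> x) \<eta>) \<longlonglongrightarrow> spec_form f (\<lambda>x. \<phi> x + c * \<psi> x) \<eta>"
    using lim L by (intro spec_form_lim[where C = C] L2_lin) auto
  moreover have "(\<lambda>i. spec_form (s i) \<phi> \<eta> + c * spec_form (s i) \<psi> \<eta>) \<longlonglongrightarrow> spec_form f \<phi> \<eta> + c * spec_form f \<psi> \<eta>"
    using lim L by (intro tendsto_intros spec_form_lim[where C = C]) auto
  ultimately show ?case unfolding lim.IH by (rule LIMSEQ_unique)
qed

lemma spec_form_cnj:
  assumes f: "bounded_borel f" and L: "\<phi> \<in> L2 M" "\<eta> \<in> L2 M"
  shows "spec_form (\<lambda>t. cnj (f t)) \<eta> \<phi> = cnj (spec_form f \<phi> \<eta>)"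
  using f
proof (induction rule: bounded_borel_induct)
  case (indicator A)
  have "(\<lambda>t. cnj (indicator A t)) = indicator A" by (auto simp: indicator_def)
  then show ?case using L indicator by (simp add: spec_form_indicator E_sym L2_inner_cnj[symmetric])
next
  case (lin f g d)
  then show ?case using L by (simp add: spec_form_lin bounded_borel_cnj)
next
  case (lim s f C)
  have "(\<lambda>i. spec_form (\<lambda>t. cnj (s i t)) \<eta> \<phi>) \<longlonglongrightarrow> spec_form (\<lambda>t. cnj (f t)) \<eta> \<phi>"
    using lim L by (intro spec_form_lim[where C = C] bounded_borel_cnj tendsto_cnj) auto
  moreover have "(\<lambda>i. cnj (spec_form (s i) \<phi> \<eta>)) \<longlonglongrightarrow> cnj (spec_form f \<phi> \<eta>)"
    using lim L by (intro tendsto_cnj spec_form_lim[where C = C]) auto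
  ultimately show ?case unfolding lim.IH by (rule LIMSEQ_unique)
qed

text \<open>If the spectral projections, tested with \<eta>, cannot distinguish v from d(T) u, then
  f(T) v equals (f d)(T) u in the same sense: both sides are linear in f and continuous under
  bounded convergence. Fixing one \<eta> keeps the lemma applicable when v is known only through its
  projections.\<close>

lemma spec_form_transfer:
  assumes f: "bounded_borel f" and d: "bounded_borel d" and L: "u \<in> L2 M" "v \<in> L2 M" "\<eta> \<in> L2 M"
    and eq: "\<And>A. A \<in> sets borel \<Longrightarrow> L2_inner M (E A v) \<eta> = spec_form (\<lambda>t. indicator A t * d t) u \<eta>"
  shows "spec_form f v \<eta> = spec_form (\<lambda>t. f t * d t) u \<eta>"
  using f
proof (induction rule: bounded_borel_induct)
  case (indicator A)
  then show ?case using L eq by (simp add: spec_form_indicator)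
next
  case (lin f g c)
  then show ?case using L spec_form_lin[of "\<lambda>t. f t * d t" "\<lambda>t. g t * d t" u \<eta> c] d
    by (simp add: spec_form_lin bounded_borel_mult algebra_simps)
next
  case (lim s f C)
  obtain D where D: "\<And>t. cmod (d t) \<le> D" using d by (auto simp: bounded_borel_def)
  have C: "0 \<le> C" using order_trans[OF norm_ge_zero lim.hyps(2)] .
  have "(\<lambda>i. spec_form (s i) v \<eta>) \<longlonglongrightarrow> spec_form f v \<eta>"
    using lim L by (intro spec_form_lim[where C = C]) auto
  moreover have "(\<lambda>i. spec_form (\<lambda>t. s i t * d t) u \<eta>) \<longlonglongrightarrow> spec_form (\<lambda>t. f t * d t) u \<eta>"
    using lim L C d D
    by (intro spec_form_lim[where C = "C * D"] bounded_borel_mult tendsto_intros)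
      (auto simp: norm_mult intro!: mult_mono)
  ultimately show ?case unfolding lim.IH by (rule LIMSEQ_unique)
qed

lemma spec_form_E_left:
  assumes "bounded_borel f" "A \<in> sets borel" "\<phi> \<in> L2 M" "\<eta> \<in> L2 M"
  shows "spec_form f (E A \<phi>) \<eta> = spec_form (\<lambda>t. f t * indicator A t) \<phi> \<eta>"
proof (rule spec_form_transfer)
  fix B :: "real set" assume B: "B \<in> sets borel"
  have "(\<lambda>t. indicator B t * indicator A t :: complex) = indicator (B \<inter> A)"
    by (auto simp: indicator_def)
  then show "L2_inner M (E B (E A \<phi>)) \<eta> = spec_form (\<lambda>t. indicator B t * indicator A t) \<phi> \<eta>"
    using assms B by (simp add: spec_form_indicator E_E)
qed (use assms in \<open>auto intro: E_L2 bounded_borel_indicator\<close>)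

lemma spec_form_E_right:
  assumes "bounded_borel f" "A \<in> sets borel" "\<phi> \<in> L2 M" "\<eta> \<in> L2 M"
  shows "spec_form f \<phi> (E A \<eta>) = spec_form (\<lambda>t. f t * indicator A t) \<phi> \<eta>"
proof -
  have "spec_form f \<phi> (E A \<eta>) = cnj (spec_form (\<lambda>t. cnj (f t)) (E A \<eta>) \<phi>)"
    using assms by (simp add: spec_form_cnj[of f] E_L2)
  also have "\<dots> = cnj (spec_form (\<lambda>t. cnj (f t) * indicator A t) \<eta> \<phi>)"
    using assms by (simp add: spec_form_E_left bounded_borel_cnj)
  also have "(\<lambda>t. cnj (f t) * indicator A t) = (\<lambda>t. cnj (f t * indicator A t))"
    by (auto simp: indicator_def)
  also have "cnj (spec_form (\<lambda>t. cnj (f t * indicator A t)) \<eta> \<phi>) = spec_form (\<lambda>t. f t * indicator A t) \<phi> \<eta>"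
    using assms by (simp add: spec_form_cnj[of "\<lambda>t. f t * indicator A t"] bounded_borel_mult bounded_borel_indicator
        del: complex_cnj_mult)
  finally show ?thesis .
qed

lemma spec_form_self:
  assumes f: "bounded_borel f" and \<phi>: "\<phi> \<in> L2 M"
  shows "spec_form f \<phi> \<phi> = integral\<^sup>L (spec_density \<phi>) f"
  using f
proof (induction rule: bounded_borel_induct)
  case (indicator A)
  then show ?case using indicator \<phi> by (simp add: spec_form_indicator integral_spec_density_indicator E_self)
next
  case (lin f g d)
  then show ?case using \<phi> by (simp add: spec_form_lin integrable_spec_density)
next
  case (lim s f C)
  have "(\<lambda>i. spec_form (s i) \<phi> \<phi>) \<longlonglongrightarrow> spec_form f \<phi> \<phi>"
    using lim \<phi> by (intro spec_form_lim[where C = C]) auto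
  moreover have "(\<lambda>i. integral\<^sup>L (spec_density \<phi>) (s i)) \<longlonglongrightarrow> integral\<^sup>L (spec_density \<phi>) f"
    using lim \<phi> by (intro integral_spec_density_lim[where C = C]) auto
  ultimately show ?case unfolding lim.IH by (rule LIMSEQ_unique)
qed

text \<open>For bounded f this says that \<psi> represents f(T) \<phi>. It is a relation because
  \<psi> is determined only almost everywhere.\<close>

definition calculus :: "(real \<Rightarrow> complex) \<Rightarrow> ('a \<Rightarrow> complex) \<Rightarrow> ('a \<Rightarrow> complex) \<Rightarrow> bool" where
  "calculus f \<phi> \<psi> \<longleftrightarrow> \<psi> \<in> L2 M \<and> (\<forall>\<eta>\<in>L2 M. L2_inner M \<psi> \<eta> = spec_form f \<phi> \<eta>)"

lemma calculus_norm:
  assumes c: "calculus f \<phi> \<psi>" and f: "bounded_borel f" and \<phi>: "\<phi> \<in> L2 M"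
  shows "(L2_norm M \<psi>)\<^sup>2 = (LINT t|spec_density \<phi>. (cmod (f t))\<^sup>2)"
proof -
  have \<psi>: "\<psi> \<in> L2 M" using c by (simp add: calculus_def)
  \<comment> \<open>The product rule for the pairing of g(T) \<phi> with f(T) \<phi>, by induction
    on g with f fixed; the norm is the case g = f.\<close>
  have eq: "spec_form g \<phi> \<psi> = spec_form (\<lambda>t. g t * cnj (f t)) \<phi> \<phi>" if "bounded_borel g" for g
    using that
  proof (induction rule: bounded_borel_induct)
    case (indicator A)
    have "L2_inner M (E A \<phi>) \<psi> = cnj (L2_inner M \<psi> (E A \<phi>))" by (rule L2_inner_cnj)
    also have "\<dots> = cnj (spec_form (\<lambda>t. f t * indicator A t) \<phi> \<phi>)"
      using c \<phi> f indicator by (simp add: calculus_def E_L2 spec_form_E_right)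
    also have "\<dots> = spec_form (\<lambda>t. cnj (f t * indicator A t)) \<phi> \<phi>"
      using \<phi> f indicator
      by (simp add: spec_form_cnj[of "\<lambda>t. f t * indicator A t"] bounded_borel_mult bounded_borel_indicator
          del: complex_cnj_mult)
    also have "(\<lambda>t. cnj (f t * indicator A t)) = (\<lambda>t. indicator A t * cnj (f t))"
      by (auto simp: indicator_def)
    finally show ?case using \<phi> \<psi> indicator by (simp add: spec_form_indicator)
  next
    case (lin g h d)
    then show ?case
      using \<phi> \<psi> f spec_form_lin[of "\<lambda>t. g t * cnj (f t)" "\<lambda>t. h t * cnj (f t)" \<phi> \<phi> d]
      by (simp add: spec_form_lin bounded_borel_mult bounded_borel_cnj algebra_simps)
  next
    case (lim s g C)
    obtain D where D: "\<And>t. cmod (f t) \<le> D" using f by (auto simp: bounded_borel_def)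
    have C: "0 \<le> C" using order_trans[OF norm_ge_zero lim.hyps(2)] .
    have "(\<lambda>i. spec_form (s i) \<phi> \<psi>) \<longlonglongrightarrow> spec_form g \<phi> \<psi>"
      using lim \<phi> \<psi> by (intro spec_form_lim[where C = C]) auto
    moreover have "(\<lambda>i. spec_form (\<lambda>t. s i t * cnj (f t)) \<phi> \<phi>) \<longlonglongrightarrow> spec_form (\<lambda>t. g t * cnj (f t)) \<phi> \<phi>"
      using lim \<phi> C D f
      by (intro spec_form_lim[where C = "C * D"] bounded_borel_mult bounded_borel_cnj tendsto_intros)
        (auto simp: norm_mult intro!: mult_mono)
    ultimately show ?case unfolding lim.IH by (rule LIMSEQ_unique)
  qed
  have "of_real ((L2_norm M \<psi>)\<^sup>2) = spec_form f \<phi> \<psi>"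
    using c \<psi> unfolding calculus_def L2_inner_self[symmetric] by blast
  also have "\<dots> = integral\<^sup>L (spec_density \<phi>) (\<lambda>t. f t * cnj (f t))"
    using f \<phi> by (simp add: eq spec_form_self bounded_borel_mult bounded_borel_cnj)
  also have "\<dots> = integral\<^sup>L (spec_density \<phi>) (\<lambda>t. of_real ((cmod (f t))\<^sup>2))"
    by (simp only: complex_norm_square)
  also have "\<dots> = of_real (LINT t|spec_density \<phi>. (cmod (f t))\<^sup>2)" by (rule integral_complex_of_real)
  finally show ?thesis using of_real_eq_iff by blast
qed

lemma calculus_norm_le:
  assumes c: "calculus f \<phi> \<psi>" and f: "bounded_borel f" and \<phi>: "\<phi> \<in> L2 M" and C: "\<And>t. cmod (f t) \<le> C"
  shows "L2_norm M \<psi> \<le> C * L2_norm M \<phi>"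
proof (rule power2_le_imp_le)
  interpret finite_measure "spec_density \<phi>" using \<phi> by (rule finite_spec_density)
  have C0: "0 \<le> C" using order_trans[OF norm_ge_zero C] .
  have "(L2_norm M \<psi>)\<^sup>2 = (LINT t|spec_density \<phi>. (cmod (f t))\<^sup>2)" using c f \<phi> by (rule calculus_norm)
  also have "\<dots> \<le> (LINT t|spec_density \<phi>. C\<^sup>2)"
  proof (rule integral_mono)
    have "integrable (spec_density \<phi>) (\<lambda>t. f t * cnj (f t))"
      using f \<phi> by (intro integrable_spec_density bounded_borel_mult bounded_borel_cnj)
    then have "integrable (spec_density \<phi>) (\<lambda>t. cmod (f t * cnj (f t)))" by (rule integrable_norm)
    then show "integrable (spec_density \<phi>) (\<lambda>t. (cmod (f t))\<^sup>2)" by (simp add: norm_mult power2_eq_square)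
    show "(cmod (f t))\<^sup>2 \<le> C\<^sup>2" for t using C by (intro power_mono) auto
  qed simp
  also have "\<dots> = (C * L2_norm M \<phi>)\<^sup>2"
    using \<phi> L2_norm_E_UNIV[of \<phi>] by (simp add: measure_spec_density power_mult_distrib mult.commute)
  finally show "(L2_norm M \<psi>)\<^sup>2 \<le> (C * L2_norm M \<phi>)\<^sup>2" .
  show "0 \<le> C * L2_norm M \<phi>" using C0 by simp
qed

lemma calculus_lin:
  assumes "calculus f \<phi> \<psi>" "calculus g \<phi> \<xi>" "bounded_borel f" "bounded_borel g" "\<phi> \<in> L2 M"
  shows "calculus (\<lambda>t. f t + c * g t) \<phi> (\<lambda>x. \<psi> x + c * \<xi> x)"
  using assms
  by (simp add: calculus_def L2_lin L2_inner_add_left L2_inner_scale_left L2_scale spec_form_lin)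

text \<open>For limits, \<open>calculus_norm\<close> turns convergence of the functions in the
  square mean of the spectral measure of \<phi> into a Cauchy sequence of vectors, and completeness
  supplies the limit.\<close>

lemma calculus_exists:
  assumes f: "bounded_borel f" and \<phi>: "\<phi> \<in> L2 M"
  shows "\<exists>\<psi>. calculus f \<phi> \<psi>"
  using f
proof (induction rule: bounded_borel_induct)
  case (indicator A)
  then show ?case using \<phi> by (intro exI[of _ "E A \<phi>"]) (simp add: calculus_def E_L2 spec_form_indicator)
next
  case (lin f g c)
  then show ?case using \<phi> calculus_lin by blast
next
  case (lim s f C)
  obtain u where u: "\<And>i. calculus (s i) \<phi> (u i)" using lim.IH by metis
  then have uL: "u i \<in> L2 M" for i by (simp add: calculus_def)
  have d: "(L2_dist M (u i) (u j))\<^sup>2 = (LINT t|spec_density \<phi>. (cmod (s i t - s j t))\<^sup>2)" for i j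
  proof -
    have "calculus (\<lambda>t. s i t + (-1) * s j t) \<phi> (\<lambda>x. u i x + (-1) * u j x)"
      using u lim \<phi> by (intro calculus_lin) auto
    from calculus_norm[OF this _ \<phi>] show ?thesis
      using bounded_borel_add[OF lim.hyps(1)[of i] bounded_borel_scale[OF lim.hyps(1)[of j], of "-1"]]
      by (simp add: L2_dist_eq)
  qed
  interpret finite_measure "spec_density \<phi>" using \<phi> by (rule finite_spec_density)
  have fm [measurable]: "s i \<in> borel_measurable borel" "f \<in> borel_measurable borel" for i
    using lim by (auto simp: bounded_borel_def)
  have fC: "cmod (f t) \<le> C" for t
    using lim.hyps(2,3) by (intro LIMSEQ_le_const2[OF tendsto_norm[OF lim.hyps(3)]]) auto
  have "(\<lambda>i. LINT t|spec_density \<phi>. (cmod (s i t - f t))\<^sup>2) \<longlonglongrightarrow> (LINT t|spec_density \<phi>. 0)"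
  proof (rule integral_dominated_convergence[where w = "\<lambda>t. (2 * C)\<^sup>2"])
    show "AE t in spec_density \<phi>. (\<lambda>i. (cmod (s i t - f t))\<^sup>2) \<longlonglongrightarrow> 0"
    proof (rule AE_I2)
      fix t
      have "(\<lambda>i. (cmod (s i t - f t))\<^sup>2) \<longlonglongrightarrow> (cmod (f t - f t))\<^sup>2"
        by (intro tendsto_intros lim)
      then show "(\<lambda>i. (cmod (s i t - f t))\<^sup>2) \<longlonglongrightarrow> 0" by simp
    qed
    show "AE t in spec_density \<phi>. norm ((cmod (s i t - f t))\<^sup>2) \<le> (2 * C)\<^sup>2" for i
    proof (rule AE_I2)
      fix t
      have "cmod (s i t - f t) \<le> 2 * C"
        using norm_triangle_ineq4[of "s i t" "f t"] lim.hyps(2)[of i t] fC[of t] by linarith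
      then show "norm ((cmod (s i t - f t))\<^sup>2) \<le> (2 * C)\<^sup>2"
        using power_mono[of "cmod (s i t - f t)" "2 * C" 2] by simp
    qed
  qed auto
  then have lim0: "(\<lambda>i. LINT t|spec_density \<phi>. (cmod (s i t - f t))\<^sup>2) \<longlonglongrightarrow> 0" by simp
  have int: "integrable (spec_density \<phi>) (\<lambda>t. (cmod (s i t - f t))\<^sup>2)" for i
  proof (rule integrable_const_bound[of _ "(2 * C)\<^sup>2"])
    show "AE t in spec_density \<phi>. norm ((cmod (s i t - f t))\<^sup>2) \<le> (2 * C)\<^sup>2"
    proof (rule AE_I2)
      fix t
      have "cmod (s i t - f t) \<le> 2 * C"
        using norm_triangle_ineq4[of "s i t" "f t"] lim.hyps(2)[of i t] fC[of t] by linarith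
      then show "norm ((cmod (s i t - f t))\<^sup>2) \<le> (2 * C)\<^sup>2"
        using power_mono[of "cmod (s i t - f t)" "2 * C" 2] by simp
    qed
  qed simp
  have "\<exists>\<psi>\<in>L2 M. (\<lambda>k. L2_dist M (u k) \<psi>) \<longlonglongrightarrow> 0"
  proof (rule L2_complete[OF uL])
    fix e :: real assume e: "0 < e"
    then have "0 < e\<^sup>2 / 4" by simp
    \<comment> \<open>Both halves of the difference enter with the factor 2 of
      \<open>cmod_add_sq_le\<close>, hence the quarter.\<close>
    then obtain K where K: "\<And>i. i \<ge> K \<Longrightarrow> (LINT t|spec_density \<phi>. (cmod (s i t - f t))\<^sup>2) < e\<^sup>2 / 4"
      using order_tendstoD(2)[OF lim0 \<open>0 < e\<^sup>2 / 4\<close>] unfolding eventually_sequentially by blast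
    have "L2_dist M (u i) (u j) < e" if "i \<ge> K" "j \<ge> K" for i j
    proof (rule power2_less_imp_less)
      have "(L2_dist M (u i) (u j))\<^sup>2 \<le>
          (LINT t|spec_density \<phi>. 2 * (cmod (s i t - f t))\<^sup>2 + 2 * (cmod (s j t - f t))\<^sup>2)"
        unfolding d
      proof (rule integral_mono')
        show "integrable (spec_density \<phi>) (\<lambda>t. 2 * (cmod (s i t - f t))\<^sup>2 + 2 * (cmod (s j t - f t))\<^sup>2)"
          using int by simp
        show "(cmod (s i t - s j t))\<^sup>2 \<le> 2 * (cmod (s i t - f t))\<^sup>2 + 2 * (cmod (s j t - f t))\<^sup>2" for t
          using cmod_add_sq_le[of "s i t - f t" "f t - s j t"] by (simp add: norm_minus_commute)
      qed auto
      also have "\<dots> < e\<^sup>2" using K[OF that(1)] K[OF that(2)] int by simp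
      finally show "(L2_dist M (u i) (u j))\<^sup>2 < e\<^sup>2" .
    qed (use e in auto)
    then show "\<exists>K. \<forall>i\<ge>K. \<forall>j\<ge>K. L2_dist M (u i) (u j) < e" by blast
  qed
  then obtain \<psi> where \<psi>: "\<psi> \<in> L2 M" "(\<lambda>k. L2_dist M (u k) \<psi>) \<longlonglongrightarrow> 0" by blast
  have "L2_inner M \<psi> \<eta> = spec_form f \<phi> \<eta>" if \<eta>: "\<eta> \<in> L2 M" for \<eta>
  proof (rule LIMSEQ_unique)
    show "(\<lambda>i. L2_inner M (u i) \<eta>) \<longlonglongrightarrow> L2_inner M \<psi> \<eta>"
      using uL \<psi> \<eta> by (intro L2_inner_tendsto_left)
    have "(\<lambda>i. spec_form (s i) \<phi> \<eta>) \<longlonglongrightarrow> spec_form f \<phi> \<eta>"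
      using lim \<phi> \<eta> by (intro spec_form_lim[where C = C]) auto
    then show "(\<lambda>i. L2_inner M (u i) \<eta>) \<longlonglongrightarrow> spec_form f \<phi> \<eta>"
      using u \<eta> by (simp add: calculus_def)
  qed
  then show ?case using \<psi> by (auto simp: calculus_def)
qed

lemma spec_form_norm_le:
  assumes "bounded_borel f" "\<phi> \<in> L2 M" "\<eta> \<in> L2 M" "\<And>t. cmod (f t) \<le> C"
  shows "cmod (spec_form f \<phi> \<eta>) \<le> C * L2_norm M \<phi> * L2_norm M \<eta>"
proof -
  obtain \<psi> where \<psi>: "calculus f \<phi> \<psi>" using calculus_exists assms by blast
  then have "cmod (spec_form f \<phi> \<eta>) \<le> L2_norm M \<psi> * L2_norm M \<eta>"
    using L2_Cauchy_Schwarz[of \<psi> M \<eta>] assms(3) by (simp add: calculus_def)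
  also have "\<dots> \<le> C * L2_norm M \<phi> * L2_norm M \<eta>"
    using calculus_norm_le[OF \<psi>] assms by (intro mult_right_mono) auto
  finally show ?thesis .
qed

end

section \<open>The unbounded operator on bounded spectral windows\<close>

context pvm begin

lemma AE_spec_density_E:
  assumes A: "A \<in> sets borel" and \<phi>: "\<phi> \<in> L2 M"
  shows "AE t in spec_density (E A \<phi>). t \<in> A"
proof (rule AE_I)
  show "{t \<in> space (spec_density (E A \<phi>)). t \<notin> A} \<subseteq> - A" by auto
  have "complex_of_real ((L2_norm M (E (- A) (E A \<phi>)))\<^sup>2) = L2_inner M (E (- A) (E A \<phi>)) (E A \<phi>)"
    using A \<phi> by (intro E_self[symmetric]) (auto intro: E_L2)
  also have "\<dots> = L2_inner M (E {} \<phi>) (E A \<phi>)"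
    using A \<phi> by (subst E_E) (auto intro: E_L2)
  also have "\<dots> = 0" using A \<phi> by (simp add: E_empty E_L2)
  finally have "(L2_norm M (E (- A) (E A \<phi>)))\<^sup>2 = 0" using of_real_eq_0_iff by blast
  then show "emeasure (spec_density (E A \<phi>)) (- A) = 0"
    using A \<phi> by (subst emeasure_spec_density) (auto intro: E_L2 simp del: zero_eq_power2)
qed (use A in auto)

definition id_cut :: "real set \<Rightarrow> real \<Rightarrow> complex" where
  "id_cut A t = of_real t * indicator A t"

lemma id_cut_le: "A \<subseteq> {-R..R} \<Longrightarrow> 0 \<le> R \<Longrightarrow> cmod (id_cut A t) \<le> R"
  by (fastforce simp: id_cut_def indicator_def norm_mult abs_le_iff)

lemma bounded_borel_id_cut:
  assumes "A \<in> sets borel" "bounded A"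
  shows "bounded_borel (id_cut A)"
proof -
  obtain R where "\<And>t. t \<in> A \<Longrightarrow> norm t \<le> R" "0 < R"
    using assms(2) bounded_pos by blast
  then have "A \<subseteq> {-R..R}" by (auto simp: abs_le_iff) (smt (verit))
  then show ?thesis
    using assms(1) id_cut_le[of A R] \<open>0 < R\<close> by (intro bounded_borelI[of _ R]) (auto simp: id_cut_def[abs_def])
qed

lemma calculus_add_left:
  assumes "bounded_borel f" "\<phi> \<in> L2 M" "\<psi> \<in> L2 M" "calculus f \<phi> u" "calculus f \<psi> v"
  shows "calculus f (\<lambda>x. \<phi> x + c * \<psi> x) (\<lambda>x. u x + c * v x)"
  using assms
  by (simp add: calculus_def L2_lin L2_inner_add_left L2_inner_scale_left L2_scale spec_form_add_left)

abbreviation dom :: "('a \<Rightarrow> complex) set" where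
  "dom \<equiv> spectral_domain M E complex_of_real"

lemma domD: "\<phi> \<in> dom \<Longrightarrow> \<phi> \<in> L2 M" "\<phi> \<in> dom \<Longrightarrow> integrable (spec_density \<phi>) (\<lambda>t. t\<^sup>2)"
  by (auto simp: spectral_domain_def)

text \<open>The truncations \<open>id_cut\<close> give bounded linear operators, so the truncated
  second moment of the sum is a squared norm, which the bound (x + y)^2 \<le> 2 x^2 + 2 y^2 controls
  by those of the summands, uniformly in the truncation; monotone convergence removes it.\<close>

lemma dom_lin:
  assumes "\<phi> \<in> dom" "\<psi> \<in> dom"
  shows "(\<lambda>x. \<phi> x + c * \<psi> x) \<in> dom"
proof -
  let ?\<xi> = "\<lambda>x. \<phi> x + c * \<psi> x"
  let ?A = "\<lambda>N::nat. {- real N .. real N}"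
  have L: "\<phi> \<in> L2 M" "\<psi> \<in> L2 M" "?\<xi> \<in> L2 M" using assms domD by (auto intro: L2_lin)
  have cut: "(LINT t|spec_density \<eta>. (cmod (id_cut (?A N) t))\<^sup>2) \<le> (LINT t|spec_density \<eta>. t\<^sup>2)" if "\<eta> \<in> dom" for \<eta> N
    using domD(2)[OF that] by (intro integral_mono') (auto simp: id_cut_def norm_mult indicator_def)
  define B where "B = 2 * (LINT t|spec_density \<phi>. t\<^sup>2) + 2 * ((cmod c)\<^sup>2 * (LINT t|spec_density \<psi>. t\<^sup>2))"
  have bd: "(LINT t|spec_density ?\<xi>. (cmod (id_cut (?A N) t))\<^sup>2) \<le> B" for N
  proof -
    have f: "bounded_borel (id_cut (?A N))" by (intro bounded_borel_id_cut) auto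
    obtain u v where uv: "calculus (id_cut (?A N)) \<phi> u" "calculus (id_cut (?A N)) \<psi> v"
      using calculus_exists[OF f] L by blast
    then have uvL: "u \<in> L2 M" "v \<in> L2 M" by (auto simp: calculus_def)
    have "(LINT t|spec_density ?\<xi>. (cmod (id_cut (?A N) t))\<^sup>2) = (L2_norm M (\<lambda>x. u x + c * v x))\<^sup>2"
      using calculus_norm[OF calculus_add_left[OF f L(1,2) uv] f L(3)] by simp
    also have "\<dots> \<le> (L2_norm M u + L2_norm M (\<lambda>x. c * v x))\<^sup>2"
      using uvL by (intro power_mono L2_norm_triangle L2_scale) auto
    also have "\<dots> \<le> 2 * (L2_norm M u)\<^sup>2 + 2 * (L2_norm M (\<lambda>x. c * v x))\<^sup>2"
      using sum_squares_bound[of "L2_norm M u" "L2_norm M (\<lambda>x. c * v x)"] by (simp add: power2_sum)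
    also have "\<dots> = 2 * (L2_norm M u)\<^sup>2 + 2 * ((cmod c)\<^sup>2 * (L2_norm M v)\<^sup>2)"
      by (simp add: L2_norm_scale power_mult_distrib)
    also have "\<dots> \<le> B"
      unfolding B_def calculus_norm[OF uv(1) f L(1)] calculus_norm[OF uv(2) f L(2)]
      using cut assms by (intro add_mono mult_left_mono) auto
    finally show ?thesis .
  qed
  interpret finite_measure "spec_density ?\<xi>" using L(3) by (rule finite_spec_density)
  have "(\<integral>\<^sup>+t. ennreal (t\<^sup>2) \<partial>spec_density ?\<xi>) = (\<integral>\<^sup>+t. (SUP N. ennreal ((cmod (id_cut (?A N) t))\<^sup>2)) \<partial>spec_density ?\<xi>)"
  proof (rule nn_integral_cong)
    fix t
    show "ennreal (t\<^sup>2) = (SUP N. ennreal ((cmod (id_cut (?A N) t))\<^sup>2))"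
    proof (rule antisym)
      obtain N :: nat where N: "\<bar>t\<bar> \<le> real N" using real_arch_simple by blast
      have "ennreal (t\<^sup>2) = ennreal ((cmod (id_cut (?A N) t))\<^sup>2)"
        using N by (auto simp: id_cut_def norm_mult indicator_def)
      then show "ennreal (t\<^sup>2) \<le> (SUP N. ennreal ((cmod (id_cut (?A N) t))\<^sup>2))"
        by (auto intro: SUP_upper2)
      show "(SUP N. ennreal ((cmod (id_cut (?A N) t))\<^sup>2)) \<le> ennreal (t\<^sup>2)"
        by (intro SUP_least ennreal_leI) (auto simp: id_cut_def norm_mult indicator_def)
    qed
  qed
  also have "\<dots> = (SUP N. \<integral>\<^sup>+t. ennreal ((cmod (id_cut (?A N) t))\<^sup>2) \<partial>spec_density ?\<xi>)"
  proof (rule nn_integral_monotone_convergence_SUP)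
    show "incseq (\<lambda>N t. ennreal ((cmod (id_cut (?A N) t))\<^sup>2))"
      by (intro incseq_SucI le_funI ennreal_leI) (auto simp: id_cut_def norm_mult indicator_def)
    show "(\<lambda>t. ennreal ((cmod (id_cut (?A N) t))\<^sup>2)) \<in> borel_measurable (spec_density ?\<xi>)" for N
      unfolding id_cut_def by simp
  qed
  also have "\<dots> \<le> ennreal B"
  proof (rule SUP_least)
    fix N
    have "integrable (spec_density ?\<xi>) (\<lambda>t. (cmod (id_cut (?A N) t))\<^sup>2)"
    proof (rule integrable_const_bound[of _ "(real N)\<^sup>2"])
      show "AE t in spec_density ?\<xi>. norm ((cmod (id_cut (?A N) t))\<^sup>2) \<le> (real N)\<^sup>2"
        using id_cut_le[of "?A N" "real N"] by (intro AE_I2) (auto intro!: power_mono)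
      show "(\<lambda>t. (cmod (id_cut (?A N) t))\<^sup>2) \<in> borel_measurable (spec_density ?\<xi>)" unfolding id_cut_def by simp
    qed
    then have "(\<integral>\<^sup>+t. ennreal ((cmod (id_cut (?A N) t))\<^sup>2) \<partial>spec_density ?\<xi>) =
        ennreal (LINT t|spec_density ?\<xi>. (cmod (id_cut (?A N) t))\<^sup>2)"
      by (intro nn_integral_eq_integral) auto
    then show "(\<integral>\<^sup>+t. ennreal ((cmod (id_cut (?A N) t))\<^sup>2) \<partial>spec_density ?\<xi>) \<le> ennreal B"
      using bd[of N] by (simp only: ennreal_leI)
  qed
  finally have "(\<integral>\<^sup>+t. ennreal (t\<^sup>2) \<partial>spec_density ?\<xi>) \<le> ennreal B" .
  then have "integrable (spec_density ?\<xi>) (\<lambda>t. t\<^sup>2)"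
    by (intro integrableI_nonneg) (auto simp: less_top[symmetric] top_unique)
  then show ?thesis using L(3) by (simp add: spectral_domain_def)
qed

lemma E_in_dom:
  assumes A: "A \<in> sets borel" "bounded A" and \<phi>: "\<phi> \<in> L2 M"
  shows "E A \<phi> \<in> dom"
proof -
  have EL: "E A \<phi> \<in> L2 M" using A \<phi> by (simp add: E_L2)
  interpret finite_measure "spec_density (E A \<phi>)" using EL by (rule finite_spec_density)
  obtain R where R: "\<And>t. t \<in> A \<Longrightarrow> \<bar>t\<bar> \<le> R"
    using A(2) by (auto simp: bounded_iff)
  have "integrable (spec_density (E A \<phi>)) (\<lambda>t. t\<^sup>2)"
  proof (rule integrable_const_bound[of _ "R\<^sup>2"])
    show "AE t in spec_density (E A \<phi>). norm (t\<^sup>2) \<le> R\<^sup>2"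
      using AE_spec_density_E[OF A(1) \<phi>]
    proof eventually_elim
      case (elim t)
      then show ?case using power_mono[OF R[OF elim], of 2] by simp
    qed
  qed simp
  then show ?thesis using EL by (simp add: spectral_domain_def)
qed

text \<open>On a vector from a bounded window the operator acts as the bounded function
  \<open>id_cut A\<close>. The definition of \<open>spectral_integral\<close> tests with every
  \<eta> in the domain and with the unbounded identity function; truncations to [-N, N] converge to
  it, dominated by 1 + t^2, which is integrable because the measures are finite and the domain is
  linear.\<close>

lemma E_in_spectral_integral:
  assumes A: "A \<in> sets borel" "bounded A" and \<phi>: "\<phi> \<in> L2 M" and w: "calculus (id_cut A) \<phi> w"
  shows "(E A \<phi>, w) \<in> spectral_integral M E complex_of_real"
proof -
  have wL: "w \<in> L2 M" using w by (simp add: calculus_def)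
  have EL: "E A \<phi> \<in> L2 M" using A \<phi> by (simp add: E_L2)
  have "L2_inner M w \<eta> = spec_form complex_of_real (E A \<phi>) \<eta>" if \<eta>: "\<eta> \<in> dom" for \<eta>
  proof (rule LIMSEQ_unique)
    let ?A = "\<lambda>N::nat. {- real N .. real N}"
    have \<eta>L: "\<eta> \<in> L2 M" using \<eta> domD by blast
    have f: "bounded_borel (id_cut (?A N))" for N by (intro bounded_borel_id_cut) auto
    show "(\<lambda>N. spec_form (id_cut (?A N)) (E A \<phi>) \<eta>) \<longlonglongrightarrow> spec_form complex_of_real (E A \<phi>) \<eta>"
      unfolding spec_form_def
    proof (intro tendsto_intros)
      fix k :: nat
      let ?\<xi> = "\<lambda>x. E A \<phi> x + \<i> ^ k * \<eta> x"
      have d: "?\<xi> \<in> dom" using E_in_dom[OF A \<phi>] \<eta> by (rule dom_lin)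
      interpret finite_measure "spec_density ?\<xi>" using domD(1)[OF d] by (rule finite_spec_density)
      show "(\<lambda>N. integral\<^sup>L (spec_density ?\<xi>) (id_cut (?A N))) \<longlonglongrightarrow> integral\<^sup>L (spec_density ?\<xi>) complex_of_real"
      proof (rule integral_dominated_convergence[where w = "\<lambda>t. 1 + t\<^sup>2"])
        show "integrable (spec_density ?\<xi>) (\<lambda>t. 1 + t\<^sup>2)" using domD(2)[OF d] by simp
        show "AE t in spec_density ?\<xi>. (\<lambda>N. id_cut (?A N) t) \<longlonglongrightarrow> complex_of_real t"
        proof (rule AE_I2)
          fix t :: real
          obtain N :: nat where N: "\<bar>t\<bar> \<le> real N" using real_arch_simple by blast
          have "id_cut (?A n) t = complex_of_real t" if "n \<ge> N" for n
            using N that by (auto simp: id_cut_def indicator_def)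
          then show "(\<lambda>N. id_cut (?A N) t) \<longlonglongrightarrow> complex_of_real t"
            by (intro tendsto_eventually eventually_sequentiallyI)
        qed
        show "AE t in spec_density ?\<xi>. norm (id_cut (?A N) t) \<le> 1 + t\<^sup>2" for N
        proof (rule AE_I2)
          fix t :: real
          have "\<bar>t\<bar> \<le> 1 + t\<^sup>2"
            using sum_squares_bound[of "1::real" "\<bar>t\<bar>"] abs_ge_zero[of t] by simp
          then show "norm (id_cut (?A N) t) \<le> 1 + t\<^sup>2"
            by (auto simp: id_cut_def norm_mult indicator_def)
        qed
        show "id_cut (?A N) \<in> borel_measurable (spec_density ?\<xi>)" for N
          using f[of N] by (simp add: bounded_borel_def)
      qed simp
    qed auto
    obtain R where R: "\<And>t. t \<in> A \<Longrightarrow> \<bar>t\<bar> \<le> R"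
      using A(2) by (auto simp: bounded_iff)
    obtain N0 :: nat where N0: "R \<le> real N0" using real_arch_simple by blast
    have "spec_form (id_cut (?A N)) (E A \<phi>) \<eta> = L2_inner M w \<eta>" if "N \<ge> N0" for N
    proof -
      have "(\<lambda>t. id_cut (?A N) t * indicator A t) = id_cut A"
      proof
        fix t
        show "id_cut (?A N) t * indicator A t = id_cut A t"
          using R[of t] N0 that by (auto simp: id_cut_def indicator_def)
      qed
      then show ?thesis using w \<eta>L \<phi> A f[of N] by (simp add: spec_form_E_left calculus_def)
    qed
    then show "(\<lambda>N. spec_form (id_cut (?A N)) (E A \<phi>) \<eta>) \<longlonglongrightarrow> L2_inner M w \<eta>"
      by (intro tendsto_eventually eventually_sequentiallyI)
  qed
  then show ?thesis
    using E_in_dom[OF A \<phi>] wL by (simp add: spectral_integral_def spec_form_def)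
qed

end

text \<open>An operator and its closure have the same adjoint, since inner products are continuous
  along the approximating sequences.\<close>

lemma op_closure_adjoint:
  assumes G: "\<And>f g. (f, g) \<in> G \<Longrightarrow> f \<in> L2 M \<and> g \<in> L2 M"
    and u: "u \<in> L2 M" "v \<in> L2 M"
    and weak: "\<And>f g. (f, g) \<in> G \<Longrightarrow> L2_inner M u g = L2_inner M v f"
    and cl: "(\<phi>, \<psi>) \<in> op_closure M G"
  shows "L2_inner M u \<psi> = L2_inner M v \<phi>"
proof -
  obtain a b where ab: "\<And>k::nat. (a k, b k) \<in> G" "(\<lambda>k. L2_dist M (a k) \<phi>) \<longlonglongrightarrow> 0"
    "(\<lambda>k. L2_dist M (b k) \<psi>) \<longlonglongrightarrow> 0" and L: "\<phi> \<in> L2 M" "\<psi> \<in> L2 M"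
    using cl by (auto simp: op_closure_def)
  have "(\<lambda>k. L2_inner M u (b k)) \<longlonglongrightarrow> L2_inner M u \<psi>"
    using G ab L u by (intro L2_inner_tendsto_right) auto
  moreover have "(\<lambda>k. L2_inner M v (a k)) \<longlonglongrightarrow> L2_inner M v \<phi>"
    using G ab L u by (intro L2_inner_tendsto_right) auto
  ultimately show ?thesis using weak[OF ab(1)] LIMSEQ_unique by simp
qed

text \<open>If (u, v) lies in the graph of the adjoint of G, then E A v is the operator applied to E
  A u. The vector E A \<phi> lies in the domain of the closure of G, so the weak identity may be
  tested with it; u itself is never placed in the domain.\<close>

lemma spectral_resolution_weak:
  assumes res: "spectral_resolution M (op_closure M G) E"
    and G: "\<And>f g. (f, g) \<in> G \<Longrightarrow> f \<in> L2 M \<and> g \<in> L2 M"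
    and u: "u \<in> L2 M" "v \<in> L2 M"
    and weak: "\<And>f g. (f, g) \<in> G \<Longrightarrow> L2_inner M u g = L2_inner M v f"
    and A: "A \<in> sets borel" "bounded A" and \<phi>: "\<phi> \<in> L2 M"
  shows "L2_inner M (E A v) \<phi> = pvm.spec_form M E (\<lambda>t. of_real t * indicator A t) u \<phi>"
proof -
  interpret pvm M E using res by unfold_locales (simp add: spectral_resolution_def)
  have f: "bounded_borel (id_cut A)" using A by (rule bounded_borel_id_cut)
  obtain w where w: "calculus (id_cut A) \<phi> w" using calculus_exists[OF f \<phi>] by blast
  have "(E A \<phi>, w) \<in> op_closure M G"
    using E_in_spectral_integral[OF A \<phi> w] res by (simp add: spectral_resolution_def)
  then have *: "L2_inner M u w = L2_inner M v (E A \<phi>)"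
    using op_closure_adjoint[OF G u weak] by blast
  have "L2_inner M (E A v) \<phi> = L2_inner M u w"
    using * A \<phi> u by (simp add: E_sym)
  also have "\<dots> = cnj (spec_form (id_cut A) \<phi> u)"
    using w u(1) by (subst L2_inner_cnj) (simp add: calculus_def)
  also have "\<dots> = spec_form (\<lambda>t. cnj (id_cut A t)) u \<phi>"
    using f \<phi> u by (simp add: spec_form_cnj)
  also have "(\<lambda>t. cnj (id_cut A t)) = (\<lambda>t. of_real t * indicator A t)"
    by (auto simp: id_cut_def indicator_def)
  finally show ?thesis .
qed

section \<open>The Bergman measure and the kernel\<close>

lemma norm_vec_sq: "(norm (z :: complex ^ 'n))\<^sup>2 = (\<Sum>i\<in>UNIV. (cmod (z $ i))\<^sup>2)"
  by (simp add: norm_vec_def L2_set_def sum_nonneg)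

lemma herm_self: "herm z z = of_real ((norm z)\<^sup>2)"
  unfolding herm_def norm_vec_sq of_real_sum complex_norm_square ..

lemma herm_cnj: "cnj (herm z w) = herm w z"
  by (simp add: herm_def mult.commute)

lemma herm_diff_left: "herm (z - w) v = herm z v - herm w v"
  by (simp add: herm_def left_diff_distrib sum_subtractf)

lemma herm_diff_right: "herm v (z - w) = herm v z - herm v w"
  by (simp add: herm_def right_diff_distrib sum_subtractf)

lemma herm_scaleR_left: "herm (r *\<^sub>R z) w = of_real r * herm z w"
  unfolding herm_def vector_scaleR_component sum_distrib_left
  by (rule sum.cong) (auto simp: scaleR_conv_of_real)

lemma herm_0_left [simp]: "herm 0 w = 0"
  by (simp add: herm_def)

lemma herm_0_right [simp]: "herm w 0 = 0"
  by (simp add: herm_def)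

lemma norm_herm_le: "cmod (herm z w) \<le> norm z * norm w"
proof -
  have "cmod (herm z w) \<le> (\<Sum>i\<in>UNIV. \<bar>cmod (z $ i)\<bar> * \<bar>cmod (w $ i)\<bar>)"
    unfolding herm_def by (rule sum_norm_le) (simp add: norm_mult)
  also have "\<dots> \<le> norm z * norm w"
    unfolding norm_vec_def by (rule L2_set_mult_ineq)
  finally show ?thesis .
qed

lemma continuous_on_herm [continuous_intros]:
  "continuous_on S f \<Longrightarrow> continuous_on S g \<Longrightarrow> continuous_on S (\<lambda>x. herm (f x) (g x))"
  unfolding herm_def by (intro continuous_intros)

lemma tendsto_herm [tendsto_intros]:
  "(f \<longlongrightarrow> a) F \<Longrightarrow> (g \<longlongrightarrow> b) F \<Longrightarrow> ((\<lambda>x. herm (f x) (g x)) \<longlongrightarrow> herm a b) F"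
  unfolding herm_def by (intro tendsto_intros)

lemma borel_measurable_herm [measurable]:
  assumes [measurable]: "f \<in> borel_measurable M" "g \<in> borel_measurable M"
  shows "(\<lambda>x. herm (f x) (g x)) \<in> borel_measurable M"
proof -
  have "continuous_on UNIV (\<lambda>p :: (complex ^ 'n) \<times> (complex ^ 'n). herm (fst p) (snd p))"
    by (intro continuous_intros)
  then have "(\<lambda>p :: (complex ^ 'n) \<times> (complex ^ 'n). herm (fst p) (snd p)) \<in> borel_measurable borel"
    by (rule borel_measurable_continuous_onI)
  from measurable_compose[OF borel_measurable_Pair[OF assms] this] show ?thesis by simp
qed

text \<open>The reciprocal of \<open>cosh\<^sup>2 d(z, w)\<close>.\<close>

definition inv_cosh2 :: "complex ^ 'n \<Rightarrow> complex ^ 'n \<Rightarrow> real" where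
  "inv_cosh2 z w = (1 - (norm z)\<^sup>2) * (1 - (norm w)\<^sup>2) / (cmod (1 - herm z w))\<^sup>2"

lemma herm_lt_1: "norm z < 1 \<Longrightarrow> norm w < 1 \<Longrightarrow> cmod (herm z w) < 1"
  using norm_herm_le[of z w] mult_strict_mono'[of "norm z" 1 "norm w" 1] by simp

lemma Re_1_minus_herm_pos: "norm z < 1 \<Longrightarrow> norm w < 1 \<Longrightarrow> 0 < Re (1 - herm z w)"
  using herm_lt_1[of z w] abs_Re_le_cmod[of "herm z w"] by simp

lemma one_minus_herm_nz: "norm z < 1 \<Longrightarrow> norm w < 1 \<Longrightarrow> 1 - herm z w \<noteq> 0"
  using Re_1_minus_herm_pos[of z w] by auto

lemma one_minus_norm_sq_pos: "norm z < 1 \<Longrightarrow> 0 < 1 - (norm z)\<^sup>2"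
  by (simp add: power_less_one_iff abs_square_less_1)

lemma inv_cosh2_pos: "norm z < 1 \<Longrightarrow> norm w < 1 \<Longrightarrow> 0 < inv_cosh2 z w"
  using one_minus_norm_sq_pos[of z] one_minus_norm_sq_pos[of w] one_minus_herm_nz[of z w]
  by (simp add: inv_cosh2_def)

lemma inv_cosh2_sym: "inv_cosh2 z w = inv_cosh2 w z"
proof -
  have "cmod (1 - herm z w) = cmod (cnj (1 - herm z w))" by (simp only: complex_mod_cnj)
  then show ?thesis by (simp add: inv_cosh2_def herm_cnj mult.commute)
qed

text \<open>The Gram determinant of \<open>z, w\<close> equals that of \<open>z, w - z\<close>.\<close>

lemma one_minus_inv_cosh2_numerator:
  "(cmod (1 - herm z w))\<^sup>2 - (1 - (norm z)\<^sup>2) * (1 - (norm w)\<^sup>2) =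
    (1 - (norm z)\<^sup>2) * (norm (w - z))\<^sup>2 + (cmod (herm (w - z) z))\<^sup>2"
proof -
  define a where "a = (norm z)\<^sup>2"
  define b where "b = (norm w)\<^sup>2"
  define c where "c = herm z w"
  have wz: "herm w z = cnj c" by (simp add: c_def herm_cnj)
  have "complex_of_real ((norm (w - z))\<^sup>2) = herm (w - z) (w - z)" by (simp add: herm_self)
  also have "\<dots> = of_real (b + a) - (c + cnj c)"
    unfolding herm_diff_left herm_diff_right herm_self[of z] herm_self[of w] wz c_def[symmetric]
    by (simp add: a_def b_def)
  also have "\<dots> = of_real (b + a - 2 * Re c)" by (simp add: complex_add_cnj)
  finally have 1: "(norm (w - z))\<^sup>2 = b + a - 2 * Re c" using of_real_eq_iff by blast
  have "herm (w - z) z = cnj c - of_real a" by (simp add: herm_diff_left herm_self wz a_def)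
  then have 2: "(cmod (herm (w - z) z))\<^sup>2 = (Re c - a)\<^sup>2 + (Im c)\<^sup>2" by (simp add: cmod_power2)
  have 3: "(cmod (1 - herm z w))\<^sup>2 = (1 - Re c)\<^sup>2 + (Im c)\<^sup>2"
    unfolding c_def[symmetric] by (simp add: cmod_power2)
  show ?thesis unfolding 1 2 3 a_def[symmetric] b_def[symmetric]
    by (simp add: power2_eq_square algebra_simps)
qed

lemma one_minus_inv_cosh2:
  assumes "norm z < 1" "norm w < 1"
  shows "1 - inv_cosh2 z w = ((1 - (norm z)\<^sup>2) * (norm (w - z))\<^sup>2 + (cmod (herm (w - z) z))\<^sup>2) / (cmod (1 - herm z w))\<^sup>2"
  using one_minus_herm_nz[OF assms] unfolding one_minus_inv_cosh2_numerator[symmetric] inv_cosh2_def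
  by (simp add: diff_divide_distrib)

lemma inv_cosh2_le_1: "norm z < 1 \<Longrightarrow> norm w < 1 \<Longrightarrow> inv_cosh2 z w \<le> 1"
proof -
  assume *: "norm z < 1" "norm w < 1"
  have "0 \<le> 1 - inv_cosh2 z w"
    unfolding one_minus_inv_cosh2[OF *] using one_minus_norm_sq_pos[OF *(1)]
    by (intro divide_nonneg_nonneg add_nonneg_nonneg mult_nonneg_nonneg) auto
  then show ?thesis by simp
qed

text \<open>Follows from \<open>1 + x \<le> exp x\<close>. The point z may approach the sphere, so
  the identity for \<open>1 - inv_cosh2\<close> is used with w as base point: its numerator is at
  least (1 - r^2) |z - w|^2 and its denominator at most 4.\<close>

lemma inv_cosh2_le_exp:
  assumes "norm z < 1" "norm w \<le> r" "r < 1"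
  shows "inv_cosh2 z w \<le> exp (- ((1 - r\<^sup>2) / 4 * (norm (z - w))\<^sup>2))"
proof -
  have w: "norm w < 1" using assms by simp
  have r: "0 \<le> r" using assms(2) norm_ge_zero order_trans by blast
  have c: "cmod (1 - herm w z) \<le> 2"
    using norm_triangle_ineq4[of 1 "herm w z"] herm_lt_1[OF w assms(1)] by simp
  have "(1 - r\<^sup>2) * (norm (z - w))\<^sup>2 \<le> (1 - (norm w)\<^sup>2) * (norm (z - w))\<^sup>2"
    using assms(2) by (intro mult_right_mono) (auto intro: power_mono)
  then have "(1 - r\<^sup>2) * (norm (z - w))\<^sup>2 \<le> (1 - (norm w)\<^sup>2) * (norm (z - w))\<^sup>2 + (cmod (herm (z - w) w))\<^sup>2"
    by (simp add: add_increasing2)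
  moreover have "0 \<le> (1 - r\<^sup>2) * (norm (z - w))\<^sup>2"
    using assms(3) r by (intro mult_nonneg_nonneg) (auto simp: power_le_one)
  moreover have "(cmod (1 - herm w z))\<^sup>2 \<le> 4"
    using power_mono[OF c, of 2] by simp
  ultimately have "(1 - r\<^sup>2) * (norm (z - w))\<^sup>2 / 4 \<le> 1 - inv_cosh2 w z"
    unfolding one_minus_inv_cosh2[OF w assms(1)] using one_minus_herm_nz[OF w assms(1)]
    by (intro frac_le) auto
  then have "inv_cosh2 z w \<le> 1 + - ((1 - r\<^sup>2) / 4 * (norm (z - w))\<^sup>2)"
    by (simp add: inv_cosh2_sym[of z w])
  also have "\<dots> \<le> exp (- ((1 - r\<^sup>2) / 4 * (norm (z - w))\<^sup>2))" by (rule exp_ge_add_one_self)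
  finally show ?thesis .
qed

text \<open>Boundary decay in z, uniform for w in a smaller ball; powers of this bound supply the
  square-integrable majorants below.\<close>

lemma inv_cosh2_le_weight:
  assumes "norm z < 1" "norm w \<le> r" "r < 1"
  shows "inv_cosh2 z w \<le> (1 - (norm z)\<^sup>2) / (1 - r)\<^sup>2"
proof -
  have w: "norm w < 1" using assms by simp
  have "1 - r \<le> cmod (1 - herm z w)"
  proof -
    have "cmod (herm z w) \<le> 1 * r"
      using norm_herm_le[of z w] mult_mono[of "norm z" 1 "norm w" r] assms by simp
    then show ?thesis using norm_triangle_ineq2[of 1 "herm z w"] by simp
  qed
  then have "(1 - r)\<^sup>2 \<le> (cmod (1 - herm z w))\<^sup>2" using assms by (intro power_mono) auto
  moreover have "(1 - (norm z)\<^sup>2) * (1 - (norm w)\<^sup>2) \<le> (1 - (norm z)\<^sup>2) * 1"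
    using one_minus_norm_sq_pos[OF assms(1)] by (intro mult_left_mono) auto
  ultimately show ?thesis
    unfolding inv_cosh2_def using assms one_minus_norm_sq_pos[OF assms(1)] by (intro frac_le) auto
qed

section \<open>The invariant measure as a Lebesgue density\<close>

definition ball_volume :: "'n::finite itself \<Rightarrow> real" where
  "ball_volume _ = measure lborel (ball (0 :: complex ^ 'n) 1)"

lemma ball_volume_pos: "0 < ball_volume TYPE('n::finite)"
  unfolding ball_volume_def by (rule content_ball_pos) simp

definition bergman_weight :: "complex ^ 'n \<Rightarrow> real" where
  "bergman_weight z = 1 / (ball_volume TYPE('n) * (1 - (norm z)\<^sup>2) ^ (CARD('n) + 1))"

lemma bergman_weight_measurable [measurable]: "bergman_weight \<in> borel_measurable borel"
  unfolding bergman_weight_def[abs_def] by measurable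

lemma bergman_weight_pos: "norm z < 1 \<Longrightarrow> 0 < bergman_weight z"
  using one_minus_norm_sq_pos[of z] by (simp add: bergman_weight_def ball_volume_pos)

abbreviation unit_ball :: "(complex ^ 'n) set" where "unit_ball \<equiv> ball 0 1"

lemma bergman_measure_eq:
  "bergman_measure = density (restrict_space lborel (unit_ball :: (complex ^ 'n) set)) (\<lambda>z. ennreal (bergman_weight z))"
proof (rule measure_eqI)
  have c: "1 / emeasure lborel (unit_ball :: (complex ^ 'n) set) = ennreal (1 / ball_volume TYPE('n))"
    using ball_volume_pos[where 'n = 'n] unfolding ball_volume_def content_ball[OF zero_le_one] emeasure_ball[OF zero_le_one]
    by (simp add: divide_ennreal flip: ennreal_1)
  show s: "sets (bergman_measure :: (complex ^ 'n) measure) =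
      sets (density (restrict_space lborel unit_ball) (\<lambda>z. ennreal (bergman_weight z)))"
    by (simp add: bergman_measure_def mu_def sets_restrict_space)
  fix A assume A: "A \<in> sets (bergman_measure :: (complex ^ 'n) measure)"
  have sub: "A \<subseteq> unit_ball" and [measurable]: "A \<in> sets borel"
    using A unfolding s by (auto simp: sets_restrict_space)
  have [measurable]: "(unit_ball :: (complex ^ 'n) set) \<in> sets borel" by simp
  let ?g = "\<lambda>z::complex ^ 'n. ennreal (1 / (1 - (norm z)\<^sup>2) ^ (CARD('n) + 1))"
  have "emeasure bergman_measure A = (\<integral>\<^sup>+z. ?g z * indicator A z \<partial>restrict_space mu unit_ball)"
    unfolding bergman_measure_def
    by (rule emeasure_density) (use A in \<open>auto simp: bergman_measure_def mu_def sets_restrict_space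
        intro!: measurable_restrict_space1\<close>)
  also have "\<dots> = (\<integral>\<^sup>+z. ?g z * indicator A z * indicator unit_ball z \<partial>mu)"
    by (rule nn_integral_restrict_space) (simp add: mu_def)
  also have "\<dots> = ennreal (1 / ball_volume TYPE('n)) * (\<integral>\<^sup>+z. ?g z * indicator A z * indicator unit_ball z \<partial>lborel)"
    unfolding mu_def c by (intro nn_integral_scale_measure) measurable
  also have "\<dots> = (\<integral>\<^sup>+z. ennreal (1 / ball_volume TYPE('n)) * (?g z * indicator A z * indicator unit_ball z) \<partial>lborel)"
    by (intro nn_integral_cmult[symmetric]) measurable
  also have "\<dots> = (\<integral>\<^sup>+z. ennreal (bergman_weight z) * indicator A z * indicator unit_ball z \<partial>lborel)"
  proof (rule nn_integral_cong)
    fix z :: "complex ^ 'n"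
    show "ennreal (1 / ball_volume TYPE('n)) * (?g z * indicator A z * indicator unit_ball z) =
        ennreal (bergman_weight z) * indicator A z * indicator unit_ball z"
      using ball_volume_pos[where 'n = 'n] one_minus_norm_sq_pos[of z]
      by (cases "norm z < 1") (auto simp: bergman_weight_def ennreal_mult[symmetric] indicator_def)
  qed
  also have "\<dots> = (\<integral>\<^sup>+z. ennreal (bergman_weight z) * indicator A z \<partial>restrict_space lborel unit_ball)"
    by (rule nn_integral_restrict_space[symmetric]) simp
  also have "\<dots> = emeasure (density (restrict_space lborel unit_ball) (\<lambda>z. ennreal (bergman_weight z))) A"
    by (rule emeasure_density[symmetric]) (use A s in \<open>auto intro!: measurable_restrict_space1\<close>)
  finally show "emeasure bergman_measure A = emeasure (density (restrict_space lborel unit_ball) (\<lambda>z. ennreal (bergman_weight z))) A" .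
qed

lemma space_bergman [simp]: "space (bergman_measure :: (complex ^ 'n) measure) = unit_ball"
  by (simp add: bergman_measure_eq space_restrict_space)

lemma sets_bergman: "sets (bergman_measure :: (complex ^ 'n) measure) = sets (restrict_space borel unit_ball)"
  by (simp add: bergman_measure_eq sets_restrict_space)

lemma bergman_id [measurable]: "(\<lambda>x. x) \<in> measurable (bergman_measure :: (complex ^ 'n) measure) borel"
  by (subst measurable_cong_sets[OF sets_bergman refl]) (intro measurable_restrict_space1 measurable_ident_sets refl)

lemma bergman_borel: "f \<in> borel_measurable borel \<Longrightarrow> f \<in> borel_measurable (bergman_measure :: (complex ^ 'n) measure)"
  using measurable_compose[OF bergman_id] by blast

lemma bergman_weight_nonneg_AE: "AE x in restrict_space lborel unit_ball. 0 \<le> bergman_weight x"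
  by (rule AE_I2) (auto simp: space_restrict_space intro!: less_imp_le bergman_weight_pos)

lemma
  fixes f :: "complex ^ 'n \<Rightarrow> 'b::{banach, second_countable_topology}"
  assumes f: "f \<in> borel_measurable (bergman_measure :: (complex ^ 'n) measure)"
  shows bergman_integral: "integral\<^sup>L bergman_measure f = (LINT z|lborel. indicator unit_ball z *\<^sub>R (bergman_weight z *\<^sub>R f z))"
    and bergman_integrable: "integrable bergman_measure f \<longleftrightarrow> integrable lborel (\<lambda>z. indicator unit_ball z *\<^sub>R (bergman_weight z *\<^sub>R f z))"
proof -
  have f': "f \<in> borel_measurable (restrict_space lborel unit_ball)"
    using f by (simp add: bergman_measure_eq)
  have b: "bergman_weight \<in> borel_measurable (restrict_space lborel (unit_ball :: (complex ^ 'n) set))"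
    by (intro measurable_restrict_space1) simp
  show "integral\<^sup>L bergman_measure f = (LINT z|lborel. indicator unit_ball z *\<^sub>R (bergman_weight z *\<^sub>R f z))"
    unfolding bergman_measure_eq integral_density[OF f' b bergman_weight_nonneg_AE]
    by (rule integral_restrict_space) simp
  show "integrable bergman_measure f \<longleftrightarrow> integrable lborel (\<lambda>z. indicator unit_ball z *\<^sub>R (bergman_weight z *\<^sub>R f z))"
    unfolding bergman_measure_eq integrable_density[OF f' b bergman_weight_nonneg_AE]
    by (rule integrable_restrict_space) simp
qed

lemma AE_bergman_iff:
  "(AE z in (bergman_measure :: (complex ^ 'n) measure). P z) \<longleftrightarrow> (AE z in lborel. z \<in> unit_ball \<longrightarrow> P z)"
proof -
  have "bergman_weight \<in> borel_measurable (restrict_space lborel (unit_ball :: (complex ^ 'n) set))"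
    by (intro measurable_restrict_space1) simp
  then have "(AE z in (bergman_measure :: (complex ^ 'n) measure). P z) \<longleftrightarrow>
      (AE z in restrict_space lborel unit_ball. 0 < ennreal (bergman_weight z) \<longrightarrow> P z)"
    unfolding bergman_measure_eq by (intro AE_density) auto
  also have "\<dots> \<longleftrightarrow> (AE z in lborel. z \<in> unit_ball \<longrightarrow> 0 < ennreal (bergman_weight z) \<longrightarrow> P z)"
    by (rule AE_restrict_space_iff) simp
  also have "\<dots> \<longleftrightarrow> (AE z in lborel. z \<in> unit_ball \<longrightarrow> P z)"
    by (intro AE_cong) (auto intro: bergman_weight_pos)
  finally show ?thesis .
qed

lemma sigma_finite_bergman: "sigma_finite_measure (bergman_measure :: (complex ^ 'n) measure)"
  unfolding bergman_measure_eq
proof (rule sigma_finite_measure.sigma_finite_iff_density_finite[THEN iffD2])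
  show "sigma_finite_measure (restrict_space lborel (unit_ball :: (complex ^ 'n) set))"
    by (intro sigma_finite_measure_restrict_space sigma_finite_lborel) simp
  show "(\<lambda>z. ennreal (bergman_weight z)) \<in> borel_measurable (restrict_space lborel (unit_ball :: (complex ^ 'n) set))"
    by (intro measurable_restrict_space1) simp
qed auto

section \<open>Radial integration\<close>

text \<open>The set \<open>(norm z)^2 \<le> a\<close> has volume proportional to a^n, as the real
  dimension is 2 n; differentiating in a gives the density. Half-lines generate the Borel sets and
  are stable under intersection.\<close>

lemma distr_norm_sq:
  "distr lborel borel (\<lambda>z :: complex ^ 'n. (norm z)\<^sup>2) =
    density lborel (\<lambda>x. ennreal (ball_volume TYPE('n) * (real CARD('n) * x ^ (CARD('n) - 1))) * indicator {0..} x)"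
  (is "?L = ?R")
proof (rule measure_eqI_generator_eq[where E = "range (\<lambda>a::real. {..a})" and \<Omega> = UNIV and A = "\<lambda>i. {..real i}"])
  let ?n = "CARD('n)"
  have eqL: "emeasure ?L {..a} = (if 0 \<le> a then ennreal (ball_volume TYPE('n) * a ^ ?n) else 0)" for a
  proof -
    have "emeasure ?L {..a} = emeasure lborel {z :: complex ^ 'n. (norm z)\<^sup>2 \<le> a}"
      by (subst emeasure_distr) (auto simp: vimage_def)
    also have "\<dots> = (if 0 \<le> a then ennreal (ball_volume TYPE('n) * a ^ ?n) else 0)"
    proof (cases "0 \<le> a")
      case True
      have "{z :: complex ^ 'n. (norm z)\<^sup>2 \<le> a} = cball 0 (sqrt a)"
      proof -
        have "(norm z)\<^sup>2 \<le> a \<longleftrightarrow> norm z \<le> sqrt a" for z :: "complex ^ 'n"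
          using real_sqrt_le_iff[of "(norm z)\<^sup>2" a] by simp
        then show ?thesis by (simp add: cball_def)
      qed
      then show ?thesis
        using True by (simp add: emeasure_cball ball_volume_def content_ball power_mult mult.commute[of ?n 2])
    next
      case False
      then have "{z :: complex ^ 'n. (norm z)\<^sup>2 \<le> a} = {}"
        using order_trans[OF zero_le_power2] by auto
      then show ?thesis using False by simp
    qed
    finally show ?thesis .
  qed
  have eqR: "emeasure ?R {..a} = (if 0 \<le> a then ennreal (ball_volume TYPE('n) * a ^ ?n) else 0)" for a
  proof -
    have "emeasure ?R {..a} = (\<integral>\<^sup>+x. ennreal (ball_volume TYPE('n) * (real ?n * x ^ (?n - 1))) * indicator {0..a} x \<partial>lborel)"
      by (subst emeasure_density) (auto intro!: nn_integral_cong simp: indicator_def)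
    also have "\<dots> = (if 0 \<le> a then ennreal (ball_volume TYPE('n) * a ^ ?n) else 0)"
    proof (cases "0 \<le> a")
      case True
      have "(\<integral>\<^sup>+x. ennreal (ball_volume TYPE('n) * (real ?n * x ^ (?n - 1))) * indicator {0..a} x \<partial>lborel) =
          ennreal (ball_volume TYPE('n) * a ^ ?n - ball_volume TYPE('n) * 0 ^ ?n)"
        using True ball_volume_pos[where 'n = 'n]
        by (intro nn_integral_FTC_Icc) (auto intro!: derivative_eq_intros mult_nonneg_nonneg)
      also have "(0::real) ^ ?n = 0" by (simp add: zero_power)
      finally show ?thesis using True by simp
    qed simp
    finally show ?thesis .
  qed
  show "emeasure ?L X = emeasure ?R X" if "X \<in> range (\<lambda>a::real. {..a})" for X
    using that eqL eqR by auto
  show "emeasure ?L {..real i} \<noteq> \<infinity>" for i by (simp add: eqL)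
  show "(\<Union>i. {..real i}) = UNIV" using real_arch_simple by auto
  show "Int_stable (range (\<lambda>a::real. {..a}))"
    by (auto simp: Int_stable_def)
  show "sets ?L = sigma_sets UNIV (range (\<lambda>a::real. {..a}))" "sets ?R = sigma_sets UNIV (range (\<lambda>a::real. {..a}))"
    by (simp_all add: borel_eq_atMost)
qed auto

lemma nn_integral_radial:
  assumes [measurable]: "g \<in> borel_measurable borel"
  shows "(\<integral>\<^sup>+z. g ((norm (z :: complex ^ 'n))\<^sup>2) \<partial>lborel) =
    (\<integral>\<^sup>+x. ennreal (ball_volume TYPE('n) * (real CARD('n) * x ^ (CARD('n) - 1))) * indicator {0..} x * g x \<partial>lborel)"
proof -
  have "(\<integral>\<^sup>+z. g ((norm (z :: complex ^ 'n))\<^sup>2) \<partial>lborel) =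
      (\<integral>\<^sup>+x. g x \<partial>distr lborel borel (\<lambda>z :: complex ^ 'n. (norm z)\<^sup>2))"
    by (rule nn_integral_distr[symmetric]) auto
  also have "\<dots> = (\<integral>\<^sup>+x. ennreal (ball_volume TYPE('n) * (real CARD('n) * x ^ (CARD('n) - 1))) * indicator {0..} x * g x \<partial>lborel)"
    unfolding distr_norm_sq by (rule nn_integral_density) auto
  finally show ?thesis .
qed

lemma powr_card_minus_1:
  "0 < x \<Longrightarrow> x powr (real CARD('n::finite) - 1) = x ^ (CARD('n) - 1)"
  using powr_realpow[of x "CARD('n) - 1"] by (simp add: of_nat_diff Suc_leI)

lemma gaussian_integral_1:
  "(\<integral>\<^sup>+z. ennreal (exp (- (norm (z :: complex ^ 'n))\<^sup>2)) \<partial>lborel) = ennreal (ball_volume TYPE('n) * fact CARD('n))"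
proof -
  let ?n = "CARD('n)"
  have "(\<integral>\<^sup>+z. ennreal (exp (- (norm (z :: complex ^ 'n))\<^sup>2)) \<partial>lborel) =
      (\<integral>\<^sup>+x. ennreal (ball_volume TYPE('n) * (real ?n * x ^ (?n - 1))) * indicator {0..} x * ennreal (exp (- x)) \<partial>lborel)"
    by (rule nn_integral_radial[of "\<lambda>x. ennreal (exp (- x))"]) simp
  also have "\<dots> = (\<integral>\<^sup>+x. ennreal (ball_volume TYPE('n) * real ?n * (indicator {0..} x * (x powr (real ?n - 1) / exp x))) \<partial>lborel)"
  proof (rule nn_integral_cong_AE)
    \<comment> \<open>The point 0 is excluded because \<open>0 powr 0 = 0\<close> whereas
      \<open>0 ^ 0 = 1\<close>, which matters for n = 1.\<close>
    have "AE x in lborel. x \<noteq> (0::real)" by (rule AE_lborel_singleton)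
    then show "AE x in lborel. ennreal (ball_volume TYPE('n) * (real ?n * x ^ (?n - 1))) * indicator {0..} x * ennreal (exp (- x)) =
        ennreal (ball_volume TYPE('n) * real ?n * (indicator {0..} x * (x powr (real ?n - 1) / exp x)))"
    proof eventually_elim
      case (elim x)
      then show ?case
        using ball_volume_pos[where 'n = 'n]
        by (auto simp: indicator_def powr_card_minus_1 exp_minus divide_inverse ennreal_mult[symmetric] mult.assoc
            intro!: arg_cong[where f = ennreal])
    qed
  qed
  also have "\<dots> = ennreal (ball_volume TYPE('n) * real ?n * Gamma (real ?n))"
  proof (rule nn_integral_has_integral_lborel)
    have "((\<lambda>t. t powr (real ?n - 1) / exp t) has_integral Gamma (real ?n)) {0..}"
      by (rule Gamma_integral_real) simp
    then have "((\<lambda>t. if t \<in> {0..} then t powr (real ?n - 1) / exp t else 0) has_integral Gamma (real ?n)) UNIV"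
      by (simp only: has_integral_restrict_UNIV)
    then have "((\<lambda>t. indicator {0..} t * (t powr (real ?n - 1) / exp t)) has_integral Gamma (real ?n)) UNIV"
      by (rule has_integral_eq[rotated]) (auto simp: indicator_def)
    then show "((\<lambda>x. ball_volume TYPE('n) * real ?n * (indicator {0..} x * (x powr (real ?n - 1) / exp x))) has_integral
        ball_volume TYPE('n) * real ?n * Gamma (real ?n)) UNIV"
      by (rule has_integral_mult_right)
  qed (use ball_volume_pos[where 'n = 'n] in \<open>auto simp: indicator_def\<close>)
  also have "ball_volume TYPE('n) * real ?n * Gamma (real ?n) = ball_volume TYPE('n) * fact ?n"
    using Gamma_fact[of "?n - 1", where 'a = real] fact_reduce[of ?n, where 'a = real] by simp
  finally show ?thesis .
qed

text \<open>Radially a Beta integral. The density of the invariant measure lowers the exponent to a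
  - n - 1, which must exceed -1. With a = 2 s this is the threshold n/2 < s above which the kernels
  are square-integrable.\<close>

lemma weight_integrable:
  assumes a: "real CARD('n) < a"
  shows "integrable (bergman_measure :: (complex ^ 'n) measure) (\<lambda>z. (1 - (norm z)\<^sup>2) powr a)"
proof -
  let ?n = "CARD('n)"
  let ?g = "\<lambda>x::real. indicator {..<1} x * (1 - x) powr (a - real ?n - 1)"
  have [measurable]: "(\<lambda>z :: complex ^ 'n. (1 - (norm z)\<^sup>2) powr a) \<in> borel_measurable borel" by measurable
  have "(\<integral>\<^sup>+z. ennreal (?g ((norm (z :: complex ^ 'n))\<^sup>2)) \<partial>lborel) =
      (\<integral>\<^sup>+x. ennreal (ball_volume TYPE('n) * (real ?n * x ^ (?n - 1))) * indicator {0..} x * ennreal (?g x) \<partial>lborel)"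
    by (rule nn_integral_radial) simp
  also have "\<dots> = (\<integral>\<^sup>+x. ennreal (ball_volume TYPE('n) * real ?n *
      (indicator {0..1} x * (x powr (real ?n - 1) * (1 - x) powr (a - real ?n - 1)))) \<partial>lborel)"
  proof (rule nn_integral_cong_AE)
    have "AE x in lborel. x \<noteq> (0::real)" "AE x in lborel. x \<noteq> (1::real)" by (rule AE_lborel_singleton)+
    then show "AE x in lborel. ennreal (ball_volume TYPE('n) * (real ?n * x ^ (?n - 1))) * indicator {0..} x * ennreal (?g x) =
        ennreal (ball_volume TYPE('n) * real ?n * (indicator {0..1} x * (x powr (real ?n - 1) * (1 - x) powr (a - real ?n - 1))))"
    proof eventually_elim
      case (elim x)
      then show ?case
        using ball_volume_pos[where 'n = 'n]
        by (auto simp: indicator_def powr_card_minus_1 ennreal_mult[symmetric] mult.assoc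
            intro!: arg_cong[where f = ennreal])
    qed
  qed
  also have "\<dots> = ennreal (ball_volume TYPE('n) * real ?n * Beta (real ?n) (a - real ?n))"
  proof (rule nn_integral_has_integral_lborel)
    have "((\<lambda>t. t powr (real ?n - 1) * (1 - t) powr (a - real ?n - 1)) has_integral Beta (real ?n) (a - real ?n)) {0..1}"
      using a by (intro has_integral_Beta_real) auto
    then have "((\<lambda>t. if t \<in> {0..1} then t powr (real ?n - 1) * (1 - t) powr (a - real ?n - 1) else 0)
        has_integral Beta (real ?n) (a - real ?n)) UNIV"
      by (simp only: has_integral_restrict_UNIV)
    then have "((\<lambda>t. indicator {0..1} t * (t powr (real ?n - 1) * (1 - t) powr (a - real ?n - 1)))
        has_integral Beta (real ?n) (a - real ?n)) UNIV"
      by (rule has_integral_eq[rotated]) (auto simp: indicator_def)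
    then show "((\<lambda>t. ball_volume TYPE('n) * real ?n * (indicator {0..1} t * (t powr (real ?n - 1) * (1 - t) powr (a - real ?n - 1))))
        has_integral (ball_volume TYPE('n) * real ?n * Beta (real ?n) (a - real ?n))) UNIV"
      by (rule has_integral_mult_right)
  qed (use ball_volume_pos[where 'n = 'n] in \<open>auto simp: indicator_def\<close>)
  finally have fin: "(\<integral>\<^sup>+z. ennreal (?g ((norm (z :: complex ^ 'n))\<^sup>2)) \<partial>lborel) < \<infinity>" by simp
  have "integrable lborel (\<lambda>z :: complex ^ 'n. ?g ((norm z)\<^sup>2))"
    using fin by (intro integrableI_nonneg) auto
  then have "integrable lborel (\<lambda>z :: complex ^ 'n. 1 / ball_volume TYPE('n) * ?g ((norm z)\<^sup>2))"
    by (rule integrable_mult_right)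
  also have "(\<lambda>z :: complex ^ 'n. 1 / ball_volume TYPE('n) * ?g ((norm z)\<^sup>2)) =
      (\<lambda>z. indicator unit_ball z *\<^sub>R (bergman_weight z *\<^sub>R (1 - (norm z)\<^sup>2) powr a))"
  proof
    fix z :: "complex ^ 'n"
    show "1 / ball_volume TYPE('n) * ?g ((norm z)\<^sup>2) = indicator unit_ball z *\<^sub>R (bergman_weight z *\<^sub>R (1 - (norm z)\<^sup>2) powr a)"
    proof (cases "norm z < 1")
      case True
      have "(1 - (norm z)\<^sup>2) powr (a - real ?n - 1) = (1 - (norm z)\<^sup>2) powr (a - real (?n + 1))"
        by (rule arg_cong) simp
      also have "\<dots> = (1 - (norm z)\<^sup>2) powr a / (1 - (norm z)\<^sup>2) ^ (?n + 1)"
        using one_minus_norm_sq_pos[OF True] by (simp only: powr_diff powr_realpow)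
      finally show ?thesis
        using True one_minus_norm_sq_pos[OF True] by (simp add: bergman_weight_def indicator_def)
    next
      case False
      then have "1 \<le> (norm z)\<^sup>2" by (simp add: one_le_power)
      then have "\<not> (norm z)\<^sup>2 < 1" by simp
      then show ?thesis using False by (simp only: indicator_def) simp
    qed
  qed
  finally show ?thesis by (subst bergman_integrable) (auto intro: bergman_borel)
qed

section \<open>Wirtinger calculus and Green's identity\<close>

text \<open>The real derivative as a combination of the differentials of the coordinates and of
  their conjugates. Carrying both families of coefficients at once turns the product and chain rules
  into introduction rules that assemble the derivatives of composite expressions.\<close>

definition has_wirtinger :: "(complex ^ 'n \<Rightarrow> complex) \<Rightarrow> ('n \<Rightarrow> complex) \<Rightarrow> ('n \<Rightarrow> complex) \<Rightarrow> complex ^ 'n \<Rightarrow> bool" where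
  "has_wirtinger F p q z \<longleftrightarrow> (F has_derivative (\<lambda>v. \<Sum>i\<in>UNIV. p i * v $ i + q i * cnj (v $ i))) (at z)"

lemma has_wirtinger_dir_deriv: "has_wirtinger F p q z \<Longrightarrow> dir_deriv v F z = (\<Sum>i\<in>UNIV. p i * v $ i + q i * cnj (v $ i))"
  unfolding has_wirtinger_def dir_deriv_def by (subst frechet_derivative_at[symmetric]) auto

lemma sum_axis: "(\<Sum>i\<in>UNIV. p i * axis j (c::complex) $ i + q i * cnj (axis j c $ i)) = p j * c + q j * cnj c"
proof -
  have "(\<Sum>i\<in>UNIV. p i * axis j c $ i + q i * cnj (axis j c $ i)) =
      (\<Sum>i\<in>UNIV. if i = j then p j * c + q j * cnj c else 0)"
    by (rule sum.cong) (auto simp: axis_def)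
  then show ?thesis by simp
qed

lemma has_wirtinger_wirtinger: "has_wirtinger F p q z \<Longrightarrow> wirtinger i F z = p i"
  by (simp add: wirtinger_def has_wirtinger_dir_deriv sum_axis algebra_simps)

lemma has_wirtinger_wirtinger_bar: "has_wirtinger F p q z \<Longrightarrow> wirtinger_bar i F z = q i"
  by (simp add: wirtinger_bar_def has_wirtinger_dir_deriv sum_axis algebra_simps)

lemma differentiable_has_wirtinger:
  assumes "F differentiable (at z)"
  shows "has_wirtinger F (\<lambda>i. wirtinger i F z) (\<lambda>i. wirtinger_bar i F z) z"
proof -
  let ?D = "frechet_derivative F (at z)"
  have D: "(F has_derivative ?D) (at z)" using assms frechet_derivative_works by blast
  interpret linear ?D using D by (rule has_derivative_linear)
  have "?D v = (\<Sum>i\<in>UNIV. wirtinger i F z * v $ i + wirtinger_bar i F z * cnj (v $ i))" for v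
  proof -
    have "v = (\<Sum>i\<in>UNIV. Re (v $ i) *\<^sub>R axis i 1 + Im (v $ i) *\<^sub>R axis i \<i>)"
    proof (subst vec_eq_iff, rule allI)
      fix j
      have "(\<Sum>i\<in>UNIV. Re (v $ i) *\<^sub>R axis i 1 + Im (v $ i) *\<^sub>R axis i \<i>) $ j =
          (\<Sum>i\<in>UNIV. if i = j then Re (v $ i) *\<^sub>R 1 + Im (v $ i) *\<^sub>R \<i> else 0)"
        unfolding sum_component by (rule sum.cong) (auto simp: axis_def)
      also have "\<dots> = v $ j" by (simp add: complex_eq_iff)
      finally show "v $ j = (\<Sum>i\<in>UNIV. Re (v $ i) *\<^sub>R axis i 1 + Im (v $ i) *\<^sub>R axis i \<i>) $ j" ..
    qed
    then have "?D v = (\<Sum>i\<in>UNIV. Re (v $ i) *\<^sub>R ?D (axis i 1) + Im (v $ i) *\<^sub>R ?D (axis i \<i>))"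
      by (metis (no_types, lifting) add scale sum sum.cong)
    also have "\<dots> = (\<Sum>i\<in>UNIV. wirtinger i F z * v $ i + wirtinger_bar i F z * cnj (v $ i))"
    proof (rule sum.cong)
      fix i
      have "a *\<^sub>R x + b *\<^sub>R y = (x - \<i> * y) / 2 * Complex a b + (x + \<i> * y) / 2 * cnj (Complex a b)" for a b x y
        by (simp add: complex_eq_iff algebra_simps add_divide_distrib diff_divide_distrib)
      from this[of "Re (v $ i)" "?D (axis i 1)" "Im (v $ i)" "?D (axis i \<i>)"]
      show "Re (v $ i) *\<^sub>R ?D (axis i 1) + Im (v $ i) *\<^sub>R ?D (axis i \<i>) =
          wirtinger i F z * v $ i + wirtinger_bar i F z * cnj (v $ i)"
        by (simp add: wirtinger_def wirtinger_bar_def dir_deriv_def)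
    qed simp
    finally show ?thesis .
  qed
  then have "?D = (\<lambda>v. \<Sum>i\<in>UNIV. wirtinger i F z * v $ i + wirtinger_bar i F z * cnj (v $ i))" by auto
  with D show ?thesis unfolding has_wirtinger_def by simp
qed

lemma has_wirtinger_const: "has_wirtinger (\<lambda>z. c) (\<lambda>i. 0) (\<lambda>i. 0) z"
  by (simp add: has_wirtinger_def)

lemma has_wirtinger_add: "has_wirtinger F p q z \<Longrightarrow> has_wirtinger G p' q' z \<Longrightarrow> has_wirtinger (\<lambda>z. F z + G z) (\<lambda>i. p i + p' i) (\<lambda>i. q i + q' i) z"
  unfolding has_wirtinger_def
  by (drule (1) has_derivative_add) (simp add: sum.distrib[symmetric] algebra_simps)

lemma has_wirtinger_mult:
  assumes "has_wirtinger F p q z" "has_wirtinger G p' q' z"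
  shows "has_wirtinger (\<lambda>z. F z * G z) (\<lambda>i. F z * p' i + p i * G z) (\<lambda>i. F z * q' i + q i * G z) z"
proof -
  have "((\<lambda>z. F z * G z) has_derivative (\<lambda>v. F z * (\<Sum>i\<in>UNIV. p' i * v $ i + q' i * cnj (v $ i)) +
      (\<Sum>i\<in>UNIV. p i * v $ i + q i * cnj (v $ i)) * G z)) (at z)"
    using assms unfolding has_wirtinger_def by (rule has_derivative_mult)
  then show ?thesis unfolding has_wirtinger_def
    by (rule has_derivative_eq_rhs)
      (simp add: sum_distrib_left sum_distrib_right sum.distrib[symmetric] algebra_simps)
qed

lemma has_wirtinger_chain:
  assumes "has_wirtinger F p q z" "(g has_field_derivative d) (at (F z))"
  shows "has_wirtinger (\<lambda>z. g (F z)) (\<lambda>i. d * p i) (\<lambda>i. d * q i) z"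
proof -
  have "((\<lambda>z. g (F z)) has_derivative (\<lambda>v. d * (\<Sum>i\<in>UNIV. p i * v $ i + q i * cnj (v $ i)))) (at z)"
    using has_derivative_compose[OF assms(1)[unfolded has_wirtinger_def], of g "\<lambda>x. d * x"] assms(2)
    by (simp add: has_field_derivative_def)
  then show ?thesis unfolding has_wirtinger_def
    by (rule has_derivative_eq_rhs) (simp add: sum_distrib_left algebra_simps)
qed

lemma has_wirtinger_cmult: "has_wirtinger F p q z \<Longrightarrow> has_wirtinger (\<lambda>z. c * F z) (\<lambda>i. c * p i) (\<lambda>i. c * q i) z"
  using has_wirtinger_mult[OF has_wirtinger_const, of F p q z c] by simp

lemma has_wirtinger_sum:
  "finite I \<Longrightarrow> (\<And>j. j \<in> I \<Longrightarrow> has_wirtinger (F j) (p j) (q j) z) \<Longrightarrow>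
    has_wirtinger (\<lambda>z. \<Sum>j\<in>I. F j z) (\<lambda>i. \<Sum>j\<in>I. p j i) (\<lambda>i. \<Sum>j\<in>I. q j i) z"
  by (induction I rule: finite_induct) (simp_all add: has_wirtinger_const has_wirtinger_add)

lemma has_wirtinger_coord: "has_wirtinger (\<lambda>z. z $ j) (\<lambda>i. of_bool (i = j)) (\<lambda>i. 0) z"
proof -
  have "((\<lambda>z. z $ j) has_derivative (\<lambda>v. v $ j)) (at z)"
    by (rule bounded_linear_imp_has_derivative[OF bounded_linear_vec_nth])
  moreover have "(\<Sum>i\<in>UNIV. of_bool (i = j) * v $ i + 0 * cnj (v $ i)) = v $ j" for v :: "complex ^ 'a"
  proof -
    have "(\<Sum>i\<in>UNIV. of_bool (i = j) * v $ i + 0 * cnj (v $ i)) = (\<Sum>i\<in>UNIV. if i = j then v $ i else 0)"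
      by (rule sum.cong) auto
    then show ?thesis by simp
  qed
  ultimately show ?thesis unfolding has_wirtinger_def by simp
qed

lemma has_wirtinger_cnj: "has_wirtinger F p q z \<Longrightarrow> has_wirtinger (\<lambda>z. cnj (F z)) (\<lambda>i. cnj (q i)) (\<lambda>i. cnj (p i)) z"
  unfolding has_wirtinger_def
  by (drule bounded_linear.has_derivative[OF bounded_linear_cnj]) (simp add: add.commute)

lemma has_wirtinger_cnj_coord: "has_wirtinger (\<lambda>z. cnj (z $ j)) (\<lambda>i. 0) (\<lambda>i. of_bool (i = j)) z"
  using has_wirtinger_cnj[OF has_wirtinger_coord, of j z] by (simp add: of_bool_def if_distrib cong: if_cong)

lemma has_wirtinger_cong_fun: "has_wirtinger F p q z \<Longrightarrow> (\<And>i. p i = p' i) \<Longrightarrow> (\<And>i. q i = q' i) \<Longrightarrow> has_wirtinger F p' q' z"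
  by (simp add: has_wirtinger_def)

lemma has_wirtinger_uminus: "has_wirtinger F p q z \<Longrightarrow> has_wirtinger (\<lambda>z. - F z) (\<lambda>i. - p i) (\<lambda>i. - q i) z"
  using has_wirtinger_cmult[of F p q z "-1"] by simp

lemma has_wirtinger_diff: "has_wirtinger F p q z \<Longrightarrow> has_wirtinger G p' q' z \<Longrightarrow> has_wirtinger (\<lambda>z. F z - G z) (\<lambda>i. p i - p' i) (\<lambda>i. q i - q' i) z"
  using has_wirtinger_add[OF _ has_wirtinger_uminus, of F p q z G p' q'] by simp

lemma sum_of_bool_eq: "(\<Sum>j\<in>UNIV. of_bool (i = j) * f j) = (f (i::'a::finite) :: complex)"
proof -
  have "(\<Sum>j\<in>UNIV. of_bool (i = j) * f j) = (\<Sum>j\<in>UNIV. if j = i then f j else 0)"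
    by (rule sum.cong) auto
  then show ?thesis by simp
qed

lemma has_wirtinger_herm_left: "has_wirtinger (\<lambda>z. herm z w) (\<lambda>i. cnj (w $ i)) (\<lambda>i. 0) z"
proof -
  have "has_wirtinger (\<lambda>z. \<Sum>j\<in>UNIV. cnj (w $ j) * z $ j) (\<lambda>i. \<Sum>j\<in>UNIV. cnj (w $ j) * of_bool (i = j)) (\<lambda>i. \<Sum>j\<in>UNIV. cnj (w $ j) * 0) z"
    by (intro has_wirtinger_sum has_wirtinger_cmult has_wirtinger_coord) auto
  then show ?thesis
    unfolding herm_def using sum_of_bool_eq[of _ "\<lambda>j. cnj (w $ j)"]
    by (simp add: mult.commute)
qed

lemma has_wirtinger_herm_right: "has_wirtinger (\<lambda>z. herm w z) (\<lambda>i. 0) (\<lambda>i. w $ i) z"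
  using has_wirtinger_cnj[OF has_wirtinger_herm_left, of w z] by (simp add: herm_cnj)

lemma has_wirtinger_herm_self: "has_wirtinger (\<lambda>z. herm z z) (\<lambda>i. cnj (z $ i)) (\<lambda>i. z $ i) z"
proof -
  have "has_wirtinger (\<lambda>z. \<Sum>j\<in>UNIV. z $ j * cnj (z $ j))
      (\<lambda>i. \<Sum>j\<in>UNIV. z $ j * 0 + of_bool (i = j) * cnj (z $ j))
      (\<lambda>i. \<Sum>j\<in>UNIV. z $ j * of_bool (i = j) + 0 * cnj (z $ j)) z"
    by (intro has_wirtinger_sum has_wirtinger_mult has_wirtinger_coord has_wirtinger_cnj_coord) auto
  then show ?thesis
    unfolding herm_def using sum_of_bool_eq[of _ "\<lambda>j. z $ j"] sum_of_bool_eq[of _ "\<lambda>j. cnj (z $ j)"]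
    by (simp add: mult.commute)
qed

text \<open>Difference quotients integrate to zero by translation invariance.\<close>

lemma integral_dir_deriv_zero:
  fixes F :: "'a::euclidean_space \<Rightarrow> complex"
  assumes K: "compact K" "K \<subseteq> U" "open U" and F0: "\<And>z. z \<notin> K \<Longrightarrow> F z = 0"
    and D: "\<And>z. z \<in> U \<Longrightarrow> (F has_derivative D z) (at z)"
    and cont: "continuous_on U (\<lambda>z. D z v)"
  shows "(LINT z|lborel. indicator U z *\<^sub>R D z v) = 0"
    and "integrable lborel (\<lambda>z. indicator U z *\<^sub>R D z v)"
proof -
  \<comment> \<open>The directional derivative extended by zero; it is continuous everywhere because
    U and the complement of K are open and cover the space.\<close>
  define g where "g z = (indicator U z :: real) *\<^sub>R D z v" for z
  have openK: "open (- K)" using K(1) by (simp add: compact_imp_closed open_Compl)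
  have D0: "(F has_derivative (\<lambda>v. 0)) (at z)" if "z \<notin> K" for z
    by (rule has_derivative_transform_within_open[OF has_derivative_const openK, of z])
      (use that F0 in auto)
  have g0: "g z = 0" if "z \<notin> K" for z
  proof (cases "z \<in> U")
    case True
    then have "D z = (\<lambda>v. 0)" using has_derivative_unique[OF D D0] that by blast
    then show ?thesis by (simp add: g_def)
  qed (simp add: g_def)
  have Dg: "\<exists>D'. (F has_derivative D') (at z) \<and> D' v = g z" for z
  proof (cases "z \<in> U")
    case True then show ?thesis using D by (auto simp: g_def)
  next
    case False
    then have "z \<notin> K" using K(2) by blast
    then show ?thesis using D0[of z] g0[of z] by (intro exI[of _ "\<lambda>v. 0"]) simp
  qed
  have gcont: "continuous_on UNIV g"
  proof -
    have "continuous_on U g" by (rule continuous_on_cong[THEN iffD2, OF refl _ cont]) (simp add: g_def)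
    moreover have "continuous_on (- K) g"
      by (rule continuous_on_cong[THEN iffD2, OF refl _ continuous_on_const[of _ 0]]) (simp add: g0)
    ultimately have "continuous_on (U \<union> - K) g"
      using K(3) openK by (rule continuous_on_open_Un[rotated 2])
    moreover have "U \<union> - K = UNIV" using K(2) by auto
    ultimately show ?thesis by simp
  qed
  have Fcont: "continuous_on UNIV F"
    by (rule continuous_at_imp_continuous_on) (use Dg has_derivative_continuous in blast)
  obtain C where C: "\<And>z. norm (g z) \<le> C" "0 \<le> C"
  proof -
    have "bounded (g ` K)"
      by (intro compact_imp_bounded compact_continuous_image K continuous_on_subset[OF gcont]) auto
    then obtain C where "C > 0" "\<And>z. z \<in> K \<Longrightarrow> norm (g z) \<le> C"
      by (auto simp: bounded_pos)
    then have "norm (g z) \<le> C" for z using g0[of z] by (cases "z \<in> K") auto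
    then show ?thesis using that[of C] \<open>C > 0\<close> by simp
  qed
  have intK: "integrable lborel f" if "continuous_on UNIV f" "\<And>z. z \<notin> K \<Longrightarrow> f z = 0" for f :: "'a \<Rightarrow> complex"
  proof -
    have "integrable lborel (\<lambda>z. indicator K z *\<^sub>R f z)"
      using K(1) that(1) by (intro borel_integrable_compact continuous_on_subset[OF that(1)]) auto
    moreover have "(\<lambda>z. indicator K z *\<^sub>R f z) = f" using that(2) by (auto simp: indicator_def)
    ultimately show ?thesis by simp
  qed
  have gint: "integrable lborel g" using gcont g0 by (rule intK)
  have Fint: "integrable lborel F" using Fcont F0 by (rule intK)
  show "integrable lborel (\<lambda>z. indicator U z *\<^sub>R D z v)" using gint unfolding g_def .
  obtain R where R: "\<And>z. z \<in> K \<Longrightarrow> norm z \<le> R" "0 < R"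
    using compact_imp_bounded[OF K(1)] by (auto simp: bounded_pos)
  define h where "h k z = of_nat (Suc k) * (F (z + (1 / real (Suc k)) *\<^sub>R v) - F z)" for k z
  have line: "((\<lambda>t. F (z + t *\<^sub>R v)) has_vector_derivative g (z + t *\<^sub>R v)) (at t)" for z t
  proof -
    obtain D' where D': "(F has_derivative D') (at (z + t *\<^sub>R v))" "D' v = g (z + t *\<^sub>R v)"
      using Dg by blast
    have "((\<lambda>t. z + t *\<^sub>R v) has_derivative (\<lambda>s. s *\<^sub>R v)) (at t)"
      by (auto intro!: derivative_eq_intros)
    from has_derivative_compose[OF this D'(1)]
    show ?thesis
      unfolding has_vector_derivative_def using linear_scale[OF has_derivative_linear[OF D'(1)]] D'(2)
      by simp
  qed
  have hb: "norm (h k z) \<le> C" for k z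
  proof -
    have "norm (F (z + (1 / real (Suc k)) *\<^sub>R v) - F (z + 0 *\<^sub>R v)) \<le> C * norm (1 / real (Suc k) - 0)"
    proof (rule differentiable_bound[where S = UNIV and f = "\<lambda>t. F (z + t *\<^sub>R v)"])
      show "((\<lambda>t. F (z + t *\<^sub>R v)) has_derivative (\<lambda>s. s *\<^sub>R g (z + t *\<^sub>R v))) (at t within UNIV)" for t
        using line[of z t] by (simp add: has_vector_derivative_def)
      show "onorm (\<lambda>s. s *\<^sub>R g (z + t *\<^sub>R v)) \<le> C" for t
        using C by (intro onorm_bound) (auto simp: mult.commute[of C] intro: mult_left_mono)
    qed auto
    then have "real (Suc k) * norm (F (z + (1 / real (Suc k)) *\<^sub>R v) - F z) \<le> real (Suc k) * (C * (1 / real (Suc k)))"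
      by (intro mult_left_mono) auto
    also have "\<dots> = C" by simp
    finally show ?thesis by (simp add: h_def norm_mult del: of_nat_Suc)
  qed
  have kern_limit: "(\<lambda>k. h k z) \<longlonglongrightarrow> g z" for z
  proof -
    have "(\<lambda>t. norm (F (z + (0 + t) *\<^sub>R v) - F (z + 0 *\<^sub>R v) - t *\<^sub>R g (z + 0 *\<^sub>R v)) / norm t) \<midarrow>0\<rightarrow> 0"
      using conjunct2[OF line[of z 0, unfolded has_vector_derivative_def has_derivative_at]] .
    then have "(\<lambda>t. norm (F (z + t *\<^sub>R v) - F z - t *\<^sub>R g z) / norm t) \<midarrow>0\<rightarrow> 0" by simp
    moreover have "filterlim (\<lambda>k. 1 / real (Suc k)) (at 0) sequentially"
      using LIMSEQ_inverse_real_of_nat by (auto simp: filterlim_at inverse_eq_divide)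
    ultimately have "(\<lambda>k. norm (F (z + (1 / real (Suc k)) *\<^sub>R v) - F z - (1 / real (Suc k)) *\<^sub>R g z) / norm (1 / real (Suc k))) \<longlonglongrightarrow> 0"
      by (rule filterlim_compose)
    moreover have "norm (F (z + (1 / real (Suc k)) *\<^sub>R v) - F z - (1 / real (Suc k)) *\<^sub>R g z) / norm (1 / real (Suc k)) =
        norm (h k z - g z)" for k
    proof -
      have "h k z - g z = of_real (real (Suc k)) * (F (z + (1 / real (Suc k)) *\<^sub>R v) - F z - (1 / real (Suc k)) *\<^sub>R g z)"
        by (simp add: h_def scaleR_conv_of_real right_diff_distrib del: of_nat_Suc)
      then show ?thesis by (simp add: norm_mult mult.commute del: of_nat_Suc)
    qed
    ultimately have "(\<lambda>k. norm (h k z - g z)) \<longlonglongrightarrow> 0" by simp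
    from tendsto_norm_zero_cancel[OF this] show ?thesis by (rule LIM_zero_cancel)
  qed
  have trans: "integrable lborel (\<lambda>z. F (z + a))" "(LINT z|lborel. F (z + a)) = (LINT z|lborel. F z)" for a
  proof -
    have "integrable (distr lborel borel ((+) a)) F" using Fint by (simp add: lborel_distr_plus)
    then show "integrable lborel (\<lambda>z. F (z + a))"
      by (subst (asm) integrable_distr_eq)
        (auto simp: add.commute borel_measurable_continuous_onI[OF Fcont])
    have "(LINT z|lborel. F z) = (LINT z|distr lborel borel ((+) a). F z)" by (simp add: lborel_distr_plus)
    also have "\<dots> = (LINT z|lborel. F (a + z))"
      by (rule integral_distr) (auto simp: borel_measurable_continuous_onI[OF Fcont])
    finally show "(LINT z|lborel. F (z + a)) = (LINT z|lborel. F z)" by (simp add: add.commute)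
  qed
  \<comment> \<open>Contains the supports of all difference quotients, since no shift is longer than
    v.\<close>
  let ?B = "cball (0::'a) (R + norm v)"
  have h0: "h k z = 0" if "z \<notin> ?B" for k z
  proof -
    let ?w = "(1 / real (Suc k)) *\<^sub>R v"
    have "norm ?w = 1 / real (Suc k) * norm v" by simp
    also have "\<dots> \<le> norm v" by (rule mult_left_le_one_le) auto
    finally have "norm ?w \<le> norm v" .
    moreover have "norm z \<le> norm (z + ?w) + norm ?w"
      using norm_triangle_ineq4[of "z + ?w" ?w] by simp
    moreover have "norm z > R + norm v" using that by simp
    ultimately have "norm (z + ?w) > R" "norm z > R" using norm_ge_zero[of v] by linarith+
    then have "\<not> norm (z + ?w) \<le> R" "\<not> norm z \<le> R" by linarith+
    then have "F (z + (1 / real (Suc k)) *\<^sub>R v) = 0" "F z = 0" using R F0 by blast+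
    then show ?thesis by (simp add: h_def)
  qed
  have "(\<lambda>k. LINT z|lborel. h k z) \<longlonglongrightarrow> (LINT z|lborel. g z)"
  proof (rule integral_dominated_convergence[where w = "\<lambda>z. indicator ?B z *\<^sub>R C"])
    show "integrable lborel (\<lambda>z. indicator ?B z *\<^sub>R C)"
      by (rule borel_integrable_compact) auto
    show "AE z in lborel. norm (h k z) \<le> indicator ?B z *\<^sub>R C" for k
      using hb h0 by (intro AE_I2) (auto simp: indicator_def)
    show "g \<in> borel_measurable lborel" using borel_measurable_continuous_onI[OF gcont] by simp
    show "h k \<in> borel_measurable lborel" for k
      unfolding h_def using trans(1) Fint
      by (intro borel_measurable_times borel_measurable_diff borel_measurable_const borel_measurable_integrable)
  qed (use kern_limit in auto)
  moreover have "(LINT z|lborel. h k z) = 0" for k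
    unfolding h_def using trans Fint by simp
  ultimately have "(LINT z|lborel. g z) = 0" by (simp add: LIMSEQ_const_iff)
  then show "(LINT z|lborel. indicator U z *\<^sub>R D z v) = 0" by (simp add: g_def)
qed

lemma has_wirtinger_integral_zero:
  fixes F :: "complex ^ 'n \<Rightarrow> complex"
  assumes K: "compact K" "K \<subseteq> U" "open U" and F0: "\<And>z. z \<notin> K \<Longrightarrow> F z = 0"
    and D: "\<And>z. z \<in> U \<Longrightarrow> has_wirtinger F (p z) (q z) z"
    and cont: "\<And>i. continuous_on U (\<lambda>z. p z i)" "\<And>i. continuous_on U (\<lambda>z. q z i)"
  shows "(LINT z|lborel. indicator U z *\<^sub>R p z i) = 0" "integrable lborel (\<lambda>z. indicator U z *\<^sub>R p z i)"
    "(LINT z|lborel. indicator U z *\<^sub>R q z i) = 0" "integrable lborel (\<lambda>z. indicator U z *\<^sub>R q z i)"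
proof -
  let ?D = "\<lambda>z v. \<Sum>i\<in>UNIV. p z i * v $ i + q z i * cnj (v $ i)"
  have *: "(LINT z|lborel. indicator U z *\<^sub>R ?D z v) = 0" "integrable lborel (\<lambda>z. indicator U z *\<^sub>R ?D z v)" for v
  proof -
    have c: "continuous_on U (\<lambda>z. ?D z v)" by (intro continuous_intros cont)
    show "(LINT z|lborel. indicator U z *\<^sub>R ?D z v) = 0"
      by (rule integral_dir_deriv_zero(1)[where K = K and U = U and F = F and D = "?D" and v = v, OF K F0 _ c]) (use D in \<open>auto simp: has_wirtinger_def\<close>)
    show "integrable lborel (\<lambda>z. indicator U z *\<^sub>R ?D z v)"
      by (rule integral_dir_deriv_zero(2)[where K = K and U = U and F = F and D = "?D" and v = v, OF K F0 _ c]) (use D in \<open>auto simp: has_wirtinger_def\<close>)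
  qed
  have 1: "(LINT z|lborel. indicator U z *\<^sub>R (p z i + q z i)) = 0" "integrable lborel (\<lambda>z. indicator U z *\<^sub>R (p z i + q z i))"
    using *[of "axis i 1"] unfolding sum_axis by simp_all
  have 2: "(LINT z|lborel. indicator U z *\<^sub>R (p z i * \<i> - q z i * \<i>)) = 0" "integrable lborel (\<lambda>z. indicator U z *\<^sub>R (p z i * \<i> - q z i * \<i>))"
    using *[of "axis i \<i>"] unfolding sum_axis by simp_all
  \<comment> \<open>The directions 1 and \<i> give a + b and \<i> (a - b); these are solved for a
    and b.\<close>
  have e: "a = 1 / 2 * (a + b) + (- \<i> / 2) * (a * \<i> - b * \<i>)" "b = 1 / 2 * (a + b) + \<i> / 2 * (a * \<i> - b * \<i>)" for a b
    by (simp_all add: algebra_simps add_divide_distrib)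
  have r: "r *\<^sub>R (c * a + d * b) = c * (r *\<^sub>R a) + d * (r *\<^sub>R b)" for r :: real and a b c d :: complex
    by (simp add: scaleR_add_right)
  have p: "indicator U z *\<^sub>R p z i =
      1 / 2 * (indicator U z *\<^sub>R (p z i + q z i)) + (- \<i> / 2) * (indicator U z *\<^sub>R (p z i * \<i> - q z i * \<i>))" for z
    by (subst e(1)[of "p z i" "q z i"]) (rule r)
  have q: "indicator U z *\<^sub>R q z i =
      1 / 2 * (indicator U z *\<^sub>R (p z i + q z i)) + \<i> / 2 * (indicator U z *\<^sub>R (p z i * \<i> - q z i * \<i>))" for z
    by (subst e(2)[of "q z i" "p z i"]) (rule r)
  have lin: "(LINT z|lborel. c * f z + d * g z) = c * (LINT z|lborel. f z) + d * (LINT z|lborel. g z)"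
    if "integrable lborel f" "integrable lborel g" for f g :: "complex ^ 'n \<Rightarrow> complex" and c d
    using that by simp
  show "integrable lborel (\<lambda>z. indicator U z *\<^sub>R p z i)" "integrable lborel (\<lambda>z. indicator U z *\<^sub>R q z i)"
    unfolding p q by (intro Bochner_Integration.integrable_add integrable_mult_right 1 2)+
  show "(LINT z|lborel. indicator U z *\<^sub>R p z i) = 0" "(LINT z|lborel. indicator U z *\<^sub>R q z i) = 0"
    unfolding p q lin[OF 1(2) 2(2)] 1(1) 2(1) by simp_all
qed

section \<open>Regularity and support of test functions\<close>

lemma test_fun_differentiable: "test_fun \<eta> \<Longrightarrow> foldr dir_deriv vs \<eta> differentiable (at z)"
  by (auto simp: test_fun_def differentiable_on_def)

lemma dir_deriv_wirtinger_bar: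
  assumes "test_fun \<eta>"
  shows "wirtinger_bar j \<eta> differentiable (at z)"
    and "dir_deriv v (wirtinger_bar j \<eta>) z =
      (dir_deriv v (dir_deriv (axis j 1) \<eta>) z + \<i> * dir_deriv v (dir_deriv (axis j \<i>) \<eta>) z) / 2"
proof -
  have 1: "(dir_deriv w \<eta> has_derivative (\<lambda>v. dir_deriv v (dir_deriv w \<eta>) z)) (at z)" for w
    using test_fun_differentiable[OF assms, of "[w]" z]
    by (simp add: dir_deriv_def frechet_derivative_works)
  have "((\<lambda>z. (dir_deriv (axis j 1) \<eta> z + \<i> * dir_deriv (axis j \<i>) \<eta> z) * (1 / 2)) has_derivative
      (\<lambda>v. (dir_deriv v (dir_deriv (axis j 1) \<eta>) z + \<i> * dir_deriv v (dir_deriv (axis j \<i>) \<eta>) z) * (1 / 2))) (at z)"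
    by (intro has_derivative_mult_left has_derivative_mult_right has_derivative_add 1)
  then have 2: "(wirtinger_bar j \<eta> has_derivative
      (\<lambda>v. (dir_deriv v (dir_deriv (axis j 1) \<eta>) z + \<i> * dir_deriv v (dir_deriv (axis j \<i>) \<eta>) z) / 2)) (at z)"
    by (simp add: wirtinger_bar_def[abs_def])
  then show "wirtinger_bar j \<eta> differentiable (at z)" by (rule differentiableI)
  show "dir_deriv v (wirtinger_bar j \<eta>) z =
      (dir_deriv v (dir_deriv (axis j 1) \<eta>) z + \<i> * dir_deriv v (dir_deriv (axis j \<i>) \<eta>) z) / 2"
    unfolding dir_deriv_def[of _ "wirtinger_bar j \<eta>"] by (subst frechet_derivative_at[OF 2, symmetric]) simp
qed

lemma test_fun_continuous:
  assumes "test_fun \<eta>"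
  shows "continuous_on S \<eta>" "continuous_on S (wirtinger i \<eta>)" "continuous_on S (wirtinger_bar j \<eta>)"
    "continuous_on S (wirtinger i (wirtinger_bar j \<eta>))" "continuous_on S (wirtinger_bar i (wirtinger_bar j \<eta>))"
proof -
  have c: "continuous_on S (foldr dir_deriv vs \<eta>)" for vs
    using test_fun_differentiable[OF assms] differentiable_imp_continuous_within
    by (intro continuous_at_imp_continuous_on) blast
  have d1: "continuous_on S (\<lambda>z. dir_deriv v \<eta> z)" for v using c[of "[v]"] by simp
  have d2: "continuous_on S (\<lambda>z. dir_deriv v (dir_deriv w \<eta>) z)" for v w using c[of "[v, w]"] by simp
  show "continuous_on S \<eta>" using c[of "[]"] by simp
  show "continuous_on S (wirtinger i \<eta>)" "continuous_on S (wirtinger_bar j \<eta>)"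
    unfolding wirtinger_def[abs_def] wirtinger_bar_def[abs_def] by (intro continuous_intros d1; simp)+
  show "continuous_on S (wirtinger i (wirtinger_bar j \<eta>))" "continuous_on S (wirtinger_bar i (wirtinger_bar j \<eta>))"
    unfolding wirtinger_def[of i "wirtinger_bar j \<eta>", abs_def] wirtinger_bar_def[of i "wirtinger_bar j \<eta>", abs_def]
      dir_deriv_wirtinger_bar(2)[OF assms]
    by (intro continuous_intros d2; simp)+
qed

lemma test_fun_has_wirtinger:
  assumes "test_fun \<eta>"
  shows "has_wirtinger \<eta> (\<lambda>i. wirtinger i \<eta> z) (\<lambda>i. wirtinger_bar i \<eta> z) z"
    "has_wirtinger (wirtinger_bar j \<eta>) (\<lambda>i. wirtinger i (wirtinger_bar j \<eta>) z) (\<lambda>i. wirtinger_bar i (wirtinger_bar j \<eta>) z) z"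
  using differentiable_has_wirtinger[OF test_fun_differentiable[OF assms, of "[]"]]
    differentiable_has_wirtinger[OF dir_deriv_wirtinger_bar(1)[OF assms]] by simp_all

lemma test_fun_zero:
  assumes "z \<notin> closure {z. \<eta> z \<noteq> 0}"
  shows "\<eta> z = 0" "wirtinger_bar j \<eta> z = 0" "wirtinger i (wirtinger_bar j \<eta>) z = 0"
proof -
  let ?U = "- closure {z. \<eta> z \<noteq> 0}"
  have U: "open ?U" by (simp add: open_Compl)
  have 0: "\<eta> w = 0" if "w \<in> ?U" for w
    using that closure_subset[of "{z. \<eta> z \<noteq> 0}"] by auto
  have *: "has_wirtinger f (\<lambda>i. 0) (\<lambda>i. 0) w" if "w \<in> ?U" "\<And>v. v \<in> ?U \<Longrightarrow> f v = 0" for f w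
    unfolding has_wirtinger_def
    by (rule has_derivative_transform_within_open[OF _ U that(1), of "\<lambda>z. 0"]) (use that(2) in auto)
  have 1: "wirtinger_bar j \<eta> w = 0" if "w \<in> ?U" for w
    using has_wirtinger_wirtinger_bar[OF *[OF that 0]] .
  have z: "z \<in> ?U" using assms by simp
  show "\<eta> z = 0" "wirtinger_bar j \<eta> z = 0" using 0[OF z] 1[OF z] .
  show "wirtinger i (wirtinger_bar j \<eta>) z = 0"
    by (rule has_wirtinger_wirtinger[OF *[OF z 1]])
qed

lemma test_fun_support:
  assumes "test_fun \<eta>"
  shows "compact (closure {z. \<eta> z \<noteq> 0})" "closure {z. \<eta> z \<noteq> 0} \<subseteq> unit_ball"
proof -
  show "closure {z. \<eta> z \<noteq> 0} \<subseteq> unit_ball" using assms by (simp add: test_fun_def)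
  then show "compact (closure {z. \<eta> z \<noteq> 0})"
    using bounded_subset[OF bounded_ball] by (simp add: compact_eq_bounded_closed)
qed

lemma integrable_continuous_support:
  fixes g :: "'a::euclidean_space \<Rightarrow> complex"
  assumes "compact K" "K \<subseteq> U" "continuous_on U g" "\<And>z. z \<notin> K \<Longrightarrow> g z = 0"
  shows "integrable lborel (\<lambda>z. indicator U z *\<^sub>R g z)"
proof -
  have "integrable lborel (\<lambda>z. indicator K z *\<^sub>R g z)"
    using assms by (intro borel_integrable_compact continuous_on_subset[OF assms(3)])
  moreover have "indicator K z *\<^sub>R g z = indicator U z *\<^sub>R g z" for z
    by (cases "z \<in> K") (use assms(2,4) in auto)
  ultimately show ?thesis by simp
qed

text \<open>Written with \<open>herm\<close> and complex values, so that the Wirtinger rules apply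
  to it directly.\<close>

definition defect :: "complex ^ 'n \<Rightarrow> complex" where "defect z = 1 - herm z z"

lemma defect_eq: "defect z = of_real (1 - (norm z)\<^sup>2)"
  by (simp add: defect_def herm_self)

lemma defect_nz: "z \<in> unit_ball \<Longrightarrow> defect z \<noteq> 0"
  using one_minus_norm_sq_pos[of z] unfolding defect_eq of_real_eq_0_iff by simp

lemma defect_nz_norm: "norm z < 1 \<Longrightarrow> defect z \<noteq> 0"
  using defect_nz[of z] by simp

lemma cnj_defect: "cnj (defect z) = defect z"
  by (simp add: defect_eq)

lemma has_wirtinger_defect: "has_wirtinger defect (\<lambda>i. - cnj (z $ i)) (\<lambda>i. - (z $ i)) z"
  unfolding defect_def[abs_def] using has_wirtinger_diff[OF has_wirtinger_const has_wirtinger_herm_self, of 1 z] by simp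

lemma continuous_on_defect [continuous_intros]: "continuous_on S f \<Longrightarrow> continuous_on S (\<lambda>x. defect (f x))"
  unfolding defect_def by (intro continuous_intros)

text \<open>The coefficients of the Laplacian times the density of the invariant measure, which put the
  Laplacian into divergence form, up to the factor 4 and a normalization, and their Wirtinger derivatives.\<close>

definition flux_coeff :: "'n \<Rightarrow> 'n \<Rightarrow> complex ^ 'n \<Rightarrow> complex" where
  "flux_coeff i j z = (of_bool (i = j) - z $ i * cnj (z $ j)) * (1 / defect z ^ CARD('n))"

definition flux_coeff_dz :: "'n \<Rightarrow> 'n \<Rightarrow> complex ^ 'n \<Rightarrow> 'n \<Rightarrow> complex" where
  "flux_coeff_dz i j z k = (of_bool (i = j) - z $ i * cnj (z $ j)) * (of_nat CARD('n) / defect z ^ (CARD('n) + 1) * cnj (z $ k))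
    - of_bool (k = i) * cnj (z $ j) * (1 / defect z ^ CARD('n))"

definition flux_coeff_dzbar :: "'n \<Rightarrow> 'n \<Rightarrow> complex ^ 'n \<Rightarrow> 'n \<Rightarrow> complex" where
  "flux_coeff_dzbar i j z k = (of_bool (i = j) - z $ i * cnj (z $ j)) * (of_nat CARD('n) / defect z ^ (CARD('n) + 1) * (z $ k))
    - z $ i * of_bool (k = j) * (1 / defect z ^ CARD('n))"

lemma has_wirtinger_flux_coeff:
  fixes z :: "complex ^ 'n"
  assumes "z \<in> unit_ball"
  shows "has_wirtinger (flux_coeff i j) (flux_coeff_dz i j z) (flux_coeff_dzbar i j z) z"
proof -
  let ?n = "CARD('n)"
  have "((\<lambda>x::complex. 1 / x ^ ?n) has_field_derivative (- of_nat ?n / x ^ (?n + 1))) (at x)" if "x \<noteq> 0" for x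
  proof -
    have "x ^ ?n = x ^ (?n - 1) * x" using power_Suc2[of x "?n - 1"] by simp
    then show ?thesis using that
      by (auto intro!: derivative_eq_intros simp: field_simps power2_eq_square)
  qed
  from has_wirtinger_chain[OF has_wirtinger_defect this[OF defect_nz[OF assms]]]
  have 1: "has_wirtinger (\<lambda>z. 1 / defect z ^ ?n) (\<lambda>k. of_nat ?n / defect z ^ (?n + 1) * cnj (z $ k)) (\<lambda>k. of_nat ?n / defect z ^ (?n + 1) * (z $ k)) z"
    by simp
  have 2: "has_wirtinger (\<lambda>z. of_bool (i = j) - z $ i * cnj (z $ j))
      (\<lambda>k. - (of_bool (k = i) * cnj (z $ j))) (\<lambda>k. - (z $ i * of_bool (k = j))) z"
    using has_wirtinger_diff[OF has_wirtinger_const[of "of_bool (i = j)"] has_wirtinger_mult[OF has_wirtinger_coord[of i z] has_wirtinger_cnj_coord[of j z]]] by simp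
  show ?thesis unfolding flux_coeff_def[abs_def]
    by (rule has_wirtinger_cong_fun[OF has_wirtinger_mult[OF 2 1]]) (simp_all add: flux_coeff_dz_def flux_coeff_dzbar_def)
qed

lemma herm_sum: "(\<Sum>i\<in>UNIV. z $ i * (cnj (w $ i) * c)) = herm z w * c"
  by (simp add: herm_def sum_distrib_right mult.assoc)

text \<open>The two contributions cancel precisely for the power n of \<open>defect\<close> in
  \<open>flux_coeff\<close>. Because the coefficients are divergence-free, the Laplacian times the
  invariant density is a divergence without first-order terms.\<close>

lemma flux_coeff_dz_div: 
  fixes z :: "complex ^ 'n"
  assumes "z \<in> unit_ball"
  shows "(\<Sum>i\<in>UNIV. flux_coeff_dz i j z i) = 0"
proof -
  let ?n = "CARD('n)"
  have "(\<Sum>i\<in>UNIV. flux_coeff_dz i j z i) =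
      (\<Sum>i\<in>UNIV. of_bool (j = i) * (of_nat ?n / defect z ^ (?n + 1) * cnj (z $ i)))
      - (\<Sum>i\<in>UNIV. z $ i * (cnj (z $ i) * (cnj (z $ j) * (of_nat ?n / defect z ^ (?n + 1)))))
      - of_nat ?n * (cnj (z $ j) * (1 / defect z ^ ?n))"
  proof -
    have "flux_coeff_dz i j z i = of_bool (j = i) * (of_nat ?n / defect z ^ (?n + 1) * cnj (z $ i))
        - z $ i * (cnj (z $ i) * (cnj (z $ j) * (of_nat ?n / defect z ^ (?n + 1)))) - cnj (z $ j) * (1 / defect z ^ ?n)" for i
      unfolding flux_coeff_dz_def
        by (cases "i = j") (simp_all add: left_diff_distrib right_diff_distrib diff_divide_distrib mult_ac)
    then show ?thesis by (simp add: sum_subtractf)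
  qed
  also have "\<dots> = of_nat ?n / defect z ^ (?n + 1) * cnj (z $ j) - herm z z * (cnj (z $ j) * (of_nat ?n / defect z ^ (?n + 1)))
      - of_nat ?n * (cnj (z $ j) * (1 / defect z ^ ?n))"
    unfolding herm_sum sum_of_bool_eq ..
  also have "\<dots> = of_nat ?n * cnj (z $ j) * ((1 - herm z z) / defect z ^ (?n + 1) - 1 / defect z ^ ?n)"
    by (simp add: field_simps diff_divide_distrib)
  also have "\<dots> = 0" using defect_nz[OF assms] by (simp add: defect_def[symmetric])
  finally show ?thesis .
qed

lemma flux_coeff_dzbar_div: 
  fixes z :: "complex ^ 'n"
  assumes "z \<in> unit_ball"
  shows "(\<Sum>j\<in>UNIV. flux_coeff_dzbar i j z j) = 0"
proof -
  have "flux_coeff_dzbar i j z j = cnj (flux_coeff_dz j i z j)" for j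
    by (cases "i = j") (simp_all add: flux_coeff_dzbar_def flux_coeff_dz_def cnj_defect mult.commute)
  then show ?thesis using flux_coeff_dz_div[OF assms, of i] by (simp flip: cnj_sum)
qed

lemma continuous_on_flux_coeff [continuous_intros]:
  "continuous_on unit_ball (flux_coeff i j)" "continuous_on unit_ball (\<lambda>z. flux_coeff_dz i j z k)" "continuous_on unit_ball (\<lambda>z. flux_coeff_dzbar i j z k)"
proof -
  have inv: "continuous_on unit_ball (\<lambda>z :: complex ^ 'a. c / defect z ^ k)" for c k
    by (intro continuous_on_divide continuous_intros) (simp add: defect_nz_norm)
  show "continuous_on unit_ball (flux_coeff i j)" "continuous_on unit_ball (\<lambda>z. flux_coeff_dz i j z k)" "continuous_on unit_ball (\<lambda>z. flux_coeff_dzbar i j z k)"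
    unfolding flux_coeff_def[abs_def] flux_coeff_dz_def flux_coeff_dzbar_def by (intro continuous_intros inv)+
qed

text \<open>Two integrations by parts, the boundary terms vanishing with \<eta>. The first moves the
  holomorphic derivative from \<eta> to H, the second the antiholomorphic one; both produce the same
  mixed term \<open>P z i * flux_coeff i j z * wirtinger_bar j \<eta> z\<close>, which
  cancels.\<close>

lemma green:
  fixes \<eta> H :: "complex ^ 'n \<Rightarrow> complex"
  assumes \<eta>: "test_fun \<eta>"
    and H: "\<And>z. z \<in> unit_ball \<Longrightarrow> has_wirtinger H (P z) (Q z) z"
    and PH: "\<And>z i. z \<in> unit_ball \<Longrightarrow> has_wirtinger (\<lambda>z. P z i) (Pp z i) (Pq z i) z"
    and cont: "\<And>i. continuous_on unit_ball (\<lambda>z. P z i)" "\<And>i. continuous_on unit_ball (\<lambda>z. Q z i)"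
      "\<And>i j. continuous_on unit_ball (\<lambda>z. Pp z i j)" "\<And>i j. continuous_on unit_ball (\<lambda>z. Pq z i j)"
  shows "(LINT z|lborel. indicator unit_ball z *\<^sub>R (H z * (\<Sum>i\<in>UNIV. \<Sum>j\<in>UNIV. flux_coeff i j z * wirtinger i (wirtinger_bar j \<eta>) z))) =
    (LINT z|lborel. indicator unit_ball z *\<^sub>R (\<eta> z * (\<Sum>i\<in>UNIV. \<Sum>j\<in>UNIV. flux_coeff i j z * Pq z i j)))"
proof -
  let ?K = "closure {z. \<eta> z \<noteq> 0}"
  note K = test_fun_support[OF \<eta>]
  note Z = test_fun_zero[of _ \<eta>]
  note C = test_fun_continuous[OF \<eta>]
  let ?E = "\<lambda>j. wirtinger_bar j \<eta>"
  have cH: "continuous_on unit_ball H"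
    by (intro continuous_at_imp_continuous_on ballI) (use H in \<open>auto simp: has_wirtinger_def intro: has_derivative_continuous\<close>)
  have cc: "continuous_on unit_ball (\<lambda>z. H z)" "continuous_on unit_ball (\<lambda>z. \<eta> z)" "continuous_on unit_ball (\<lambda>z. wirtinger i \<eta> z)"
    "continuous_on unit_ball (\<lambda>z. wirtinger_bar i \<eta> z)" "continuous_on unit_ball (\<lambda>z. wirtinger i (?E j) z)"
    "continuous_on unit_ball (\<lambda>z. wirtinger_bar i (?E j) z)" "continuous_on unit_ball (\<lambda>z. flux_coeff i j z)"
    "continuous_on unit_ball (\<lambda>z. flux_coeff_dz i j z k)" "continuous_on unit_ball (\<lambda>z. flux_coeff_dzbar i j z k)" for i j k
    using cH C continuous_on_flux_coeff by auto
  \<comment> \<open>Wirtinger derivatives of the two vector fields: \<open>Xp\<close>,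
    \<open>Xq\<close> for H times the gradient of \<eta>, \<open>Yp\<close>, \<open>Yq\<close> for
    \<eta> times the gradient of H. The divergences are the sums of \<open>Xp i z i\<close> and of
    \<open>Yq j z j\<close>.\<close>
  define Xp where "Xp i z k = (\<Sum>j\<in>UNIV. H z * flux_coeff i j z * wirtinger k (?E j) z + (H z * flux_coeff_dz i j z k + P z k * flux_coeff i j z) * ?E j z)" for i z k
  define Xq where "Xq i z k = (\<Sum>j\<in>UNIV. H z * flux_coeff i j z * wirtinger_bar k (?E j) z + (H z * flux_coeff_dzbar i j z k + Q z k * flux_coeff i j z) * ?E j z)" for i z k
  define Yp where "Yp j z k = (\<Sum>i\<in>UNIV. \<eta> z * flux_coeff i j z * Pp z i k + (\<eta> z * flux_coeff_dz i j z k + wirtinger k \<eta> z * flux_coeff i j z) * P z i)" for j z k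
  define Yq where "Yq j z k = (\<Sum>i\<in>UNIV. \<eta> z * flux_coeff i j z * Pq z i k + (\<eta> z * flux_coeff_dzbar i j z k + ?E k z * flux_coeff i j z) * P z i)" for j z k
  have X: "has_wirtinger (\<lambda>z. \<Sum>j\<in>UNIV. H z * flux_coeff i j z * ?E j z) (Xp i z) (Xq i z) z" if "z \<in> unit_ball" for i z
    unfolding Xp_def[abs_def] Xq_def[abs_def]
    by (intro has_wirtinger_sum has_wirtinger_mult H has_wirtinger_flux_coeff that test_fun_has_wirtinger \<eta>) simp
  have Y: "has_wirtinger (\<lambda>z. \<Sum>i\<in>UNIV. \<eta> z * flux_coeff i j z * P z i) (Yp j z) (Yq j z) z" if "z \<in> unit_ball" for j z
    unfolding Yp_def[abs_def] Yq_def[abs_def]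
    by (intro has_wirtinger_sum has_wirtinger_mult PH has_wirtinger_flux_coeff that test_fun_has_wirtinger \<eta>) simp
  have X0: "(\<Sum>j\<in>UNIV. H z * flux_coeff i j z * ?E j z) = 0" if "z \<notin> ?K" for i z
    unfolding Z(2)[OF that] by simp
  have Y0: "(\<Sum>j\<in>UNIV. \<eta> z * flux_coeff j i z * P z j) = 0" if "z \<notin> ?K" for i z
    unfolding Z(1)[OF that] by simp
  have A0: "H z * (\<Sum>i\<in>UNIV. \<Sum>j\<in>UNIV. flux_coeff i j z * wirtinger i (?E j) z) = 0" if "z \<notin> ?K" for z
    unfolding Z(3)[OF that] by simp
  have B0: "\<eta> z * (\<Sum>i\<in>UNIV. \<Sum>j\<in>UNIV. flux_coeff i j z * Pq z i j) = 0" if "z \<notin> ?K" for z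
    unfolding Z(1)[OF that] by simp
  have IX: "(LINT z|lborel. indicator unit_ball z *\<^sub>R Xp i z i) = 0" "integrable lborel (\<lambda>z. indicator unit_ball z *\<^sub>R Xp i z i)" for i
  proof -
    have c: "continuous_on unit_ball (\<lambda>z. Xp i z k)" "continuous_on unit_ball (\<lambda>z. Xq i z k)" for k
      unfolding Xp_def Xq_def by (intro continuous_intros cc cont)+
    show "(LINT z|lborel. indicator unit_ball z *\<^sub>R Xp i z i) = 0"
      by (rule has_wirtinger_integral_zero(1)[where F = "\<lambda>z. \<Sum>j\<in>UNIV. H z * flux_coeff i j z * ?E j z" and p = "Xp i" and q = "Xq i",
            OF K open_ball X0 X c])
    show "integrable lborel (\<lambda>z. indicator unit_ball z *\<^sub>R Xp i z i)"
      by (rule has_wirtinger_integral_zero(2)[where F = "\<lambda>z. \<Sum>j\<in>UNIV. H z * flux_coeff i j z * ?E j z" and p = "Xp i" and q = "Xq i",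
            OF K open_ball X0 X c])
  qed
  have IY: "(LINT z|lborel. indicator unit_ball z *\<^sub>R Yq i z i) = 0" "integrable lborel (\<lambda>z. indicator unit_ball z *\<^sub>R Yq i z i)" for i
  proof -
    have c: "continuous_on unit_ball (\<lambda>z. Yp i z k)" "continuous_on unit_ball (\<lambda>z. Yq i z k)" for k
      unfolding Yp_def Yq_def by (intro continuous_intros cc cont)+
    show "(LINT z|lborel. indicator unit_ball z *\<^sub>R Yq i z i) = 0"
      by (rule has_wirtinger_integral_zero(3)[where F = "\<lambda>z. \<Sum>j\<in>UNIV. \<eta> z * flux_coeff j i z * P z j" and p = "Yp i" and q = "Yq i",
            OF K open_ball Y0 Y c])
    show "integrable lborel (\<lambda>z. indicator unit_ball z *\<^sub>R Yq i z i)"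
      by (rule has_wirtinger_integral_zero(4)[where F = "\<lambda>z. \<Sum>j\<in>UNIV. \<eta> z * flux_coeff j i z * P z j" and p = "Yp i" and q = "Yq i",
            OF K open_ball Y0 Y c])
  qed
  have eqX: "(\<Sum>i\<in>UNIV. Xp i z i) = H z * (\<Sum>i\<in>UNIV. \<Sum>j\<in>UNIV. flux_coeff i j z * wirtinger i (?E j) z) +
      (\<Sum>i\<in>UNIV. \<Sum>j\<in>UNIV. P z i * flux_coeff i j z * ?E j z)" if "z \<in> unit_ball" for z
  proof -
    have "(\<Sum>i\<in>UNIV. \<Sum>j\<in>UNIV. H z * flux_coeff_dz i j z i * ?E j z) = (\<Sum>j\<in>UNIV. H z * ?E j z * (\<Sum>i\<in>UNIV. flux_coeff_dz i j z i))"
      by (subst sum.swap) (simp add: sum_distrib_left mult_ac)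
    also have "\<dots> = 0" using flux_coeff_dz_div[OF that] by simp
    finally have 0: "(\<Sum>i\<in>UNIV. \<Sum>j\<in>UNIV. H z * flux_coeff_dz i j z i * ?E j z) = 0" .
    have "(\<Sum>i\<in>UNIV. Xp i z i) = (\<Sum>i\<in>UNIV. \<Sum>j\<in>UNIV. H z * (flux_coeff i j z * wirtinger i (?E j) z)) +
        (\<Sum>i\<in>UNIV. \<Sum>j\<in>UNIV. H z * flux_coeff_dz i j z i * ?E j z) + (\<Sum>i\<in>UNIV. \<Sum>j\<in>UNIV. P z i * flux_coeff i j z * ?E j z)"
      unfolding Xp_def sum.distrib[symmetric] by (intro sum.cong refl) (simp only: distrib_right mult.assoc add.assoc)
    then show ?thesis unfolding 0 sum_distrib_left by simp
  qed
  have eqY: "(\<Sum>j\<in>UNIV. Yq j z j) = \<eta> z * (\<Sum>i\<in>UNIV. \<Sum>j\<in>UNIV. flux_coeff i j z * Pq z i j) +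
      (\<Sum>i\<in>UNIV. \<Sum>j\<in>UNIV. P z i * flux_coeff i j z * ?E j z)" if "z \<in> unit_ball" for z
  proof -
    have 0: "(\<Sum>i\<in>UNIV. \<Sum>j\<in>UNIV. \<eta> z * flux_coeff_dzbar i j z j * P z i) = (\<Sum>i\<in>UNIV. \<eta> z * P z i * (\<Sum>j\<in>UNIV. flux_coeff_dzbar i j z j))"
      by (simp add: sum_distrib_left mult_ac)
    also have "\<dots> = 0" using flux_coeff_dzbar_div[OF that] by simp
    finally have 0: "(\<Sum>i\<in>UNIV. \<Sum>j\<in>UNIV. \<eta> z * flux_coeff_dzbar i j z j * P z i) = 0" .
    have "(\<Sum>j\<in>UNIV. Yq j z j) = (\<Sum>i\<in>UNIV. \<Sum>j\<in>UNIV. \<eta> z * flux_coeff i j z * Pq z i j + (\<eta> z * flux_coeff_dzbar i j z j + ?E j z * flux_coeff i j z) * P z i)"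
      unfolding Yq_def by (rule sum.swap)
    also have "\<dots> = (\<Sum>i\<in>UNIV. \<Sum>j\<in>UNIV. \<eta> z * (flux_coeff i j z * Pq z i j)) +
        (\<Sum>i\<in>UNIV. \<Sum>j\<in>UNIV. \<eta> z * flux_coeff_dzbar i j z j * P z i) + (\<Sum>i\<in>UNIV. \<Sum>j\<in>UNIV. P z i * flux_coeff i j z * ?E j z)"
      unfolding sum.distrib[symmetric] by (intro sum.cong refl) (simp add: algebra_simps)
    finally show ?thesis unfolding 0 sum_distrib_left by simp
  qed
  let ?A = "\<lambda>z. H z * (\<Sum>i\<in>UNIV. \<Sum>j\<in>UNIV. flux_coeff i j z * wirtinger i (?E j) z)"
  let ?B = "\<lambda>z. \<eta> z * (\<Sum>i\<in>UNIV. \<Sum>j\<in>UNIV. flux_coeff i j z * Pq z i j)"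
  have A: "integrable lborel (\<lambda>z. indicator unit_ball z *\<^sub>R ?A z)"
    by (rule integrable_continuous_support[OF K _ A0]) (intro continuous_intros cc)+
  have B: "integrable lborel (\<lambda>z. indicator unit_ball z *\<^sub>R ?B z)"
    by (rule integrable_continuous_support[OF K _ B0]) (intro continuous_intros cc cont)+
  have "(\<lambda>z. indicator unit_ball z *\<^sub>R ?A z - indicator unit_ball z *\<^sub>R ?B z) =
      (\<lambda>z. (\<Sum>i\<in>UNIV. indicator unit_ball z *\<^sub>R Xp i z i) - (\<Sum>j\<in>UNIV. indicator unit_ball z *\<^sub>R Yq j z j))"
  proof
    fix z
    show "indicator unit_ball z *\<^sub>R ?A z - indicator unit_ball z *\<^sub>R ?B z =
        (\<Sum>i\<in>UNIV. indicator unit_ball z *\<^sub>R Xp i z i) - (\<Sum>j\<in>UNIV. indicator unit_ball z *\<^sub>R Yq j z j)"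
    proof (cases "z \<in> unit_ball")
      case True
      have *: "r *\<^sub>R a - r *\<^sub>R b = r *\<^sub>R (a + s) - r *\<^sub>R (b + s)" for r :: real and a b s :: complex
        by (simp add: scaleR_add_right)
      show ?thesis
        unfolding scaleR_sum_right[symmetric] eqX[OF True] eqY[OF True] by (rule *)
    next
      case False
      then have "indicator unit_ball z = (0::real)" by simp
      then show ?thesis by (simp only: scaleR_zero_left sum.neutral_const diff_self)
    qed
  qed
  then have "(LINT z|lborel. indicator unit_ball z *\<^sub>R ?A z - indicator unit_ball z *\<^sub>R ?B z) =
      (LINT z|lborel. (\<Sum>i\<in>UNIV. indicator unit_ball z *\<^sub>R Xp i z i) - (\<Sum>j\<in>UNIV. indicator unit_ball z *\<^sub>R Yq j z j))"
    by (rule arg_cong[where f = "integral\<^sup>L lborel"])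
  also have "\<dots> = (LINT z|lborel. (\<Sum>i\<in>UNIV. indicator unit_ball z *\<^sub>R Xp i z i)) - (LINT z|lborel. (\<Sum>j\<in>UNIV. indicator unit_ball z *\<^sub>R Yq j z j))"
    by (rule Bochner_Integration.integral_diff) (intro Bochner_Integration.integrable_sum IX(2) IY(2))+
  also have "\<dots> = 0"
    unfolding Bochner_Integration.integral_sum[OF IX(2)] Bochner_Integration.integral_sum[OF IY(2)] IX(1) IY(1)
    by simp
  finally show ?thesis
    using Bochner_Integration.integral_diff[OF A B] by simp
qed

section \<open>The kernels \<open>cosh\<^sup>-\<^sup>2\<^sup>s d\<close> and the Laplacian\<close>

definition kern :: "real \<Rightarrow> complex ^ 'n \<Rightarrow> complex ^ 'n \<Rightarrow> real" where
  "kern s z w = inv_cosh2 z w powr s"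

definition herm_factor :: "complex ^ 'n \<Rightarrow> complex ^ 'n \<Rightarrow> complex" where
  "herm_factor \<xi> z = 1 - herm z \<xi>"

definition herm_factor_bar :: "complex ^ 'n \<Rightarrow> complex ^ 'n \<Rightarrow> complex" where
  "herm_factor_bar \<xi> z = 1 - herm \<xi> z"

lemma herm_factor_bar_cnj: "herm_factor_bar \<xi> z = cnj (herm_factor \<xi> z)"
  by (simp add: herm_factor_def herm_factor_bar_def herm_cnj)

lemma Re_herm_factor_pos: "z \<in> unit_ball \<Longrightarrow> \<xi> \<in> unit_ball \<Longrightarrow> 0 < Re (herm_factor \<xi> z)"
  using Re_1_minus_herm_pos[of z \<xi>] by (simp add: herm_factor_def)

lemma Re_herm_factor_bar_pos: "z \<in> unit_ball \<Longrightarrow> \<xi> \<in> unit_ball \<Longrightarrow> 0 < Re (herm_factor_bar \<xi> z)"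
  unfolding herm_factor_bar_cnj using Re_herm_factor_pos by simp

lemma Re_pos_nonpos_Reals: "0 < Re w \<Longrightarrow> w \<notin> \<real>\<^sub>\<le>\<^sub>0"
  by (auto simp: complex_nonpos_Reals_iff)

lemma Re_defect_pos: "z \<in> unit_ball \<Longrightarrow> 0 < Re (defect z)"
  using one_minus_norm_sq_pos[of z] by (simp add: defect_eq)

text \<open>Logarithms, available since \<open>1 - \<langle>z, \<xi>\<rangle>\<close> has positive real part, turn the kernel into a function
  to which the chain rule for the Wirtinger derivatives applies.\<close>

definition kern_exp :: "real \<Rightarrow> complex ^ 'n \<Rightarrow> complex ^ 'n \<Rightarrow> complex" where
  "kern_exp s \<xi> z = exp (of_real s * (Ln (defect z) + Ln (defect \<xi>) - (Ln (herm_factor \<xi> z) + Ln (herm_factor_bar \<xi> z))))"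

lemma kern_exp_eq:
  assumes "z \<in> unit_ball" "\<xi> \<in> unit_ball"
  shows "kern_exp s \<xi> z = of_real (kern s z \<xi>)"
proof -
  have z: "norm z < 1" and x: "norm \<xi> < 1" using assms by auto
  have c: "herm_factor \<xi> z \<noteq> 0" using Re_herm_factor_pos[OF assms] by auto
  have 1: "Ln (defect w) = of_real (ln (1 - (norm w)\<^sup>2))" if "norm w < 1" for w :: "complex ^ 'n"
    unfolding defect_eq using one_minus_norm_sq_pos[OF that] by (rule Ln_of_real)
  have "Ln (herm_factor \<xi> z) + Ln (herm_factor_bar \<xi> z) = Ln (herm_factor \<xi> z) + cnj (Ln (herm_factor \<xi> z))"
    unfolding herm_factor_bar_cnj using cnj_Ln[OF Re_pos_nonpos_Reals[OF Re_herm_factor_pos[OF assms]]] by simp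
  also have "\<dots> = of_real (2 * ln (cmod (herm_factor \<xi> z)))"
    using c by (simp add: complex_add_cnj Re_Ln)
  finally have 2: "Ln (herm_factor \<xi> z) + Ln (herm_factor_bar \<xi> z) = of_real (2 * ln (cmod (herm_factor \<xi> z)))" .
  have "ln (inv_cosh2 z \<xi>) = ln (1 - (norm z)\<^sup>2) + ln (1 - (norm \<xi>)\<^sup>2) - 2 * ln (cmod (herm_factor \<xi> z))"
    unfolding inv_cosh2_def herm_factor_def[symmetric]
    using c one_minus_norm_sq_pos[OF z] one_minus_norm_sq_pos[OF x]
    by (simp add: ln_div ln_mult ln_realpow)
  then have "kern_exp s \<xi> z = of_real (exp (s * ln (inv_cosh2 z \<xi>)))"
    unfolding kern_exp_def 1[OF z] 1[OF x] 2 exp_of_real[symmetric] by simp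
  then show ?thesis using inv_cosh2_pos[OF z x] by (simp add: kern_def powr_def)
qed

text \<open>The Wirtinger derivatives of the logarithm of \<open>inv_cosh2 z \<xi>\<close> in \<open>z\<close>.\<close>

definition log_kern_dz :: "complex ^ 'n \<Rightarrow> complex ^ 'n \<Rightarrow> 'n \<Rightarrow> complex" where
  "log_kern_dz \<xi> z i = cnj (\<xi> $ i) * (1 / herm_factor \<xi> z) - cnj (z $ i) * (1 / defect z)"

definition log_kern_dzbar :: "complex ^ 'n \<Rightarrow> complex ^ 'n \<Rightarrow> 'n \<Rightarrow> complex" where
  "log_kern_dzbar \<xi> z i = \<xi> $ i * (1 / herm_factor_bar \<xi> z) - z $ i * (1 / defect z)"

lemma has_wirtinger_herm_factor: "has_wirtinger (herm_factor \<xi>) (\<lambda>i. - cnj (\<xi> $ i)) (\<lambda>i. 0) z"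
  unfolding herm_factor_def[abs_def] using has_wirtinger_diff[OF has_wirtinger_const[of 1] has_wirtinger_herm_left[where z = z and w = \<xi>]] by simp

lemma has_wirtinger_herm_factor_bar: "has_wirtinger (herm_factor_bar \<xi>) (\<lambda>i. 0) (\<lambda>i. - (\<xi> $ i)) z"
  unfolding herm_factor_bar_def[abs_def] using has_wirtinger_diff[OF has_wirtinger_const[of 1] has_wirtinger_herm_right[where z = z and w = \<xi>]] by simp

lemma has_wirtinger_Ln:
  assumes "has_wirtinger F p q z" "0 < Re (F z)"
  shows "has_wirtinger (\<lambda>z. Ln (F z)) (\<lambda>i. 1 / F z * p i) (\<lambda>i. 1 / F z * q i) z"
  by (rule has_wirtinger_chain[OF assms(1)])
    (use has_field_derivative_Ln[OF Re_pos_nonpos_Reals[OF assms(2)]] in \<open>simp add: inverse_eq_divide\<close>)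

lemma has_wirtinger_inverse:
  assumes "has_wirtinger F p q z" "F z \<noteq> 0"
  shows "has_wirtinger (\<lambda>z. 1 / F z) (\<lambda>i. - (1 / (F z)\<^sup>2) * p i) (\<lambda>i. - (1 / (F z)\<^sup>2) * q i) z"
  by (rule has_wirtinger_chain[OF assms(1)])
    (use assms(2) in \<open>auto intro!: derivative_eq_intros simp: power2_eq_square\<close>)

lemma has_wirtinger_kern_exp:
  assumes "z \<in> unit_ball" "\<xi> \<in> unit_ball"
  shows "has_wirtinger (kern_exp s \<xi>) (\<lambda>i. of_real s * (kern_exp s \<xi> z * log_kern_dz \<xi> z i)) (\<lambda>i. of_real s * (kern_exp s \<xi> z * log_kern_dzbar \<xi> z i)) z"
proof -
  let ?L = "\<lambda>z. of_real s * (Ln (defect z) + Ln (defect \<xi>) - (Ln (herm_factor \<xi> z) + Ln (herm_factor_bar \<xi> z)))"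
  have "has_wirtinger (\<lambda>z. Ln (defect z) + Ln (defect \<xi>) - (Ln (herm_factor \<xi> z) + Ln (herm_factor_bar \<xi> z)))
      (\<lambda>i. 1 / defect z * (- cnj (z $ i)) + 0 - (1 / herm_factor \<xi> z * (- cnj (\<xi> $ i)) + 1 / herm_factor_bar \<xi> z * 0))
      (\<lambda>i. 1 / defect z * (- (z $ i)) + 0 - (1 / herm_factor \<xi> z * 0 + 1 / herm_factor_bar \<xi> z * (- (\<xi> $ i)))) z"
    using assms by (intro has_wirtinger_diff has_wirtinger_add has_wirtinger_Ln has_wirtinger_const has_wirtinger_defect has_wirtinger_herm_factor has_wirtinger_herm_factor_bar Re_defect_pos Re_herm_factor_pos Re_herm_factor_bar_pos)
  then have "has_wirtinger (\<lambda>z. Ln (defect z) + Ln (defect \<xi>) - (Ln (herm_factor \<xi> z) + Ln (herm_factor_bar \<xi> z))) (log_kern_dz \<xi> z) (log_kern_dzbar \<xi> z) z"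
    by (rule has_wirtinger_cong_fun) (simp_all add: log_kern_dz_def log_kern_dzbar_def algebra_simps)
  from has_wirtinger_cmult[OF this, of "of_real s"]
  have "has_wirtinger ?L (\<lambda>i. of_real s * log_kern_dz \<xi> z i) (\<lambda>i. of_real s * log_kern_dzbar \<xi> z i) z" .
  from has_wirtinger_chain[OF this DERIV_exp]
  have "has_wirtinger (kern_exp s \<xi>) (\<lambda>i. kern_exp s \<xi> z * (of_real s * log_kern_dz \<xi> z i)) (\<lambda>i. kern_exp s \<xi> z * (of_real s * log_kern_dzbar \<xi> z i)) z"
    unfolding kern_exp_def[abs_def] .
  then show ?thesis by (rule has_wirtinger_cong_fun) simp_all
qed

definition log_kern_dz_dz :: "complex ^ 'n \<Rightarrow> complex ^ 'n \<Rightarrow> 'n \<Rightarrow> 'n \<Rightarrow> complex" where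
  "log_kern_dz_dz \<xi> z i j = cnj (\<xi> $ i) * (1 / (herm_factor \<xi> z)\<^sup>2 * cnj (\<xi> $ j)) - cnj (z $ i) * (1 / (defect z)\<^sup>2 * cnj (z $ j))"

definition log_kern_dz_dzbar :: "complex ^ 'n \<Rightarrow> complex ^ 'n \<Rightarrow> 'n \<Rightarrow> 'n \<Rightarrow> complex" where
  "log_kern_dz_dzbar \<xi> z i j = - (cnj (z $ i) * (1 / (defect z)\<^sup>2 * (z $ j)) + of_bool (j = i) * (1 / defect z))"

lemma has_wirtinger_log_kern_dz:
  assumes "z \<in> unit_ball" "\<xi> \<in> unit_ball"
  shows "has_wirtinger (\<lambda>z. log_kern_dz \<xi> z i) (log_kern_dz_dz \<xi> z i) (log_kern_dz_dzbar \<xi> z i) z"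
proof -
  have "herm_factor \<xi> z \<noteq> 0" using Re_herm_factor_pos[OF assms] by auto
  then have "has_wirtinger (\<lambda>z. log_kern_dz \<xi> z i)
     (\<lambda>j. cnj (\<xi> $ i) * (- (1 / (herm_factor \<xi> z)\<^sup>2) * (- cnj (\<xi> $ j))) - (cnj (z $ i) * (- (1 / (defect z)\<^sup>2) * (- cnj (z $ j))) + 0 * (1 / defect z)))
     (\<lambda>j. cnj (\<xi> $ i) * (- (1 / (herm_factor \<xi> z)\<^sup>2) * 0) - (cnj (z $ i) * (- (1 / (defect z)\<^sup>2) * (- (z $ j))) + of_bool (j = i) * (1 / defect z))) z"
    unfolding log_kern_dz_def
    by (intro has_wirtinger_diff has_wirtinger_cmult has_wirtinger_mult has_wirtinger_inverse has_wirtinger_herm_factor has_wirtinger_defect has_wirtinger_cnj_coord defect_nz assms)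
  then show ?thesis by (rule has_wirtinger_cong_fun) (simp_all add: log_kern_dz_dz_def log_kern_dz_dzbar_def)
qed

lemma continuous_on_kernel_parts:
  assumes "\<xi> \<in> unit_ball"
  shows "continuous_on unit_ball (kern_exp s \<xi>)" "continuous_on unit_ball (\<lambda>z. log_kern_dz \<xi> z i)" "continuous_on unit_ball (\<lambda>z. log_kern_dzbar \<xi> z i)"
    "continuous_on unit_ball (\<lambda>z. log_kern_dz_dz \<xi> z i j)" "continuous_on unit_ball (\<lambda>z. log_kern_dz_dzbar \<xi> z i j)"
proof -
  have nz: "herm_factor \<xi> z \<noteq> 0" "herm_factor_bar \<xi> z \<noteq> 0" if "z \<in> unit_ball" for z
    using Re_herm_factor_pos[OF that assms] Re_herm_factor_bar_pos[OF that assms] by auto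
  have c: "continuous_on unit_ball (herm_factor \<xi>)" "continuous_on unit_ball (herm_factor_bar \<xi>)"
    unfolding herm_factor_def[abs_def] herm_factor_bar_def[abs_def] by (intro continuous_intros)+
  have inv: "continuous_on unit_ball (\<lambda>z. 1 / herm_factor \<xi> z)" "continuous_on unit_ball (\<lambda>z. 1 / herm_factor_bar \<xi> z)"
    "continuous_on unit_ball (\<lambda>z :: complex ^ 'a. 1 / defect z)" "continuous_on unit_ball (\<lambda>z. 1 / (herm_factor \<xi> z)\<^sup>2)" "continuous_on unit_ball (\<lambda>z :: complex ^ 'a. 1 / (defect z)\<^sup>2)"
    by (intro continuous_on_divide continuous_intros c; simp add: nz defect_nz_norm)+
  show "continuous_on unit_ball (kern_exp s \<xi>)"
    by (intro continuous_at_imp_continuous_on ballI has_derivative_continuous)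
      (use has_wirtinger_kern_exp[OF _ assms] in \<open>auto simp: has_wirtinger_def\<close>)
  show "continuous_on unit_ball (\<lambda>z. log_kern_dz \<xi> z i)" "continuous_on unit_ball (\<lambda>z. log_kern_dzbar \<xi> z i)"
    "continuous_on unit_ball (\<lambda>z. log_kern_dz_dz \<xi> z i j)" "continuous_on unit_ball (\<lambda>z. log_kern_dz_dzbar \<xi> z i j)"
    unfolding log_kern_dz_def log_kern_dzbar_def log_kern_dz_dz_def log_kern_dz_dzbar_def by (intro continuous_intros inv)+
qed

lemma sum_of_bool_eq2: "(\<Sum>i\<in>UNIV. \<Sum>j\<in>UNIV. of_bool (i = j) * f i j) = (\<Sum>i\<in>UNIV. (f i (i::'a::finite)) :: complex)"
  unfolding sum_of_bool_eq ..

text \<open>C and D stand for \<open>herm_factor\<close> and \<open>herm_factor_bar\<close>, R and X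
  for \<open>defect\<close> at z and at \<xi>. The inner products in the sum to be computed are one
  minus these, so every quotient splits into partial fractions that mostly cancel.\<close>

lemma laplace_kernel_algebra:
  fixes C D R X :: complex
  assumes "C \<noteq> 0" "D \<noteq> 0" "R \<noteq> 0"
  shows "((1 - X) / (C * D) - (1 - D) / (R * D) - (1 - C) / (R * C) + (1 - R) / R\<^sup>2
      - ((1 - C) / C - (1 - R) / R) * ((1 - D) / D - (1 - R) / R)) * R = 1 - R * X / (C * D)"
proof -
  have 1: "(1 - C) / C - (1 - R) / R = 1 / C - 1 / R" "(1 - D) / D - (1 - R) / R = 1 / D - 1 / R"
    using assms by (simp_all add: diff_divide_distrib)
  have 2: "(1 - D) / (R * D) = 1 / (R * D) - 1 / R" "(1 - C) / (R * C) = 1 / (R * C) - 1 / R"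
    "(1 - R) / R\<^sup>2 = 1 / R\<^sup>2 - 1 / R" "(1 - X) / (C * D) = 1 / (C * D) - X / (C * D)"
    using assms by (simp_all add: diff_divide_distrib power2_eq_square)
  have 3: "(1 / C - 1 / R) * (1 / D - 1 / R) = 1 / (C * D) - 1 / (R * C) - 1 / (R * D) + 1 / R\<^sup>2"
    by (simp add: algebra_simps power2_eq_square)
  have "((1 - X) / (C * D) - (1 - D) / (R * D) - (1 - C) / (R * C) + (1 - R) / R\<^sup>2
      - ((1 - C) / C - (1 - R) / R) * ((1 - D) / D - (1 - R) / R)) = 1 / R - X / (C * D)"
    unfolding 1 2 3 by simp
  then show ?thesis using assms by (simp add: left_diff_distrib)
qed

text \<open>With L the logarithm of \<open>inv_cosh2 z \<xi>\<close>, a mixed second derivative of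
  exp (s L) is s exp (s L) times s times the product of the first derivatives plus the mixed
  derivative of L. Contracted and multiplied by \<open>defect z\<close>, the gradient part yields 1
  - \<open>inv_cosh2 z \<xi>\<close>, and the mixed part, which does not involve \<xi>, yields
  -n.\<close>

lemma laplace_kernel_sum:
  fixes z \<xi> :: "complex ^ 'n"
  assumes "z \<in> unit_ball" "\<xi> \<in> unit_ball"
  shows "(\<Sum>i\<in>UNIV. \<Sum>j\<in>UNIV. (of_bool (i = j) - z $ i * cnj (z $ j)) * (of_real s * (log_kern_dzbar \<xi> z j * log_kern_dz \<xi> z i) + log_kern_dz_dzbar \<xi> z i j)) * defect z =
    of_real s * (1 - defect z * defect \<xi> / (herm_factor \<xi> z * herm_factor_bar \<xi> z)) - of_nat CARD('n)"
proof -
  let ?R = "defect z" and ?c = "herm z \<xi>" and ?d = "herm \<xi> z" and ?r = "herm z z" and ?x = "herm \<xi> \<xi>"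
  have R: "?R \<noteq> 0" using defect_nz[OF assms(1)] .
  have C: "herm_factor \<xi> z \<noteq> 0" "herm_factor_bar \<xi> z \<noteq> 0" using Re_herm_factor_pos[OF assms] Re_herm_factor_bar_pos[OF assms] by auto
  have C1: "1 - ?c \<noteq> 0" "1 - ?d \<noteq> 0" "1 - ?r \<noteq> 0" using C R by (simp_all add: herm_factor_def herm_factor_bar_def defect_def)
  have zB: "(\<Sum>i\<in>UNIV. z $ i * log_kern_dz \<xi> z i) = ?c / herm_factor \<xi> z - ?r / ?R"
    by (simp add: log_kern_dz_def herm_def right_diff_distrib sum_subtractf sum_divide_distrib)
  have zBc: "(\<Sum>j\<in>UNIV. cnj (z $ j) * log_kern_dzbar \<xi> z j) = ?d / herm_factor_bar \<xi> z - ?r / ?R"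
    by (simp add: log_kern_dzbar_def herm_def right_diff_distrib sum_subtractf sum_divide_distrib mult.commute)
  have log_kern_dz: "(\<Sum>i\<in>UNIV. log_kern_dzbar \<xi> z i * log_kern_dz \<xi> z i) = ?x / (herm_factor \<xi> z * herm_factor_bar \<xi> z) - ?d / (?R * herm_factor_bar \<xi> z) - ?c / (?R * herm_factor \<xi> z) + ?r / ?R\<^sup>2"
  proof -
    have "log_kern_dzbar \<xi> z i * log_kern_dz \<xi> z i = \<xi> $ i * cnj (\<xi> $ i) * (1 / (herm_factor \<xi> z * herm_factor_bar \<xi> z)) - \<xi> $ i * cnj (z $ i) * (1 / (?R * herm_factor_bar \<xi> z))
        - z $ i * cnj (\<xi> $ i) * (1 / (?R * herm_factor \<xi> z)) + z $ i * cnj (z $ i) * (1 / ?R\<^sup>2)" for i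
      by (simp add: log_kern_dz_def log_kern_dzbar_def algebra_simps power2_eq_square)
    then have "(\<Sum>i\<in>UNIV. log_kern_dzbar \<xi> z i * log_kern_dz \<xi> z i) = ?x * (1 / (herm_factor \<xi> z * herm_factor_bar \<xi> z)) - ?d * (1 / (?R * herm_factor_bar \<xi> z))
        - ?c * (1 / (?R * herm_factor \<xi> z)) + ?r * (1 / ?R\<^sup>2)"
      by (simp only: sum.distrib sum_subtractf sum_distrib_right[symmetric] herm_def)
    then show ?thesis by simp
  qed
  have S1: "(\<Sum>i\<in>UNIV. \<Sum>j\<in>UNIV. (of_bool (i = j) - z $ i * cnj (z $ j)) * (log_kern_dzbar \<xi> z j * log_kern_dz \<xi> z i)) =
      (\<Sum>i\<in>UNIV. log_kern_dzbar \<xi> z i * log_kern_dz \<xi> z i) - (\<Sum>i\<in>UNIV. z $ i * log_kern_dz \<xi> z i) * (\<Sum>j\<in>UNIV. cnj (z $ j) * log_kern_dzbar \<xi> z j)"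
  proof -
    have "(\<Sum>i\<in>UNIV. \<Sum>j\<in>UNIV. (of_bool (i = j) - z $ i * cnj (z $ j)) * (log_kern_dzbar \<xi> z j * log_kern_dz \<xi> z i)) =
        (\<Sum>i\<in>UNIV. \<Sum>j\<in>UNIV. of_bool (i = j) * (log_kern_dzbar \<xi> z j * log_kern_dz \<xi> z i)) -
        (\<Sum>i\<in>UNIV. \<Sum>j\<in>UNIV. (z $ i * log_kern_dz \<xi> z i) * (cnj (z $ j) * log_kern_dzbar \<xi> z j))"
      unfolding sum_subtractf[symmetric] by (intro sum.cong refl) (simp add: algebra_simps)
    moreover have "(\<Sum>i\<in>UNIV. \<Sum>j\<in>UNIV. of_bool (i = j) * (log_kern_dzbar \<xi> z j * log_kern_dz \<xi> z i)) = (\<Sum>i\<in>UNIV. log_kern_dzbar \<xi> z i * log_kern_dz \<xi> z i)"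
      by (rule sum_of_bool_eq2)
    moreover have "(\<Sum>i\<in>UNIV. \<Sum>j\<in>UNIV. (z $ i * log_kern_dz \<xi> z i) * (cnj (z $ j) * log_kern_dzbar \<xi> z j)) =
        (\<Sum>i\<in>UNIV. z $ i * log_kern_dz \<xi> z i) * (\<Sum>j\<in>UNIV. cnj (z $ j) * log_kern_dzbar \<xi> z j)"
      by (rule sum_product[symmetric])
    ultimately show ?thesis by (simp only:)
  qed
  have S2: "(\<Sum>i\<in>UNIV. \<Sum>j\<in>UNIV. (of_bool (i = j) - z $ i * cnj (z $ j)) * log_kern_dz_dzbar \<xi> z i j) =
      - (?r / ?R\<^sup>2 + of_nat CARD('n) / ?R - ?r * ?r / ?R\<^sup>2 - ?r / ?R)"
  proof -
    have a: "(\<Sum>i\<in>UNIV. log_kern_dz_dzbar \<xi> z i i) = - (?r / ?R\<^sup>2 + of_nat CARD('n) / ?R)"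
      by (simp add: log_kern_dz_dzbar_def sum_subtractf sum_negf herm_def sum_divide_distrib mult.commute)
    have "(\<Sum>i\<in>UNIV. \<Sum>j\<in>UNIV. z $ i * cnj (z $ j) * log_kern_dz_dzbar \<xi> z i j) =
        - ((\<Sum>i\<in>UNIV. \<Sum>j\<in>UNIV. (z $ i * cnj (z $ i)) * (z $ j * cnj (z $ j)) * (1 / ?R\<^sup>2)) +
           (\<Sum>i\<in>UNIV. \<Sum>j\<in>UNIV. of_bool (i = j) * (z $ i * cnj (z $ j) * (1 / ?R))))"
      unfolding sum.distrib[symmetric] sum_negf[symmetric]
      by (intro sum.cong refl) (simp add: log_kern_dz_dzbar_def algebra_simps of_bool_def)
    also have "\<dots> = - (?r * ?r / ?R\<^sup>2 + ?r / ?R)"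
      unfolding sum_of_bool_eq2
      by (simp add: herm_def sum_product sum_divide_distrib)
    finally have b: "(\<Sum>i\<in>UNIV. \<Sum>j\<in>UNIV. z $ i * cnj (z $ j) * log_kern_dz_dzbar \<xi> z i j) = - (?r * ?r / ?R\<^sup>2 + ?r / ?R)" .
    show ?thesis
      by (simp only: left_diff_distrib sum_subtractf sum_of_bool_eq2 a b) (simp add: algebra_simps)
  qed
  have f1: "(\<Sum>i\<in>UNIV. \<Sum>j\<in>UNIV. (of_bool (i = j) - z $ i * cnj (z $ j)) * (of_real s * (log_kern_dzbar \<xi> z j * log_kern_dz \<xi> z i) + log_kern_dz_dzbar \<xi> z i j)) =
      of_real s * (\<Sum>i\<in>UNIV. \<Sum>j\<in>UNIV. (of_bool (i = j) - z $ i * cnj (z $ j)) * (log_kern_dzbar \<xi> z j * log_kern_dz \<xi> z i)) +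
      (\<Sum>i\<in>UNIV. \<Sum>j\<in>UNIV. (of_bool (i = j) - z $ i * cnj (z $ j)) * log_kern_dz_dzbar \<xi> z i j)"
    unfolding sum_distrib_left sum.distrib[symmetric]
    by (intro sum.cong refl) (simp only: distrib_left mult_ac)
  have f2: "(?x / (herm_factor \<xi> z * herm_factor_bar \<xi> z) - ?d / (?R * herm_factor_bar \<xi> z) - ?c / (?R * herm_factor \<xi> z) + ?r / ?R\<^sup>2
        - (?c / herm_factor \<xi> z - ?r / ?R) * (?d / herm_factor_bar \<xi> z - ?r / ?R)) * ?R = 1 - ?R * defect \<xi> / (herm_factor \<xi> z * herm_factor_bar \<xi> z)"
    using laplace_kernel_algebra[of "herm_factor \<xi> z" "herm_factor_bar \<xi> z" ?R "defect \<xi>"] C R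
    by (simp add: herm_factor_def herm_factor_bar_def defect_def)
  have f3: "- (?r / ?R\<^sup>2 + of_nat CARD('n) / ?R - ?r * ?r / ?R\<^sup>2 - ?r / ?R) * ?R = - of_nat CARD('n)"
  proof -
    have r: "?r = 1 - ?R" by (simp add: defect_def)
    have "(1 - ?R) / ?R\<^sup>2 - (1 - ?R) * (1 - ?R) / ?R\<^sup>2 - (1 - ?R) / ?R = 0"
      using R by (simp add: field_simps power2_eq_square)
    then have e: "?r / ?R\<^sup>2 + of_nat CARD('n) / ?R - ?r * ?r / ?R\<^sup>2 - ?r / ?R = of_nat CARD('n) / ?R"
      unfolding r by (simp add: algebra_simps)
    show ?thesis unfolding e using R by simp
  qed
  show ?thesis
    unfolding f1 S1 S2 log_kern_dz zB zBc distrib_right mult.assoc f2[unfolded mult.assoc] f3[unfolded mult.assoc]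
    by simp
qed

lemma kern_Suc: "z \<in> unit_ball \<Longrightarrow> w \<in> unit_ball \<Longrightarrow> kern (s + 1) z w = kern s z w * inv_cosh2 z w"
  using inv_cosh2_pos[of z w] by (simp add: kern_def powr_add)

lemma inv_cosh2_defect:
  assumes "z \<in> unit_ball" "\<xi> \<in> unit_ball"
  shows "defect z * defect \<xi> / (herm_factor \<xi> z * herm_factor_bar \<xi> z) = of_real (inv_cosh2 z \<xi>)"
proof -
  have "herm_factor \<xi> z * herm_factor_bar \<xi> z = of_real ((cmod (herm_factor \<xi> z))\<^sup>2)"
    unfolding herm_factor_bar_cnj complex_norm_square ..
  then show ?thesis by (simp add: defect_eq inv_cosh2_def herm_factor_def)
qed

text \<open>The formula for the Laplacian of the kernel, in integrated form: Green's identity with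
  the kernel as H, so that all derivatives fall on it.\<close>

lemma kern_green:
  fixes \<eta> :: "complex ^ 'n \<Rightarrow> complex"
  assumes \<eta>: "test_fun \<eta>" and \<xi>: "\<xi> \<in> unit_ball"
  shows "(LINT z|bergman_measure. of_real (kern s z \<xi>) * laplace_beltrami \<eta> z) =
    (LINT z|bergman_measure. of_real (4 * s * (s - real CARD('n)) * kern s z \<xi> - 4 * s\<^sup>2 * kern (s + 1) z \<xi>) * \<eta> z)"
proof -
  let ?n = "CARD('n)"
  let ?S = "complex_of_real s"
  let ?W = "\<lambda>i j. wirtinger i (wirtinger_bar j \<eta>)"
  note cp = continuous_on_kernel_parts[OF \<xi>]
  define P where "P z i = ?S * (kern_exp s \<xi> z * log_kern_dz \<xi> z i)" for z i
  define Pq where "Pq z i j = ?S * (kern_exp s \<xi> z * log_kern_dz_dzbar \<xi> z i j + ?S * (kern_exp s \<xi> z * log_kern_dzbar \<xi> z j) * log_kern_dz \<xi> z i)" for z i j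
  have g: "(LINT z|lborel. indicator unit_ball z *\<^sub>R (kern_exp s \<xi> z * (\<Sum>i\<in>UNIV. \<Sum>j\<in>UNIV. flux_coeff i j z * ?W i j z))) =
    (LINT z|lborel. indicator unit_ball z *\<^sub>R (\<eta> z * (\<Sum>i\<in>UNIV. \<Sum>j\<in>UNIV. flux_coeff i j z * Pq z i j)))"
  proof (rule green[where H = "kern_exp s \<xi>" and P = P and Q = "\<lambda>z i. ?S * (kern_exp s \<xi> z * log_kern_dzbar \<xi> z i)" and Pq = Pq and
        Pp = "\<lambda>z i j. ?S * (kern_exp s \<xi> z * log_kern_dz_dz \<xi> z i j + ?S * (kern_exp s \<xi> z * log_kern_dz \<xi> z j) * log_kern_dz \<xi> z i)", OF \<eta>])
    fix z :: "complex ^ 'n" assume z: "z \<in> unit_ball"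
    show "has_wirtinger (kern_exp s \<xi>) (P z) (\<lambda>i. ?S * (kern_exp s \<xi> z * log_kern_dzbar \<xi> z i)) z"
      unfolding P_def[abs_def] using has_wirtinger_kern_exp[OF z \<xi>] .
    show "has_wirtinger (\<lambda>z. P z i) (\<lambda>j. ?S * (kern_exp s \<xi> z * log_kern_dz_dz \<xi> z i j + ?S * (kern_exp s \<xi> z * log_kern_dz \<xi> z j) * log_kern_dz \<xi> z i)) (Pq z i) z" for i
      unfolding P_def Pq_def[abs_def] by (intro has_wirtinger_cmult has_wirtinger_mult has_wirtinger_kern_exp has_wirtinger_log_kern_dz z \<xi>)
  next
    show "continuous_on unit_ball (\<lambda>z. P z i)" "continuous_on unit_ball (\<lambda>z. ?S * (kern_exp s \<xi> z * log_kern_dzbar \<xi> z i))"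
      "continuous_on unit_ball (\<lambda>z. ?S * (kern_exp s \<xi> z * log_kern_dz_dz \<xi> z i j + ?S * (kern_exp s \<xi> z * log_kern_dz \<xi> z j) * log_kern_dz \<xi> z i))"
      "continuous_on unit_ball (\<lambda>z. Pq z i j)" for i j
      unfolding P_def Pq_def by (intro continuous_intros cp)+
  qed
  have km: "(\<lambda>z. kern s z \<xi>) \<in> borel_measurable borel" for s
    unfolding kern_def inv_cosh2_def by measurable
  have wm: "?W i j \<in> borel_measurable borel" "\<eta> \<in> borel_measurable borel" for i j
    using test_fun_continuous[OF \<eta>, of UNIV] by (auto intro: borel_measurable_continuous_onI)
  have lm: "laplace_beltrami \<eta> \<in> borel_measurable borel"
    unfolding laplace_beltrami_def[abs_def]
    by (intro borel_measurable_continuous_onI continuous_intros test_fun_continuous \<eta>)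
  have v: "ball_volume TYPE('n) \<noteq> 0" using ball_volume_pos[where 'n = 'n] by simp
  \<comment> \<open>One factor \<open>defect z\<close> of the Laplacian cancels against the power n
    + 1 in the weight, leaving the power n of \<open>flux_coeff\<close>.\<close>
  have L: "indicator unit_ball z *\<^sub>R (bergman_weight z *\<^sub>R (of_real (kern s z \<xi>) * laplace_beltrami \<eta> z)) =
      of_real (4 / ball_volume TYPE('n)) * (indicator unit_ball z *\<^sub>R (kern_exp s \<xi> z * (\<Sum>i\<in>UNIV. \<Sum>j\<in>UNIV. flux_coeff i j z * ?W i j z)))" for z
  proof (cases "z \<in> unit_ball")
    case True
    let ?T = "\<Sum>i\<in>UNIV. \<Sum>j\<in>UNIV. (of_bool (i = j) - z $ i * cnj (z $ j)) * ?W i j z"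
    have 1: "(\<Sum>i\<in>UNIV. \<Sum>j\<in>UNIV. flux_coeff i j z * ?W i j z) = ?T * (1 / defect z ^ ?n)"
      unfolding flux_coeff_def sum_distrib_right by (intro sum.cong refl) simp
    have 2: "laplace_beltrami \<eta> z = 4 * defect z * ?T" by (simp add: laplace_beltrami_def defect_eq)
    have 3: "complex_of_real (bergman_weight z) = 1 / (of_real (ball_volume TYPE('n)) * defect z ^ (?n + 1))"
      by (simp add: bergman_weight_def defect_eq)
    have "1 / (v * R ^ (?n + 1)) * (k * (4 * R * T)) = 4 / v * (k * (T * (1 / R ^ ?n)))"
      if "R \<noteq> 0" "v \<noteq> 0" for R v k T :: complex
      using that by (simp add: field_simps)
    from this[OF defect_nz[OF True], of "of_real (ball_volume TYPE('n))" "of_real (kern s z \<xi>)" ?T] True v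
    show ?thesis
      unfolding 1 2 kern_exp_eq[OF True \<xi>] scaleR_conv_of_real[of "bergman_weight z"] 3 by simp
  qed simp
  have R: "indicator unit_ball z *\<^sub>R (bergman_weight z *\<^sub>R (of_real (4 * s * (s - real ?n) * kern s z \<xi> - 4 * s\<^sup>2 * kern (s + 1) z \<xi>) * \<eta> z)) =
      of_real (4 / ball_volume TYPE('n)) * (indicator unit_ball z *\<^sub>R (\<eta> z * (\<Sum>i\<in>UNIV. \<Sum>j\<in>UNIV. flux_coeff i j z * Pq z i j)))" for z
  proof (cases "z \<in> unit_ball")
    case True
    let ?T = "\<Sum>i\<in>UNIV. \<Sum>j\<in>UNIV. (of_bool (i = j) - z $ i * cnj (z $ j)) * (?S * (log_kern_dzbar \<xi> z j * log_kern_dz \<xi> z i) + log_kern_dz_dzbar \<xi> z i j)"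
    have T: "?T = (?S * (1 - of_real (inv_cosh2 z \<xi>)) - of_nat ?n) / defect z"
      using laplace_kernel_sum[OF True \<xi>, of s] defect_nz[OF True] unfolding inv_cosh2_defect[OF True \<xi>]
      by (simp add: eq_divide_eq)
    have 1: "(\<Sum>i\<in>UNIV. \<Sum>j\<in>UNIV. flux_coeff i j z * Pq z i j) = ?S * kern_exp s \<xi> z * (1 / defect z ^ ?n) * ?T"
      unfolding flux_coeff_def Pq_def sum_distrib_left by (intro sum.cong refl) (simp add: algebra_simps)
    have 2: "complex_of_real (bergman_weight z) = 1 / (of_real (ball_volume TYPE('n)) * defect z ^ (?n + 1))"
      by (simp add: bergman_weight_def defect_eq)
    have k: "kern (s + 1) z \<xi> = kern s z \<xi> * inv_cosh2 z \<xi>" using kern_Suc[OF True \<xi>] .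
    have 3: "complex_of_real (4 * s * (s - real ?n) * kern s z \<xi> - 4 * s\<^sup>2 * kern (s + 1) z \<xi>) =
        4 * ?S * kern_exp s \<xi> z * (?S * (1 - of_real (inv_cosh2 z \<xi>)) - of_nat ?n)"
      unfolding kern_exp_eq[OF True \<xi>] k by (simp add: algebra_simps power2_eq_square)
    have "1 / (v * R ^ (?n + 1)) * (4 * S * h * T * e) = 4 / v * (e * (S * h * (1 / R ^ ?n) * (T / R)))"
      if "R \<noteq> 0" "v \<noteq> 0" for R v S h T e :: complex
      using that by (simp add: field_simps)
    from this[OF defect_nz[OF True], of "of_real (ball_volume TYPE('n))" ?S "kern_exp s \<xi> z" "?S * (1 - of_real (inv_cosh2 z \<xi>)) - of_nat ?n" "\<eta> z"] True v
    show ?thesis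
      unfolding 1 T 3 scaleR_conv_of_real[of "bergman_weight z"] 2 by simp
  qed simp
  have "(LINT z|bergman_measure. of_real (kern s z \<xi>) * laplace_beltrami \<eta> z) =
      (LINT z|lborel. indicator unit_ball z *\<^sub>R (bergman_weight z *\<^sub>R (of_real (kern s z \<xi>) * laplace_beltrami \<eta> z)))"
    using km lm by (intro bergman_integral bergman_borel borel_measurable_times) auto
  also have "\<dots> = of_real (4 / ball_volume TYPE('n)) * (LINT z|lborel. indicator unit_ball z *\<^sub>R (\<eta> z * (\<Sum>i\<in>UNIV. \<Sum>j\<in>UNIV. flux_coeff i j z * Pq z i j)))"
    by (simp only: L integral_mult_right_zero g)
  also have "\<dots> = (LINT z|lborel. indicator unit_ball z *\<^sub>R
      (bergman_weight z *\<^sub>R (of_real (4 * s * (s - real ?n) * kern s z \<xi> - 4 * s\<^sup>2 * kern (s + 1) z \<xi>) * \<eta> z)))"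
    by (simp only: R integral_mult_right_zero)
  also have "\<dots> = (LINT z|bergman_measure. of_real (4 * s * (s - real ?n) * kern s z \<xi> - 4 * s\<^sup>2 * kern (s + 1) z \<xi>) * \<eta> z)"
    by (intro bergman_integral[symmetric] bergman_borel borel_measurable_times wm(2)
        measurable_compose[OF _ borel_measurable_of_real] borel_measurable_diff borel_measurable_const km)
  finally show ?thesis .
qed

section \<open>Integral operators with kernel \<open>cosh\<^sup>-\<^sup>2\<^sup>s d\<close>\<close>

lemma L2_inner_lin_left:
  assumes "f \<in> L2 M" "g \<in> L2 M" "\<eta> \<in> L2 M"
  shows "L2_inner M (\<lambda>x. a * f x + b * g x) \<eta> = a * L2_inner M f \<eta> + b * L2_inner M g \<eta>"
  using assms by (simp add: L2_inner_add_left L2_inner_scale_left L2_scale)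

lemma L2_inner_lin_right:
  assumes "f \<in> L2 M" "g \<in> L2 M" "\<eta> \<in> L2 M"
  shows "L2_inner M \<eta> (\<lambda>x. a * f x + b * g x) = cnj a * L2_inner M \<eta> f + cnj b * L2_inner M \<eta> g"
  using assms by (simp add: L2_inner_add_right L2_inner_scale_right L2_scale)

text \<open>These functions live on the whole space and vanish outside a ball of radius less than 1.
  Unlike test functions they stay in the class under multiplication by functions merely continuous
  on the ball, such as \<open>kern_limit\<close>, whose smoothness is not established.\<close>

definition Cc :: "(complex ^ 'n \<Rightarrow> complex) set" where
  "Cc = {\<theta>. continuous_on UNIV \<theta> \<and> (\<exists>r<1. \<forall>z. \<theta> z \<noteq> 0 \<longrightarrow> norm z \<le> r)}"

abbreviation BM :: "(complex ^ 'n) measure" where "BM \<equiv> bergman_measure"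

lemma CcE:
  assumes "\<theta> \<in> Cc"
  obtains r where "0 \<le> r" "r < 1" "\<And>z. r < norm z \<Longrightarrow> \<theta> z = 0"
proof -
  obtain r where r: "r < 1" "\<And>z. \<theta> z \<noteq> 0 \<Longrightarrow> norm z \<le> r" using assms by (auto simp: Cc_def)
  show ?thesis
  proof (rule that[of "max r 0"])
    show "\<theta> z = 0" if "max r 0 < norm z" for z using r(2)[of z] that by fastforce
  qed (use r in auto)
qed

lemma Cc_continuous: "\<theta> \<in> Cc \<Longrightarrow> continuous_on UNIV \<theta>"
  by (simp add: Cc_def)

lemma Cc_measurable [measurable_dest]: "\<theta> \<in> Cc \<Longrightarrow> \<theta> \<in> borel_measurable borel"
  by (intro borel_measurable_continuous_onI Cc_continuous)

lemma CcI_ball: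
  fixes g :: "complex ^ 'n \<Rightarrow> complex"
  assumes c: "continuous_on unit_ball g" and r: "r < 1" and 0: "\<And>z. r < norm z \<Longrightarrow> g z = 0"
  shows "g \<in> Cc"
proof -
  have "open (- cball (0 :: complex ^ 'n) r)" by (simp add: open_Compl)
  moreover have "continuous_on (- cball 0 r) g"
    by (rule continuous_on_cong[THEN iffD2, OF refl _ continuous_on_const[of _ 0]]) (simp add: 0)
  ultimately have "continuous_on (unit_ball \<union> - cball 0 r) g"
    using c by (intro continuous_on_open_Un) auto
  moreover have "unit_ball \<union> - cball 0 r = (UNIV :: (complex ^ 'n) set)" using r by auto
  ultimately have "continuous_on UNIV g" by simp
  moreover have "\<forall>z. g z \<noteq> 0 \<longrightarrow> norm z \<le> r" using 0 by (meson linorder_not_le)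
  ultimately show ?thesis using r by (auto simp: Cc_def)
qed

lemma Cc_mult:
  assumes "continuous_on unit_ball g" "\<theta> \<in> Cc"
  shows "(\<lambda>z. g z * \<theta> z) \<in> Cc"
proof -
  obtain r where r: "0 \<le> r" "r < 1" "\<And>z. r < norm z \<Longrightarrow> \<theta> z = 0" using CcE[OF assms(2)] by blast
  have c: "continuous_on unit_ball \<theta>" by (rule continuous_on_subset[OF Cc_continuous[OF assms(2)]]) simp
  show ?thesis
    by (rule CcI_ball[OF continuous_on_mult[OF assms(1) c] r(2)]) (simp add: r(3))
qed

lemma Cc_cnj: "\<theta> \<in> Cc \<Longrightarrow> (\<lambda>z. cnj (\<theta> z)) \<in> Cc"
  by (auto simp: Cc_def intro: continuous_intros)

lemma Cc_norm: "\<theta> \<in> Cc \<Longrightarrow> (\<lambda>z. of_real (cmod (\<theta> z))) \<in> Cc"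
  by (auto simp: Cc_def intro!: continuous_intros)

lemma Cc_bounded:
  assumes "\<theta> \<in> Cc"
  obtains C where "0 \<le> C" "\<And>z. cmod (\<theta> z) \<le> C"
proof -
  obtain r where r: "0 \<le> r" "r < 1" "\<And>z. r < norm z \<Longrightarrow> \<theta> z = 0" using CcE[OF assms] by blast
  have "bounded (\<theta> ` cball 0 r)"
    by (intro compact_imp_bounded compact_continuous_image continuous_on_subset[OF Cc_continuous[OF assms]]) auto
  then obtain C where C: "C > 0" "\<And>z. z \<in> cball 0 r \<Longrightarrow> cmod (\<theta> z) \<le> C"
    by (auto simp: bounded_pos)
  have "cmod (\<theta> z) \<le> C" for z using C r(3)[of z] by (cases "norm z \<le> r") auto
  then show ?thesis using that[of C] C(1) by simp
qed

lemma continuous_on_bergman_weight: "continuous_on unit_ball (bergman_weight :: complex ^ 'n \<Rightarrow> real)"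
  unfolding bergman_weight_def[abs_def] using one_minus_norm_sq_pos ball_volume_pos[where 'n = 'n]
  by (intro continuous_intros) fastforce

lemma Cc_integrable:
  assumes "\<theta> \<in> Cc"
  shows "integrable BM \<theta>"
proof -
  obtain r where r: "0 \<le> r" "r < 1" "\<And>z. r < norm z \<Longrightarrow> \<theta> z = 0" using CcE[OF assms] by blast
  have "integrable lborel (\<lambda>z. indicator unit_ball z *\<^sub>R (bergman_weight z *\<^sub>R \<theta> z))"
    using r by (intro integrable_continuous_support[of "cball 0 r"] continuous_intros continuous_on_bergman_weight
        continuous_on_subset[OF Cc_continuous[OF assms]]) auto
  then show ?thesis using bergman_integrable[OF bergman_borel[OF Cc_measurable[OF assms]]] by blast
qed

lemma Cc_L2:
  assumes "\<theta> \<in> Cc"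
  shows "\<theta> \<in> L2 BM"
proof -
  have "(\<lambda>z. cnj (\<theta> z) * \<theta> z) \<in> Cc"
    using assms by (intro Cc_mult continuous_on_subset[OF Cc_continuous[OF Cc_cnj[OF assms]]]) auto
  then have "integrable BM (\<lambda>z. cmod (cnj (\<theta> z) * \<theta> z))" using Cc_integrable integrable_norm by blast
  then have "integrable BM (\<lambda>z. (cmod (\<theta> z))\<^sup>2)" by (simp add: norm_mult power2_eq_square)
  then show ?thesis using assms by (simp add: L2_def bergman_borel Cc_measurable)
qed

lemma test_fun_Cc:
  assumes "test_fun \<eta>"
  shows "\<eta> \<in> Cc" "laplace_beltrami \<eta> \<in> Cc"
proof -
  let ?K = "closure {z. \<eta> z \<noteq> 0}"
  note K = test_fun_support[OF assms]
  obtain r where r: "r < 1" "?K \<subseteq> cball 0 r"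
  proof (cases "?K = {}")
    case True then show ?thesis using that[of 0] by simp
  next
    case False
    have "continuous_on ?K norm" by (intro continuous_intros)
    from continuous_attains_sup[OF K(1) False this]
    obtain x where "x \<in> ?K" "\<And>y. y \<in> ?K \<Longrightarrow> norm y \<le> norm x" by blast
    then have "norm x < 1" "?K \<subseteq> cball 0 (norm x)" using K(2) by auto
    then show ?thesis using that by blast
  qed
  have nK: "z \<notin> ?K" if "r < norm z" for z using r(2) that by auto
  show "\<eta> \<in> Cc"
    using test_fun_continuous(1)[OF assms] test_fun_zero(1)[OF nK] r(1) by (intro CcI_ball[of _ r])
  have "laplace_beltrami \<eta> z = 0" if "r < norm z" for z
    unfolding laplace_beltrami_def test_fun_zero(3)[OF nK[OF that]] by simp
  moreover have "continuous_on unit_ball (laplace_beltrami \<eta>)"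
    unfolding laplace_beltrami_def[abs_def] by (intro continuous_intros test_fun_continuous assms)
  ultimately show "laplace_beltrami \<eta> \<in> Cc" using r(1) by (intro CcI_ball[of _ r])
qed

section \<open>The kernel operators on functions of compact support\<close>

lemma kern_measurable [measurable]:
  assumes [measurable]: "f \<in> borel_measurable N" "g \<in> borel_measurable N"
  shows "(\<lambda>x. kern s (f x) (g x)) \<in> borel_measurable N"
  unfolding kern_def inv_cosh2_def by measurable

lemma kern_sym: "kern s z w = kern s w z"
  by (simp add: kern_def inv_cosh2_sym)

lemma kern_nonneg: "0 \<le> kern s z w"
  by (simp add: kern_def)

lemma kern_le_1: "z \<in> unit_ball \<Longrightarrow> w \<in> unit_ball \<Longrightarrow> 0 \<le> s \<Longrightarrow> kern s z w \<le> 1"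
  using inv_cosh2_le_1[of z w] inv_cosh2_pos[of z w] powr_mono2[of s "inv_cosh2 z w" 1] by (simp add: kern_def)

lemma kern_le_weight:
  assumes "z \<in> unit_ball" "norm w \<le> r" "r < 1" "0 \<le> s"
  shows "kern s z w \<le> (1 / (1 - r)\<^sup>2) powr s * (1 - (norm z)\<^sup>2) powr s"
proof -
  have "kern s z w \<le> ((1 - (norm z)\<^sup>2) / (1 - r)\<^sup>2) powr s"
    unfolding kern_def using assms inv_cosh2_le_weight[of z w r] inv_cosh2_pos[of z w] by (intro powr_mono2) auto
  also have "\<dots> = (1 / (1 - r)\<^sup>2 * (1 - (norm z)\<^sup>2)) powr s" by simp
  also have "\<dots> = (1 / (1 - r)\<^sup>2) powr s * (1 - (norm z)\<^sup>2) powr s"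
    using assms one_minus_norm_sq_pos[of z] by (intro powr_mult)
  finally show ?thesis .
qed

definition kern_op :: "real \<Rightarrow> (complex ^ 'n \<Rightarrow> complex) \<Rightarrow> complex ^ 'n \<Rightarrow> complex" where
  "kern_op s \<phi> z = (LINT w|BM. of_real (kern s z w) * \<phi> w)"

lemma kern_op_measurable:
  assumes "\<phi> \<in> borel_measurable BM"
  shows "kern_op s \<phi> \<in> borel_measurable BM"
proof -
  interpret sigma_finite_measure BM by (rule sigma_finite_bergman)
  note [measurable] = assms
  show ?thesis unfolding kern_op_def[abs_def]
    by (rule borel_measurable_lebesgue_integral) measurable
qed

lemma weight_L2:
  assumes "real CARD('n) / 2 < s" "f \<in> borel_measurable BM"
    "\<And>z :: complex ^ 'n. z \<in> unit_ball \<Longrightarrow> cmod (f z) \<le> C * (1 - (norm z)\<^sup>2) powr s"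
  shows "f \<in> L2 (BM :: (complex ^ 'n) measure)"
proof -
  have "integrable BM (\<lambda>z :: complex ^ 'n. (cmod (f z))\<^sup>2)"
  proof (rule Bochner_Integration.integrable_bound)
    show "integrable BM (\<lambda>z :: complex ^ 'n. C\<^sup>2 * (1 - (norm z)\<^sup>2) powr (2 * s))"
      using assms(1) by (intro integrable_mult_right weight_integrable) simp
    show "AE z in BM. norm ((cmod (f z))\<^sup>2) \<le> norm (C\<^sup>2 * (1 - (norm z)\<^sup>2) powr (2 * s))"
    proof (rule AE_I2)
      fix z :: "complex ^ 'n" assume z: "z \<in> space BM"
      then have "(cmod (f z))\<^sup>2 \<le> (C * (1 - (norm z)\<^sup>2) powr s)\<^sup>2"
        using assms(3)[of z] by (intro power_mono) auto
      also have "\<dots> = C\<^sup>2 * (1 - (norm z)\<^sup>2) powr (2 * s)"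
        by (simp add: power_mult_distrib powr_powr[symmetric] power2_eq_square powr_add[symmetric])
      finally show "norm ((cmod (f z))\<^sup>2) \<le> norm (C\<^sup>2 * (1 - (norm z)\<^sup>2) powr (2 * s))" by simp
    qed
  qed (use assms(2) in measurable)
  then show ?thesis using assms(2) by (simp add: L2_def)
qed

lemma kern_L2:
  fixes z :: "complex ^ 'n"
  assumes "real CARD('n) / 2 < s" "z \<in> unit_ball"
  shows "(\<lambda>w. of_real (kern s z w)) \<in> L2 BM"
proof (rule weight_L2[OF assms(1)])
  have [measurable]: "(\<lambda>w. kern s z w) \<in> borel_measurable BM" by measurable
  show "(\<lambda>w. complex_of_real (kern s z w)) \<in> borel_measurable BM" by measurable
  have s: "0 \<le> s" using assms(1) by (meson divide_nonneg_nonneg less_imp_le of_nat_0_le_iff order_trans zero_le_numeral)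
  show "cmod (of_real (kern s z w)) \<le> (1 / (1 - norm z)\<^sup>2) powr s * (1 - (norm w)\<^sup>2) powr s" if "w \<in> unit_ball" for w
    using kern_le_weight[of w z "norm z" s] that assms(2) s by (simp add: kern_nonneg kern_sym)
qed

lemma kern_L2_integrable:
  fixes z :: "complex ^ 'n"
  assumes "real CARD('n) / 2 < s" "z \<in> unit_ball" "\<phi> \<in> L2 BM"
  shows "integrable BM (\<lambda>w. of_real (kern s z w) * \<phi> w)"
  using kern_L2[OF assms(1,2)] assms(3) by (rule L2_prod_integrable)

lemma kern_op_bound:
  fixes \<theta> :: "complex ^ 'n \<Rightarrow> complex"
  assumes "\<theta> \<in> Cc" "0 \<le> s"
  obtains C where "0 \<le> C" "\<And>z. z \<in> unit_ball \<Longrightarrow> cmod (kern_op s \<theta> z) \<le> C * (1 - (norm z)\<^sup>2) powr s"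
proof -
  obtain r where r: "0 \<le> r" "r < 1" "\<And>z. r < norm z \<Longrightarrow> \<theta> z = 0" using CcE[OF assms(1)] by blast
  define D where "D = (1 / (1 - r)\<^sup>2) powr s"
  define I where "I = (LINT w|BM. cmod (\<theta> w))"
  have int: "integrable BM (\<lambda>w. cmod (\<theta> w))" using Cc_integrable[OF assms(1)] by simp
  have "cmod (kern_op s \<theta> z) \<le> D * I * (1 - (norm z)\<^sup>2) powr s" if z: "z \<in> unit_ball" for z
  proof -
    have "cmod (kern_op s \<theta> z) \<le> (LINT w|BM. cmod (of_real (kern s z w) * \<theta> w))"
      unfolding kern_op_def by (rule integral_norm_bound)
    also have "\<dots> \<le> (LINT w|BM. D * (1 - (norm z)\<^sup>2) powr s * cmod (\<theta> w))"
    proof (rule integral_mono')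
      show "integrable BM (\<lambda>w. D * (1 - (norm z)\<^sup>2) powr s * cmod (\<theta> w))" using int by simp
      show "0 \<le> D * (1 - (norm z)\<^sup>2) powr s * cmod (\<theta> w)" for w by (simp add: D_def)
      fix w :: "complex ^ 'n"
        show "cmod (complex_of_real (kern s z w) * \<theta> w) \<le> D * (1 - (norm z)\<^sup>2) powr s * cmod (\<theta> w)"
        proof (cases "norm w \<le> r")
          case True
          then show ?thesis
            using kern_le_weight[OF z True r(2) assms(2)] kern_nonneg[of s z w]
            by (simp add: norm_mult D_def mult_right_mono)
        next
          case False then show ?thesis using r(3)[of w] by simp
        qed
    qed
    also have "\<dots> = D * I * (1 - (norm z)\<^sup>2) powr s" by (simp add: I_def)
    finally show ?thesis .
  qed
  moreover have "0 \<le> D * I" by (simp add: D_def I_def)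
  ultimately show ?thesis using that by blast
qed

lemma kern_op_L2:
  fixes \<theta> :: "complex ^ 'n \<Rightarrow> complex"
  assumes "\<theta> \<in> Cc" "real CARD('n) / 2 < s"
  shows "kern_op s \<theta> \<in> L2 BM"
proof -
  have s: "0 \<le> s" using assms(2) by (meson divide_nonneg_nonneg less_imp_le of_nat_0_le_iff order_trans zero_le_numeral)
  obtain C where "0 \<le> C" "\<And>z. z \<in> unit_ball \<Longrightarrow> cmod (kern_op s \<theta> z) \<le> C * (1 - (norm z)\<^sup>2) powr s"
    using kern_op_bound[OF assms(1) s] by blast
  then show ?thesis
    using assms by (intro weight_L2[of s _ C] kern_op_measurable bergman_borel Cc_measurable)
qed

text \<open>Fubini and the symmetry of the kernel. The function \<open>kern_op s \<phi>\<close> is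
  not known to be square-integrable, hence the first claim. Absolute integrability comes from the
  other side: \<open>kern_op s\<close> applied to the modulus of \<theta> is square-integrable and
  may be paired with \<phi>.\<close>

lemma kern_op_swap:
  fixes \<theta> \<phi> :: "complex ^ 'n \<Rightarrow> complex"
  assumes \<theta>: "\<theta> \<in> Cc" and \<phi>: "\<phi> \<in> L2 BM" and s: "real CARD('n) / 2 < s"
  shows "integrable BM (\<lambda>z. kern_op s \<phi> z * cnj (\<theta> z))"
    and "L2_inner BM (kern_op s \<phi>) \<theta> = L2_inner BM \<phi> (kern_op s \<theta>)"
proof -
  let ?M = "BM :: (complex ^ 'n) measure"
  interpret M: sigma_finite_measure ?M by (rule sigma_finite_bergman)
  interpret P: pair_sigma_finite ?M ?M ..
  note [measurable] = L2_measurable[OF \<phi>] bergman_borel[OF Cc_measurable[OF \<theta>]]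
  let ?f = "\<lambda>w z. complex_of_real (kern s z w) * \<phi> w * cnj (\<theta> z)"
  have int: "integrable (?M \<Otimes>\<^sub>M ?M) (\<lambda>(w, z). ?f w z)"
  proof (rule P.Fubini_integrable)
    show "(\<lambda>(w, z). ?f w z) \<in> borel_measurable (?M \<Otimes>\<^sub>M ?M)" by measurable
    have "kern_op s (\<lambda>z. of_real (cmod (\<theta> z))) \<in> L2 ?M" using s by (intro kern_op_L2 Cc_norm \<theta>)
    then have "integrable ?M (\<lambda>w. cmod (\<phi> w * kern_op s (\<lambda>z. of_real (cmod (\<theta> z))) w))"
      using L2_prod_integrable[OF \<phi>] integrable_norm by blast
    also have "(\<lambda>w. cmod (\<phi> w * kern_op s (\<lambda>z. of_real (cmod (\<theta> z))) w)) =
        (\<lambda>w. LINT z|?M. norm (case (w, z) of (w, z) \<Rightarrow> ?f w z))"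
    proof
      fix w :: "complex ^ 'n"
      have "kern_op s (\<lambda>z. of_real (cmod (\<theta> z))) w = (LINT z|?M. of_real (kern s w z * cmod (\<theta> z)))"
        by (simp add: kern_op_def)
      also have "\<dots> = of_real (LINT z|?M. kern s w z * cmod (\<theta> z))" by (rule integral_complex_of_real)
      finally have "cmod (\<phi> w * kern_op s (\<lambda>z. of_real (cmod (\<theta> z))) w) = cmod (\<phi> w) * (LINT z|?M. kern s w z * cmod (\<theta> z))"
        by (simp add: norm_mult kern_nonneg integral_nonneg)
      also have "\<dots> = (LINT z|?M. cmod (\<phi> w) * (kern s w z * cmod (\<theta> z)))" by simp
      also have "\<dots> = (LINT z|?M. norm (case (w, z) of (w, z) \<Rightarrow> ?f w z))"
        by (simp add: norm_mult kern_nonneg kern_sym[of s w] mult_ac)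
      finally show "cmod (\<phi> w * kern_op s (\<lambda>z. of_real (cmod (\<theta> z))) w) = (LINT z|?M. norm (case (w, z) of (w, z) \<Rightarrow> ?f w z))" .
    qed
    finally show "integrable ?M (\<lambda>w. LINT z|?M. norm (case (w, z) of (w, z) \<Rightarrow> ?f w z))" .
    show "AE w in ?M. integrable ?M (\<lambda>z. case (w, z) of (w, z) \<Rightarrow> ?f w z)"
    proof (rule AE_I2)
      fix w :: "complex ^ 'n" assume "w \<in> space ?M"
      then have "integrable ?M (\<lambda>z. \<phi> w * (of_real (kern s w z) * cnj (\<theta> z)))"
        using s by (intro integrable_mult_right kern_L2_integrable Cc_L2 Cc_cnj \<theta>) auto
      then show "integrable ?M (\<lambda>z. case (w, z) of (w, z) \<Rightarrow> ?f w z)"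
        by (simp add: kern_sym[of s w] mult_ac)
    qed
  qed
  have e1: "(LINT w|?M. ?f w z) = kern_op s \<phi> z * cnj (\<theta> z)" for z by (simp add: kern_op_def)
  have e2: "(LINT z|?M. ?f w z) = \<phi> w * cnj (kern_op s \<theta> w)" for w
  proof -
    have "(LINT z|?M. ?f w z) = \<phi> w * (LINT z|?M. cnj (of_real (kern s w z) * \<theta> z))"
      by (subst integral_mult_right_zero[symmetric]) (simp add: kern_sym[of s w] mult_ac)
    then show ?thesis by (simp add: kern_op_def del: complex_cnj_mult)
  qed
  show "integrable ?M (\<lambda>z. kern_op s \<phi> z * cnj (\<theta> z))"
    using P.integrable_snd[OF int] by (simp only: e1)
  show "L2_inner BM (kern_op s \<phi>) \<theta> = L2_inner BM \<phi> (kern_op s \<theta>)"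
    using P.Fubini_integral[OF int] by (simp only: e1 e2 L2_inner_def)
qed

text \<open>Symmetry brings the Laplacian of \<eta> under the kernel, where
  \<open>kern_green\<close> applies pointwise; symmetry again returns the kernels to \<theta>. This
  is the pair (u, v) for \<open>spectral_resolution_weak\<close>.\<close>

lemma kern_op_laplace_weak:
  fixes \<theta> :: "complex ^ 'n \<Rightarrow> complex"
  assumes \<theta>: "\<theta> \<in> Cc" and s: "real CARD('n) / 2 < s" and \<eta>: "test_fun \<eta>"
  shows "L2_inner BM (kern_op s \<theta>) (laplace_beltrami \<eta>) =
    L2_inner BM (\<lambda>z. of_real (4 * s * (s - real CARD('n))) * kern_op s \<theta> z + of_real (- (4 * s\<^sup>2)) * kern_op (s + 1) \<theta> z) \<eta>"
proof -
  let ?a = "4 * s * (s - real CARD('n))" and ?b = "- (4 * s\<^sup>2)"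
  have s1: "real CARD('n) / 2 < s + 1" using s by simp
  note \<eta>C = test_fun_Cc[OF \<eta>]
  have K: "kern_op s \<eta> \<in> L2 BM" "kern_op (s + 1) \<eta> \<in> L2 BM" "kern_op s \<theta> \<in> L2 BM" "kern_op (s + 1) \<theta> \<in> L2 BM"
    using s s1 \<theta> \<eta>C by (auto intro: kern_op_L2)
  have L: "kern_op s (laplace_beltrami \<eta>) w = of_real ?a * kern_op s \<eta> w + of_real ?b * kern_op (s + 1) \<eta> w" if w: "w \<in> unit_ball" for w
  proof -
    have i: "integrable BM (\<lambda>z. of_real (kern t w z) * \<eta> z)" if "real CARD('n) / 2 < t" for t
      using that w Cc_L2[OF \<eta>C(1)] by (rule kern_L2_integrable)
    have "kern_op s (laplace_beltrami \<eta>) w = (LINT z|BM. of_real (kern s z w) * laplace_beltrami \<eta> z)"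
      by (simp add: kern_op_def kern_sym[of s w])
    also have "\<dots> = (LINT z|BM. of_real (?a * kern s z w - 4 * s\<^sup>2 * kern (s + 1) z w) * \<eta> z)"
      by (rule kern_green[OF \<eta> w])
    also have "\<dots> = (LINT z|BM. of_real ?a * (of_real (kern s w z) * \<eta> z) + of_real ?b * (of_real (kern (s + 1) w z) * \<eta> z))"
      by (intro Bochner_Integration.integral_cong refl) (simp add: kern_sym[of _ w] algebra_simps)
    also have "\<dots> = of_real ?a * kern_op s \<eta> w + of_real ?b * kern_op (s + 1) \<eta> w"
      unfolding kern_op_def
      by (subst Bochner_Integration.integral_add) (simp_all only: integral_mult_right_zero integrable_mult_right i[OF s] i[OF s1])
    finally show ?thesis .
  qed
  have "L2_inner BM (kern_op s \<theta>) (laplace_beltrami \<eta>) = L2_inner BM \<theta> (kern_op s (laplace_beltrami \<eta>))"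
    by (rule kern_op_swap(2)[OF \<eta>C(2) Cc_L2[OF \<theta>] s])
  also have "\<dots> = L2_inner BM \<theta> (\<lambda>w. of_real ?a * kern_op s \<eta> w + of_real ?b * kern_op (s + 1) \<eta> w)"
    unfolding L2_inner_def by (intro Bochner_Integration.integral_cong refl) (simp only: L space_bergman)
  also have "\<dots> = of_real ?a * L2_inner BM \<theta> (kern_op s \<eta>) + of_real ?b * L2_inner BM \<theta> (kern_op (s + 1) \<eta>)"
    unfolding L2_inner_lin_right[OF K(1,2) Cc_L2[OF \<theta>]] complex_cnj_complex_of_real ..
  also have "\<dots> = of_real ?a * L2_inner BM (kern_op s \<theta>) \<eta> + of_real ?b * L2_inner BM (kern_op (s + 1) \<theta>) \<eta>"
    using kern_op_swap(2)[OF \<eta>C(1) Cc_L2[OF \<theta>] s] kern_op_swap(2)[OF \<eta>C(1) Cc_L2[OF \<theta>] s1] by simp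
  also have "\<dots> = L2_inner BM (\<lambda>z. of_real ?a * kern_op s \<theta> z + of_real ?b * kern_op (s + 1) \<theta> z) \<eta>"
    unfolding L2_inner_lin_left[OF K(3,4) Cc_L2[OF \<eta>C(1)]] ..
  finally show ?thesis .
qed

section \<open>Approximate identities\<close>

lemma lborel_scale:
  fixes f :: "'a::euclidean_space \<Rightarrow> 'b::{banach, second_countable_topology}"
  assumes c: "0 < c" and [measurable]: "f \<in> borel_measurable borel"
  shows "integral\<^sup>L lborel f = c ^ DIM('a) *\<^sub>R (LINT u|lborel. f (t + c *\<^sub>R u))"
    and "integrable lborel f \<Longrightarrow> integrable lborel (\<lambda>u. f (t + c *\<^sub>R u))"
proof -
  let ?T = "\<lambda>u::'a. t + c *\<^sub>R u"
  have l: "lborel = density (distr lborel borel ?T) (\<lambda>_. ennreal (c ^ DIM('a)))"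
    using lborel_affine[of c t] c by simp
  have "integral\<^sup>L lborel f = integral\<^sup>L (density (distr lborel borel ?T) (\<lambda>_. ennreal (c ^ DIM('a)))) f"
    using l by simp
  also have "\<dots> = (LINT x|distr lborel borel ?T. c ^ DIM('a) *\<^sub>R f x)"
    using c by (intro integral_density) auto
  also have "\<dots> = (LINT u|lborel. c ^ DIM('a) *\<^sub>R f (?T u))"
    by (rule integral_distr) auto
  finally show "integral\<^sup>L lborel f = c ^ DIM('a) *\<^sub>R (LINT u|lborel. f (t + c *\<^sub>R u))" by simp
  assume "integrable lborel f"
  then have "integrable (density (distr lborel borel ?T) (\<lambda>_. ennreal (c ^ DIM('a)))) f"
    using l by simp
  then have "integrable (distr lborel borel ?T) (\<lambda>x. c ^ DIM('a) *\<^sub>R f x)"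
    using c by (subst (asm) integrable_density) auto
  then have "integrable lborel (\<lambda>u. c ^ DIM('a) *\<^sub>R f (?T u))"
    by (subst (asm) integrable_distr_eq) auto
  then have "integrable lborel (\<lambda>u. inverse (c ^ DIM('a)) *\<^sub>R (c ^ DIM('a) *\<^sub>R f (?T u)))"
    by (rule integrable_scaleR_right)
  then show "integrable lborel (\<lambda>u. f (t + c *\<^sub>R u))" using c by (simp add: field_simps)
qed

lemma gauss_integrable:
  assumes "0 < c"
  shows "integrable lborel (\<lambda>u :: complex ^ 'n. exp (- (c * (norm u)\<^sup>2)))"
proof -
  have "integrable lborel (\<lambda>u :: complex ^ 'n. exp (- (norm u)\<^sup>2))"
    using gaussian_integral_1[where 'n = 'n] by (intro integrableI_nonneg) auto
  from lborel_scale(2)[OF _ _ this, of "sqrt c" 0] show ?thesis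
    using assms by (simp add: power_mult_distrib)
qed

lemma gauss_integral_1: "(LINT u|lborel. exp (- (norm (u :: complex ^ 'n))\<^sup>2)) = ball_volume TYPE('n) * fact CARD('n)"
  using gaussian_integral_1[where 'n = 'n] ball_volume_pos[where 'n = 'n]
  by (intro integral_eq_nn_integral[THEN trans]) auto

text \<open>From \<open>- x / (1 - x) \<le> ln (1 - x) \<le> - x\<close>, the lower bound being
  \<open>ln_le_minus_one\<close> at the reciprocal of 1 - x.\<close>

lemma one_minus_powr_tendsto:
  fixes \<sigma> x :: "nat \<Rightarrow> real"
  assumes \<sigma>: "filterlim \<sigma> at_top sequentially" and x: "\<forall>\<^sub>F k in sequentially. 0 \<le> x k \<and> x k < 1"
    and lim: "(\<lambda>k. \<sigma> k * x k) \<longlonglongrightarrow> q"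
  shows "(\<lambda>k. (1 - x k) powr \<sigma> k) \<longlonglongrightarrow> exp (- q)"
proof -
  have x0: "x \<longlonglongrightarrow> 0"
  proof -
    have "(\<lambda>k. (\<sigma> k * x k) * inverse (\<sigma> k)) \<longlonglongrightarrow> q * 0"
      by (intro tendsto_mult lim tendsto_inverse_0_at_top \<sigma>)
    moreover have "\<forall>\<^sub>F k in sequentially. (\<sigma> k * x k) * inverse (\<sigma> k) = x k"
      using filterlim_at_top_dense[THEN iffD1, OF \<sigma>, rule_format, of 0]
      by eventually_elim simp
    ultimately show ?thesis by (simp add: tendsto_cong)
  qed
  have "(\<lambda>k. \<sigma> k * ln (1 - x k)) \<longlonglongrightarrow> - q"
  proof (rule tendsto_sandwich[of "\<lambda>k. - (\<sigma> k * x k / (1 - x k))" _ _ "\<lambda>k. - (\<sigma> k * x k)"])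
    show "(\<lambda>k. - (\<sigma> k * x k)) \<longlonglongrightarrow> - q" by (intro tendsto_minus lim)
    have "(\<lambda>k. - (\<sigma> k * x k / (1 - x k))) \<longlonglongrightarrow> - (q / (1 - 0))"
      by (intro tendsto_intros lim x0) simp
    then show "(\<lambda>k. - (\<sigma> k * x k / (1 - x k))) \<longlonglongrightarrow> - q" by simp
    have ev: "\<forall>\<^sub>F k in sequentially. 0 < \<sigma> k \<and> 0 \<le> x k \<and> x k < 1"
      using filterlim_at_top_dense[THEN iffD1, OF \<sigma>, rule_format, of 0] x by eventually_elim simp
    then show "\<forall>\<^sub>F k in sequentially. \<sigma> k * ln (1 - x k) \<le> - (\<sigma> k * x k)"
    proof eventually_elim
      case (elim k)
      have "ln (1 - x k) \<le> - x k" using ln_le_minus_one[of "1 - x k"] elim by simp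
      then have "\<sigma> k * ln (1 - x k) \<le> \<sigma> k * (- x k)" using elim by (intro mult_left_mono) auto
      then show ?case by simp
    qed
    show "\<forall>\<^sub>F k in sequentially. - (\<sigma> k * x k / (1 - x k)) \<le> \<sigma> k * ln (1 - x k)"
      using ev
    proof eventually_elim
      case (elim k)
      have "ln (inverse (1 - x k)) \<le> inverse (1 - x k) - 1" using elim by (intro ln_le_minus_one) simp
      also have "\<dots> = x k / (1 - x k)" using elim by (simp add: field_simps)
      finally have "- (x k / (1 - x k)) \<le> ln (1 - x k)" using elim by (simp add: ln_inverse)
      then have "\<sigma> k * (- (x k / (1 - x k))) \<le> \<sigma> k * ln (1 - x k)" using elim by (intro mult_left_mono) auto
      then show ?case by simp
    qed
  qed
  then have "(\<lambda>k. exp (\<sigma> k * ln (1 - x k))) \<longlonglongrightarrow> exp (- q)" by (rule tendsto_exp)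
  moreover have "\<forall>\<^sub>F k in sequentially. exp (\<sigma> k * ln (1 - x k)) = (1 - x k) powr \<sigma> k"
    using x by eventually_elim (simp add: powr_def)
  ultimately show ?thesis by (simp add: tendsto_cong)
qed

text \<open>Near the diagonal \<open>inv_cosh2 z (z + u)\<close> is \<open>exp (- gauss_form z u)\<close> to second order, so \<open>\<sigma>\<^sup>n kern_op \<sigma> \<theta>\<close> tends to
  \<open>kern_limit \<theta>\<close>. By invariance of the metric \<open>kern_limit\<close> is constant; this is deduced later, from the symmetry
  of \<open>kern_op\<close>.\<close>

definition gauss_form :: "complex ^ 'n \<Rightarrow> complex ^ 'n \<Rightarrow> real" where
  "gauss_form z u = ((1 - (norm z)\<^sup>2) * (norm u)\<^sup>2 + (cmod (herm u z))\<^sup>2) / (1 - (norm z)\<^sup>2)\<^sup>2"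

definition kern_limit :: "complex ^ 'n \<Rightarrow> real" where
  "kern_limit z = bergman_weight z * (LINT u|lborel. exp (- gauss_form z u))"

text \<open>Provides the dominating function exp (- |u|^2), the same for all z.\<close>

lemma gauss_form_ge:
  assumes "z \<in> unit_ball"
  shows "(norm u)\<^sup>2 \<le> gauss_form z u"
proof -
  let ?a = "1 - (norm z)\<^sup>2"
  have a: "0 < ?a" "?a \<le> 1" using one_minus_norm_sq_pos[of z] assms by auto
  have "(norm u)\<^sup>2 * ?a\<^sup>2 \<le> (norm u)\<^sup>2 * (?a * 1)"
    using a by (intro mult_left_mono) (auto simp: power2_eq_square)
  also have "\<dots> \<le> ?a * (norm u)\<^sup>2 + (cmod (herm u z))\<^sup>2" by (simp add: mult.commute)
  finally show ?thesis using a by (simp add: gauss_form_def pos_le_divide_eq)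
qed

lemma gauss_form_measurable [measurable]: "gauss_form z \<in> borel_measurable borel"
  unfolding gauss_form_def[abs_def] by measurable

lemma exp_gauss_form_integrable:
  fixes z :: "complex ^ 'n"
  assumes "z \<in> unit_ball"
  shows "integrable lborel (\<lambda>u. exp (- gauss_form z u))"
  using gauss_integrable[of 1, where 'n = 'n]
  by (rule Bochner_Integration.integrable_bound) (use gauss_form_ge[OF assms] in auto)

lemma kern_limit_0: "kern_limit (0 :: complex ^ 'n) = fact CARD('n)"
  using ball_volume_pos[where 'n = 'n] by (simp add: kern_limit_def gauss_form_def bergman_weight_def gauss_integral_1)

lemma continuous_on_kern_limit: "continuous_on unit_ball (kern_limit :: complex ^ 'n \<Rightarrow> real)"
proof -
  have "continuous_on unit_ball (\<lambda>z :: complex ^ 'n. LINT u|lborel. exp (- gauss_form z u))"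
  proof (rule continuous_on_sequentiallyI)
    fix x :: "nat \<Rightarrow> complex ^ 'n" and a
    assume x: "\<forall>n. x n \<in> unit_ball" and a: "a \<in> unit_ball" and lim: "x \<longlonglongrightarrow> a"
    show "(\<lambda>n. LINT u|lborel. exp (- gauss_form (x n) u)) \<longlonglongrightarrow> (LINT u|lborel. exp (- gauss_form a u))"
    proof (rule integral_dominated_convergence[where w = "\<lambda>u. exp (- (norm u)\<^sup>2)"])
      show "integrable lborel (\<lambda>u :: complex ^ 'n. exp (- (norm u)\<^sup>2))"
        using gauss_integrable[of 1, where 'n = 'n] by simp
      show "AE u in lborel. (\<lambda>n. exp (- gauss_form (x n) u)) \<longlonglongrightarrow> exp (- gauss_form a u)"
        unfolding gauss_form_def using one_minus_norm_sq_pos[of a] a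
        by (intro AE_I2 tendsto_intros lim) auto
      show "AE u in lborel. norm (exp (- gauss_form (x n) u)) \<le> exp (- (norm u)\<^sup>2)" for n
        using gauss_form_ge[of "x n"] x by (intro AE_I2) simp
    qed auto
  qed
  then show ?thesis unfolding kern_limit_def by (intro continuous_on_mult continuous_on_bergman_weight)
qed

section \<open>Concentration of the rescaled kernel operators\<close>

definition weight_cut :: "(complex ^ 'n \<Rightarrow> complex) \<Rightarrow> complex ^ 'n \<Rightarrow> complex" where
  "weight_cut \<theta> z = indicator unit_ball z *\<^sub>R (bergman_weight z *\<^sub>R \<theta> z)"

lemma weight_cut_Cc:
  assumes "\<theta> \<in> Cc"
  shows "weight_cut \<theta> \<in> Cc"
proof -
  obtain r where r: "0 \<le> r" "r < 1" "\<And>z. r < norm z \<Longrightarrow> \<theta> z = 0" using CcE[OF assms] by blast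
  have "continuous_on unit_ball (\<lambda>z. bergman_weight z *\<^sub>R \<theta> z)"
    by (intro continuous_intros continuous_on_bergman_weight continuous_on_subset[OF Cc_continuous[OF assms]]) simp
  then have "continuous_on unit_ball (weight_cut \<theta>)"
    by (rule continuous_on_cong[THEN iffD2, OF refl, rotated]) (simp add: weight_cut_def)
  then show ?thesis using r(2) by (rule CcI_ball) (simp add: weight_cut_def r(3))
qed

lemma weight_cut_support: "\<theta> z = 0 \<Longrightarrow> weight_cut \<theta> z = 0"
  by (simp add: weight_cut_def)

text \<open>The substitution w = z + u / sqrt \<sigma>. Its Jacobian is \<sigma>^(-n), the real
  dimension being 2 n, which fixes the normalization \<sigma>^n of the approximate identity.\<close>

lemma kern_op_scaled:
  fixes \<theta> :: "complex ^ 'n \<Rightarrow> complex"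
  assumes "\<theta> \<in> Cc" "0 < \<sigma>"
  shows "of_real (\<sigma> ^ CARD('n)) * kern_op \<sigma> \<theta> z =
    (LINT u|lborel. of_real (kern \<sigma> z (z + (1 / sqrt \<sigma>) *\<^sub>R u)) * weight_cut \<theta> (z + (1 / sqrt \<sigma>) *\<^sub>R u))"
proof -
  note [measurable] = Cc_measurable[OF assms(1)] Cc_measurable[OF weight_cut_Cc[OF assms(1)]]
  have k: "(\<lambda>w. kern \<sigma> z w) \<in> borel_measurable borel" by measurable
  have "kern_op \<sigma> \<theta> z = (LINT w|lborel. indicator unit_ball w *\<^sub>R (bergman_weight w *\<^sub>R (of_real (kern \<sigma> z w) * \<theta> w)))"
    unfolding kern_op_def by (intro bergman_integral bergman_borel) measurable
  also have "\<dots> = (LINT w|lborel. of_real (kern \<sigma> z w) * weight_cut \<theta> w)"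
    by (intro Bochner_Integration.integral_cong refl) (simp add: weight_cut_def)
  also have "\<dots> = (1 / sqrt \<sigma>) ^ DIM(complex ^ 'n) *\<^sub>R
      (LINT u|lborel. of_real (kern \<sigma> z (z + (1 / sqrt \<sigma>) *\<^sub>R u)) * weight_cut \<theta> (z + (1 / sqrt \<sigma>) *\<^sub>R u))"
    by (rule lborel_scale(1)) (use assms in \<open>auto intro!: borel_measurable_times measurable_compose[OF k]\<close>)
  also have "(1 / sqrt \<sigma>) ^ DIM(complex ^ 'n) = 1 / \<sigma> ^ CARD('n)"
  proof -
    have "(1 / sqrt \<sigma>) ^ DIM(complex ^ 'n) = ((1 / sqrt \<sigma>)\<^sup>2) ^ CARD('n)"
      by (simp add: power_mult[symmetric] mult.commute)
    also have "(1 / sqrt \<sigma>)\<^sup>2 = 1 / \<sigma>" using assms(2) by (simp add: power_divide)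
    finally show ?thesis by (simp add: power_divide)
  qed
  finally show ?thesis using assms(2) by (simp add: scaleR_conv_of_real)
qed

lemma kern_gauss:
  assumes "z \<in> unit_ball" "norm w \<le> r" "r < 1" "0 \<le> s"
  shows "kern s z w \<le> exp (- ((1 - r\<^sup>2) / 4 * (s * (norm (z - w))\<^sup>2)))"
proof -
  have "kern s z w \<le> exp (- ((1 - r\<^sup>2) / 4 * (norm (z - w))\<^sup>2)) powr s"
    unfolding kern_def using inv_cosh2_le_exp[of z w r] inv_cosh2_pos[of z w] assms by (intro powr_mono2) auto
  also have "\<dots> = exp (- ((1 - r\<^sup>2) / 4 * (s * (norm (z - w))\<^sup>2)))"
    by (simp add: powr_def algebra_simps)
  finally show ?thesis .
qed

lemma kern_tendsto:
  fixes z u :: "complex ^ 'n"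
  assumes z: "z \<in> unit_ball" and \<sigma>: "filterlim \<sigma> at_top sequentially"
  shows "(\<lambda>k. kern (\<sigma> k) z (z + (1 / sqrt (\<sigma> k)) *\<^sub>R u)) \<longlonglongrightarrow> exp (- gauss_form z u)"
proof -
  define e where "e k = 1 / sqrt (\<sigma> k)" for k
  define w where "w k = z + e k *\<^sub>R u" for k
  have pos: "\<forall>\<^sub>F k in sequentially. 0 < \<sigma> k"
    using filterlim_at_top_dense[THEN iffD1, OF \<sigma>, rule_format, of 0] .
  have e0: "e \<longlonglongrightarrow> 0"
    unfolding e_def using tendsto_inverse_0_at_top[OF filterlim_compose[OF sqrt_at_top \<sigma>]]
    by (simp add: inverse_eq_divide)
  have w: "w \<longlonglongrightarrow> z"
  proof -
    have "w \<longlonglongrightarrow> z + 0 *\<^sub>R u" unfolding w_def by (intro tendsto_intros e0)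
    then show ?thesis by simp
  qed
  have ev: "\<forall>\<^sub>F k in sequentially. w k \<in> unit_ball"
    using topological_tendstoD[OF w _ z] by simp
  \<comment> \<open>The identity for \<open>1 - inv_cosh2\<close> is exact, so \<sigma> (1 -
    inv_cosh2) equals N over a convergent denominator, with no remainder to estimate.\<close>
  define N where "N = (1 - (norm z)\<^sup>2) * (norm u)\<^sup>2 + (cmod (herm u z))\<^sup>2"
  have x: "\<sigma> k * (1 - inv_cosh2 z (w k)) = N / (cmod (1 - herm z (w k)))\<^sup>2" if "0 < \<sigma> k" "w k \<in> unit_ball" for k
  proof -
    have "w k - z = e k *\<^sub>R u" by (simp add: w_def)
    then have "1 - inv_cosh2 z (w k) = (e k)\<^sup>2 * N / (cmod (1 - herm z (w k)))\<^sup>2"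
      using z that one_minus_inv_cosh2[of z "w k"]
      by (simp add: herm_scaleR_left norm_mult power_mult_distrib N_def distrib_left mult_ac)
    moreover have "\<sigma> k * (e k)\<^sup>2 = 1" using that by (simp add: e_def power_divide)
    ultimately show ?thesis by (metis (no_types, lifting) mult.assoc mult_1 times_divide_eq_right)
  qed
  have "(\<lambda>k. \<sigma> k * (1 - inv_cosh2 z (w k))) \<longlonglongrightarrow> gauss_form z u"
  proof -
    have "(cmod (1 - herm z z))\<^sup>2 = (1 - (norm z)\<^sup>2)\<^sup>2"
    proof -
      have "1 - herm z z = of_real (1 - (norm z)\<^sup>2)" by (simp add: herm_self)
      then show ?thesis by (simp only: norm_of_real power2_abs)
    qed
    then have gauss_form: "gauss_form z u = N / (cmod (1 - herm z z))\<^sup>2" by (simp add: gauss_form_def N_def)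
    have "(\<lambda>k. N / (cmod (1 - herm z (w k)))\<^sup>2) \<longlonglongrightarrow> gauss_form z u"
      unfolding gauss_form using one_minus_herm_nz[of z z] z by (intro tendsto_intros w) auto
    moreover have "\<forall>\<^sub>F k in sequentially. N / (cmod (1 - herm z (w k)))\<^sup>2 = \<sigma> k * (1 - inv_cosh2 z (w k))"
      using pos ev by eventually_elim (simp add: x)
    ultimately show ?thesis by (rule Lim_transform_eventually)
  qed
  moreover have "\<forall>\<^sub>F k in sequentially. 0 \<le> 1 - inv_cosh2 z (w k) \<and> 1 - inv_cosh2 z (w k) < 1"
    using ev
  proof eventually_elim
    case (elim k)
    then show ?case using z inv_cosh2_pos[of z "w k"] inv_cosh2_le_1[of z "w k"] by simp
  qed
  ultimately have "(\<lambda>k. (1 - (1 - inv_cosh2 z (w k))) powr \<sigma> k) \<longlonglongrightarrow> exp (- gauss_form z u)"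
    by (intro one_minus_powr_tendsto \<sigma>)
  then show ?thesis by (simp add: kern_def w_def e_def)
qed

lemma kern_op_approx_pointwise:
  fixes \<theta> :: "complex ^ 'n \<Rightarrow> complex"
  assumes \<theta>: "\<theta> \<in> Cc" and z: "z \<in> unit_ball" and \<sigma>: "filterlim \<sigma> at_top sequentially" and pos: "\<And>k. 0 < \<sigma> k"
  shows "(\<lambda>k. of_real (\<sigma> k ^ CARD('n)) * kern_op (\<sigma> k) \<theta> z) \<longlonglongrightarrow> of_real (kern_limit z) * \<theta> z"
proof -
  obtain r where r: "0 \<le> r" "r < 1" "\<And>z. r < norm z \<Longrightarrow> \<theta> z = 0" using CcE[OF \<theta>] by blast
  have cC: "weight_cut \<theta> \<in> Cc" using \<theta> by (rule weight_cut_Cc)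
  obtain C where C: "0 \<le> C" "\<And>z. cmod (weight_cut \<theta> z) \<le> C" using Cc_bounded[OF cC] by blast
  \<comment> \<open>The rate in \<open>kern_gauss\<close>, which applies wherever
    \<open>weight_cut \<theta>\<close> does not vanish.\<close>
  define c where "c = (1 - r\<^sup>2) / 4"
  have c: "0 < c" using r by (simp add: c_def power_less_one_iff abs_square_less_1)
  define w where "w k u = z + (1 / sqrt (\<sigma> k)) *\<^sub>R u" for k u
  have "(\<lambda>k. LINT u|lborel. of_real (kern (\<sigma> k) z (w k u)) * weight_cut \<theta> (w k u)) \<longlonglongrightarrow>
      (LINT u|lborel. of_real (exp (- gauss_form z u)) * weight_cut \<theta> z)"
  proof (rule integral_dominated_convergence[where w = "\<lambda>u. C * exp (- (c * (norm u)\<^sup>2))"])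
    show "integrable lborel (\<lambda>u :: complex ^ 'n. C * exp (- (c * (norm u)\<^sup>2)))"
      using gauss_integrable[OF c] by (rule integrable_mult_right)
    show "AE u in lborel. (\<lambda>k. of_real (kern (\<sigma> k) z (w k u)) * weight_cut \<theta> (w k u)) \<longlonglongrightarrow> of_real (exp (- gauss_form z u)) * weight_cut \<theta> z"
    proof (rule AE_I2)
      fix u
      have "(\<lambda>k. 1 / sqrt (\<sigma> k)) \<longlonglongrightarrow> 0"
        using tendsto_inverse_0_at_top[OF filterlim_compose[OF sqrt_at_top \<sigma>]] by (simp add: inverse_eq_divide)
      then have "(\<lambda>k. w k u) \<longlonglongrightarrow> z + 0 *\<^sub>R u" unfolding w_def by (intro tendsto_intros)
      then have "(\<lambda>k. weight_cut \<theta> (w k u)) \<longlonglongrightarrow> weight_cut \<theta> z"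
        using continuous_on_tendsto_compose[OF Cc_continuous[OF cC], of "\<lambda>k. w k u" z] by simp
      then show "(\<lambda>k. of_real (kern (\<sigma> k) z (w k u)) * weight_cut \<theta> (w k u)) \<longlonglongrightarrow> of_real (exp (- gauss_form z u)) * weight_cut \<theta> z"
        using kern_tendsto[OF z \<sigma>, of u] unfolding w_def by (intro tendsto_intros)
    qed
    show "AE u in lborel. cmod (of_real (kern (\<sigma> k) z (w k u)) * weight_cut \<theta> (w k u)) \<le> C * exp (- (c * (norm u)\<^sup>2))" for k
    proof (rule AE_I2)
      fix u
      show "cmod (of_real (kern (\<sigma> k) z (w k u)) * weight_cut \<theta> (w k u)) \<le> C * exp (- (c * (norm u)\<^sup>2))"
      proof (cases "norm (w k u) \<le> r")
        case True
        have "\<sigma> k * (norm (z - w k u))\<^sup>2 = (norm u)\<^sup>2"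
          using pos[of k] by (simp add: w_def power_divide)
        then have "kern (\<sigma> k) z (w k u) \<le> exp (- (c * (norm u)\<^sup>2))"
          using kern_gauss[OF z True r(2), of "\<sigma> k"] pos[of k] by (simp add: c_def)
        then have "kern (\<sigma> k) z (w k u) * cmod (weight_cut \<theta> (w k u)) \<le> exp (- (c * (norm u)\<^sup>2)) * C"
          using C by (intro mult_mono) auto
        then show ?thesis by (simp add: norm_mult kern_nonneg mult.commute)
      next
        case False
        then show ?thesis using C r(3)[of "w k u"] by (simp add: weight_cut_support)
      qed
    qed
    show "(\<lambda>u. of_real (kern (\<sigma> k) z (w k u)) * weight_cut \<theta> (w k u)) \<in> borel_measurable lborel" for k
    proof -
      have w: "w k \<in> borel_measurable borel" unfolding w_def by measurable
      have "(\<lambda>u. kern (\<sigma> k) z (w k u)) \<in> borel_measurable borel"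
        by (intro kern_measurable w borel_measurable_const)
      then have "(\<lambda>u. complex_of_real (kern (\<sigma> k) z (w k u)) * weight_cut \<theta> (w k u)) \<in> borel_measurable borel"
        by (intro borel_measurable_times measurable_compose[OF w Cc_measurable[OF cC]]) simp
      then show ?thesis by simp
    qed
    have "(\<lambda>u. exp (- gauss_form z u)) \<in> borel_measurable borel" by measurable
    then show "(\<lambda>u. of_real (exp (- gauss_form z u)) * weight_cut \<theta> z) \<in> borel_measurable lborel"
      by (intro borel_measurable_times borel_measurable_const) simp
  qed
  moreover have "(LINT u|lborel. of_real (exp (- gauss_form z u)) * weight_cut \<theta> z) = of_real (kern_limit z) * \<theta> z"
    using z by (simp add: kern_limit_def weight_cut_def scaleR_conv_of_real)
  ultimately show ?thesis unfolding kern_op_scaled[OF \<theta> pos] w_def by simp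
qed

text \<open>The kernel of exponent \<sigma> is split into exponents s and \<sigma> - s. The first
  factor gives boundary decay independent of \<sigma>; for the second, 2 s \<le> \<sigma> leaves
  \<sigma> - s \<ge> \<sigma> / 2, so half of the Gaussian rate survives the rescaling.\<close>

lemma kern_op_approx_bound:
  fixes \<theta> :: "complex ^ 'n \<Rightarrow> complex"
  assumes \<theta>: "\<theta> \<in> Cc" and s: "0 < s"
  obtains D where "0 \<le> D" "\<And>z \<sigma>. z \<in> unit_ball \<Longrightarrow> 2 * s \<le> \<sigma> \<Longrightarrow>
    cmod (of_real (\<sigma> ^ CARD('n)) * kern_op \<sigma> \<theta> z) \<le> D * (1 - (norm z)\<^sup>2) powr s"
proof -
  obtain r where r: "0 \<le> r" "r < 1" "\<And>z. r < norm z \<Longrightarrow> \<theta> z = 0" using CcE[OF \<theta>] by blast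
  have cC: "weight_cut \<theta> \<in> Cc" using \<theta> by (rule weight_cut_Cc)
  obtain C where C: "0 \<le> C" "\<And>z. cmod (weight_cut \<theta> z) \<le> C" using Cc_bounded[OF cC] by blast
  define c where "c = (1 - r\<^sup>2) / 4"
  have c: "0 < c" using r by (simp add: c_def power_less_one_iff abs_square_less_1)
  define A where "A = (1 / (1 - r)\<^sup>2) powr s"
  define G where "G = (LINT u :: complex ^ 'n|lborel. exp (- (c / 2 * (norm u)\<^sup>2)))"
  have int: "integrable lborel (\<lambda>u :: complex ^ 'n. exp (- (c / 2 * (norm u)\<^sup>2)))"
    using gauss_integrable[of "c / 2"] c by simp
  have "cmod (of_real (\<sigma> ^ CARD('n)) * kern_op \<sigma> \<theta> z) \<le> C * A * G * (1 - (norm z)\<^sup>2) powr s"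
    if z: "z \<in> unit_ball" and \<sigma>: "2 * s \<le> \<sigma>" for z \<sigma>
  proof -
    have pos: "0 < \<sigma>" using s \<sigma> by simp
    define w where "w u = z + (1 / sqrt \<sigma>) *\<^sub>R u" for u
    define P where "P = C * (A * (1 - (norm z)\<^sup>2) powr s)"
    have P: "0 \<le> P" using C by (simp add: P_def A_def)
    have "cmod (of_real (\<sigma> ^ CARD('n)) * kern_op \<sigma> \<theta> z) \<le>
        (LINT u|lborel. cmod (of_real (kern \<sigma> z (w u)) * weight_cut \<theta> (w u)))"
      unfolding kern_op_scaled[OF \<theta> pos] w_def by (rule integral_norm_bound)
    also have "\<dots> \<le> (LINT u :: complex ^ 'n|lborel. P * exp (- (c / 2 * (norm u)\<^sup>2)))"
    proof (rule integral_mono')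
      show "integrable lborel (\<lambda>u :: complex ^ 'n. P * exp (- (c / 2 * (norm u)\<^sup>2)))"
        using int by (rule integrable_mult_right)
      fix u :: "complex ^ 'n"
      show "0 \<le> P * exp (- (c / 2 * (norm u)\<^sup>2))" using P by simp
      show "cmod (of_real (kern \<sigma> z (w u)) * weight_cut \<theta> (w u)) \<le> P * exp (- (c / 2 * (norm u)\<^sup>2))"
      proof (cases "norm (w u) \<le> r")
        case True
        have "\<sigma> * (norm (z - w u))\<^sup>2 = (norm u)\<^sup>2" using pos by (simp add: w_def power_divide)
        moreover have "\<sigma> / 2 * (norm (z - w u))\<^sup>2 \<le> (\<sigma> - s) * (norm (z - w u))\<^sup>2"
          using \<sigma> by (intro mult_right_mono) auto
        ultimately have "c / 2 * (norm u)\<^sup>2 \<le> c * ((\<sigma> - s) * (norm (z - w u))\<^sup>2)"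
          using c by simp
        then have "kern (\<sigma> - s) z (w u) \<le> exp (- (c / 2 * (norm u)\<^sup>2))"
          using kern_gauss[OF z True r(2), of "\<sigma> - s"] \<sigma> s by (auto simp: c_def intro: order_trans)
        moreover have "kern s z (w u) \<le> A * (1 - (norm z)\<^sup>2) powr s"
          using kern_le_weight[OF z True r(2), of s] s by (simp add: A_def)
        moreover have "kern \<sigma> z (w u) = kern s z (w u) * kern (\<sigma> - s) z (w u)"
          by (simp add: kern_def powr_add[symmetric])
        ultimately have "kern \<sigma> z (w u) \<le> A * (1 - (norm z)\<^sup>2) powr s * exp (- (c / 2 * (norm u)\<^sup>2))"
          using kern_nonneg by (auto intro!: mult_mono simp: A_def)
        then have "kern \<sigma> z (w u) * cmod (weight_cut \<theta> (w u)) \<le> A * (1 - (norm z)\<^sup>2) powr s * exp (- (c / 2 * (norm u)\<^sup>2)) * C"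
          using C by (intro mult_mono) (auto simp: A_def)
        then show ?thesis by (simp add: norm_mult kern_nonneg P_def mult_ac)
      next
        case False
        then show ?thesis using P r(3)[of "w u"] by (simp add: weight_cut_support)
      qed
    qed
    also have "\<dots> = C * A * G * (1 - (norm z)\<^sup>2) powr s"
      by (simp add: P_def G_def)
    finally show ?thesis .
  qed
  moreover have "0 \<le> C * A * G" using C by (simp add: A_def G_def)
  ultimately show ?thesis using that by blast
qed

lemma kern_limit_Cc: "\<theta> \<in> Cc \<Longrightarrow> (\<lambda>z. of_real (kern_limit z) * \<theta> z) \<in> Cc"
  by (intro Cc_mult continuous_on_of_real continuous_on_kern_limit)

lemma kern_op_approx_L2:
  fixes \<theta> :: "complex ^ 'n \<Rightarrow> complex"
  assumes \<theta>: "\<theta> \<in> Cc" and \<sigma>: "filterlim \<sigma> at_top sequentially" and pos: "\<And>k. 0 < \<sigma> k"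
  shows "(\<lambda>k. L2_dist BM (\<lambda>z. of_real (\<sigma> k ^ CARD('n)) * kern_op (\<sigma> k) \<theta> z) (\<lambda>z. of_real (kern_limit z) * \<theta> z)) \<longlonglongrightarrow> 0"
proof -
  \<comment> \<open>Any s > n/2 makes (1 - |z|^2)^(2 s) integrable; s = n is a convenient
    choice.\<close>
  define s where "s = real CARD('n)"
  have s: "0 < s" "s < 2 * s" by (simp_all add: s_def)
  obtain D where D: "0 \<le> D" "\<And>z \<sigma>. z \<in> unit_ball \<Longrightarrow> 2 * s \<le> \<sigma> \<Longrightarrow>
      cmod (of_real (\<sigma> ^ CARD('n)) * kern_op \<sigma> \<theta> z) \<le> D * (1 - (norm z)\<^sup>2) powr s"
    using kern_op_approx_bound[OF \<theta> s(1)] by blast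
  define f where "f k z = of_real (\<sigma> k ^ CARD('n)) * kern_op (\<sigma> k) \<theta> z" for k z
  define g where "g z = of_real (kern_limit z) * \<theta> z" for z
  have lim: "(\<lambda>k. f k z) \<longlonglongrightarrow> g z" if "z \<in> unit_ball" for z
    unfolding f_def g_def by (rule kern_op_approx_pointwise[OF \<theta> that \<sigma> pos])
  obtain k0 where k0: "\<And>k. k \<ge> k0 \<Longrightarrow> 2 * s \<le> \<sigma> k"
    using filterlim_at_top[THEN iffD1, OF \<sigma>, rule_format, of "2 * s"] by (auto simp: eventually_sequentially)
  have fb: "cmod (f k z) \<le> D * (1 - (norm z)\<^sup>2) powr s" if "k \<ge> k0" "z \<in> unit_ball" for k z
    using D(2)[OF that(2) k0[OF that(1)]] by (simp add: f_def)
  have gb: "cmod (g z) \<le> D * (1 - (norm z)\<^sup>2) powr s" if "z \<in> unit_ball" for z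
    by (rule LIMSEQ_le_const2[OF tendsto_norm[OF lim[OF that]]]) (use fb that in blast)
  have [measurable]: "f k \<in> borel_measurable BM" for k
    unfolding f_def using kern_op_measurable[OF bergman_borel[OF Cc_measurable[OF \<theta>]]] by measurable
  have [measurable]: "g \<in> borel_measurable BM"
    unfolding g_def[abs_def] using bergman_borel[OF Cc_measurable[OF kern_limit_Cc[OF \<theta>]]] .
  have "(\<lambda>k. LINT z|BM. (cmod (f (k + k0) z - g z))\<^sup>2) \<longlonglongrightarrow> (LINT z|(BM :: (complex ^ 'n) measure). 0)"
  proof (rule integral_dominated_convergence[where w = "\<lambda>z. (2 * D)\<^sup>2 * (1 - (norm z)\<^sup>2) powr (2 * s)"])
    show "integrable BM (\<lambda>z :: complex ^ 'n. (2 * D)\<^sup>2 * (1 - (norm z)\<^sup>2) powr (2 * s))"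
      using s by (intro integrable_mult_right weight_integrable) (simp add: s_def)
    show "AE z in BM. (\<lambda>k. (cmod (f (k + k0) z - g z))\<^sup>2) \<longlonglongrightarrow> 0"
    proof (rule AE_I2)
      fix z :: "complex ^ 'n" assume "z \<in> space BM"
      then have "(\<lambda>k. f (k + k0) z) \<longlonglongrightarrow> g z" using LIMSEQ_ignore_initial_segment[OF lim[of z]] by simp
      then have "(\<lambda>k. (cmod (f (k + k0) z - g z))\<^sup>2) \<longlonglongrightarrow> (cmod (g z - g z))\<^sup>2" by (intro tendsto_intros)
      then show "(\<lambda>k. (cmod (f (k + k0) z - g z))\<^sup>2) \<longlonglongrightarrow> 0" by simp
    qed
    show "AE z in BM. norm ((cmod (f (k + k0) z - g z))\<^sup>2) \<le> (2 * D)\<^sup>2 * (1 - (norm z)\<^sup>2) powr (2 * s)" for k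
    proof (rule AE_I2)
      fix z :: "complex ^ 'n" assume "z \<in> space BM"
      then have z: "z \<in> unit_ball" by simp
      have "cmod (f (k + k0) z - g z) \<le> 2 * D * (1 - (norm z)\<^sup>2) powr s"
        using norm_triangle_ineq4[of "f (k + k0) z" "g z"] fb[of "k + k0", OF _ z] gb[OF z] by simp
      then have "(cmod (f (k + k0) z - g z))\<^sup>2 \<le> (2 * D * (1 - (norm z)\<^sup>2) powr s)\<^sup>2"
        by (intro power_mono) auto
      also have "\<dots> = (2 * D)\<^sup>2 * (1 - (norm z)\<^sup>2) powr (2 * s)"
      proof -
        have "(a powr s)\<^sup>2 = a powr (2 * s)" for a :: real
          by (simp add: power2_eq_square powr_add[symmetric])
        then show ?thesis by (simp only: power_mult_distrib)
      qed
      finally show "norm ((cmod (f (k + k0) z - g z))\<^sup>2) \<le> (2 * D)\<^sup>2 * (1 - (norm z)\<^sup>2) powr (2 * s)" by simp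
    qed
  qed measurable
  then have "(\<lambda>k. sqrt (LINT z|BM. (cmod (f (k + k0) z - g z))\<^sup>2)) \<longlonglongrightarrow> sqrt 0"
    by (intro tendsto_real_sqrt) simp
  then have "(\<lambda>k. L2_dist BM (f (k + k0)) g) \<longlonglongrightarrow> 0" by (simp add: L2_dist_def)
  then have "(\<lambda>k. L2_dist BM (f k) g) \<longlonglongrightarrow> 0" by (rule LIMSEQ_offset)
  then show ?thesis by (simp only: f_def[abs_def] g_def[abs_def])
qed

section \<open>Testing against compactly supported functions\<close>

lemma Cc_indicator_approx:
  fixes K :: "(complex ^ 'n) set"
  assumes K: "compact K" "K \<noteq> {}" "K \<subseteq> cball 0 r" and r: "r < 1"
  obtains \<theta> where "\<And>j::nat. \<theta> j \<in> Cc" "\<And>z. (\<lambda>j. \<theta> j z) \<longlonglongrightarrow> (indicator K z :: complex)"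
    "\<And>j z. cmod (\<theta> j z) \<le> cmod (\<theta> 0 z)"
proof -
  \<comment> \<open>Half the gap to the unit sphere: the bumps around K vanish at distance e, hence
    beyond radius r + e < 1. They decrease in j, so the first one dominates.\<close>
  define e where "e = (1 - r) / 2"
  have e: "0 < e" "r + e < 1" using r by (auto simp: e_def field_simps)
  define \<theta> where "\<theta> j z = complex_of_real (max 0 (1 - real (Suc j) / e * infdist z K))" for j z
  have le: "infdist z K / e \<le> real (Suc j) / e * infdist z K" for j and z :: "complex ^ 'n"
    using mult_right_mono[of 1 "real (Suc j)" "infdist z K / e"] e infdist_nonneg[of z K] by simp
  have "\<theta> j \<in> Cc" for j
  proof (rule CcI_ball[OF _ e(2)])
    show "continuous_on unit_ball (\<theta> j)" unfolding \<theta>_def[abs_def] by (intro continuous_intros)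
    fix z :: "complex ^ 'n" assume z: "r + e < norm z"
    have "e \<le> infdist z K"
      unfolding infdist_notempty[OF K(2)]
    proof (rule cINF_greatest[OF K(2)])
      fix y assume "y \<in> K"
      then have "norm y \<le> r" using K(3) by auto
      then show "e \<le> dist z y" using z norm_triangle_ineq2[of z y] by (simp add: dist_norm)
    qed
    then have "1 \<le> infdist z K / e" using e by simp
    then show "\<theta> j z = 0" using le[of z j] by (simp add: \<theta>_def)
  qed
  moreover have "(\<lambda>j. \<theta> j z) \<longlonglongrightarrow> indicator K z" for z
  proof (cases "z \<in> K")
    case True
    then show ?thesis by (simp add: \<theta>_def)
  next
    case False
    then have d: "0 < infdist z K"
      using K(1,2) in_closed_iff_infdist_zero[of K z] infdist_nonneg[of z K] compact_imp_closed by fastforce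
    obtain j0 :: nat where j0: "e / infdist z K \<le> real j0" using real_arch_simple by blast
    have "\<theta> j z = 0" if "j \<ge> j0" for j
    proof -
      have "e / infdist z K \<le> real (Suc j)" using j0 that by simp
      then have "1 \<le> real (Suc j) / e * infdist z K" using d e by (simp add: field_simps)
      then show ?thesis by (simp add: \<theta>_def)
    qed
    then show ?thesis using False by (intro tendsto_eventually eventually_sequentiallyI[of j0]) simp
  qed
  moreover have "cmod (\<theta> j z) \<le> cmod (\<theta> 0 z)" for j z
    using le[of z j] by (auto simp: \<theta>_def)
  ultimately show ?thesis using that by blast
qed

text \<open>The fundamental lemma of the calculus of variations, stated for f integrable against
  \<open>Cc\<close> because it is later applied to kernel operators of general square-integrable
  functions. Dominated convergence passes from \<open>Cc\<close> to compact sets, a Dynkin argument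
  to Borel subsets of a closed ball, and countably many closed balls exhaust the unit ball.\<close>

lemma Cc_test_zero:
  fixes f :: "complex ^ 'n \<Rightarrow> complex"
  assumes fm: "f \<in> borel_measurable BM"
    and int: "\<And>\<theta>. \<theta> \<in> Cc \<Longrightarrow> integrable BM (\<lambda>z. f z * \<theta> z)"
    and zero: "\<And>\<theta>. \<theta> \<in> Cc \<Longrightarrow> (LINT z|BM. f z * \<theta> z) = 0"
  shows "AE z in BM. f z = 0"
proof -
  have ind: "(\<lambda>z. indicator A z :: complex) \<in> borel_measurable (BM :: (complex ^ 'n) measure)" if "A \<in> sets borel" for A
    using that by (intro bergman_borel) simp
  have K: "integrable BM (\<lambda>z. f z * indicator K z) \<and> (LINT z|BM. f z * indicator K z) = 0"
    if K: "compact K" "K \<subseteq> cball 0 r" and r: "r < 1" for K r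
  proof (cases "K = {}")
    case False
    obtain \<theta> where \<theta>: "\<And>j::nat. \<theta> j \<in> Cc" "\<And>z. (\<lambda>j. \<theta> j z) \<longlonglongrightarrow> (indicator K z :: complex)"
      "\<And>j z. cmod (\<theta> j z) \<le> cmod (\<theta> 0 z)"
      using Cc_indicator_approx[OF K(1) False K(2) r] by blast
    have w: "integrable BM (\<lambda>z. cmod (f z * \<theta> 0 z))" using int[OF \<theta>(1)] by (rule integrable_norm)
    have m: "(\<lambda>z. f z * indicator K z) \<in> borel_measurable BM"
      by (intro borel_measurable_times fm ind borel_compact K(1))
    have b: "AE z in BM. norm (f z * \<theta> j z) \<le> cmod (f z * \<theta> 0 z)" for j
      using \<theta>(3) by (intro AE_I2) (simp add: norm_mult mult_left_mono)
    have l: "AE z in BM. (\<lambda>j. f z * \<theta> j z) \<longlonglongrightarrow> f z * indicator K z"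
      by (intro AE_I2 tendsto_intros \<theta>(2))
    have "(\<lambda>j. LINT z|BM. f z * \<theta> j z) \<longlonglongrightarrow> (LINT z|BM. f z * indicator K z)"
      by (rule integral_dominated_convergence[OF m _ w l b]) (use int[OF \<theta>(1)] in auto)
    moreover have "integrable BM (\<lambda>z. f z * indicator K z)"
      by (rule integrable_dominated_convergence[OF m _ w l b]) (use int[OF \<theta>(1)] in auto)
    ultimately show ?thesis using zero[OF \<theta>(1)] by (simp add: LIMSEQ_const_iff)
  qed simp
  have *: "AE z in BM. z \<in> cball 0 r \<longrightarrow> f z = 0" if r: "r < 1" for r
  proof -
    let ?C = "cball (0 :: complex ^ 'n) r"
    have ib: "integrable BM (\<lambda>z. f z * indicator ?C z)" using K[OF compact_cball _ r] by auto
    have iA: "integrable BM (\<lambda>z. f z * indicator (A \<inter> ?C) z)" if "A \<in> sets borel" for A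
    proof (rule Bochner_Integration.integrable_bound[OF ib])
      show "(\<lambda>z. f z * indicator (A \<inter> ?C) z) \<in> borel_measurable BM"
        using that by (intro borel_measurable_times fm ind) auto
    qed (auto simp: indicator_def)
    have "(LINT z|BM. f z * indicator (A \<inter> ?C) z) = 0" if A: "A \<in> sets borel" for A
    proof -
      have "Int_stable (Collect closed :: (complex ^ 'n) set set)" by (auto simp: Int_stable_def)
      moreover have "(Collect closed :: (complex ^ 'n) set set) \<subseteq> Pow UNIV" by simp
      moreover have "A \<in> sigma_sets UNIV (Collect closed)"
        using A by (simp add: borel_eq_closed)
      ultimately show ?thesis
      proof (induction rule: sigma_sets_induct_disjoint)
        case (basic A)
        then have "compact (A \<inter> ?C)" by (simp add: closed_Int_compact)
        then show ?case using K[OF _ _ r, of "A \<inter> ?C"] by auto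
      next
        case (compl A)
        have Ab: "A \<in> sets borel" using compl(1) by (simp add: borel_eq_closed)
        have "(\<lambda>z. f z * indicator ((UNIV - A) \<inter> ?C) z) = (\<lambda>z. f z * indicator ?C z - f z * indicator (A \<inter> ?C) z)"
          by (auto simp: indicator_def)
        then show ?case using K[OF compact_cball order_refl r] compl(2) ib iA[OF Ab] by simp
      next
        case (union A)
        have Ab: "A i \<in> sets borel" for i using union(2) by (auto simp: borel_eq_closed)
        have "(\<lambda>N. LINT z|BM. (\<Sum>i<N. f z * indicator (A i \<inter> ?C) z)) \<longlonglongrightarrow>
            (LINT z|BM. f z * indicator ((\<Union>i. A i) \<inter> ?C) z)"
        proof (rule integral_dominated_convergence[where w = "\<lambda>z. cmod (f z * indicator ?C z)"])
          have s: "(\<Sum>i<N. indicator (A i \<inter> ?C) z) = (indicator ((\<Union>i<N. A i) \<inter> ?C) z :: complex)" for N z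
          proof -
            have e: "(\<Union>i<N. A i) \<inter> ?C = (\<Union>i<N. A i \<inter> ?C)" by auto
            have "disjoint_family_on (\<lambda>i. A i \<inter> ?C) {..<N}"
              using union(1) by (auto simp: disjoint_family_on_def)
            then show ?thesis unfolding e by (rule indicator_UN_disjoint[OF finite_lessThan, symmetric])
          qed
          show "AE z in BM. (\<lambda>N. \<Sum>i<N. f z * indicator (A i \<inter> ?C) z) \<longlonglongrightarrow> f z * indicator ((\<Union>i. A i) \<inter> ?C) z"
          proof (rule AE_I2)
            fix z
            have "(\<lambda>N. indicator ((\<Union>i<N. A i) \<inter> ?C) z :: complex) \<longlonglongrightarrow> indicator ((\<Union>i. A i) \<inter> ?C) z"
            proof (cases "z \<in> (\<Union>i. A i) \<inter> ?C")
              case True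
              then obtain i where "z \<in> A i" "z \<in> ?C" by blast
              then have "indicator ((\<Union>i<N. A i) \<inter> ?C) z = (1 :: complex)" if "N \<ge> Suc i" for N
                using that by (auto simp: indicator_def)
              then show ?thesis using True by (intro tendsto_eventually eventually_sequentiallyI[of "Suc i"]) auto
            next
              case False
              then have "indicator ((\<Union>i<N. A i) \<inter> ?C) z = (0 :: complex)" for N by (auto simp: indicator_def)
              then show ?thesis using False by (auto simp: indicator_def)
            qed
            then show "(\<lambda>N. \<Sum>i<N. f z * indicator (A i \<inter> ?C) z) \<longlonglongrightarrow> f z * indicator ((\<Union>i. A i) \<inter> ?C) z"
              unfolding sum_distrib_left[symmetric] s by (intro tendsto_intros)
          qed
          show "AE z in BM. norm (\<Sum>i<N. f z * indicator (A i \<inter> ?C) z) \<le> cmod (f z * indicator ?C z)" for N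
            unfolding sum_distrib_left[symmetric] s by (intro AE_I2) (auto simp: norm_mult indicator_def)
          show "(\<lambda>z. f z * indicator ((\<Union>i. A i) \<inter> ?C) z) \<in> borel_measurable BM"
            using iA[of "\<Union>i. A i"] Ab by auto
          show "(\<lambda>z. \<Sum>i<N. f z * indicator (A i \<inter> ?C) z) \<in> borel_measurable BM" for N
            using iA Ab by (intro borel_measurable_sum) auto
          show "integrable BM (\<lambda>z. cmod (f z * indicator ?C z))" using ib by (rule integrable_norm)
        qed
        moreover have "(LINT z|BM. (\<Sum>i<N. f z * indicator (A i \<inter> ?C) z)) = 0" for N
          using union(3) iA[OF Ab] by (subst Bochner_Integration.integral_sum) auto
        ultimately show ?case by (simp add: LIMSEQ_const_iff)
      qed (auto simp: borel_eq_closed)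
    qed
    note zeroA = this
    have set0: "(LINT z|BM. indicator A z *\<^sub>R (f z * indicator ?C z)) = 0" if "A \<in> sets (BM :: (complex ^ 'n) measure)" for A
    proof -
      have "A \<in> sets borel" using that unfolding sets_bergman by (auto simp: sets_restrict_space)
      moreover have "(\<lambda>z. indicator A z *\<^sub>R (f z * indicator ?C z)) = (\<lambda>z. f z * indicator (A \<inter> ?C) z)"
        by (auto simp: indicator_def)
      ultimately show ?thesis using zeroA by simp
    qed
    have isc: "integrable BM (\<lambda>z. indicator A z *\<^sub>R (f z * indicator ?C z))" if "A \<in> sets (BM :: (complex ^ 'n) measure)" for A
      using that ib by (rule integrable_mult_indicator)
    have "AE z in BM. Re (f z * indicator ?C z) = 0"
    proof (rule density_unique_real)
      show "integrable BM (\<lambda>z. Re (f z * indicator ?C z))" using ib by (rule integrable_Re)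
      fix A :: "(complex ^ 'n) set" assume "A \<in> sets BM"
      then show "(\<integral>z\<in>A. Re (f z * indicator ?C z) \<partial>BM) = (\<integral>z\<in>A. 0 \<partial>BM)"
        using arg_cong[OF set0, of A Re] integral_Re[OF isc, of A] by (simp add: set_lebesgue_integral_def)
    qed simp
    moreover have "AE z in BM. Im (f z * indicator ?C z) = 0"
    proof (rule density_unique_real)
      show "integrable BM (\<lambda>z. Im (f z * indicator ?C z))" using ib by (rule integrable_Im)
      fix A :: "(complex ^ 'n) set" assume "A \<in> sets BM"
      then show "(\<integral>z\<in>A. Im (f z * indicator ?C z) \<partial>BM) = (\<integral>z\<in>A. 0 \<partial>BM)"
        using arg_cong[OF set0, of A Im] integral_Im[OF isc, of A] by (simp add: set_lebesgue_integral_def)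
    qed simp
    ultimately show ?thesis
      by eventually_elim (auto simp: complex_eq_iff indicator_def split: if_splits)
  qed
  have "AE z in BM. \<forall>k::nat. z \<in> cball 0 (1 - 1 / real (Suc k)) \<longrightarrow> f z = 0"
    unfolding AE_all_countable using * by simp
  moreover have "\<exists>k::nat. z \<in> cball 0 (1 - 1 / real (Suc k))" if "z \<in> unit_ball" for z :: "complex ^ 'n"
  proof -
    have "0 < 1 - norm z" using that by simp
    then obtain k where "inverse (real (Suc k)) < 1 - norm z" using reals_Archimedean by blast
    then show ?thesis by (intro exI[of _ k]) (simp add: inverse_eq_divide)
  qed
  ultimately show ?thesis unfolding AE_bergman_iff by (auto elim!: eventually_mono)
qed

text \<open>Positivity allows division by \<open>kern_limit\<close> within \<open>Cc\<close>, so
  that every element of \<open>Cc\<close> is the product of \<open>kern_limit\<close> with another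
  one.\<close>

lemma kern_limit_pos:
  fixes z :: "complex ^ 'n"
  assumes "z \<in> unit_ball"
  shows "0 < kern_limit z"
proof -
  have "(LINT u|lborel. exp (- gauss_form z u)) \<noteq> 0"
  proof
    assume "(LINT u|lborel. exp (- gauss_form z u)) = 0"
    then have "AE u :: complex ^ 'n in lborel. False"
      using integral_nonneg_eq_0_iff_AE[OF exp_gauss_form_integrable[OF assms]] by simp
    then have "(UNIV :: (complex ^ 'n) set) \<in> null_sets lborel"
      by (subst AE_iff_null_sets) auto
    then show False by (simp add: null_sets_def)
  qed
  moreover have "0 \<le> (LINT u|lborel. exp (- gauss_form z u))" by simp
  ultimately have "0 < (LINT u|lborel. exp (- gauss_form z u))" by linarith
  moreover have "0 < bergman_weight z" using bergman_weight_pos[of z] assms by simp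
  ultimately show ?thesis unfolding kern_limit_def by (rule mult_pos_pos[rotated])
qed

section \<open>The Gamma function limit\<close>

text \<open>\<open>ratio_prod n s N t\<close> is the factor by which \<open>kern_op (s + N)\<close> differs from \<open>kern_op s\<close> on the eigenspace of \<open>t\<close>. The
  Gauss limit of \<open>N\<^sup>n ratio_prod n s N\<close> is \<open>inv_symbol_complex n s\<close>, which is real.\<close>

definition ratio_prod :: "real \<Rightarrow> real \<Rightarrow> nat \<Rightarrow> real \<Rightarrow> real" where
  "ratio_prod n s N t = (\<Prod>j<N. (4 * (s + real j) * (s + real j - n) - t) / (4 * (s + real j)\<^sup>2))"

text \<open>The square root is complex because the symbol has to be defined for t > -n^2 as well,
  until the spectrum is located.\<close>

definition spec_param :: "real \<Rightarrow> real \<Rightarrow> complex" where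
  "spec_param n t = csqrt (of_real (- t - n\<^sup>2))"

definition inv_symbol_complex :: "real \<Rightarrow> real \<Rightarrow> real \<Rightarrow> complex" where
  "inv_symbol_complex n s t = of_real ((Gamma s)\<^sup>2) * rGamma (of_real (s - n / 2) + \<i> / 2 * spec_param n t) * rGamma (of_real (s - n / 2) - \<i> / 2 * spec_param n t)"

definition inv_symbol :: "real \<Rightarrow> real \<Rightarrow> real \<Rightarrow> real" where
  "inv_symbol n s t = Re (inv_symbol_complex n s t)"

lemma spec_param_sq: "(spec_param n t)\<^sup>2 = of_real (- t - n\<^sup>2)"
  by (simp add: spec_param_def)

text \<open>Completing the square: 4 (s + j) (s + j - n) - t is 4 times (s - n/2 + j)^2 + x^2 with x
  half of \<open>spec_param n t\<close>, and this sum of squares splits into two linear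
  factors.\<close>

lemma ratio_prod_pochhammer:
  assumes "0 < s"
  shows "complex_of_real (ratio_prod n s N t) =
    pochhammer (of_real (s - n / 2) + \<i> / 2 * spec_param n t) N * pochhammer (of_real (s - n / 2) - \<i> / 2 * spec_param n t) N /
    (pochhammer (of_real s) N)\<^sup>2"
proof -
  let ?a = "complex_of_real (s - n / 2)" and ?b = "\<i> / 2 * spec_param n t"
  have f: "(?a + ?b + of_nat j) * (?a - ?b + of_nat j) / (of_real s + of_nat j)\<^sup>2 =
      of_real ((4 * (s + real j) * (s + real j - n) - t) / (4 * (s + real j)\<^sup>2))" for j
  proof -
    have "(?a + ?b + of_nat j) * (?a - ?b + of_nat j) = (?a + of_nat j)\<^sup>2 - ?b\<^sup>2"
    proof -
      have "(a + b + c) * (a - b + c) = (a + c)\<^sup>2 - b\<^sup>2" for a b c :: complex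
        by (simp add: power2_eq_square algebra_simps)
      then show ?thesis .
    qed
    also have "?b\<^sup>2 = - (of_real (- t - n\<^sup>2) / 4)"
      unfolding power_mult_distrib spec_param_sq by (simp add: power_divide)
    also have "(?a + of_nat j)\<^sup>2 - - (of_real (- t - n\<^sup>2) / 4) = of_real ((s - n / 2 + real j)\<^sup>2 + (- t - n\<^sup>2) / 4)"
      by simp
    also have "(s - n / 2 + real j)\<^sup>2 + (- t - n\<^sup>2) / 4 = (4 * (s + real j) * (s + real j - n) - t) / 4"
      by (simp add: power2_eq_square field_simps)
    finally have E: "(?a + ?b + of_nat j) * (?a - ?b + of_nat j) = of_real ((4 * (s + real j) * (s + real j - n) - t) / 4)" .
    have e: "complex_of_real s + of_nat j = of_real (s + real j)" by simp
    show ?thesis unfolding E e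
      by (simp only: of_real_power[symmetric] of_real_divide[symmetric] divide_divide_eq_left)
  qed
  have "complex_of_real (ratio_prod n s N t) = (\<Prod>j<N. (?a + ?b + of_nat j) * (?a - ?b + of_nat j) / (of_real s + of_nat j)\<^sup>2)"
    unfolding ratio_prod_def of_real_prod f ..
  then show ?thesis
    by (simp only: pochhammer_prod prod_dividef prod.distrib prod_power_distrib atLeast0LessThan)
qed

text \<open>Gauss's limit for the reciprocal Gamma function at the three parameters p, q and s.
  Since p + q = 2 s - n, the powers of M in the three series combine to exactly M^n, and the
  factorials cancel. There are M + 1 factors, as in \<open>rGamma_series\<close>.\<close>

lemma inv_symbol_complex_tendsto:
  assumes s: "0 < s"
  shows "(\<lambda>M. complex_of_real (real M ^ n * ratio_prod (real n) s (Suc M) t)) \<longlonglongrightarrow> inv_symbol_complex (real n) s t"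
proof -
  let ?p = "of_real (s - real n / 2) + \<i> / 2 * spec_param (real n) t"
  let ?q = "of_real (s - real n / 2) - \<i> / 2 * spec_param (real n) t"
  let ?s = "complex_of_real s"
  have "rGamma s \<noteq> 0" using Gamma_real_pos[OF s] by (simp add: rGamma_inverse_Gamma)
  then have rs: "rGamma ?s \<noteq> 0" by (simp only: rGamma_complex_of_real of_real_eq_0_iff simp_thms)
  have "(\<lambda>M. rGamma_series ?p M * rGamma_series ?q M / (rGamma_series ?s M)\<^sup>2) \<longlonglongrightarrow> rGamma ?p * rGamma ?q / (rGamma ?s)\<^sup>2"
    using rs by (intro tendsto_intros) auto
  also have "rGamma ?p * rGamma ?q / (rGamma ?s)\<^sup>2 = inv_symbol_complex (real n) s t"
  proof -
    have "(rGamma ?s)\<^sup>2 = inverse (complex_of_real ((Gamma s)\<^sup>2))"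
      unfolding rGamma_complex_of_real rGamma_inverse_Gamma[of s] by (simp add: power_inverse)
    then have "complex_of_real ((Gamma s)\<^sup>2) = inverse ((rGamma ?s)\<^sup>2)" by (simp only: inverse_inverse_eq)
    then show ?thesis unfolding inv_symbol_complex_def by (simp only: divide_inverse mult_ac)
  qed
  finally have "(\<lambda>M. rGamma_series ?p M * rGamma_series ?q M / (rGamma_series ?s M)\<^sup>2) \<longlonglongrightarrow> inv_symbol_complex (real n) s t" .
  moreover have "\<forall>\<^sub>F M in sequentially. rGamma_series ?p M * rGamma_series ?q M / (rGamma_series ?s M)\<^sup>2 =
      complex_of_real (real M ^ n * ratio_prod (real n) s (Suc M) t)"
    using eventually_gt_at_top[of 0]
  proof eventually_elim
    case (elim M)
    define L where "L = complex_of_real (ln (real M))"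
    have e: "exp (?p * L) * exp (?q * L) * of_real (real M ^ n) = (exp (?s * L))\<^sup>2"
    proof -
      have "complex_of_real (real M ^ n) = exp (of_nat n * L)"
        using elim by (simp add: L_def exp_of_nat_mult exp_of_real)
      then have "exp (?p * L) * exp (?q * L) * of_real (real M ^ n) = exp (?p * L + ?q * L + of_nat n * L)"
        by (simp add: exp_add)
      also have "?p * L + ?q * L + of_nat n * L = 2 * (?s * L)" by (simp add: algebra_simps)
      finally show ?thesis by (simp add: exp_double)
    qed
    have ps: "pochhammer ?s (Suc M) \<noteq> 0"
      using s by (simp add: pochhammer_of_real pochhammer_eq_0_iff) 
    have "rGamma_series ?p M * rGamma_series ?q M / (rGamma_series ?s M)\<^sup>2 =
        pochhammer ?p (Suc M) * pochhammer ?q (Suc M) / (pochhammer ?s (Suc M))\<^sup>2 *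
        ((exp (?s * L))\<^sup>2 / (exp (?p * L) * exp (?q * L)))"
      unfolding rGamma_series_def L_def[symmetric] of_real_of_nat_eq Suc_eq_plus1[symmetric]
      by (simp add: field_simps power2_eq_square L_def)
    also have "(exp (?s * L))\<^sup>2 / (exp (?p * L) * exp (?q * L)) = of_real (real M ^ n)"
      unfolding e[symmetric] by simp
    finally show ?case using ratio_prod_pochhammer[OF s, of "real n" "Suc M" t] by simp
  qed
  ultimately show ?thesis by (rule Lim_transform_eventually)
qed

lemma inv_symbol_tendsto:
  assumes "0 < s"
  shows "(\<lambda>M. real M ^ n * ratio_prod (real n) s (Suc M) t) \<longlonglongrightarrow> inv_symbol (real n) s t"
  using tendsto_Re[OF inv_symbol_complex_tendsto[OF assms, of n t]] by (simp add: inv_symbol_def)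

text \<open>4 (s + j) (s + j - n) = (2 (s + j) - n)^2 - n^2 is at least -n^2. Hence at the single
  point -(2 n^2 + R) every factor is nonnegative and dominates the modulus of the factor at any t
  with |t| \<le> R, and convergence at this point bounds all of them.\<close>

lemma ratio_prod_bound:
  assumes s: "0 < s"
  obtains C where "\<And>M t. \<bar>t\<bar> \<le> R \<Longrightarrow> \<bar>real M ^ n * ratio_prod (real n) s (Suc M) t\<bar> \<le> C"
proof -
  let ?t = "- (2 * (real n)\<^sup>2 + R)"
  have le: "\<bar>ratio_prod (real n) s N t\<bar> \<le> ratio_prod (real n) s N ?t" if t: "\<bar>t\<bar> \<le> R" for N t
    unfolding ratio_prod_def abs_prod
  proof (rule prod_mono, intro conjI)
    fix j
    let ?X = "4 * (s + real j) * (s + real j - real n)"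
    have "0 \<le> (2 * (s + real j) - real n)\<^sup>2" by simp
    also have "\<dots> = ?X + (real n)\<^sup>2" by (simp add: power2_eq_square algebra_simps)
    finally have "\<bar>4 * (s + real j) * (s + real j - real n) - t\<bar> \<le> 4 * (s + real j) * (s + real j - real n) - ?t"
      using t zero_le_power2[of "real n"] unfolding abs_le_iff by linarith
    then show "\<bar>(4 * (s + real j) * (s + real j - real n) - t) / (4 * (s + real j)\<^sup>2)\<bar> \<le>
        (4 * (s + real j) * (s + real j - real n) - ?t) / (4 * (s + real j)\<^sup>2)"
      by (simp add: abs_divide divide_right_mono)
  qed simp
  have "Bseq (\<lambda>M. real M ^ n * ratio_prod (real n) s (Suc M) ?t)"
    using inv_symbol_tendsto[OF s] convergentI by (intro convergent_imp_Bseq) blast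
  then obtain C where C: "\<And>M. norm (real M ^ n * ratio_prod (real n) s (Suc M) ?t) \<le> C" by (auto simp: Bseq_def)
  show ?thesis
  proof (rule that[of C])
    fix M t assume t: "\<bar>t\<bar> \<le> R"
    have "\<bar>real M ^ n * ratio_prod (real n) s (Suc M) t\<bar> = real M ^ n * \<bar>ratio_prod (real n) s (Suc M) t\<bar>" by (simp add: abs_mult)
    also have "\<dots> \<le> real M ^ n * ratio_prod (real n) s (Suc M) ?t" using le[OF t] by (intro mult_left_mono) auto
    also have "\<dots> \<le> C" using C[of M] by simp
    finally show "\<bar>real M ^ n * ratio_prod (real n) s (Suc M) t\<bar> \<le> C" .
  qed
qed

lemma inv_symbol_measurable [measurable]:
  assumes "0 < s"
  shows "inv_symbol (real n) s \<in> borel_measurable borel"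
  by (rule borel_measurable_LIMSEQ_real[OF inv_symbol_tendsto[OF assms]]) (simp add: ratio_prod_def)

lemma spec_param_nonneg: "t \<le> - n\<^sup>2 \<Longrightarrow> spec_param n t = of_real (sqrt (- t - n\<^sup>2))"
  unfolding spec_param_def by (rule of_real_sqrt[symmetric]) simp

lemma inv_symbol_Gamma:
  assumes s: "n / 2 < s" "0 \<le> n" and t: "t \<le> - n\<^sup>2"
  shows "inv_symbol n s t * (cmod (Gamma (of_real (s - n / 2) + \<i> / 2 * of_real (sqrt (- t - n\<^sup>2)))))\<^sup>2 = (Gamma s)\<^sup>2"
proof -
  let ?z = "of_real (s - n / 2) + \<i> / 2 * of_real (sqrt (- t - n\<^sup>2))"
  have c: "of_real (s - n / 2) - \<i> / 2 * of_real (sqrt (- t - n\<^sup>2)) = cnj ?z" by simp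
  have nz: "Gamma ?z \<noteq> 0"
  proof -
    have "?z \<notin> \<int>\<^sub>\<le>\<^sub>0" using s by (auto elim!: nonpos_Ints_cases simp: complex_eq_iff)
    then show ?thesis by (simp add: Gamma_eq_zero_iff)
  qed
  have "inv_symbol_complex n s t = of_real ((Gamma s)\<^sup>2) * (rGamma ?z * cnj (rGamma ?z))"
    unfolding inv_symbol_complex_def spec_param_nonneg[OF t] c cnj_rGamma by (simp add: mult.assoc)
  also have "rGamma ?z * cnj (rGamma ?z) = of_real ((cmod (rGamma ?z))\<^sup>2)" by (rule complex_norm_square[symmetric])
  finally have "inv_symbol n s t = (Gamma s)\<^sup>2 * (cmod (rGamma ?z))\<^sup>2" by (simp add: inv_symbol_def)
  also have "cmod (rGamma ?z) = inverse (cmod (Gamma ?z))" by (simp add: rGamma_inverse_Gamma norm_inverse)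
  finally show ?thesis using nz by (simp add: power_inverse)
qed

text \<open>For t \<le> -n^2 the factors of \<open>ratio_prod\<close> are nonnegative and decrease
  in t, so the least value of the limit is the one at -n^2, which is positive by
  \<open>inv_symbol_Gamma\<close>.\<close>

lemma inv_symbol_lower:
  assumes s: "real n / 2 < s"
  obtains c where "0 < c" "\<And>t. t \<le> - (real n)\<^sup>2 \<Longrightarrow> c \<le> inv_symbol (real n) s t"
proof (rule that)
  have s0: "0 < s" using s by (meson divide_nonneg_nonneg le_less_trans of_nat_0_le_iff zero_le_numeral)
  have "inv_symbol (real n) s (- (real n)\<^sup>2) * (cmod (Gamma (of_real (s - real n / 2))))\<^sup>2 = (Gamma s)\<^sup>2"
    using inv_symbol_Gamma[of "real n" s "- (real n)\<^sup>2"] s by simp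
  moreover have "0 < (Gamma s)\<^sup>2" using Gamma_real_pos[OF s0] by simp
  ultimately have "0 < inv_symbol (real n) s (- (real n)\<^sup>2) * (cmod (Gamma (of_real (s - real n / 2))))\<^sup>2" by simp
  then show "0 < inv_symbol (real n) s (- (real n)\<^sup>2)" using zero_less_mult_iff[of "inv_symbol (real n) s (- (real n)\<^sup>2)"] by (metis not_less zero_le_power2)
  fix t assume t: "t \<le> - (real n)\<^sup>2"
  show "inv_symbol (real n) s (- (real n)\<^sup>2) \<le> inv_symbol (real n) s t"
  proof (rule LIMSEQ_le[OF inv_symbol_tendsto[OF s0] inv_symbol_tendsto[OF s0]], intro exI allI impI mult_left_mono)
    fix M
    show "ratio_prod (real n) s (Suc M) (- (real n)\<^sup>2) \<le> ratio_prod (real n) s (Suc M) t"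
      unfolding ratio_prod_def
    proof (rule prod_mono, intro conjI divide_right_mono divide_nonneg_nonneg)
      fix j
      have "0 \<le> (2 * (s + real j) - real n)\<^sup>2" by simp
      then show "0 \<le> 4 * (s + real j) * (s + real j - real n) - - (real n)\<^sup>2"
        by (simp add: power2_eq_square algebra_simps)
    qed (use t in auto)
  qed simp
qed

text \<open>The exponent solves 4 s (s - n) = \<tau>, and then the symbol vanishes at t = \<tau>:
  the zero sits in \<open>rGamma (x \<tau> - x t)\<close>. Splitting off the first factor of both
  reciprocal Gamma functions produces (\<tau> - t) / 4; the rest is continuous on a compact square,
  so the bound is uniform in \<tau>.\<close>

lemma inv_symbol_zero_bound:
  assumes a: "- (real n)\<^sup>2 < a"
  obtains C where "\<And>\<tau> t. a \<le> \<tau> \<Longrightarrow> \<tau> \<le> b \<Longrightarrow> a \<le> t \<Longrightarrow> t \<le> b \<Longrightarrow>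
    \<bar>inv_symbol (real n) ((real n + sqrt ((real n)\<^sup>2 + \<tau>)) / 2) t\<bar> \<le> C * \<bar>t - \<tau>\<bar>"
proof -
  define x where "x \<tau> = sqrt ((real n)\<^sup>2 + \<tau>) / 2" for \<tau>
  let ?g = "\<lambda>p. (Gamma (real n / 2 + x (fst p)))\<^sup>2 * rGamma (x (fst p) - x (snd p) + 1) * rGamma (x (fst p) + x (snd p) + 1)"
  let ?S = "{a..b} \<times> {a..b}"
  have xpos: "0 < x \<tau>" if "a \<le> \<tau>" for \<tau> using a that by (simp add: x_def)
  have "continuous_on ?S ?g"
  proof -
    have c: "continuous_on ?S (\<lambda>p. x (fst p))" "continuous_on ?S (\<lambda>p. x (snd p))"
      unfolding x_def by (intro continuous_intros; simp)+
    have "continuous_on ?S (\<lambda>p. Gamma (real n / 2 + x (fst p)))"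
    proof (rule continuous_on_compose2[of "{0<..}" Gamma])
      show "continuous_on {0<..} (Gamma :: real \<Rightarrow> real)"
        by (intro continuous_on_Gamma) (auto elim!: nonpos_Ints_cases)
      show "(\<lambda>p. real n / 2 + x (fst p)) ` ?S \<subseteq> {0<..}"
        using xpos by (auto intro!: add_nonneg_pos)
    qed (intro continuous_intros c)
    moreover have "continuous_on ?S (\<lambda>p. rGamma (x (fst p) - x (snd p) + 1))"
      by (rule continuous_on_compose2[OF continuous_on_rGamma[of UNIV]]) (auto intro!: continuous_intros c)
    moreover have "continuous_on ?S (\<lambda>p. rGamma (x (fst p) + x (snd p) + 1))"
      by (rule continuous_on_compose2[OF continuous_on_rGamma[of UNIV]]) (auto intro!: continuous_intros c)
    ultimately show ?thesis by (intro continuous_on_mult continuous_on_power)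
  qed
  then have "bounded (?g ` ?S)" by (intro compact_imp_bounded compact_continuous_image compact_Times) auto
  then obtain C where "\<forall>y\<in>?g ` ?S. norm y \<le> C" unfolding bounded_iff by blast
  then have C: "\<bar>?g p\<bar> \<le> C" if "p \<in> ?S" for p
    using bspec[OF _ imageI[OF that, of ?g]] by (simp only: real_norm_def)
  show ?thesis
  proof (rule that[of "C / 4"])
    fix \<tau> t assume T: "a \<le> \<tau>" "\<tau> \<le> b" "a \<le> t" "t \<le> b"
    let ?s = "(real n + sqrt ((real n)\<^sup>2 + \<tau>)) / 2"
    have sx: "?s = real n / 2 + x \<tau>" "?s - real n / 2 = x \<tau>" by (simp_all add: x_def add_divide_distrib)
    have "spec_param (real n) t = \<i> * of_real (2 * x t)"
    proof -
      have "0 < (real n)\<^sup>2 + t" using a T by simp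
      then show ?thesis by (simp add: spec_param_def x_def)
    qed
    then have l: "\<i> / 2 * spec_param (real n) t = of_real (- x t)" by simp
    have "inv_symbol_complex (real n) ?s t = of_real ((Gamma (real n / 2 + x \<tau>))\<^sup>2 * rGamma (x \<tau> - x t) * rGamma (x \<tau> + x t))"
      unfolding inv_symbol_complex_def l sx(2) unfolding sx(1)
      by (simp add: rGamma_complex_of_real[symmetric])
    then have "inv_symbol (real n) ?s t = (Gamma (real n / 2 + x \<tau>))\<^sup>2 * rGamma (x \<tau> - x t) * rGamma (x \<tau> + x t)"
      by (simp add: inv_symbol_def)
    also have "\<dots> = ((x \<tau> - x t) * (x \<tau> + x t)) * ?g (\<tau>, t)"
      by (subst rGamma_plus1[of "x \<tau> - x t", symmetric], subst rGamma_plus1[of "x \<tau> + x t", symmetric])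
        (simp add: mult_ac)
    also have "(x \<tau> - x t) * (x \<tau> + x t) = (\<tau> - t) / 4"
    proof -
      have "(x \<tau> - x t) * (x \<tau> + x t) = (x \<tau>)\<^sup>2 - (x t)\<^sup>2" by (simp add: power2_eq_square algebra_simps)
      also have "\<dots> = (\<tau> - t) / 4" using a T by (simp add: x_def power_divide diff_divide_distrib add_divide_distrib)
      finally show ?thesis .
    qed
    finally have "\<bar>inv_symbol (real n) ?s t\<bar> = \<bar>(\<tau> - t) / 4 * ?g (\<tau>, t)\<bar>" by (simp only:)
    also have "\<dots> = \<bar>\<tau> - t\<bar> / 4 * \<bar>?g (\<tau>, t)\<bar>"
      unfolding abs_mult[of "(\<tau> - t) / 4"] by simp
    also have "\<dots> \<le> \<bar>\<tau> - t\<bar> / 4 * C" using C[of "(\<tau>, t)"] T by (intro mult_left_mono) auto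
    finally show "\<bar>inv_symbol (real n) ?s t\<bar> \<le> C / 4 * \<bar>t - \<tau>\<bar>" by (simp add: abs_minus_commute mult.commute)
  qed
qed

section \<open>The kernel operators as functions of the Laplacian\<close>

lemma bounded_borel_cut_continuous:
  assumes A: "A \<in> sets borel" "bounded A" and g: "continuous_on UNIV g"
  shows "bounded_borel (\<lambda>t. indicator A t * complex_of_real (g t))"
proof -
  have "compact (closure A)" using A(2) by simp
  then have "bounded (g ` closure A)"
    by (intro compact_imp_bounded compact_continuous_image continuous_on_subset[OF g]) auto
  then obtain C where C: "0 < C" "\<And>t. t \<in> closure A \<Longrightarrow> \<bar>g t\<bar> \<le> C" by (auto simp: bounded_pos)
  have "g \<in> borel_measurable borel" using g by (rule borel_measurable_continuous_onI)
  then show ?thesis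
    using A(1) C closure_subset[of A] by (intro bounded_borelI[of _ C]) (auto simp: indicator_def norm_mult)
qed

context pvm begin

lemma spec_form_scale:
  assumes "bounded_borel f" "\<phi> \<in> L2 M" "\<eta> \<in> L2 M"
  shows "spec_form (\<lambda>t. c * f t) \<phi> \<eta> = c * spec_form f \<phi> \<eta>"
  using spec_form_lin[OF bounded_borel_const[of 0] assms, of c] by (simp add: spec_form_def)

end

locale bergman_spectral =
  fixes E :: "real set \<Rightarrow> (complex ^ 'n \<Rightarrow> complex) \<Rightarrow> (complex ^ 'n \<Rightarrow> complex)"
  assumes res: "spectral_resolution bergman_measure laplace_beltrami_op E"
begin

sublocale pvm bergman_measure E
  using res by unfold_locales (simp add: spectral_resolution_def)

text \<open>\<open>kern_op_laplace_weak\<close> projected to a spectral window and solved for the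
  kernel of exponent s + 1; dividing by -4 s^2 gives one factor of
  \<open>ratio_prod\<close>.\<close>

lemma E_kern_op_step:
  assumes A: "A \<in> sets borel" "bounded A" and \<theta>: "\<theta> \<in> Cc" and s: "real CARD('n) / 2 < s" and \<phi>: "\<phi> \<in> L2 BM"
  shows "L2_inner BM (E A (kern_op (s + 1) \<theta>)) \<phi> =
    spec_form (\<lambda>t. indicator A t * of_real ((4 * s * (s - (real CARD('n))) - t) / (4 * s\<^sup>2))) (kern_op s \<theta>) \<phi>"
proof -
  let ?a = "complex_of_real (4 * s * (s - (real CARD('n))))" and ?b = "complex_of_real (- (4 * s\<^sup>2))"
  let ?u = "kern_op s \<theta>" and ?w = "kern_op (s + 1) \<theta>"
  let ?v = "\<lambda>z. ?a * ?u z + ?b * ?w z"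
  let ?G = "{(f, laplace_beltrami f) | f :: complex ^ 'n \<Rightarrow> complex. test_fun f}"
  have s0: "0 < s" using s by (meson divide_nonneg_nonneg le_less_trans of_nat_0_le_iff zero_le_numeral)
  have K: "?u \<in> L2 BM" "?w \<in> L2 BM" using \<theta> s by (auto intro: kern_op_L2)
  have v: "?v \<in> L2 BM" using K by (intro L2_add L2_scale)
  have EA: "E A \<phi> \<in> L2 BM" using A \<phi> by (simp add: E_L2)
  have f: "bounded_borel (\<lambda>t. of_real t * indicator A t)"
    using bounded_borel_id_cut[OF A] by (simp add: id_cut_def[abs_def])
  have "L2_inner BM (E A ?v) \<phi> = spec_form (\<lambda>t. of_real t * indicator A t) ?u \<phi>"
  proof (rule spectral_resolution_weak[where G = ?G])
    show "spectral_resolution BM (op_closure BM ?G) E"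
      using res by (simp add: laplace_beltrami_op_def)
    show "f \<in> L2 BM \<and> g \<in> L2 BM" if "(f, g) \<in> ?G" for f g
      using that test_fun_Cc Cc_L2 by blast
    show "L2_inner BM ?u g = L2_inner BM ?v f" if "(f, g) \<in> ?G" for f g
      using that kern_op_laplace_weak[OF \<theta> s] by blast
  qed (use K v A \<phi> in auto)
  moreover have "L2_inner BM (E A ?v) \<phi> = ?a * L2_inner BM (E A ?u) \<phi> + ?b * L2_inner BM (E A ?w) \<phi>"
    using A \<phi> K v EA by (simp only: E_sym L2_inner_lin_left)
  ultimately have 1: "?b * L2_inner BM (E A ?w) \<phi> = spec_form (\<lambda>t. of_real t * indicator A t) ?u \<phi> - ?a * spec_form (indicator A) ?u \<phi>"
    using A K \<phi> by (simp add: spec_form_indicator algebra_simps)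
  have b: "?b \<noteq> 0" using s0 by simp
  have "spec_form (\<lambda>t. indicator A t * of_real ((4 * s * (s - (real CARD('n))) - t) / (4 * s\<^sup>2))) ?u \<phi> =
      spec_form (\<lambda>t. (1 / ?b) * (of_real t * indicator A t) + (- ?a / ?b) * indicator A t) ?u \<phi>"
    using s0 by (intro arg_cong[where f = "\<lambda>f. spec_form f ?u \<phi>"] ext) (simp add: field_simps)
  also have "\<dots> = (1 / ?b) * spec_form (\<lambda>t. of_real t * indicator A t) ?u \<phi> + (- ?a / ?b) * spec_form (indicator A) ?u \<phi>"
    using f A K \<phi> by (simp only: spec_form_lin spec_form_scale bounded_borel_scale bounded_borel_indicator)
  also have "\<dots> = (1 / ?b) * (?b * L2_inner BM (E A ?w) \<phi>)"
    unfolding 1 by (simp add: algebra_simps diff_divide_distrib)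
  also have "\<dots> = L2_inner BM (E A ?w) \<phi>" using b by simp
  finally show ?thesis ..
qed

lemma ratio_prod_continuous: "continuous_on UNIV (\<lambda>t. ratio_prod n s N t)"
  unfolding ratio_prod_def divide_inverse by (intro continuous_intros)

lemma E_kern_op_iter:
  assumes A: "A \<in> sets borel" "bounded A" and \<theta>: "\<theta> \<in> Cc" and s: "real CARD('n) / 2 < s" and \<phi>: "\<phi> \<in> L2 BM"
  shows "L2_inner BM (E A (kern_op (s + real N) \<theta>)) \<phi> =
    spec_form (\<lambda>t. indicator A t * of_real (ratio_prod (real CARD('n)) s N t)) (kern_op s \<theta>) \<phi>"
  using A
\<comment> \<open>The window varies because \<open>spec_form_transfer\<close> asks for all windows B
  \<inter> A.\<close>
proof (induction N arbitrary: A)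
  case 0
  have "(\<lambda>t. indicator A t * complex_of_real (ratio_prod (real CARD('n)) s 0 t)) = indicator A" by (simp add: ratio_prod_def)
  then show ?case using 0 \<theta> s \<phi> by (simp add: spec_form_indicator kern_op_L2)
next
  case (Suc N)
  let ?s = "s + real N"
  define q where "q t = (4 * ?s * (?s - (real CARD('n))) - t) / (4 * ?s\<^sup>2)" for t
  let ?f = "\<lambda>t. indicator A t * complex_of_real (q t)"
  let ?d = "\<lambda>t. indicator A t * complex_of_real (ratio_prod (real CARD('n)) s N t)"
  have sN: "real CARD('n) / 2 < ?s" using s by simp
  have K: "kern_op ?s \<theta> \<in> L2 BM" "kern_op s \<theta> \<in> L2 BM" using \<theta> s sN by (auto intro: kern_op_L2)
  have f: "bounded_borel ?f"
    unfolding q_def divide_inverse using Suc.prems by (intro bounded_borel_cut_continuous continuous_intros)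
  have d: "bounded_borel ?d" using Suc.prems by (intro bounded_borel_cut_continuous ratio_prod_continuous)
  have "L2_inner BM (E A (kern_op (s + real (Suc N)) \<theta>)) \<phi> = spec_form ?f (kern_op ?s \<theta>) \<phi>"
    using E_kern_op_step[OF Suc.prems \<theta> sN \<phi>] by (simp add: q_def add_ac)
  also have "\<dots> = spec_form (\<lambda>t. ?f t * indicator A t) (kern_op ?s \<theta>) \<phi>"
    by (intro arg_cong[where f = "\<lambda>f. spec_form f (kern_op ?s \<theta>) \<phi>"] ext) (simp add: indicator_def)
  also have "\<dots> = spec_form ?f (E A (kern_op ?s \<theta>)) \<phi>"
    using f Suc.prems K \<phi> by (simp only: spec_form_E_left)
  also have "\<dots> = spec_form (\<lambda>t. ?f t * ?d t) (kern_op s \<theta>) \<phi>"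
  proof (rule spec_form_transfer[OF f d K(2) _ \<phi>])
    show "E A (kern_op ?s \<theta>) \<in> L2 BM" using Suc.prems K by (simp add: E_L2)
    fix B :: "real set" assume B: "B \<in> sets borel"
    have "L2_inner BM (E B (E A (kern_op ?s \<theta>))) \<phi> = L2_inner BM (E (B \<inter> A) (kern_op ?s \<theta>)) \<phi>"
      using B Suc.prems K \<phi> by (simp add: E_E)
    also have "\<dots> = spec_form (\<lambda>t. indicator (B \<inter> A) t * of_real (ratio_prod (real CARD('n)) s N t)) (kern_op s \<theta>) \<phi>"
      using B Suc.prems by (intro Suc.IH) (auto intro: bounded_subset)
    also have "(\<lambda>t. indicator (B \<inter> A) t * complex_of_real (ratio_prod (real CARD('n)) s N t)) = (\<lambda>t. indicator B t * ?d t)"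
      by (auto simp: indicator_def)
    finally show "L2_inner BM (E B (E A (kern_op ?s \<theta>))) \<phi> = spec_form (\<lambda>t. indicator B t * ?d t) (kern_op s \<theta>) \<phi>" .
  qed
  also have "(\<lambda>t. ?f t * ?d t) = (\<lambda>t. indicator A t * complex_of_real (ratio_prod (real CARD('n)) s (Suc N) t))"
    by (auto simp: indicator_def ratio_prod_def q_def)
  finally show ?case .
qed

lemma bounded_borel_inv_symbol:
  assumes A: "A \<in> sets borel" "bounded A" and s: "0 < s"
  shows "bounded_borel (\<lambda>t. indicator A t * of_real (inv_symbol (real CARD('n)) s t))"
proof -
  obtain R where R: "\<And>t. t \<in> A \<Longrightarrow> \<bar>t\<bar> \<le> R" using A(2) by (auto simp: bounded_iff)
  obtain C where C: "\<And>M t. \<bar>t\<bar> \<le> R \<Longrightarrow> \<bar>real M ^ CARD('n) * ratio_prod (real CARD('n)) s (Suc M) t\<bar> \<le> C"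
    using ratio_prod_bound[OF s] by blast
  have b: "\<bar>inv_symbol (real CARD('n)) s t\<bar> \<le> C" if "t \<in> A" for t
    by (rule LIMSEQ_le_const2[OF tendsto_rabs[OF inv_symbol_tendsto[OF s]]]) (use C R that in blast)
  have m: "inv_symbol (real CARD('n)) s \<in> borel_measurable borel" using s by (rule inv_symbol_measurable)
  show ?thesis
  proof (rule bounded_borelI)
    show "(\<lambda>t. indicator A t * complex_of_real (inv_symbol (real CARD('n)) s t)) \<in> borel_measurable borel"
      using m A(1) by measurable
    show "cmod (indicator A t * complex_of_real (inv_symbol (real CARD('n)) s t)) \<le> \<bar>C\<bar>" for t
      using b[of t] by (auto simp: indicator_def norm_mult)
  qed
qed

abbreviation times_limit :: "(complex ^ 'n \<Rightarrow> complex) \<Rightarrow> complex ^ 'n \<Rightarrow> complex" where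
  "times_limit \<theta> \<equiv> (\<lambda>z. of_real (kern_limit z) * \<theta> z)"

lemma times_limit_L2: "\<theta> \<in> Cc \<Longrightarrow> times_limit \<theta> \<in> L2 BM"
  by (intro Cc_L2 kern_limit_Cc)

text \<open>\<open>E_kern_op_iter\<close> multiplied by M^n, in the limit:
  \<open>kern_op_approx_L2\<close> on the left, bounded convergence of the symbols on the right. The
  left-hand side does not involve s, which is what later allows s to be chosen freely for each
  spectral window.\<close>

lemma E_times_limit:
  assumes A: "A \<in> sets borel" "bounded A" and \<theta>: "\<theta> \<in> Cc" and s: "real CARD('n) / 2 < s" and \<phi>: "\<phi> \<in> L2 BM"
  shows "L2_inner BM (E A (times_limit \<theta>)) \<phi> = spec_form (\<lambda>t. indicator A t * of_real (inv_symbol (real CARD('n)) s t)) (kern_op s \<theta>) \<phi>"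
proof (rule LIMSEQ_unique)
  let ?n = "CARD('n)"
  have s0: "0 < s" using s by (meson divide_nonneg_nonneg le_less_trans of_nat_0_le_iff zero_le_numeral)
  define \<sigma> where "\<sigma> M = s + real (Suc M)" for M
  have \<sigma>: "filterlim \<sigma> at_top sequentially" "\<And>M. 0 < \<sigma> M"
  proof -
    have "filterlim (\<lambda>M. real (Suc M)) at_top sequentially"
      by (rule filterlim_compose[OF filterlim_real_sequentially filterlim_Suc])
    then show "filterlim \<sigma> at_top sequentially" unfolding \<sigma>_def
      by (intro filterlim_tendsto_add_at_top[OF tendsto_const])
  qed (use s0 in \<open>simp add: \<sigma>_def\<close>)
  have EA: "E A \<phi> \<in> L2 BM" using A \<phi> by (simp add: E_L2)
  have \<sigma>2: "real CARD('n) / 2 < \<sigma> M" for M using s by (simp add: \<sigma>_def)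
  have K: "kern_op (\<sigma> M) \<theta> \<in> L2 BM" "kern_op s \<theta> \<in> L2 BM" for M
    using \<theta> s \<sigma>2 by (auto intro!: kern_op_L2)
  let ?L = "\<lambda>M. of_real (real M ^ ?n) * L2_inner BM (E A (kern_op (\<sigma> M) \<theta>)) \<phi>"
  \<comment> \<open>The operators are normalized with \<sigma> M = s + M + 1 but the products with
    M; the quotient tends to 1.\<close>
  have ratio: "(\<lambda>M. real M / \<sigma> M) \<longlonglongrightarrow> 1"
  proof -
    have "(\<lambda>M. 1 - (s + 1) * inverse (\<sigma> M)) \<longlonglongrightarrow> 1 - (s + 1) * 0"
      by (intro tendsto_intros tendsto_inverse_0_at_top \<sigma>)
    moreover have "1 - (s + 1) * inverse (\<sigma> M) = real M / \<sigma> M" for M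
      using \<sigma>(2)[of M] by (simp add: \<sigma>_def field_simps)
    ultimately show ?thesis by simp
  qed
  have "(\<lambda>M. L2_inner BM (\<lambda>z. of_real (\<sigma> M ^ ?n) * kern_op (\<sigma> M) \<theta> z) (E A \<phi>)) \<longlonglongrightarrow> L2_inner BM (times_limit \<theta>) (E A \<phi>)"
    using K EA \<theta> by (intro L2_inner_tendsto_left kern_op_approx_L2 \<sigma> L2_scale times_limit_L2)
  then have "(\<lambda>M. of_real ((real M / \<sigma> M) ^ ?n) * L2_inner BM (\<lambda>z. of_real (\<sigma> M ^ ?n) * kern_op (\<sigma> M) \<theta> z) (E A \<phi>))
      \<longlonglongrightarrow> of_real (1 ^ ?n) * L2_inner BM (times_limit \<theta>) (E A \<phi>)"
    by (intro tendsto_intros ratio)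
  moreover have "of_real ((real M / \<sigma> M) ^ ?n) * L2_inner BM (\<lambda>z. of_real (\<sigma> M ^ ?n) * kern_op (\<sigma> M) \<theta> z) (E A \<phi>) = ?L M" for M
  proof -
    have "of_real ((real M / \<sigma> M) ^ ?n) * complex_of_real (\<sigma> M ^ ?n) = of_real (real M ^ ?n)"
      unfolding of_real_mult[symmetric] using \<sigma>(2)[of M] by (simp add: power_divide)
    then show ?thesis
      using A \<phi> K by (simp only: E_sym L2_inner_scale_left mult.assoc[symmetric])
  qed
  ultimately show "?L \<longlonglongrightarrow> L2_inner BM (E A (times_limit \<theta>)) \<phi>"
    using A \<phi> \<theta> by (simp add: E_sym times_limit_L2)
  obtain R where R: "\<And>t. t \<in> A \<Longrightarrow> \<bar>t\<bar> \<le> R" using A(2) by (auto simp: bounded_iff)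
  obtain C where C: "\<And>M t. \<bar>t\<bar> \<le> R \<Longrightarrow> \<bar>real M ^ ?n * ratio_prod (real CARD('n)) s (Suc M) t\<bar> \<le> C"
    using ratio_prod_bound[OF s0] by blast
  have b: "bounded_borel (\<lambda>t. indicator A t * complex_of_real (real M ^ ?n * ratio_prod (real CARD('n)) s (Suc M) t))" for M
    using A by (intro bounded_borel_cut_continuous continuous_on_mult continuous_on_const ratio_prod_continuous)
  have "(\<lambda>M. spec_form (\<lambda>t. indicator A t * complex_of_real (real M ^ ?n * ratio_prod (real CARD('n)) s (Suc M) t)) (kern_op s \<theta>) \<phi>) \<longlonglongrightarrow>
      spec_form (\<lambda>t. indicator A t * of_real (inv_symbol (real CARD('n)) s t)) (kern_op s \<theta>) \<phi>"
  proof (rule spec_form_lim[where C = "\<bar>C\<bar>", OF b bounded_borel_inv_symbol[OF A s0]])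
    show "cmod (indicator A t * complex_of_real (real M ^ ?n * ratio_prod (real CARD('n)) s (Suc M) t)) \<le> \<bar>C\<bar>" for M t
    proof (cases "t \<in> A")
      case True
      have "cmod (complex_of_real (real M ^ ?n * ratio_prod (real CARD('n)) s (Suc M) t)) \<le> C"
        unfolding norm_of_real by (rule C[OF R[OF True]])
      then show ?thesis using True by simp
    qed simp
    show "(\<lambda>M. indicator A t * complex_of_real (real M ^ ?n * ratio_prod (real CARD('n)) s (Suc M) t)) \<longlonglongrightarrow> indicator A t * complex_of_real (inv_symbol (real CARD('n)) s t)" for t
      by (intro tendsto_mult tendsto_const tendsto_of_real inv_symbol_tendsto s0)
  qed (use K \<phi> in auto)
  moreover have "spec_form (\<lambda>t. indicator A t * complex_of_real (real M ^ ?n * ratio_prod (real CARD('n)) s (Suc M) t)) (kern_op s \<theta>) \<phi> = ?L M" for M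
  proof -
    have e: "(\<lambda>t. indicator A t * complex_of_real (real M ^ ?n * ratio_prod (real CARD('n)) s (Suc M) t)) =
        (\<lambda>t. of_real (real M ^ ?n) * (indicator A t * complex_of_real (ratio_prod (real CARD('n)) s (Suc M) t)))"
      by (simp add: fun_eq_iff mult_ac)
    have "bounded_borel (\<lambda>t. indicator A t * complex_of_real (ratio_prod (real CARD('n)) s (Suc M) t))"
      using A by (intro bounded_borel_cut_continuous ratio_prod_continuous)
    then show ?thesis
      unfolding e using K \<phi> E_kern_op_iter[OF A \<theta> s \<phi>, of "Suc M"] by (simp only: spec_form_scale \<sigma>_def)
  qed
  ultimately show "?L \<longlonglongrightarrow> spec_form (\<lambda>t. indicator A t * of_real (inv_symbol (real CARD('n)) s t)) (kern_op s \<theta>) \<phi>" by simp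
qed

text \<open>\<open>inv_cosh2\<close> is at most 1, so the kernel decreases in the exponent. This
  makes the window estimate uniform in the exponents it uses.\<close>

lemma kern_op_mono_L2_norm:
  fixes \<theta> :: "complex ^ 'n \<Rightarrow> complex"
  assumes "\<theta> \<in> Cc" "real CARD('n) / 2 < s0" "s0 \<le> s"
  shows "L2_norm BM (kern_op s \<theta>) \<le> L2_norm BM (kern_op s0 (\<lambda>z. of_real (cmod (\<theta> z))))"
proof -
  have le: "cmod (kern_op s \<theta> z) \<le> cmod (kern_op s0 (\<lambda>z. of_real (cmod (\<theta> z))) z)" if z: "z \<in> unit_ball" for z :: "complex ^ 'n"
  proof -
    have int: "integrable BM (\<lambda>w. kern s0 z w * cmod (\<theta> w))"
      using kern_L2_integrable[OF assms(2) z Cc_L2[OF assms(1)], THEN integrable_norm]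
      by (simp add: norm_mult kern_nonneg)
    have "cmod (kern_op s \<theta> z) \<le> (LINT w|BM. cmod (of_real (kern s z w) * \<theta> w))"
      unfolding kern_op_def by (rule integral_norm_bound)
    also have "\<dots> \<le> (LINT w|BM. kern s0 z w * cmod (\<theta> w))"
    proof (rule integral_mono'[OF int])
      fix w :: "complex ^ 'n" assume "w \<in> space BM"
      then have w: "w \<in> unit_ball" by simp
      have "kern s z w \<le> kern s0 z w"
        unfolding kern_def using inv_cosh2_pos[of z w] inv_cosh2_le_1[of z w] z w assms(3) by (intro powr_mono') auto
      then show "cmod (of_real (kern s z w) * \<theta> w) \<le> kern s0 z w * cmod (\<theta> w)"
        by (simp add: norm_mult kern_nonneg mult_right_mono)
      show "0 \<le> kern s0 z w * cmod (\<theta> w)" by (simp add: kern_nonneg)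
    qed
    also have "\<dots> = cmod (of_real (LINT w|BM. kern s0 z w * cmod (\<theta> w)))"
      by (simp add: integral_nonneg kern_nonneg)
    also have "of_real (LINT w|BM. kern s0 z w * cmod (\<theta> w)) = kern_op s0 (\<lambda>z. of_real (cmod (\<theta> z))) z"
      unfolding kern_op_def of_real_mult[symmetric] by (rule integral_complex_of_real[symmetric])
    finally show ?thesis .
  qed
  have "kern_op s0 (\<lambda>z. of_real (cmod (\<theta> z))) \<in> L2 BM" using assms by (intro kern_op_L2 Cc_norm)
  then show ?thesis
    unfolding L2_norm_def using le
    by (intro real_sqrt_le_mono integral_mono') (auto simp: L2_def intro: power_mono)
qed

text \<open>The spectrum lies in \<open>(-\<infinity>, -n\<^sup>2]\<close>: on a spectral window of length \<open>\<delta>\<close> around \<open>\<tau> > -n\<^sup>2\<close>, choosing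
  \<open>s\<close> with \<open>4 s (s - n) = \<tau>\<close> makes the symbol of the inverse of \<open>kern_op s\<close> of order \<open>\<delta>\<close>. So the spectral
  measure of the window is of order \<open>\<delta>\<^sup>2\<close>, and summing over windows gives zero.\<close>

lemma E_times_limit_window:
  assumes \<theta>: "\<theta> \<in> Cc" and a: "- (real CARD('n))\<^sup>2 < a"
  obtains C where "0 \<le> C" "\<And>\<tau> \<delta>. a \<le> \<tau> \<Longrightarrow> 0 \<le> \<delta> \<Longrightarrow> \<tau> + \<delta> \<le> b \<Longrightarrow> L2_norm BM (E {\<tau>..\<tau> + \<delta>} (times_limit \<theta>)) \<le> C * \<delta>"
proof -
  obtain C where C: "\<And>\<tau> t. a \<le> \<tau> \<Longrightarrow> \<tau> \<le> b \<Longrightarrow> a \<le> t \<Longrightarrow> t \<le> b \<Longrightarrow>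
    \<bar>inv_symbol (real CARD('n)) (((real CARD('n)) + sqrt ((real CARD('n))\<^sup>2 + \<tau>)) / 2) t\<bar> \<le> C * \<bar>t - \<tau>\<bar>"
    using inv_symbol_zero_bound[OF a] by blast
  \<comment> \<open>The exponent belonging to the left end a is the smallest one that occurs, so K
    bounds the norms for all windows.\<close>
  define s0 where "s0 = ((real CARD('n)) + sqrt ((real CARD('n))\<^sup>2 + a)) / 2"
  have s0: "real CARD('n) / 2 < s0" using a by (simp add: s0_def)
  define K where "K = L2_norm BM (kern_op s0 (\<lambda>z. of_real (cmod (\<theta> z))))"
  show ?thesis
  proof (rule that[of "\<bar>C\<bar> * K"])
    show "0 \<le> \<bar>C\<bar> * K" by (simp add: K_def)
    fix \<tau> \<delta> assume T: "a \<le> \<tau>" "0 \<le> \<delta>" "\<tau> + \<delta> \<le> b"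
    let ?A = "{\<tau>..\<tau> + \<delta>}"
    define s where "s = ((real CARD('n)) + sqrt ((real CARD('n))\<^sup>2 + \<tau>)) / 2"
    have ss: "s0 \<le> s" using T by (simp add: s0_def s_def)
    then have s: "real CARD('n) / 2 < s" using s0 by simp
    have s_pos: "0 < s" using s by (meson divide_nonneg_nonneg le_less_trans of_nat_0_le_iff zero_le_numeral)
    let ?\<phi> = "E ?A (times_limit \<theta>)"
    have L: "times_limit \<theta> \<in> L2 BM" "?\<phi> \<in> L2 BM" "kern_op s \<theta> \<in> L2 BM" using \<theta> s by (auto intro: times_limit_L2 E_L2 kern_op_L2)
    have b: "cmod (indicator ?A t * complex_of_real (inv_symbol (real CARD('n)) s t)) \<le> \<bar>C\<bar> * \<delta>" for t
    proof (cases "t \<in> ?A")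
      case True
      then have "\<bar>inv_symbol (real CARD('n)) s t\<bar> \<le> C * \<bar>t - \<tau>\<bar>" unfolding s_def using T by (intro C) auto
      also have "\<dots> \<le> \<bar>C\<bar> * \<delta>" using True by (intro mult_mono) auto
      finally show ?thesis using True by simp
    qed (use T in simp)
    have "complex_of_real ((L2_norm BM ?\<phi>)\<^sup>2) = L2_inner BM ?\<phi> ?\<phi>" by (simp only: L2_inner_self)
    also have "\<dots> = spec_form (\<lambda>t. indicator ?A t * of_real (inv_symbol (real CARD('n)) s t)) (kern_op s \<theta>) ?\<phi>"
      by (rule E_times_limit[OF _ _ \<theta> s L(2)]) auto
    finally have e: "complex_of_real ((L2_norm BM ?\<phi>)\<^sup>2) = spec_form (\<lambda>t. indicator ?A t * of_real (inv_symbol (real CARD('n)) s t)) (kern_op s \<theta>) ?\<phi>" .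
    have "(L2_norm BM ?\<phi>)\<^sup>2 = cmod (spec_form (\<lambda>t. indicator ?A t * of_real (inv_symbol (real CARD('n)) s t)) (kern_op s \<theta>) ?\<phi>)"
      unfolding e[symmetric] norm_of_real by (rule abs_of_nonneg[symmetric]) (rule zero_le_power2)
    also have "\<dots> \<le> \<bar>C\<bar> * \<delta> * L2_norm BM (kern_op s \<theta>) * L2_norm BM ?\<phi>"
      using L b s_pos by (intro spec_form_norm_le bounded_borel_inv_symbol) auto
    also have "\<dots> \<le> \<bar>C\<bar> * \<delta> * K * L2_norm BM ?\<phi>"
      unfolding K_def using kern_op_mono_L2_norm[OF \<theta> s0 ss] T by (intro mult_right_mono mult_left_mono) auto
    finally have "L2_norm BM ?\<phi> * L2_norm BM ?\<phi> \<le> (\<bar>C\<bar> * \<delta> * K) * L2_norm BM ?\<phi>" by (simp add: power2_eq_square)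
    moreover have "0 \<le> \<bar>C\<bar> * \<delta> * K" using T by (simp add: K_def)
    ultimately have "L2_norm BM ?\<phi> \<le> \<bar>C\<bar> * \<delta> * K"
      using L2_norm_nonneg[of BM ?\<phi>] by (cases "L2_norm BM ?\<phi> = 0") (auto simp: mult_le_cancel_right)
    then show "L2_norm BM ?\<phi> \<le> \<bar>C\<bar> * K * \<delta>" by (simp add: mult_ac)
  qed
qed

lemma spec_density_times_limit_interval:
  assumes \<theta>: "\<theta> \<in> Cc" and a: "- (real CARD('n))\<^sup>2 < a" "a \<le> b"
  shows "emeasure (spec_density (times_limit \<theta>)) {a..b} = 0"
proof -
  interpret finite_measure "spec_density (times_limit \<theta>)" using \<theta> by (intro finite_spec_density times_limit_L2)
  obtain C where C: "0 \<le> C" "\<And>\<tau> \<delta>. a \<le> \<tau> \<Longrightarrow> 0 \<le> \<delta> \<Longrightarrow> \<tau> + \<delta> \<le> b \<Longrightarrow> L2_norm BM (E {\<tau>..\<tau> + \<delta>} (times_limit \<theta>)) \<le> C * \<delta>"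
    using E_times_limit_window[OF \<theta> a(1)] by blast
  have le: "measure (spec_density (times_limit \<theta>)) {a..b} \<le> (C * (b - a))\<^sup>2 / real (Suc N)" for N
  proof -
    define \<delta> where "\<delta> = (b - a) / real (Suc N)"
    have \<delta>: "0 \<le> \<delta>" "real (Suc N) * \<delta> = b - a" using a by (simp_all add: \<delta>_def)
    let ?A = "\<lambda>i. {a + real i * \<delta>..a + real i * \<delta> + \<delta>}"
    have cover: "{a..b} \<subseteq> (\<Union>i<Suc N. ?A i)"
    proof
      fix t assume t: "t \<in> {a..b}"
      show "t \<in> (\<Union>i<Suc N. ?A i)"
      \<comment> \<open>The right endpoint goes into the last window, since its floor index would be
        N + 1; and \<delta> = 0 must be kept out of the quotient.\<close>
      proof (cases "\<delta> = 0 \<or> t = b")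
        case True
        have "t = b" using True \<delta>(2) t by auto
        moreover have "b = a + real N * \<delta> + \<delta>" using \<delta>(2) by (simp add: algebra_simps)
        ultimately show ?thesis using \<delta>(1) by (intro UN_I[of N]) auto
      next
        case False
        then have d: "0 < \<delta>" "t < b" using \<delta> t by auto
        define i where "i = nat \<lfloor>(t - a) / \<delta>\<rfloor>"
        have i: "real i \<le> (t - a) / \<delta>" "(t - a) / \<delta> < real i + 1"
          using t d by (auto simp: i_def of_nat_nat)
        have "real i * \<delta> \<le> t - a" "t - a < (real i + 1) * \<delta>"
          using i d by (simp_all add: field_simps)
        moreover have "real i * \<delta> < real (Suc N) * \<delta>" using calculation(1) d \<delta>(2) by simp
        then have "i < Suc N" using d by simp
        ultimately show ?thesis by (intro UN_I[of i]) (auto simp: algebra_simps)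
      qed
    qed
    have "measure (spec_density (times_limit \<theta>)) {a..b} \<le> measure (spec_density (times_limit \<theta>)) (\<Union>i<Suc N. ?A i)"
      using cover by (intro finite_measure_mono) auto
    also have "\<dots> \<le> (\<Sum>i<Suc N. measure (spec_density (times_limit \<theta>)) (?A i))"
      by (intro finite_measure_subadditive_finite) auto
    also have "\<dots> \<le> (\<Sum>i<Suc N. (C * \<delta>)\<^sup>2)"
    proof (rule sum_mono)
      fix i assume "i \<in> {..<Suc N}"
      then have "(real i + 1) * \<delta> \<le> real (Suc N) * \<delta>" using \<delta>(1) by (intro mult_right_mono) auto
      then have "a + real i * \<delta> + \<delta> \<le> b" using \<delta>(2) by (simp add: algebra_simps)
      then have "L2_norm BM (E (?A i) (times_limit \<theta>)) \<le> C * \<delta>" using \<delta>(1) by (intro C) auto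
      then have "(L2_norm BM (E (?A i) (times_limit \<theta>)))\<^sup>2 \<le> (C * \<delta>)\<^sup>2" by (intro power_mono) auto
      then show "measure (spec_density (times_limit \<theta>)) (?A i) \<le> (C * \<delta>)\<^sup>2"
        using \<theta> by (subst measure_spec_density) (auto intro: times_limit_L2)
    qed
    also have "\<dots> = (C * (b - a))\<^sup>2 / real (Suc N)"
      by (simp add: \<delta>_def power_mult_distrib power_divide power2_eq_square del: of_nat_Suc)
    finally show ?thesis .
  qed
  have "(\<lambda>N. (C * (b - a))\<^sup>2 * inverse (real (Suc N))) \<longlonglongrightarrow> (C * (b - a))\<^sup>2 * 0"
    by (intro tendsto_intros LIMSEQ_inverse_real_of_nat)
  then have "measure (spec_density (times_limit \<theta>)) {a..b} \<le> 0"
    using le by (intro LIMSEQ_le_const[of _ 0]) (auto simp: divide_inverse)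
  then have "measure (spec_density (times_limit \<theta>)) {a..b} = 0" using measure_nonneg[of "spec_density (times_limit \<theta>)" "{a..b}"] by linarith
  then show ?thesis by (simp add: emeasure_eq_measure)
qed

text \<open>The projection kills \<open>times_limit \<theta>\<close> for every \<theta> in
  \<open>Cc\<close>, and these products exhaust \<open>Cc\<close>. By symmetry the projection of
  \<phi> is therefore orthogonal to \<open>Cc\<close>.\<close>

lemma E_upper_zero:
  assumes \<phi>: "\<phi> \<in> L2 BM"
  shows "AE z in BM. E {- (real CARD('n))\<^sup>2<..} \<phi> z = 0"
proof -
  let ?P = "{- (real CARD('n))\<^sup>2<..}"
  have h0: "L2_inner BM \<eta> (E ?P (times_limit \<theta>)) = 0" if \<theta>: "\<theta> \<in> Cc" and \<eta>: "\<eta> \<in> L2 BM" for \<theta> \<eta>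
  proof -
    have "?P = (\<Union>k. {- (real CARD('n))\<^sup>2 + 1 / real (Suc k)..real k})"
    proof (intro set_eqI iffI)
      fix t assume "t \<in> ?P"
      then have "0 < t + (real CARD('n))\<^sup>2" by simp
      then obtain k where k: "inverse (real (Suc k)) < t + (real CARD('n))\<^sup>2" using reals_Archimedean by blast
      obtain l :: nat where l: "t \<le> real l" using real_arch_simple by blast
      have "1 / real (Suc (max k l)) \<le> inverse (real (Suc k))" by (simp add: inverse_eq_divide frac_le)
      then show "t \<in> (\<Union>k. {- (real CARD('n))\<^sup>2 + 1 / real (Suc k)..real k})"
        using k l by (intro UN_I[of "max k l"]) auto
    next
      fix t assume "t \<in> (\<Union>k. {- (real CARD('n))\<^sup>2 + 1 / real (Suc k)..real k})"
      then obtain k where "- (real CARD('n))\<^sup>2 + 1 / real (Suc k) \<le> t" by auto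
      moreover have "0 < 1 / real (Suc k)" by simp
      ultimately show "t \<in> ?P" by (simp only: greaterThan_iff)
    qed
    moreover have "{- (real CARD('n))\<^sup>2 + 1 / real (Suc k)..real k} \<in> null_sets (spec_density (times_limit \<theta>))" for k
    proof (cases "- (real CARD('n))\<^sup>2 + 1 / real (Suc k) \<le> real k")
      case True
      have "- (real CARD('n))\<^sup>2 < - (real CARD('n))\<^sup>2 + 1 / real (Suc k)" by simp
      then show ?thesis using spec_density_times_limit_interval[OF \<theta> _ True] by (auto simp: null_sets_def)
    qed simp
    ultimately have "?P \<in> null_sets (spec_density (times_limit \<theta>))" by (simp only: null_sets_UN)
    then have "L2_norm BM (E ?P (times_limit \<theta>)) = 0"
      using emeasure_spec_density[OF times_limit_L2[OF \<theta>], of ?P] by (auto simp: null_sets_def)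
    moreover have "E ?P (times_limit \<theta>) \<in> L2 BM" using \<theta> by (intro E_L2 times_limit_L2) auto
    ultimately show ?thesis using L2_Cauchy_Schwarz[OF \<eta>, of "E ?P (times_limit \<theta>)"] by simp
  qed
  have EL: "E ?P \<phi> \<in> L2 BM" using \<phi> by (simp add: E_L2)
  have z: "L2_inner BM (E ?P \<phi>) \<theta> = 0" if \<theta>: "\<theta> \<in> Cc" for \<theta>
  proof -
    have "continuous_on unit_ball (\<lambda>z :: complex ^ 'n. complex_of_real (1 / kern_limit z))"
      using kern_limit_pos by (intro continuous_intros continuous_on_kern_limit) force
    then have c: "(\<lambda>z. of_real (1 / kern_limit z) * \<theta> z) \<in> Cc" using \<theta> by (rule Cc_mult)
    have "L2_inner BM (E ?P \<phi>) \<theta> = L2_inner BM (E ?P \<phi>) (times_limit (\<lambda>z. of_real (1 / kern_limit z) * \<theta> z))"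
      unfolding L2_inner_def
    proof (intro Bochner_Integration.integral_cong refl)
      fix z :: "complex ^ 'n" assume "z \<in> space BM"
      then have "kern_limit z \<noteq> 0" using kern_limit_pos[of z] by simp
      then show "E ?P \<phi> z * cnj (\<theta> z) = E ?P \<phi> z * cnj (times_limit (\<lambda>z. of_real (1 / kern_limit z) * \<theta> z) z)" by simp
    qed
    also have "\<dots> = L2_inner BM \<phi> (E ?P (times_limit (\<lambda>z. of_real (1 / kern_limit z) * \<theta> z)))"
      using \<phi> c by (intro E_sym times_limit_L2) auto
    also have "\<dots> = 0" using c \<phi> by (rule h0)
    finally show ?thesis .
  qed
  show ?thesis
  proof (rule Cc_test_zero[OF L2_measurable[OF EL]])
    fix \<theta> :: "complex ^ 'n \<Rightarrow> complex" assume \<theta>: "\<theta> \<in> Cc"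
    show "integrable BM (\<lambda>z. E ?P \<phi> z * \<theta> z)" by (intro L2_prod_integrable EL Cc_L2[OF \<theta>])
    show "(LINT z|BM. E ?P \<phi> z * \<theta> z) = 0" using z[OF Cc_cnj[OF \<theta>]] by (simp add: L2_inner_def)
  qed
qed

lemma spec_density_upper_zero:
  assumes \<phi>: "\<phi> \<in> L2 BM"
  shows "AE t in spec_density \<phi>. t \<le> - (real CARD('n))\<^sup>2"
proof -
  let ?P = "{- (real CARD('n))\<^sup>2<..}"
  have "L2_inner BM (E ?P \<phi>) \<phi> = L2_inner BM (\<lambda>z. 0) \<phi>"
    using E_upper_zero[OF \<phi>] \<phi> by (intro L2_inner_cong_AE) (auto intro!: L2_measurable E_L2)
  then have "(L2_norm BM (E ?P \<phi>))\<^sup>2 = 0"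
    using E_self[of ?P \<phi>] \<phi> by (simp add: L2_inner_zero_left)
  then have "?P \<in> null_sets (spec_density \<phi>)" using \<phi> by (simp add: null_sets_def emeasure_spec_density)
  then have "AE t in spec_density \<phi>. t \<notin> ?P" by (rule AE_not_in)
  then show ?thesis by eventually_elim simp
qed

text \<open>The symbol of \<open>kern_op s\<close> up to the factor \<open>n!\<close>; beyond \<open>-n\<^sup>2\<close> the spectral measure vanishes, so that
  the value there does not matter.\<close>

definition kern_symbol :: "real \<Rightarrow> real \<Rightarrow> complex" where
  "kern_symbol s t = indicator {..- (real CARD('n))\<^sup>2} t * of_real (1 / inv_symbol (real CARD('n)) s t)"

lemma kern_symbol_bound:
  assumes s: "real CARD('n) / 2 < s"
  obtains C where "\<And>t. cmod (kern_symbol s t) \<le> C"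
proof -
  obtain c where c: "0 < c" "\<And>t. t \<le> - (real CARD('n))\<^sup>2 \<Longrightarrow> c \<le> inv_symbol (real CARD('n)) s t" using inv_symbol_lower[OF s] by blast
  show ?thesis
  proof (rule that[of "1 / c"])
    fix t show "cmod (kern_symbol s t) \<le> 1 / c"
    proof (cases "t \<le> - (real CARD('n))\<^sup>2")
      case True
      have "1 / inv_symbol (real CARD('n)) s t \<le> 1 / c" using c(1) c(2)[OF True] by (intro frac_le) auto
      then show ?thesis using True c(1) c(2)[OF True] by (simp add: kern_symbol_def norm_divide)
    qed (use c(1) in \<open>simp add: kern_symbol_def\<close>)
  qed
qed

lemma bounded_borel_kern_symbol:
  assumes s: "real CARD('n) / 2 < s"
  shows "bounded_borel (kern_symbol s)"
proof -
  obtain C where C: "\<And>t. cmod (kern_symbol s t) \<le> C" using kern_symbol_bound[OF s] by blast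
  have "0 < s" using s by (meson divide_nonneg_nonneg le_less_trans of_nat_0_le_iff zero_le_numeral)
  then have m: "inv_symbol (real CARD('n)) s \<in> borel_measurable borel" by (rule inv_symbol_measurable)
  have "kern_symbol s \<in> borel_measurable borel" unfolding kern_symbol_def[abs_def] using m by measurable
  then show ?thesis using C by (rule bounded_borelI)
qed

lemma spec_form_cong_AE:
  assumes "\<And>t. t \<le> - (real CARD('n))\<^sup>2 \<Longrightarrow> f t = g t" "f \<in> borel_measurable borel" "g \<in> borel_measurable borel"
    "\<phi> \<in> L2 BM" "\<eta> \<in> L2 BM"
  shows "spec_form f \<phi> \<eta> = spec_form g \<phi> \<eta>"
proof -
  have "integral\<^sup>L (spec_density (\<lambda>x. \<phi> x + c * \<eta> x)) f = integral\<^sup>L (spec_density (\<lambda>x. \<phi> x + c * \<eta> x)) g" for c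
  proof (rule integral_cong_AE)
    have "AE t in spec_density (\<lambda>x. \<phi> x + c * \<eta> x). t \<le> - (real CARD('n))\<^sup>2" using assms by (intro spec_density_upper_zero L2_lin)
    then show "AE t in spec_density (\<lambda>x. \<phi> x + c * \<eta> x). f t = g t" by eventually_elim (rule assms(1))
  qed (use assms in auto)
  then show ?thesis by (simp add: spec_form_def)
qed

text \<open>\<open>E_times_limit\<close> inverted: on the spectrum the reciprocal of
  \<open>inv_symbol\<close> is bounded, so \<open>spec_form_transfer\<close> may multiply by it.
  Bounded windows are exhausted at the end, which loses nothing because the part beyond -n^2 carries
  no mass.\<close>

lemma kern_op_calculus_times_limit:
  assumes \<theta>: "\<theta> \<in> Cc" and s: "real CARD('n) / 2 < s" and \<phi>: "\<phi> \<in> L2 BM"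
  shows "L2_inner BM (kern_op s \<theta>) \<phi> = spec_form (kern_symbol s) (times_limit \<theta>) \<phi>"
proof (rule LIMSEQ_unique)
  let ?A = "\<lambda>R::nat. {- real R..- (real CARD('n))\<^sup>2}"
  have s0: "0 < s" using s by (meson divide_nonneg_nonneg le_less_trans of_nat_0_le_iff zero_le_numeral)
  have L: "times_limit \<theta> \<in> L2 BM" "kern_op s \<theta> \<in> L2 BM" using \<theta> s by (auto intro: times_limit_L2 kern_op_L2)
  obtain C where C: "\<And>t. cmod (kern_symbol s t) \<le> C" using kern_symbol_bound[OF s] by blast
  note G = bounded_borel_kern_symbol[OF s]
  obtain c where c: "0 < c" "\<And>t. t \<le> - (real CARD('n))\<^sup>2 \<Longrightarrow> c \<le> inv_symbol (real CARD('n)) s t" using inv_symbol_lower[OF s] by blast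
  have ind: "bounded_borel (\<lambda>t. indicator (?A R) t)" for R by (intro bounded_borel_indicator) simp
  have eq: "spec_form (indicator (?A R)) (kern_op s \<theta>) \<phi> = spec_form (\<lambda>t. indicator (?A R) t * kern_symbol s t) (times_limit \<theta>) \<phi>" for R
  proof -
    have A: "?A R \<in> sets borel" "bounded (?A R)" by auto
    let ?d = "\<lambda>t. indicator (?A R) t * complex_of_real (inv_symbol (real CARD('n)) s t)"
    have "spec_form (\<lambda>t. indicator (?A R) t * kern_symbol s t) (times_limit \<theta>) \<phi> = spec_form (\<lambda>t. kern_symbol s t * indicator (?A R) t) (times_limit \<theta>) \<phi>"
      by (simp only: mult.commute)
    also have "\<dots> = spec_form (kern_symbol s) (E (?A R) (times_limit \<theta>)) \<phi>"
      using G A L \<phi> by (simp only: spec_form_E_left)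
    also have "\<dots> = spec_form (\<lambda>t. kern_symbol s t * ?d t) (kern_op s \<theta>) \<phi>"
    proof (rule spec_form_transfer[OF G bounded_borel_inv_symbol[OF A s0] L(2) _ \<phi>])
      show "E (?A R) (times_limit \<theta>) \<in> L2 BM" using A L by (intro E_L2)
      fix B :: "real set" assume B: "B \<in> sets borel"
      have "L2_inner BM (E B (E (?A R) (times_limit \<theta>))) \<phi> = L2_inner BM (E (B \<inter> ?A R) (times_limit \<theta>)) \<phi>"
        using B A L \<phi> by (intro E_E)
      also have "\<dots> = spec_form (\<lambda>t. indicator (B \<inter> ?A R) t * of_real (inv_symbol (real CARD('n)) s t)) (kern_op s \<theta>) \<phi>"
        using B by (intro E_times_limit \<theta> s \<phi>) (auto intro: bounded_subset[OF A(2)])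
      also have "(\<lambda>t. indicator (B \<inter> ?A R) t * complex_of_real (inv_symbol (real CARD('n)) s t)) = (\<lambda>t. indicator B t * ?d t)"
        by (auto simp: indicator_def)
      finally show "L2_inner BM (E B (E (?A R) (times_limit \<theta>))) \<phi> = spec_form (\<lambda>t. indicator B t * ?d t) (kern_op s \<theta>) \<phi>" .
    qed
    \<comment> \<open>The window lies below -n^2, where \<open>inv_symbol\<close> is at least c > 0
      and cancels against its reciprocal.\<close>
    also have "(\<lambda>t. kern_symbol s t * ?d t) = indicator (?A R)"
    proof
      fix t show "kern_symbol s t * ?d t = indicator (?A R) t"
        using c(1) c(2)[of t] by (auto simp: kern_symbol_def indicator_def)
    qed
    finally show ?thesis by simp
  qed
  have lim: "(\<lambda>R. indicator (?A R) t :: complex) \<longlonglongrightarrow> indicator {..- (real CARD('n))\<^sup>2} t" for t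
  proof -
    obtain R0 :: nat where R0: "- t \<le> real R0" using real_arch_simple by blast
    have "indicator (?A R) t = (indicator {..- (real CARD('n))\<^sup>2} t :: complex)" if "R \<ge> R0" for R
      using R0 that by (auto simp: indicator_def)
    then show ?thesis by (intro tendsto_eventually eventually_sequentiallyI)
  qed
  have "(\<lambda>R. spec_form (indicator (?A R)) (kern_op s \<theta>) \<phi>) \<longlonglongrightarrow> spec_form (indicator {..- (real CARD('n))\<^sup>2}) (kern_op s \<theta>) \<phi>"
    using ind L \<phi> lim by (intro spec_form_lim[where C = 1] bounded_borel_indicator) (auto simp: indicator_def)
  also have "spec_form (indicator {..- (real CARD('n))\<^sup>2}) (kern_op s \<theta>) \<phi> = spec_form (indicator UNIV) (kern_op s \<theta>) \<phi>"
    using L \<phi> by (intro spec_form_cong_AE) (auto simp: indicator_def)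
  also have "\<dots> = L2_inner BM (kern_op s \<theta>) \<phi>"
    by (subst spec_form_indicator[OF _ L(2) \<phi>]) (simp_all add: E_UNIV L(2) \<phi>)
  finally show "(\<lambda>R. spec_form (indicator (?A R)) (kern_op s \<theta>) \<phi>) \<longlonglongrightarrow> L2_inner BM (kern_op s \<theta>) \<phi>" .
  have "(\<lambda>R. spec_form (\<lambda>t. indicator (?A R) t * kern_symbol s t) (times_limit \<theta>) \<phi>) \<longlonglongrightarrow> spec_form (kern_symbol s) (times_limit \<theta>) \<phi>"
  proof (rule spec_form_lim[where C = C])
    show "bounded_borel (\<lambda>t. indicator (?A R) t * kern_symbol s t)" for R by (intro bounded_borel_mult ind G)
    show "cmod (indicator (?A R) t * kern_symbol s t) \<le> C" for R t
      using C[of t] order_trans[OF norm_ge_zero C[of t]] by (auto simp: norm_mult indicator_def)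
    show "(\<lambda>R. indicator (?A R) t * kern_symbol s t) \<longlonglongrightarrow> kern_symbol s t" for t
    proof -
      have "(\<lambda>R. indicator (?A R) t * kern_symbol s t) \<longlonglongrightarrow> indicator {..- (real CARD('n))\<^sup>2} t * kern_symbol s t" by (intro tendsto_mult lim tendsto_const)
      moreover have "indicator {..- (real CARD('n))\<^sup>2} t * kern_symbol s t = kern_symbol s t" by (simp add: kern_symbol_def indicator_def)
      ultimately show ?thesis by (simp only:)
    qed
  qed (use G L \<phi> in auto)
  then show "(\<lambda>R. spec_form (indicator (?A R)) (kern_op s \<theta>) \<phi>) \<longlonglongrightarrow> spec_form (kern_symbol s) (times_limit \<theta>) \<phi>" by (simp only: eq)
qed

end

section \<open>Constancy of the limit function\<close>

lemma continuous_AE_zero: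
  fixes f :: "complex ^ 'n \<Rightarrow> complex"
  assumes "continuous_on unit_ball f" "AE z in BM. f z = 0" "z \<in> unit_ball"
  shows "f z = 0"
proof (rule ccontr)
  assume nz: "f z \<noteq> 0"
  let ?S = "f -` (- {0}) \<inter> unit_ball"
  have o: "open ?S" using assms(1) by (simp add: continuous_on_open_vimage open_Compl)
  have "AE x in lborel. x \<notin> ?S" using assms(2) unfolding AE_bergman_iff by eventually_elim auto
  then have "?S \<in> null_sets lborel"
    using o by (subst (asm) AE_iff_null_sets[symmetric]) auto
  then have "negligible ?S" by (simp add: negligible_iff_null_sets null_sets_completionI)
  moreover have "z \<in> ?S" using nz assms(3) by simp
  ultimately show False using open_not_negligible[OF o] by blast
qed

text \<open>Continuity allows an identity that holds almost everywhere to be evaluated at the single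
  point 0.\<close>

lemma kern_op_continuous:
  fixes \<theta> :: "complex ^ 'n \<Rightarrow> complex"
  assumes \<theta>: "\<theta> \<in> Cc" and s: "0 \<le> s"
  shows "continuous_on unit_ball (kern_op s \<theta>)"
proof (rule continuous_on_sequentiallyI)
  fix x :: "nat \<Rightarrow> complex ^ 'n" and a
  assume x: "\<forall>n. x n \<in> unit_ball" and a: "a \<in> unit_ball" and lim: "x \<longlonglongrightarrow> a"
  have m [measurable]: "\<theta> \<in> borel_measurable BM" using \<theta> by (intro L2_measurable Cc_L2)
  show "(\<lambda>n. kern_op s \<theta> (x n)) \<longlonglongrightarrow> kern_op s \<theta> a"
    unfolding kern_op_def
  proof (rule integral_dominated_convergence[where w = "\<lambda>w. cmod (\<theta> w)"])
    show "integrable BM (\<lambda>w. cmod (\<theta> w))" using Cc_integrable[OF \<theta>] by (rule integrable_norm)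
    show "AE w in BM. norm (of_real (kern s (x n) w) * \<theta> w) \<le> cmod (\<theta> w)" for n
    proof (rule AE_I2)
      fix w :: "complex ^ 'n" assume "w \<in> space BM"
      then have "kern s (x n) w \<le> 1" using x s by (intro kern_le_1) auto
      then show "norm (of_real (kern s (x n) w) * \<theta> w) \<le> cmod (\<theta> w)"
        using mult_right_mono[of "kern s (x n) w" 1 "cmod (\<theta> w)"] by (simp add: norm_mult kern_nonneg)
    qed
    show "AE w in BM. (\<lambda>n. of_real (kern s (x n) w) * \<theta> w) \<longlonglongrightarrow> of_real (kern s a w) * \<theta> w"
    proof (rule AE_I2)
      fix w :: "complex ^ 'n" assume "w \<in> space BM"
      then have w: "norm w < 1" "norm a < 1" using a by auto
      have "(\<lambda>n. inv_cosh2 (x n) w) \<longlonglongrightarrow> inv_cosh2 a w"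
        unfolding inv_cosh2_def using one_minus_herm_nz[OF w(2,1)] by (intro tendsto_intros lim) auto
      then have "(\<lambda>n. kern s (x n) w) \<longlonglongrightarrow> kern s a w"
        unfolding kern_def using inv_cosh2_pos[OF w(2,1)] by (intro tendsto_powr tendsto_const) auto
      then show "(\<lambda>n. of_real (kern s (x n) w) * \<theta> w) \<longlonglongrightarrow> of_real (kern s a w) * \<theta> w"
        by (intro tendsto_intros)
    qed
  qed (auto simp: m)
qed

lemma kern_limit_measurable: "(\<lambda>z :: complex ^ 'n. complex_of_real (kern_limit z)) \<in> borel_measurable BM"
proof -
  have "continuous_on unit_ball (\<lambda>z :: complex ^ 'n. complex_of_real (kern_limit z))"
    by (intro continuous_on_of_real continuous_on_kern_limit)
  then show ?thesis
    by (simp add: measurable_cong_sets[OF sets_bergman refl] borel_measurable_continuous_on_restrict)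
qed

context bergman_spectral begin

text \<open>Both \<open>kern_op s\<close> and \<open>kern_op s\<close> composed with the inverse of this multiplication are symmetric.\<close>

lemma kern_op_times_limit_commute:
  fixes \<theta> :: "complex ^ 'n \<Rightarrow> complex"
  assumes \<theta>: "\<theta> \<in> Cc" and s: "real CARD('n) / 2 < s" and z: "z \<in> unit_ball"
  shows "kern_op s (times_limit \<theta>) z = of_real (kern_limit z) * kern_op s \<theta> z"
proof -
  have s0: "0 \<le> s" using s by (meson divide_nonneg_nonneg less_imp_le order_trans of_nat_0_le_iff zero_le_numeral)
  let ?f = "\<lambda>z. cnj (of_real (kern_limit z) * kern_op s \<theta> z - kern_op s (times_limit \<theta>) z)"
  have c: "continuous_on unit_ball ?f"
    using \<theta> s0 by (intro continuous_intros continuous_on_kern_limit kern_op_continuous kern_limit_Cc)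
  have K: "kern_op s \<theta> \<in> L2 BM" "kern_op s (times_limit \<theta>) \<in> L2 BM" using \<theta> s by (auto intro!: kern_op_L2 kern_limit_Cc)
  have "AE z in BM. ?f z = 0"
  proof (rule Cc_test_zero)
    show "?f \<in> borel_measurable BM"
      using kern_limit_measurable K[THEN L2_measurable] by measurable
    fix \<eta> :: "complex ^ 'n \<Rightarrow> complex" assume \<eta>: "\<eta> \<in> Cc"
    have e: "?f z * \<eta> z = times_limit \<eta> z * cnj (kern_op s \<theta> z) - \<eta> z * cnj (kern_op s (times_limit \<theta>) z)" for z
      by (simp add: algebra_simps)
    have i: "integrable BM (\<lambda>z. times_limit \<eta> z * cnj (kern_op s \<theta> z))" "integrable BM (\<lambda>z. \<eta> z * cnj (kern_op s (times_limit \<theta>) z))"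
      using \<eta> K by (auto intro: L2_inner_integrable times_limit_L2 Cc_L2)
    show "integrable BM (\<lambda>z. ?f z * \<eta> z)"
      unfolding e using i by (rule Bochner_Integration.integrable_diff)
    have L: "times_limit \<eta> \<in> L2 BM" "times_limit \<theta> \<in> L2 BM" "\<eta> \<in> L2 BM" using \<theta> \<eta> by (auto intro: times_limit_L2 Cc_L2)
    have g: "(\<lambda>t. cnj (kern_symbol s t)) = kern_symbol s" by (auto simp: kern_symbol_def indicator_def)
    have "L2_inner BM \<eta> (kern_op s (times_limit \<theta>)) = L2_inner BM (kern_op s \<eta>) (times_limit \<theta>)"
      using \<theta> L s by (intro kern_op_swap(2)[symmetric] kern_limit_Cc)
    also have "\<dots> = spec_form (kern_symbol s) (times_limit \<eta>) (times_limit \<theta>)" using \<eta> s L by (intro kern_op_calculus_times_limit)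
    also have "\<dots> = cnj (spec_form (kern_symbol s) (times_limit \<theta>) (times_limit \<eta>))"
      using spec_form_cnj[OF bounded_borel_kern_symbol[OF s] L(2,1)] by (simp only: g)
    also have "\<dots> = cnj (L2_inner BM (kern_op s \<theta>) (times_limit \<eta>))"
      using \<theta> s L by (simp only: kern_op_calculus_times_limit)
    also have "\<dots> = L2_inner BM (times_limit \<eta>) (kern_op s \<theta>)" by (rule L2_inner_cnj[symmetric])
    finally show "(LINT z|BM. ?f z * \<eta> z) = 0"
      unfolding e using i by (simp add: L2_inner_def)
  qed
  then have "?f z = 0" by (rule continuous_AE_zero[OF c _ z])
  then have "of_real (kern_limit z) * kern_op s \<theta> z - kern_op s (times_limit \<theta>) z = 0" by (simp only: complex_cnj_zero_iff)
  then show ?thesis by simp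
qed

text \<open>The commutation relation is evaluated at z = 0, where the value n! of
  \<open>kern_limit\<close> is known. It says that the positive kernel at 0 times the difference of
  \<open>kern_limit\<close> and n! is orthogonal to all of \<open>Cc\<close>.\<close>

lemma kern_limit_const: "AE z in BM. kern_limit (z :: complex ^ 'n) = fact CARD('n)"
proof -
  let ?s = "real CARD('n)"
  let ?k = "\<lambda>w :: complex ^ 'n. complex_of_real (kern ?s 0 w)"
  have s: "real CARD('n) / 2 < ?s" by simp
  have "AE w in BM. ?k w * (of_real (kern_limit w) - of_real (fact CARD('n))) = 0"
  proof (rule Cc_test_zero)
    show "(\<lambda>w. ?k w * (of_real (kern_limit w) - of_real (fact CARD('n)))) \<in> borel_measurable BM"
      using kern_limit_measurable by measurable
    fix \<theta> :: "complex ^ 'n \<Rightarrow> complex" assume \<theta>: "\<theta> \<in> Cc"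
    have e: "?k w * (of_real (kern_limit w) - of_real (fact CARD('n))) * \<theta> w =
      ?k w * times_limit \<theta> w - of_real (fact CARD('n)) * (?k w * \<theta> w)" for w
      by (simp add: algebra_simps)
    have i: "integrable BM (\<lambda>w. ?k w * times_limit \<theta> w)" "integrable BM (\<lambda>w. ?k w * \<theta> w)"
      using \<theta> by (auto intro: kern_L2_integrable[OF s] times_limit_L2 Cc_L2)
    show "integrable BM (\<lambda>w. ?k w * (of_real (kern_limit w) - of_real (fact CARD('n))) * \<theta> w)"
      unfolding e using i by (intro Bochner_Integration.integrable_diff integrable_mult_right)
    have "(LINT w|BM. ?k w * (of_real (kern_limit w) - of_real (fact CARD('n))) * \<theta> w) =
        kern_op ?s (times_limit \<theta>) 0 - of_real (fact CARD('n)) * kern_op ?s \<theta> 0"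
      unfolding e kern_op_def using i by (subst Bochner_Integration.integral_diff) auto
    also have "\<dots> = 0"
      using kern_op_times_limit_commute[OF \<theta> s, of 0] by (simp add: kern_limit_0)
    finally show "(LINT w|BM. ?k w * (of_real (kern_limit w) - of_real (fact CARD('n))) * \<theta> w) = 0" .
  qed
  then show ?thesis
  proof (rule AE_mp, intro AE_I2 impI)
    fix w :: "complex ^ 'n" assume w: "w \<in> space BM" and eq: "?k w * (of_real (kern_limit w) - of_real (fact CARD('n))) = 0"
    have "kern ?s 0 w \<noteq> 0" using w inv_cosh2_pos[of 0 w] by (simp add: kern_def)
    then have "complex_of_real (kern_limit w) = of_real (fact CARD('n))" using eq by simp
    then show "kern_limit w = fact CARD('n)" by (simp only: of_real_eq_iff)
  qed
qed

lemma kern_op_calculus: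
  assumes \<theta>: "\<theta> \<in> Cc" and s: "real CARD('n) / 2 < s" and \<phi>: "\<phi> \<in> L2 BM"
  shows "L2_inner BM (kern_op s \<theta>) \<phi> = spec_form (\<lambda>t. fact CARD('n) * kern_symbol s t) \<theta> \<phi>"
proof -
  let ?c = "\<lambda>z. fact CARD('n) * \<theta> z"
  note G = bounded_borel_kern_symbol[OF s]
  have L: "\<theta> \<in> L2 BM" "times_limit \<theta> \<in> L2 BM" "?c \<in> L2 BM" using \<theta> by (auto intro: times_limit_L2 Cc_L2 L2_scale)
  \<comment> \<open>\<open>spec_form\<close> depends on its first argument through spectral
    measures, so the equality almost everywhere of \<open>kern_limit_const\<close> is not directly
    usable there; the symbol is first moved to the other argument, leaving an inner product.\<close>
  obtain \<psi> where \<psi>: "calculus (\<lambda>t. cnj (kern_symbol s t)) \<phi> \<psi>"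
    using calculus_exists[OF bounded_borel_cnj[OF G] \<phi>] by blast
  have \<psi>2: "\<psi> \<in> L2 BM" using \<psi> by (simp add: calculus_def)
  have dual: "spec_form (kern_symbol s) \<eta> \<phi> = L2_inner BM \<eta> \<psi>" if "\<eta> \<in> L2 BM" for \<eta>
  proof -
    have "spec_form (\<lambda>t. cnj (kern_symbol s t)) \<phi> \<eta> = L2_inner BM \<psi> \<eta>" using \<psi> that by (simp add: calculus_def)
    then have "cnj (spec_form (\<lambda>t. cnj (kern_symbol s t)) \<phi> \<eta>) = L2_inner BM \<eta> \<psi>" by (simp only: L2_inner_cnj[symmetric])
    then show ?thesis using spec_form_cnj[OF G that \<phi>] by simp
  qed
  have "L2_inner BM (kern_op s \<theta>) \<phi> = L2_inner BM (times_limit \<theta>) \<psi>"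
    using kern_op_calculus_times_limit[OF \<theta> s \<phi>] dual[OF L(2)] by simp
  also have "\<dots> = L2_inner BM ?c \<psi>"
    by (intro L2_inner_cong_AE L2_measurable L \<psi>2) (use kern_limit_const in \<open>auto elim: eventually_mono\<close>)
  also have "\<dots> = fact CARD('n) * spec_form (kern_symbol s) \<theta> \<phi>"
    using dual[OF L(1)] by (simp add: L2_inner_scale_left)
  finally show ?thesis using spec_form_scale[OF G L(1) \<phi>] by simp
qed

end

section \<open>Jacobi and Wilson polynomials\<close>

lemma eval_fps_hypergeo_terminating:
  fixes z :: "'a :: {banach, real_normed_field}"
  shows "eval_fps (fps_hypergeo (- of_nat k # as) bs 1) z =
    (\<Sum>j\<le>k. fps_nth (fps_hypergeo (- of_nat k # as) bs 1) j * z ^ j)"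
proof -
  have "foldl (\<lambda>r a. r * pochhammer a j) x cs = 0 \<longleftrightarrow> x = 0 \<or> (\<exists>a\<in>set cs. pochhammer a j = 0)"
    for x :: 'a and cs :: "'a list" and j
    by (induction cs arbitrary: x) auto
  moreover have "pochhammer (- of_nat k :: 'a) j = 0" if "j \<notin> {..k}" for j
    using that by (simp add: pochhammer_of_nat_eq_0_iff)
  ultimately have "fps_nth (fps_hypergeo (- of_nat k # as) bs 1) j * z ^ j = 0" if "j \<notin> {..k}" for j
    using that by simp
  then show ?thesis unfolding eval_fps_def by (intro suminf_finite) auto
qed

text \<open>The Jacobi polynomial with parameters a - 1 and c - a at 1 - 2 t. In the parameters a
  and c the hypergeometric sum has upper entries -k, k + c and lower entry a, and reflection
  exchanges a with c + 1 - a while c stays.\<close>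

definition jacobi_poly :: "real \<Rightarrow> real \<Rightarrow> nat \<Rightarrow> real \<Rightarrow> real" where
  "jacobi_poly a c k t = pochhammer a k / fact k *
     (\<Sum>i\<le>k. pochhammer (- real k) i * pochhammer (real k + c) i / (pochhammer a i * fact i) * t ^ i)"

lemma jacobi_jacobi_poly:
  assumes "0 < a"
  shows "jacobi k (a - 1) \<beta> (1 - 2 * t) = jacobi_poly a (a + \<beta>) k t"
proof -
  have "a \<notin> \<int>\<^sub>\<le>\<^sub>0" using assms by (auto elim!: nonpos_Ints_cases)
  then have "pochhammer a k = Gamma (a + real k) / Gamma a" by (rule pochhammer_Gamma)
  moreover have "real k + (a - 1) + \<beta> + 1 = real k + (a + \<beta>)" by simp
  ultimately show ?thesis
    by (simp add: jacobi_def jacobi_poly_def eval_fps_hypergeo_terminating[of k] add_ac)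
qed

lemma pochhammer_neg_nat:
  assumes "j \<le> m"
  shows "pochhammer (- real m) j = (-1) ^ j * fact m / fact (m - j)"
proof -
  have f: "(fact m :: real) = fact (m - j) * pochhammer (1 + real (m - j)) j"
    using pochhammer_product'[of "1 :: real" "m - j" j] assms by (simp add: pochhammer_fact)
  have e: "real m - real j + 1 = 1 + real (m - j)" using assms by simp
  show ?thesis unfolding pochhammer_minus e f by simp
qed

lemma pochhammer_reverse:
  assumes "q \<le> m" "0 < (a :: real)"
  shows "pochhammer (1 - a - real m) q = (-1) ^ q * pochhammer a m / pochhammer a (m - q)"
proof -
  have "pochhammer a m = pochhammer a (m - q) * pochhammer (a + real (m - q)) q"
    using pochhammer_product'[of a "m - q" q] assms by simp
  moreover have "pochhammer (1 - a - real m) q = (-1) ^ q * pochhammer (a + real (m - q)) q"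
    using pochhammer_minus[of "a + real m - 1" q] assms by (simp add: of_nat_diff algebra_simps)
  ultimately show ?thesis using pochhammer_pos[OF assms(2), of "m - q"] by simp
qed

text \<open>The sum read from its highest power downwards. The reversed Pochhammer symbols are the
  ones with negative arguments that appear in \<open>S_coeff\<close>.\<close>

lemma jacobi_poly_reverse:
  assumes "0 < a" "0 < c"
  shows "jacobi_poly a c m t = (-1) ^ m * pochhammer (real m + c) m / fact m *
    (\<Sum>q\<le>m. pochhammer (- real m) q * pochhammer (1 - a - real m) q /
      (pochhammer (1 - c - 2 * real m) q * fact q) * t ^ (m - q))"
proof -
  have "jacobi_poly a c m t = pochhammer a m / fact m *
     (\<Sum>q\<le>m. pochhammer (- real m) (m - q) * pochhammer (real m + c) (m - q) /
       (pochhammer a (m - q) * fact (m - q)) * t ^ (m - q))"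
    unfolding jacobi_poly_def by (intro arg_cong2[of _ _ _ _ "(*)"] refl sum.reindex_bij_witness[of _ "\<lambda>i. m - i" "\<lambda>i. m - i"]) auto
  also have "\<dots> = (-1) ^ m * pochhammer (real m + c) m / fact m *
    (\<Sum>q\<le>m. pochhammer (- real m) q * pochhammer (1 - a - real m) q /
      (pochhammer (1 - c - 2 * real m) q * fact q) * t ^ (m - q))"
    unfolding sum_distrib_left
  proof (rule sum.cong[OF refl])
    fix q assume "q \<in> {..m}"
    then have q: "q \<le> m" by simp
    have c': "0 < real m + c" using assms by simp
    have 1: "pochhammer (1 - c - 2 * real m) q = (-1) ^ q * pochhammer (real m + c) m / pochhammer (real m + c) (m - q)"
      using pochhammer_reverse[OF q c'] by (simp add: algebra_simps)
    have 2: "pochhammer (- real m) (m - q) = (-1) ^ m * (-1) ^ q * fact m / fact q"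
      using pochhammer_neg_nat[of "m - q" m] q by (simp add: power_diff_conv_inverse minus_one_power_iff)
    have nz: "pochhammer a m \<noteq> 0" "pochhammer a (m - q) \<noteq> 0" "pochhammer (real m + c) m \<noteq> 0" "pochhammer (real m + c) (m - q) \<noteq> 0"
      using pochhammer_pos[OF assms(1)] pochhammer_pos[OF c'] by (auto simp: less_imp_neq[symmetric])
    have s: "((-1) ^ q :: real) * (-1) ^ q = 1" by (simp flip: power_add)
    show "pochhammer a m / fact m * (pochhammer (- real m) (m - q) * pochhammer (real m + c) (m - q) /
       (pochhammer a (m - q) * fact (m - q)) * t ^ (m - q)) =
      (-1) ^ m * pochhammer (real m + c) m / fact m * (pochhammer (- real m) q * pochhammer (1 - a - real m) q /
      (pochhammer (1 - c - 2 * real m) q * fact q) * t ^ (m - q))"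
      unfolding 1 2 pochhammer_neg_nat[OF q] pochhammer_reverse[OF q assms(1)]
      using nz s by (simp add: divide_simps)
  qed
  finally show ?thesis .
qed

lemma sum_shift_0:
  assumes "i \<le> (l :: nat)"
  shows "(\<Sum>k=i..l. f k) = (\<Sum>p=0..l - i. f (p + i))"
  using sum.shift_bounds_cl_nat_ivl[of f 0 i "l - i"] assms by simp

text \<open>The symmetry of Jacobi polynomials under a change of sign of the variable. After
  binomial expansion of the powers of 1 - x, each coefficient is a Chu-Vandermonde sum. It is used
  to pass from tanh^2 d to cosh^(-2) d = 1 - tanh^2 d.\<close>

lemma jacobi_poly_reflect:
  assumes "0 < a" "0 < b" "a + b = c + 1"
  shows "jacobi_poly a c k (1 - x) = (-1) ^ k * jacobi_poly b c k x"
proof -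
  have inner: "(\<Sum>i\<le>k. pochhammer (- real k) i * pochhammer (real k + c) i / (pochhammer a i * fact i) *
      (real (i choose j) * (-1) ^ j)) * pochhammer a k = (-1) ^ k * pochhammer b k * (pochhammer (- real k) j * pochhammer (real k + c) j / (pochhammer b j * fact j))"
    if j: "j \<le> k" for j
  proof -
    let ?A = "a + real j"
    have A: "0 < ?A" using assms by simp
    have "(\<Sum>i\<le>k. pochhammer (- real k) i * pochhammer (real k + c) i / (pochhammer a i * fact i) *
      (real (i choose j) * (-1) ^ j)) =
      (\<Sum>i=j..k. pochhammer (- real k) i * pochhammer (real k + c) i / (pochhammer a i * fact i) *
      (real (i choose j) * (-1) ^ j))"
      using j by (intro sum.mono_neutral_right) auto
    also have "\<dots> = (\<Sum>p=0..k - j. pochhammer (- real k) (p + j) * pochhammer (real k + c) (p + j) /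
      (pochhammer a (p + j) * fact (p + j)) * (real ((p + j) choose j) * (-1) ^ j))"
      by (rule sum_shift_0[OF j])
    also have "\<dots> = (-1) ^ j * pochhammer (- real k) j * pochhammer (real k + c) j / (pochhammer a j * fact j) *
      (\<Sum>p=0..k - j. pochhammer (real k + c + real j) p * pochhammer (- real (k - j)) p / (fact p * pochhammer ?A p))"
      unfolding sum_distrib_left
    proof (rule sum.cong[OF refl])
      fix p assume "p \<in> {0..k - j}"
      have 1: "real ((p + j) choose j) = fact (p + j) / (fact j * fact p)"
        by (simp add: binomial_fact)
      have 2: "pochhammer (- real k) (p + j) = pochhammer (- real k) j * pochhammer (- real (k - j)) p"
        using pochhammer_product'[of "- real k" j p] j by (simp add: add.commute of_nat_diff)
      have 3: "pochhammer z (p + j) = pochhammer z j * pochhammer (z + real j) p" for z :: real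
        using pochhammer_product'[of z j p] by (simp add: add.commute)
      have g: "X * Y * (Z * W) / (U * V * F) * (F / (f * g) * e) = e * X * Z / (U * f) * (W * Y / (g * V))"
        if "F \<noteq> 0" for X Y Z W U V F f g e :: real
        using that by (simp add: mult_ac)
      show "pochhammer (- real k) (p + j) * pochhammer (real k + c) (p + j) /
          (pochhammer a (p + j) * fact (p + j)) * (real ((p + j) choose j) * (-1) ^ j) =
        (-1) ^ j * pochhammer (- real k) j * pochhammer (real k + c) j / (pochhammer a j * fact j) *
        (pochhammer (real k + c + real j) p * pochhammer (- real (k - j)) p / (fact p * pochhammer ?A p))"
        unfolding 1 2 3[of "real k + c"] 3[of a] by (rule g) simp
    qed
    also have "(\<Sum>p=0..k - j. pochhammer (real k + c + real j) p * pochhammer (- real (k - j)) p / (fact p * pochhammer ?A p)) =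
        pochhammer (?A - (real k + c + real j)) (k - j) / pochhammer ?A (k - j)"
      using Vandermonde_pochhammer[of "k - j" ?A "real k + c + real j"] A by simp
    also have "?A - (real k + c + real j) = 1 - b - real k" using assms(3) by simp
    also have "pochhammer (1 - b - real k) (k - j) = (-1) ^ (k - j) * pochhammer b k / pochhammer b j"
      using pochhammer_reverse[of "k - j" k b] assms j by simp
    finally have 1: "(\<Sum>i\<le>k. pochhammer (- real k) i * pochhammer (real k + c) i / (pochhammer a i * fact i) *
      (real (i choose j) * (-1) ^ j)) =
      (-1) ^ j * pochhammer (- real k) j * pochhammer (real k + c) j / (pochhammer a j * fact j) *
      ((-1) ^ (k - j) * pochhammer b k / pochhammer b j / pochhammer ?A (k - j))" .
    have 2: "pochhammer a k = pochhammer a j * pochhammer ?A (k - j)" using j by (rule pochhammer_product)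
    have 3: "((-1) ^ k :: real) = (-1) ^ j * (-1) ^ (k - j)" using j by (simp flip: power_add)
    have g: "e * P * Q / (A * f) * (s * B / b / H) * (A * H) = e * s * B * (P * Q / (b * f))"
      if "A \<noteq> 0" "H \<noteq> 0" for e P Q A f s B b H :: real
      using that by (simp add: divide_simps)
    have "pochhammer a j \<noteq> 0" "pochhammer ?A (k - j) \<noteq> 0"
      using pochhammer_pos[OF assms(1)] pochhammer_pos[OF A] by (auto simp: less_imp_neq[symmetric])
    then show ?thesis unfolding 1 2 3 by (rule g)
  qed
  have "jacobi_poly a c k (1 - x) = pochhammer a k / fact k * (\<Sum>i\<le>k. pochhammer (- real k) i * pochhammer (real k + c) i / (pochhammer a i * fact i) *
      (\<Sum>j\<le>k. real (i choose j) * (-1) ^ j * x ^ j))"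
  proof -
    have "(1 - x) ^ i = (\<Sum>j\<le>k. real (i choose j) * (-1) ^ j * x ^ j)" if i: "i \<le> k" for i
    proof -
      have "(1 - x) ^ i = (\<Sum>j\<le>i. real (i choose j) * (- x) ^ j * 1 ^ (i - j))"
        using binomial_ring[of "- x" 1 i] by simp
      also have "\<dots> = (\<Sum>j\<le>i. real (i choose j) * (-1) ^ j * x ^ j)"
        by (intro sum.cong) (simp_all add: power_minus[of x] mult_ac)
      also have "\<dots> = (\<Sum>j\<le>k. real (i choose j) * (-1) ^ j * x ^ j)"
        using i by (intro sum.mono_neutral_left) auto
      finally show ?thesis .
    qed
    then show ?thesis unfolding jacobi_poly_def by simp
  qed
  also have "\<dots> = (\<Sum>j\<le>k. (\<Sum>i\<le>k. pochhammer (- real k) i * pochhammer (real k + c) i / (pochhammer a i * fact i) *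
      (real (i choose j) * (-1) ^ j)) * pochhammer a k * x ^ j / fact k)"
    unfolding sum_distrib_left sum_distrib_right sum_divide_distrib
    by (subst sum.swap) (simp add: mult_ac)
  also have "\<dots> = (\<Sum>j\<le>k. (-1) ^ k * pochhammer b k * (pochhammer (- real k) j * pochhammer (real k + c) j / (pochhammer b j * fact j)) * x ^ j / fact k)"
    by (intro sum.cong refl) (simp only: inner atMost_iff)
  also have "\<dots> = (-1) ^ k * jacobi_poly b c k x"
    unfolding jacobi_poly_def by (simp add: sum_distrib_left mult_ac)
  finally show ?thesis .
qed

text \<open>The partial sums have a closed form proportional to \<open>M - 1 choose q\<close>, which
  vanishes at q = M. This is the inversion relation that isolates a single power in
  \<open>power_jacobi_poly\<close>.\<close>

lemma alternating_pochhammer_sum: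
  assumes c: "0 < (c :: real)"
  shows "(\<Sum>p\<le>M. (-1) ^ p * real (M choose p) * (2 * real p + c) / pochhammer (c + real p) (Suc M)) = of_bool (M = 0)"
proof (cases M)
  case 0
  then show ?thesis using c by simp
next
  case (Suc N)
  have "(\<Sum>p\<le>q. (-1) ^ p * real (M choose p) * (2 * real p + c) / pochhammer (c + real p) (Suc M)) =
      (-1) ^ q * real (N choose q) / pochhammer (c + real q + 1) M" for q
  proof (induction q)
    case 0
    have "pochhammer (c + 1) M \<noteq> 0" using pochhammer_pos[of "c + 1" M] c by simp
    then show ?case using c by (simp add: pochhammer_rec)
  next
    case (Suc q)
    let ?z = "c + real q + 1"
    have z: "0 < ?z" using c by simp
    have ab: "real (Suc q) * real (N choose Suc q) = (real N - real q) * real (N choose q)"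
    proof (cases "q \<le> N")
      case True
      have "Suc q * (N choose Suc q) = (N - q) * (N choose q)"
        by (simp only: binomial_absorption binomial_absorb_comp)
      then have "real (Suc q * (N choose Suc q)) = real ((N - q) * (N choose q))" by (rule arg_cong)
      then show ?thesis using True by (simp add: of_nat_diff algebra_simps)
    qed (simp add: binomial_eq_0)
    have p1: "pochhammer ?z (Suc M) = ?z * pochhammer (?z + 1) M" by (rule pochhammer_rec)
    have p2: "pochhammer ?z (Suc M) = (?z + real M) * pochhammer ?z M" by (rule pochhammer_rec')
    have nz: "pochhammer ?z M \<noteq> 0" "pochhammer (?z + 1) M \<noteq> 0" "?z \<noteq> 0" "?z + real M \<noteq> 0"
      using pochhammer_pos[OF z, of M] pochhammer_pos[of "?z + 1" M] z by auto
    have e1: "1 / pochhammer ?z M = (?z + real M) / pochhammer ?z (Suc M)" unfolding p2 using nz by simp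
    have e2: "1 / pochhammer (?z + 1) M = ?z / pochhammer ?z (Suc M)" unfolding p1 using nz by simp
    have ch: "real (M choose Suc q) = real (N choose q) + real (N choose Suc q)" using Suc.prems by (simp add: \<open>M = Suc N\<close>)
    have "(\<Sum>p\<le>Suc q. (-1) ^ p * real (M choose p) * (2 * real p + c) / pochhammer (c + real p) (Suc M)) =
      (-1) ^ q * real (N choose q) * (1 / pochhammer ?z M) -
      (-1) ^ q * real (M choose Suc q) * (2 * real (Suc q) + c) / pochhammer ?z (Suc M)"
      using Suc.IH by (simp add: add_ac del: binomial_Suc_Suc)
    also have "\<dots> = (-1) ^ q * (real (N choose q) * (?z + real M) - (real (N choose q) + real (N choose Suc q)) * (2 * real (Suc q) + c)) / pochhammer ?z (Suc M)"
    proof -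
      have g: "s * a * (w / P) - s * b * d / P = s * (a * w - b * d) / P" for s a w P b d :: real
        by (simp add: diff_divide_distrib right_diff_distrib)
      show ?thesis unfolding e1 ch by (rule g)
    qed
    also have "real (N choose q) * (?z + real M) - (real (N choose q) + real (N choose Suc q)) * (2 * real (Suc q) + c) =
      - (real (N choose Suc q) * ?z)"
      using ab by (simp add: \<open>M = Suc N\<close> algebra_simps)
    also have "(-1) ^ q * - (real (N choose Suc q) * ?z) / pochhammer ?z (Suc M) = (-1) ^ Suc q * real (N choose Suc q) * (1 / pochhammer (?z + 1) M)"
      unfolding e2 by simp
    finally show ?case by (simp add: add_ac)
  qed
  from this[of M] show ?thesis using Suc by simp
qed

definition power_coeff :: "real \<Rightarrow> real \<Rightarrow> nat \<Rightarrow> nat \<Rightarrow> real" where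
  "power_coeff a c L k = (-1) ^ k * pochhammer c k * (2 * real k + c) * pochhammer a L * fact L /
     (pochhammer a k * pochhammer c (Suc (L + k)) * fact (L - k))"

text \<open>After inserting the Jacobi polynomials and interchanging the sums, the coefficient of
  t^i is an instance of \<open>alternating_pochhammer_sum\<close> with c + 2 i and M = L - i, hence
  zero unless i = L.\<close>

lemma power_jacobi_poly:
  assumes "0 < a" "0 < c"
  shows "t ^ L = (\<Sum>k\<le>L. power_coeff a c L k * jacobi_poly a c k t)"
proof -
  have nz: "pochhammer a i \<noteq> 0" "pochhammer c i \<noteq> 0" for i
    using pochhammer_pos[OF assms(1), of i] pochhammer_pos[OF assms(2), of i] by auto
  let ?h = "\<lambda>k i. (-1) ^ (k + i) * pochhammer c (k + i) * (2 * real k + c) /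
     (pochhammer c (Suc (L + k)) * fact (L - k) * fact (k - i))"
  let ?b = "\<lambda>i. pochhammer a L * fact L / (pochhammer a i * fact i) * t ^ i"
  have "power_coeff a c L k * jacobi_poly a c k t = (\<Sum>i\<le>L. of_bool (i \<le> k) * (?b i * ?h k i))" if k: "k \<le> L" for k
  proof -
    have "power_coeff a c L k * jacobi_poly a c k t = (\<Sum>i\<le>k. ?b i * ?h k i)"
      unfolding jacobi_poly_def sum_distrib_left
    proof (rule sum.cong[OF refl])
      fix i assume "i \<in> {..k}"
      then have i: "i \<le> k" by simp
      have "pochhammer c (k + i) = pochhammer c k * pochhammer (real k + c) i"
        using pochhammer_product'[of c k i] by (simp add: add.commute)
      then show "power_coeff a c L k * (pochhammer a k / fact k * (pochhammer (- real k) i * pochhammer (real k + c) i / (pochhammer a i * fact i) * t ^ i)) =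
         ?b i * ?h k i"
        unfolding power_coeff_def pochhammer_neg_nat[OF i] using nz by (simp add: divide_simps power_add)
    qed
    also have "\<dots> = (\<Sum>i\<le>L. of_bool (i \<le> k) * (?b i * ?h k i))"
      using k by (intro sum.mono_neutral_cong_left) auto
    finally show ?thesis .
  qed
  then have "(\<Sum>k\<le>L. power_coeff a c L k * jacobi_poly a c k t) = (\<Sum>k\<le>L. \<Sum>i\<le>L. of_bool (i \<le> k) * (?b i * ?h k i))"
    by simp
  also have "\<dots> = (\<Sum>i\<le>L. \<Sum>k\<le>L. of_bool (i \<le> k) * (?b i * ?h k i))" by (rule sum.swap)
  also have "\<dots> = (\<Sum>i\<le>L. of_bool (i = L) * ?b i)"
  proof (rule sum.cong[OF refl])
    fix i assume "i \<in> {..L}"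
    then have i: "i \<le> L" by simp
    let ?M = "L - i" and ?c = "c + 2 * real i"
    have "(\<Sum>k\<le>L. of_bool (i \<le> k) * (?b i * ?h k i)) = (\<Sum>k=i..L. ?b i * ?h k i)"
      using i by (intro sum.mono_neutral_cong_right) auto
    also have "\<dots> = (\<Sum>p=0..?M. ?b i * ?h (p + i) i)"
      by (rule sum_shift_0[OF i])
    also have "\<dots> = ?b i / fact ?M * (\<Sum>p\<le>?M. (-1) ^ p * real (?M choose p) * (2 * real p + ?c) / pochhammer (?c + real p) (Suc ?M))"
      unfolding sum_distrib_left atLeast0AtMost
    proof (rule sum.cong[OF refl])
      fix p assume "p \<in> {..?M}"
      then have p: "p \<le> ?M" by simp
      have 1: "pochhammer c (Suc (L + (p + i))) = pochhammer c (p + i + i) * pochhammer (?c + real p) (Suc ?M)"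
        using pochhammer_product'[of c "p + i + i" "Suc ?M"] i p by (simp add: algebra_simps)
      have 2: "real (?M choose p) = fact ?M / (fact p * fact (L - (p + i)))"
        using p by (simp add: binomial_fact add.commute)
      have 3: "((-1) ^ (p + i + i) :: real) = (-1) ^ p" by (simp add: power_add flip: power_mult_distrib)
      have 4: "2 * real (p + i) + c = 2 * real p + ?c" "p + i - i = p" by simp_all
      have g: "b * (s * C * d / (C * Q * G * H)) = b / F * (s * (F / (H * G)) * d / Q)"
        if "C \<noteq> 0" "F \<noteq> 0" for b s C d Q G H F :: real
        using that by simp
      show "?b i * ?h (p + i) i =
        ?b i / fact ?M * ((-1) ^ p * real (?M choose p) * (2 * real p + ?c) / pochhammer (?c + real p) (Suc ?M))"
        unfolding 1 2 3 4 by (rule g) (simp_all add: nz)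
    qed
    also have "\<dots> = of_bool (i = L) * ?b i"
      using alternating_pochhammer_sum[of ?c ?M] assms i by (auto split: if_splits)
    finally show "(\<Sum>k\<le>L. of_bool (i \<le> k) * (?b i * ?h k i)) = of_bool (i = L) * ?b i" .
  qed
  also have "\<dots> = (\<Sum>i\<le>L. if i = L then ?b i else 0)" by (intro sum.cong) auto
  also have "\<dots> = t ^ L" using nz by (simp add: sum.delta)
  finally show ?thesis ..
qed

text \<open>The double sum in \<open>S_coeff\<close> comes from a product of two reversed Jacobi
  sums: q and s index their terms, and the power 2 m - (q + s) of the variable is expanded by
  \<open>power_coeff\<close>. The symbols depending on q + s alone are converted by
  reversal.\<close>

lemma A_coeff_eq:
  fixes \<nu> :: real and n m k :: nat
  defines "\<sigma> \<equiv> 2 * (\<nu> - real m)"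
  assumes n: "0 < n" and \<sigma>: "0 < \<sigma>" and k: "k \<le> 2 * m"
  shows "A_coeff \<nu> n m k = (\<Sum>(q, s) \<in> {(q, s). q \<le> m \<and> s \<le> m \<and> q + s + k \<le> 2 * m}.
    (pochhammer (real m + \<sigma>) m / fact m)\<^sup>2 *
    (pochhammer (- real m) q * pochhammer (1 - real n - real m) q / (pochhammer (1 - \<sigma> - 2 * real m) q * fact q)) *
    (pochhammer (- real m) s * pochhammer (1 - real n - real m) s / (pochhammer (1 - \<sigma> - 2 * real m) s * fact s)) *
    power_coeff (real n) (\<sigma> + real n) (2 * m - (q + s)) k)"
  unfolding A_coeff_def S_coeff_def sum_distrib_left
proof (rule sum.cong[OF refl], clarify)
  fix q s assume qs: "q + s + k \<le> 2 * m"
  define c where "c = \<sigma> + real n"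
  define r where "r = q + s"
  have r: "r \<le> 2 * m - k" "r \<le> 2 * m" using qs k by (auto simp: r_def)
  have c: "0 < c" "0 < real n" using n \<sigma> by (simp_all add: c_def)
  let ?u = "\<lambda>q. pochhammer (- real m) q * pochhammer (1 - real n - real m) q / (pochhammer (1 - \<sigma> - 2 * real m) q * fact q)"
  have e1: "pochhammer (- 2 * real m + real k) r = (-1) ^ r * fact (2 * m - k) / fact (2 * m - r - k)"
    using pochhammer_neg_nat[OF r(1)] k by (simp add: of_nat_diff add.commute)
  have e2: "pochhammer (- 2 * real m) r = (-1) ^ r * fact (2 * m) / fact (2 * m - r)"
    using pochhammer_neg_nat[OF r(2)] by simp
  have e3: "pochhammer (- 2 * real m - real n + 1) r = (-1) ^ r * pochhammer (real n) (2 * m) / pochhammer (real n) (2 * m - r)"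
    using pochhammer_reverse[OF r(2) c(2)] by (simp add: algebra_simps)
  have e4: "pochhammer (- 2 * \<nu> - real k - real n) r = (-1) ^ r * pochhammer c (2 * m + k + 1) / pochhammer c (Suc (2 * m - r + k))"
  proof -
    have "r \<le> 2 * m + k + 1" using r by simp
    note pochhammer_reverse[OF this c(1)]
    moreover have "1 - c - real (2 * m + k + 1) = - 2 * \<nu> - real k - real n" by (simp add: c_def \<sigma>_def)
    moreover have "2 * m + k + 1 - r = Suc (2 * m - r + k)" using r by simp
    ultimately show ?thesis by (simp only:)
  qed
  have e5: "pochhammer \<sigma> (2 * m) = pochhammer \<sigma> m * pochhammer (real m + \<sigma>) m"
    using pochhammer_product'[of \<sigma> m m] by (simp add: mult_2 add.commute)
  have u: "(pochhammer (- real m) q * pochhammer (- real n - real m + 1) q) / (pochhammer (1 - 2 * \<nu>) q * fact q) = ?u q" for q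
    by (simp add: \<sigma>_def algebra_simps)
  have nz: "pochhammer \<sigma> i \<noteq> 0" "pochhammer c i \<noteq> 0" "pochhammer (real n) i \<noteq> 0" for i
    using pochhammer_pos[OF \<sigma>, of i] pochhammer_pos[OF c(1), of i] pochhammer_pos[OF c(2), of i] by auto
  have s: "((-1) ^ r :: real) * (-1) ^ r = 1" by (simp flip: power_mult_distrib)
  have main: "(pochhammer c k * pochhammer (real n) (2 * m) * (2 * real k + c) * (-1) ^ k * fact (2 * m) *
      (pochhammer \<sigma> (2 * m))\<^sup>2) /
     (pochhammer (real n) k * pochhammer c (2 * m + k + 1) * (fact m)\<^sup>2 * fact (2 * m - k) * (pochhammer \<sigma> m)\<^sup>2) *
     ((pochhammer (- 2 * real m + real k) r * pochhammer (- 2 * \<nu> - real k - real n) r) /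
        (pochhammer (- 2 * real m) r * pochhammer (- 2 * real m - real n + 1) r)) =
     (pochhammer (real m + \<sigma>) m / fact m)\<^sup>2 * power_coeff (real n) c (2 * m - r) k"
    unfolding e1 e2 e3 e4 e5 power_coeff_def using nz s
    by (simp add: divide_simps power2_eq_square)
  have "2 * (\<nu> - real m) + real n = c" "2 * real k + 2 * (\<nu> - real m) + real n = 2 * real k + c" by (simp_all add: c_def \<sigma>_def)
  moreover have g: "X / Y * (R * u * v) = D * u * v * e" if "X / Y * R = D * e" for X Y R u v D e :: real
    unfolding mult.assoc[symmetric] that by (simp only: mult_ac)
  ultimately show "pochhammer (2 * (\<nu> - real m) + real n) k * pochhammer (real n) (2 * m) *
       (2 * real k + 2 * (\<nu> - real m) + real n) * (- 1) ^ k * fact (2 * m) *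
       (pochhammer (2 * (\<nu> - real m)) (2 * m))\<^sup>2 /
       (pochhammer (real n) k * pochhammer (2 * (\<nu> - real m) + real n) (2 * m + k + 1) *
        (fact m)\<^sup>2 * fact (2 * m - k) * (pochhammer (2 * (\<nu> - real m)) m)\<^sup>2) *
       (pochhammer (- 2 * real m + real k) (q + s) * pochhammer (- 2 * \<nu> - real k - real n) (q + s) /
        (pochhammer (- 2 * real m) (q + s) * pochhammer (- 2 * real m - real n + 1) (q + s)) *
        (pochhammer (- real m) q * pochhammer (- real n - real m + 1) q / (pochhammer (1 - 2 * \<nu>) q * fact q)) *
        (pochhammer (- real m) s * pochhammer (- real n - real m + 1) s / (pochhammer (1 - 2 * \<nu>) s * fact s))) =
       (pochhammer (real m + \<sigma>) m / fact m)\<^sup>2 * ?u q * ?u s * power_coeff (real n) (\<sigma> + real n) (2 * m - (q + s)) k"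
    unfolding u c_def[symmetric] r_def[symmetric] \<sigma>_def[symmetric] using main by (simp only: g)
qed

text \<open>The reversed sum is squared and every power of t expanded. With \<open>of_bool\<close>
  the range of k no longer depends on q and s, so the sums can be interchanged.\<close>

lemma jacobi_poly_square:
  fixes \<nu> :: real and n m :: nat
  defines "\<sigma> \<equiv> 2 * (\<nu> - real m)"
  assumes n: "0 < n" and \<sigma>: "0 < \<sigma>"
  shows "(jacobi_poly (real n) \<sigma> m t)\<^sup>2 = (\<Sum>k\<le>2 * m. A_coeff \<nu> n m k * jacobi_poly (real n) (\<sigma> + real n) k t)"
proof -
  let ?u = "\<lambda>q. pochhammer (- real m) q * pochhammer (1 - real n - real m) q / (pochhammer (1 - \<sigma> - 2 * real m) q * fact q)"
  let ?D = "pochhammer (real m + \<sigma>) m / fact m" and ?c = "\<sigma> + real n" and ?a = "real n"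
  let ?J = "\<lambda>k. jacobi_poly ?a ?c k t"
  let ?I = "{..m} \<times> {..m}"
  have s: "((-1) ^ m)\<^sup>2 = (1 :: real)" by (simp flip: power_mult)
  have "(jacobi_poly ?a \<sigma> m t)\<^sup>2 = ?D\<^sup>2 * (\<Sum>q\<le>m. ?u q * t ^ (m - q))\<^sup>2"
    using n \<sigma> s by (subst jacobi_poly_reverse) (simp_all add: power_mult_distrib power_divide)
  also have "\<dots> = (\<Sum>(q, s)\<in>?I. ?D\<^sup>2 * ?u q * ?u s * t ^ (2 * m - (q + s)))"
    unfolding power2_eq_square[of "sum _ _"] sum_product sum.cartesian_product unfolding sum_distrib_left
  proof (rule sum.cong[OF refl], clarsimp simp only: split_beta mem_Times_iff atMost_iff fst_conv snd_conv)
    fix q s assume "q \<le> m" "s \<le> m"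
    then have "2 * m - (q + s) = (m - q) + (m - s)" by arith
    then have "t ^ (2 * m - (q + s)) = t ^ (m - q) * t ^ (m - s)" by (simp only: power_add)
    then show "?D\<^sup>2 * (?u q * t ^ (m - q) * (?u s * t ^ (m - s))) = ?D\<^sup>2 * ?u q * ?u s * t ^ (2 * m - (q + s))"
      by (simp only: mult_ac)
  qed
  also have "\<dots> = (\<Sum>(q, s)\<in>?I. \<Sum>k\<le>2 * m. of_bool (q + s + k \<le> 2 * m) * (?D\<^sup>2 * ?u q * ?u s * power_coeff ?a ?c (2 * m - (q + s)) k * ?J k))"
  proof (rule sum.cong[OF refl], clarsimp simp only: split_beta mem_Times_iff atMost_iff fst_conv snd_conv)
    fix q s assume qs: "q \<le> m" "s \<le> m"
    have "t ^ (2 * m - (q + s)) = (\<Sum>k\<le>2 * m - (q + s). power_coeff ?a ?c (2 * m - (q + s)) k * ?J k)"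
      using n \<sigma> by (intro power_jacobi_poly) auto
    also have "\<dots> = (\<Sum>k\<le>2 * m. of_bool (q + s + k \<le> 2 * m) * (power_coeff ?a ?c (2 * m - (q + s)) k * ?J k))"
      using qs by (intro sum.mono_neutral_cong_left) auto
    finally have e: "t ^ (2 * m - (q + s)) = (\<Sum>k\<le>2 * m. of_bool (q + s + k \<le> 2 * m) * (power_coeff ?a ?c (2 * m - (q + s)) k * ?J k))" .
    show "?D\<^sup>2 * ?u q * ?u s * t ^ (2 * m - (q + s)) =
      (\<Sum>k\<le>2 * m. of_bool (q + s + k \<le> 2 * m) * (?D\<^sup>2 * ?u q * ?u s * power_coeff ?a ?c (2 * m - (q + s)) k * ?J k))"
      unfolding e sum_distrib_left by (intro sum.cong refl) (simp only: mult_ac)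
  qed
  also have "\<dots> = (\<Sum>k\<le>2 * m. \<Sum>(q, s)\<in>?I. of_bool (q + s + k \<le> 2 * m) * (?D\<^sup>2 * ?u q * ?u s * power_coeff ?a ?c (2 * m - (q + s)) k * ?J k))"
    unfolding split_beta by (rule sum.swap)
  also have "\<dots> = (\<Sum>k\<le>2 * m. A_coeff \<nu> n m k * ?J k)"
  proof (rule sum.cong[OF refl])
    fix k assume "k \<in> {..2 * m}"
    then have k: "k \<le> 2 * m" by simp
    show "(\<Sum>(q, s)\<in>?I. of_bool (q + s + k \<le> 2 * m) * (?D\<^sup>2 * ?u q * ?u s * power_coeff ?a ?c (2 * m - (q + s)) k * ?J k)) =
      A_coeff \<nu> n m k * ?J k"
      unfolding A_coeff_eq[OF n \<sigma>[unfolded \<sigma>_def] k, folded \<sigma>_def] sum_distrib_right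
      by (rule sum.mono_neutral_cong_right) auto
  qed
  finally show ?thesis .
qed

text \<open>The conjugate-type parameters pair up as (a + l)^2 + X, so the square root disappears
  and a polynomial in X remains.\<close>

lemma wilson_sum:
  "wilson k X a b c d = pochhammer (a + b) k * pochhammer (a + c) k * pochhammer (a + d) k *
    (\<Sum>j\<le>k. pochhammer (- of_nat k) j * pochhammer (of_nat k + a + b + c + d - 1) j *
       (\<Prod>l<j. (a + of_nat l)\<^sup>2 + X) /
       (pochhammer (a + b) j * pochhammer (a + c) j * pochhammer (a + d) j * fact j))"
proof -
  have "pochhammer (a + \<i> * csqrt X) j * pochhammer (a - \<i> * csqrt X) j = (\<Prod>l<j. (a + of_nat l)\<^sup>2 + X)" for j
  proof -
    have "(a + \<i> * csqrt X + of_nat l) * (a - \<i> * csqrt X + of_nat l) = (a + of_nat l)\<^sup>2 + X" for l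
    proof -
      have "(a + \<i> * csqrt X + of_nat l) * (a - \<i> * csqrt X + of_nat l) = (a + of_nat l)\<^sup>2 - (\<i> * csqrt X)\<^sup>2"
        by (simp add: power2_eq_square algebra_simps)
      then show ?thesis by (simp add: power_mult_distrib)
    qed
    then show ?thesis by (simp add: pochhammer_prod atLeast0LessThan flip: prod.distrib)
  qed
  then show ?thesis
    unfolding wilson_def eval_fps_hypergeo_terminating[of k] by (simp add: mult.assoc)
qed

lemma Gamma_shift_cmod:
  assumes "0 < a"
  shows "(cmod (Gamma (of_real (a + real j) + \<i> / 2 * of_real lm)))\<^sup>2 =
    (cmod (Gamma (of_real a + \<i> / 2 * of_real lm)))\<^sup>2 * (\<Prod>l<j. (a + real l)\<^sup>2 + lm\<^sup>2 / 4)"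
proof (induction j)
  case (Suc j)
  let ?w = "complex_of_real (a + real j) + \<i> / 2 * of_real lm"
  have "?w \<notin> \<int>\<^sub>\<le>\<^sub>0" using assms by (auto elim!: nonpos_Ints_cases simp: complex_eq_iff)
  moreover have "complex_of_real (a + real (Suc j)) + \<i> / 2 * of_real lm = ?w + 1" by simp
  ultimately have "Gamma (complex_of_real (a + real (Suc j)) + \<i> / 2 * of_real lm) = ?w * Gamma ?w"
    using Gamma_plus1[of ?w] by metis
  moreover have "(cmod ?w)\<^sup>2 = (a + real j)\<^sup>2 + lm\<^sup>2 / 4"
    by (simp add: cmod_power2 power_divide)
  ultimately show ?case using Suc.IH by (simp add: norm_mult power_mult_distrib mult_ac)
qed simp

text \<open>With a = \<sigma> - n/2 and the other parameters 1 + n/2, n/2, n/2, the sums of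
  parameters are \<sigma> + 1, \<sigma>, \<sigma> and k + \<sigma> + n. The coefficients are thus
  those of \<open>jacobi_poly (\<sigma> + 1) (\<sigma> + n) k\<close>, with x^j replaced by the
  squared modulus of the shifted Gamma function over the square of
  \<open>pochhammer \<sigma> j\<close>; the Gamma factor absorbs the product over l.\<close>

lemma wilson_Gamma:
  assumes s: "n / 2 < \<sigma>" "0 \<le> n"
  shows "of_real ((cmod (Gamma (of_real (\<sigma> - n / 2) + \<i> / 2 * of_real lm)))\<^sup>2) *
     wilson k (of_real (lm\<^sup>2 / 4)) (of_real (\<sigma> - n / 2)) (of_real (1 + n / 2)) (of_real (n / 2)) (of_real (n / 2)) =
   complex_of_real (pochhammer (\<sigma> + 1) k * (pochhammer \<sigma> k)\<^sup>2 *
     (\<Sum>j\<le>k. pochhammer (- real k) j * pochhammer (real k + (\<sigma> + n)) j / (pochhammer (\<sigma> + 1) j * fact j) *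
       ((cmod (Gamma (of_real (\<sigma> + real j - n / 2) + \<i> / 2 * of_real lm)))\<^sup>2 / (pochhammer \<sigma> j)\<^sup>2)))"
proof -
  let ?a = "\<sigma> - n / 2"
  have e: "complex_of_real ?a + of_real (1 + n / 2) = of_real (\<sigma> + 1)" "complex_of_real ?a + of_real (n / 2) = of_real \<sigma>"
    "of_nat k + complex_of_real ?a + of_real (1 + n / 2) + of_real (n / 2) + of_real (n / 2) - 1 = of_real (real k + (\<sigma> + n))"
    "- of_nat k = complex_of_real (- real k)"
    by simp_all
  have p: "(\<Prod>l<j. (complex_of_real ?a + of_nat l)\<^sup>2 + of_real (lm\<^sup>2 / 4)) = of_real (\<Prod>l<j. (?a + real l)\<^sup>2 + lm\<^sup>2 / 4)" for j
    by simp
  have G: "(cmod (Gamma (of_real (\<sigma> + real j - n / 2) + \<i> / 2 * of_real lm)))\<^sup>2 =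
    (cmod (Gamma (of_real ?a + \<i> / 2 * of_real lm)))\<^sup>2 * (\<Prod>l<j. (?a + real l)\<^sup>2 + lm\<^sup>2 / 4)" for j
  proof -
    have "\<sigma> + real j - n / 2 = ?a + real j" by simp
    then show ?thesis using Gamma_shift_cmod[of ?a j lm] s by (simp only:)
  qed
  define g where "g = (cmod (Gamma (of_real ?a + \<i> / 2 * of_real lm)))\<^sup>2"
  have "of_real g * wilson k (of_real (lm\<^sup>2 / 4)) (of_real ?a) (of_real (1 + n / 2)) (of_real (n / 2)) (of_real (n / 2)) =
    complex_of_real (g * (pochhammer (\<sigma> + 1) k * pochhammer \<sigma> k * pochhammer \<sigma> k *
    (\<Sum>j\<le>k. pochhammer (- real k) j * pochhammer (real k + (\<sigma> + n)) j *
       (\<Prod>l<j. (?a + real l)\<^sup>2 + lm\<^sup>2 / 4) /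
       (pochhammer (\<sigma> + 1) j * pochhammer \<sigma> j * pochhammer \<sigma> j * fact j))))"
    unfolding wilson_sum e p pochhammer_of_real by (simp del: of_real_prod of_real_add of_real_minus of_real_power of_real_diff)
  also have "g * (pochhammer (\<sigma> + 1) k * pochhammer \<sigma> k * pochhammer \<sigma> k *
    (\<Sum>j\<le>k. pochhammer (- real k) j * pochhammer (real k + (\<sigma> + n)) j *
       (\<Prod>l<j. (?a + real l)\<^sup>2 + lm\<^sup>2 / 4) /
       (pochhammer (\<sigma> + 1) j * pochhammer \<sigma> j * pochhammer \<sigma> j * fact j))) =
    pochhammer (\<sigma> + 1) k * (pochhammer \<sigma> k)\<^sup>2 *
     (\<Sum>j\<le>k. pochhammer (- real k) j * pochhammer (real k + (\<sigma> + n)) j / (pochhammer (\<sigma> + 1) j * fact j) *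
       (g * (\<Prod>l<j. (?a + real l)\<^sup>2 + lm\<^sup>2 / 4) / (pochhammer \<sigma> j)\<^sup>2))"
    unfolding sum_distrib_left by (intro sum.cong refl) (simp add: power2_eq_square mult_ac)
  finally show ?thesis unfolding G g_def .
qed

text \<open>With \<sigma> = 2 (\<nu> - m) and x = cosh^(-2) d, the coefficient of x^(\<sigma> + j)
  contributed by the k-th term in the expansion of x^\<sigma> times the squared Jacobi
  polynomial.\<close>

definition kern_coeff :: "real \<Rightarrow> nat \<Rightarrow> nat \<Rightarrow> nat \<Rightarrow> nat \<Rightarrow> real" where
  "kern_coeff \<nu> n m k j = A_coeff \<nu> n m k * (-1) ^ k *
     (pochhammer (2 * (\<nu> - real m) + 1) k / fact k) *
     (pochhammer (- real k) j * pochhammer (real k + (2 * (\<nu> - real m) + real n)) j /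
       (pochhammer (2 * (\<nu> - real m) + 1) j * fact j))"

definition berezin_symbol :: "real \<Rightarrow> nat \<Rightarrow> nat \<Rightarrow> real \<Rightarrow> complex" where
  "berezin_symbol \<nu> n m t =
     of_real ((cmod (Gamma (of_real (2 * (\<nu> - real m) - real n / 2)
                                 + \<i> / 2 * of_real (sqrt (- t - (real n)\<^sup>2)))))\<^sup>2) *
           (\<Sum>k\<le>2 * m. of_real (gamma_coeff \<nu> n m k) *
              wilson k (of_real (- t / 4 - (real n)\<^sup>2 / 4))
                (of_real (2 * (\<nu> - real m) - real n / 2))
                (of_real (1 + real n / 2)) (of_real (real n / 2)) (of_real (real n / 2)))"

lemma berezin_symbol_measurable:
  assumes "real n / 2 < 2 * (\<nu> - real m)"
  shows "berezin_symbol \<nu> n m \<in> borel_measurable borel"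
proof (rule borel_measurable_continuous_onI)
  have "complex_of_real (2 * (\<nu> - real m) - real n / 2) + \<i> / 2 * of_real x \<notin> \<int>\<^sub>\<le>\<^sub>0" for x
    using assms by (auto elim!: nonpos_Ints_cases simp: complex_eq_iff)
  \<comment> \<open>On negative reals \<open>sqrt\<close> is the odd extension, so it is continuous
    on the whole line, and the real part of the argument stays positive.\<close>
  then have "continuous_on UNIV (\<lambda>t. Gamma (complex_of_real (2 * (\<nu> - real m) - real n / 2) + \<i> / 2 * of_real (sqrt (- t - (real n)\<^sup>2))))"
    by (intro continuous_on_compose2[OF continuous_on_Gamma[of "range (\<lambda>x::real. complex_of_real (2 * (\<nu> - real m) - real n / 2) + \<i> / 2 * of_real x)"]] continuous_intros) auto
  moreover have "continuous_on UNIV (\<lambda>t::real. wilson k (of_real (- t / 4 - (real n)\<^sup>2 / 4)) a b c d)" for k a b c d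
    unfolding wilson_sum divide_inverse by (intro continuous_intros)
  ultimately show "continuous_on UNIV (berezin_symbol \<nu> n m)"
    unfolding berezin_symbol_def by (intro continuous_intros)
qed

text \<open>By \<open>wilson_Gamma\<close> each summand is a combination of squared moduli of Gamma
  functions, and these are reciprocals of \<open>inv_symbol\<close> times the square of Gamma
  (\<sigma> + j). Writing the Pochhammer symbols of \<sigma> as Gamma quotients, the square of Gamma
  (\<sigma> + k) in the denominator of \<open>gamma_coeff\<close> cancels.\<close>

lemma berezin_symbol_eq:
  fixes \<nu> :: real and n m :: nat
  defines "\<sigma> \<equiv> 2 * (\<nu> - real m)"
  assumes \<sigma>: "real n / 2 < \<sigma>" and t: "t \<le> - (real n)\<^sup>2"
  shows "berezin_symbol \<nu> n m t =
    (\<Sum>k\<le>2 * m. \<Sum>j\<le>k. of_real (berezin_const \<nu> n m * kern_coeff \<nu> n m k j) * (fact n * of_real (1 / inv_symbol (real n) (\<sigma> + real j) t)))"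
proof -
  define lm where "lm = sqrt (- t - (real n)\<^sup>2)"
  have lm: "- t / 4 - (real n)\<^sup>2 / 4 = lm\<^sup>2 / 4" using t by (simp add: lm_def field_simps)
  define g where "g = (\<lambda>j. (cmod (Gamma (of_real (\<sigma> + real j - real n / 2) + \<i> / 2 * of_real lm)))\<^sup>2)"
  have \<sigma>0: "0 < \<sigma>" using \<sigma> by (meson divide_nonneg_nonneg le_less_trans of_nat_0_le_iff zero_le_numeral)
  have kern_symbol: "Gamma (\<sigma> + real j) \<noteq> 0" for j
    using \<sigma>0 Gamma_real_pos[of "\<sigma> + real j"] by (intro less_imp_neq[symmetric]) simp
  have inv_symbol: "1 / inv_symbol (real n) (\<sigma> + real j) t = g j / (Gamma (\<sigma> + real j))\<^sup>2" for j
  proof -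
    have "inv_symbol (real n) (\<sigma> + real j) t * g j = (Gamma (\<sigma> + real j))\<^sup>2"
      unfolding g_def lm_def using \<sigma> t by (intro inv_symbol_Gamma) auto
    moreover then have "inv_symbol (real n) (\<sigma> + real j) t \<noteq> 0" "g j \<noteq> 0" using kern_symbol[of j] by auto
    ultimately show ?thesis using kern_symbol[of j] by (simp add: field_simps)
  qed
  have poch: "pochhammer \<sigma> j = Gamma (\<sigma> + real j) / Gamma \<sigma>" for j
    using \<sigma>0 by (intro pochhammer_Gamma) (auto elim!: nonpos_Ints_cases)
  have G0: "Gamma \<sigma> \<noteq> 0" using kern_symbol[of 0] by simp
  have tm: "gamma_coeff \<nu> n m k * (pochhammer (\<sigma> + 1) k * (pochhammer \<sigma> k)\<^sup>2 *
     (\<Sum>j\<le>k. pochhammer (- real k) j * pochhammer (real k + (\<sigma> + real n)) j / (pochhammer (\<sigma> + 1) j * fact j) *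
       (g j / (pochhammer \<sigma> j)\<^sup>2))) = (\<Sum>j\<le>k. berezin_const \<nu> n m * kern_coeff \<nu> n m k j * (fact n * (1 / inv_symbol (real n) (\<sigma> + real j) t)))" for k
    unfolding sum_distrib_left
  proof (rule sum.cong[OF refl])
    fix j assume "j \<in> {..k}"
    have gc: "gamma_coeff \<nu> n m k = berezin_const \<nu> n m * fact n * (-1) ^ k / (fact k * (Gamma (\<sigma> + real k))\<^sup>2) * A_coeff \<nu> n m k"
      by (simp add: gamma_coeff_def berezin_const_def \<sigma>_def mult_ac)
    have "B * F * e / (f * K\<^sup>2) * A * (p * (K / H)\<^sup>2 * (q * (x / (J / H)\<^sup>2))) = B * (A * e * (p / f) * q) * (F * (x / J\<^sup>2))"
      if "K \<noteq> 0" "H \<noteq> 0" "J \<noteq> 0" for B F e f K A p H q x J :: real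
      using that by (simp add: power_divide mult_ac)
    from this[OF kern_symbol G0 kern_symbol]
    show "gamma_coeff \<nu> n m k * (pochhammer (\<sigma> + 1) k * (pochhammer \<sigma> k)\<^sup>2 *
      (pochhammer (- real k) j * pochhammer (real k + (\<sigma> + real n)) j / (pochhammer (\<sigma> + 1) j * fact j) *
       (g j / (pochhammer \<sigma> j)\<^sup>2))) = berezin_const \<nu> n m * kern_coeff \<nu> n m k j * (fact n * (1 / inv_symbol (real n) (\<sigma> + real j) t))"
      unfolding gc inv_symbol kern_coeff_def \<sigma>_def[symmetric] poch .
  qed
  have "berezin_symbol \<nu> n m t = (\<Sum>k\<le>2 * m. of_real (gamma_coeff \<nu> n m k) *
     (of_real (g 0) * wilson k (of_real (lm\<^sup>2 / 4)) (of_real (\<sigma> - real n / 2)) (of_real (1 + real n / 2)) (of_real (real n / 2)) (of_real (real n / 2))))"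
    unfolding berezin_symbol_def lm lm_def[symmetric] \<sigma>_def[symmetric] g_def sum_distrib_left
    by (intro sum.cong refl) (simp add: mult_ac)
  also have "\<dots> = (\<Sum>k\<le>2 * m. of_real (gamma_coeff \<nu> n m k * (pochhammer (\<sigma> + 1) k * (pochhammer \<sigma> k)\<^sup>2 *
     (\<Sum>j\<le>k. pochhammer (- real k) j * pochhammer (real k + (\<sigma> + real n)) j / (pochhammer (\<sigma> + 1) j * fact j) *
       (g j / (pochhammer \<sigma> j)\<^sup>2)))))"
  proof (rule sum.cong[OF refl])
    fix k
    have 0: "\<sigma> + real 0 - real n / 2 = \<sigma> - real n / 2" by simp
    show "of_real (gamma_coeff \<nu> n m k) *
     (of_real (g 0) * wilson k (of_real (lm\<^sup>2 / 4)) (of_real (\<sigma> - real n / 2)) (of_real (1 + real n / 2)) (of_real (real n / 2)) (of_real (real n / 2))) =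
     complex_of_real (gamma_coeff \<nu> n m k * (pochhammer (\<sigma> + 1) k * (pochhammer \<sigma> k)\<^sup>2 *
     (\<Sum>j\<le>k. pochhammer (- real k) j * pochhammer (real k + (\<sigma> + real n)) j / (pochhammer (\<sigma> + 1) j * fact j) *
       (g j / (pochhammer \<sigma> j)\<^sup>2))))"
      unfolding g_def 0 wilson_Gamma[OF \<sigma> of_nat_0_le_iff] by (rule of_real_mult[symmetric])
  qed
  finally show ?thesis unfolding tm by simp
qed

section \<open>The Berezin kernel as a combination of powers\<close>

lemma cosh_bergman_dist:
  assumes "z \<in> unit_ball" "w \<in> unit_ball"
  shows "(cosh (bergman_dist z w))\<^sup>2 = 1 / inv_cosh2 z w"
proof -
  have k: "0 < inv_cosh2 z w" "inv_cosh2 z w \<le> 1" using assms inv_cosh2_pos[of z w] inv_cosh2_le_1[of z w] by auto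
  have "bergman_dist z w = arcosh (sqrt (1 / inv_cosh2 z w))" by (simp add: bergman_dist_def inv_cosh2_def)
  moreover have "1 \<le> sqrt (1 / inv_cosh2 z w)" using k by simp
  ultimately have "cosh (bergman_dist z w) = sqrt (1 / inv_cosh2 z w)" by simp
  then show ?thesis using k by simp
qed

text \<open>In x = \<open>inv_cosh2 z w\<close>, the variable tanh^2 d is 1 - x and the reciprocal
  power of cosh is x^\<sigma>. \<open>jacobi_poly_square\<close> linearizes the square in the
  variable 1 - x, and \<open>jacobi_poly_reflect\<close> turns each term into powers of x.\<close>

lemma berezin_kernel:
  fixes \<nu> :: real and m :: nat and z w :: "complex ^ 'n"
  defines "n \<equiv> CARD('n)" and "\<sigma> \<equiv> 2 * (\<nu> - real m)"
  assumes \<sigma>: "real n / 2 < \<sigma>" and zw: "z \<in> unit_ball" "w \<in> unit_ball"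
  shows "(jacobi m (real n - 1) (\<sigma> - real n) (1 - 2 * (tanh (bergman_dist z w))\<^sup>2))\<^sup>2 /
              cosh (bergman_dist z w) powr (4 * (\<nu> - real m)) =
    (\<Sum>k\<le>2 * m. \<Sum>j\<le>k. kern_coeff \<nu> n m k j * kern (\<sigma> + real j) z w)"
proof -
  let ?x = "inv_cosh2 z w"
  have n: "0 < n" by (simp add: n_def)
  have \<sigma>0: "0 < \<sigma>" using \<sigma> by (meson divide_nonneg_nonneg le_less_trans of_nat_0_le_iff zero_le_numeral)
  have k: "0 < ?x" using zw inv_cosh2_pos[of z w] by auto
  note ch = cosh_bergman_dist[OF zw]
  have th: "(tanh (bergman_dist z w))\<^sup>2 = 1 - ?x"
  proof -
    have "(tanh (bergman_dist z w))\<^sup>2 = ((cosh (bergman_dist z w))\<^sup>2 - 1) / (cosh (bergman_dist z w))\<^sup>2"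
      by (simp add: tanh_def power_divide sinh_square_eq)
    then show ?thesis unfolding ch using k by (simp add: left_diff_distrib)
  qed
  have cp: "cosh (bergman_dist z w) powr (4 * (\<nu> - real m)) = 1 / (?x powr \<sigma>)"
  proof -
    have "4 * (\<nu> - real m) = 2 * \<sigma>" by (simp add: \<sigma>_def)
    then have "cosh (bergman_dist z w) powr (4 * (\<nu> - real m)) = (cosh (bergman_dist z w) powr 2) powr \<sigma>"
      by (simp only: powr_powr)
    also have "cosh (bergman_dist z w) powr 2 = 1 / ?x"
      using ch cosh_real_pos[of "bergman_dist z w"] by simp
    finally show ?thesis using k by (simp add: powr_divide)
  qed
  have "jacobi m (real n - 1) (\<sigma> - real n) (1 - 2 * (1 - ?x)) = jacobi_poly (real n) \<sigma> m (1 - ?x)"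
    using n by (subst jacobi_jacobi_poly) auto
  then have "(jacobi m (real n - 1) (\<sigma> - real n) (1 - 2 * (1 - ?x)))\<^sup>2 =
     (\<Sum>k\<le>2 * m. A_coeff \<nu> n m k * ((-1) ^ k * jacobi_poly (\<sigma> + 1) (\<sigma> + real n) k ?x))"
    using n \<sigma>0 jacobi_poly_square[OF n \<sigma>0[unfolded \<sigma>_def], of "1 - ?x", folded \<sigma>_def]
      jacobi_poly_reflect[of "real n" "\<sigma> + 1" "\<sigma> + real n" _ ?x] by simp
  then have "(jacobi m (real n - 1) (\<sigma> - real n) (1 - 2 * (1 - ?x)))\<^sup>2 / (1 / (?x powr \<sigma>)) =
    (\<Sum>k\<le>2 * m. A_coeff \<nu> n m k * (-1) ^ k * (jacobi_poly (\<sigma> + 1) (\<sigma> + real n) k ?x * ?x powr \<sigma>))"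
    by (simp add: sum_distrib_left sum_distrib_right mult_ac)
  also have "\<dots> = (\<Sum>k\<le>2 * m. \<Sum>j\<le>k. kern_coeff \<nu> n m k j * kern (\<sigma> + real j) z w)"
  proof (rule sum.cong[OF refl])
    fix k
    have "kern (\<sigma> + real j) z w = ?x ^ j * ?x powr \<sigma>" for j
      using k by (simp add: kern_def powr_add powr_realpow)
    then show "A_coeff \<nu> n m k * (-1) ^ k * (jacobi_poly (\<sigma> + 1) (\<sigma> + real n) k ?x * ?x powr \<sigma>) =
      (\<Sum>j\<le>k. kern_coeff \<nu> n m k j * kern (\<sigma> + real j) z w)"
      unfolding jacobi_poly_def kern_coeff_def \<sigma>_def[symmetric] sum_distrib_left sum_distrib_right
      by (intro sum.cong refl) (simp only: mult_ac)
  qed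
  finally show ?thesis unfolding th cp .
qed

section \<open>Identification of the operators\<close>

context pvm begin

lemma spec_form_sum:
  assumes "finite I" "\<And>i. i \<in> I \<Longrightarrow> bounded_borel (f i)" "\<phi> \<in> L2 M" "\<eta> \<in> L2 M"
  shows "spec_form (\<lambda>t. \<Sum>i\<in>I. c i * f i t) \<phi> \<eta> = (\<Sum>i\<in>I. c i * spec_form (f i) \<phi> \<eta>)"
  using assms(1,2)
proof (induction I rule: finite_induct)
  case (insert i I)
  have "spec_form (\<lambda>t. (\<Sum>j\<in>I. c j * f j t) + c i * f i t) \<phi> \<eta> = (\<Sum>j\<in>I. c j * spec_form (f j) \<phi> \<eta>) + c i * spec_form (f i) \<phi> \<eta>"
    using insert assms(3,4) by (subst spec_form_lin) (auto intro!: bounded_borel_sum bounded_borel_scale)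
  then show ?case using insert by (simp add: add.commute)
qed (simp add: spec_form_def)

end

context bergman_spectral begin

text \<open>The kernel operators of functions in \<open>L\<^sup>2\<close> need not be known to be in \<open>L\<^sup>2\<close>; testing with
  functions in \<open>Cc\<close> and moving the operator there identifies them nevertheless.\<close>

lemma kern_op_sum_graph:
  fixes c :: "'i \<Rightarrow> real" and s :: "'i \<Rightarrow> real"
  assumes I: "finite I" and s: "\<And>i. i \<in> I \<Longrightarrow> real CARD('n) / 2 < s i"
    and f: "f \<in> borel_measurable borel"
      "\<And>t. t \<le> - (real CARD('n))\<^sup>2 \<Longrightarrow> f t = (\<Sum>i\<in>I. of_real (c i) * (fact CARD('n) * kern_symbol (s i) t))"
  shows "spectral_integral bergman_measure E f =
    {(\<phi>, \<psi>). \<phi> \<in> L2 BM \<and> \<psi> \<in> L2 BM \<and> (AE z in BM. \<psi> z = (\<Sum>i\<in>I. of_real (c i) * kern_op (s i) \<phi> z))}"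
proof -
  \<comment> \<open>A bounded real function that agrees with f on the spectrum; f itself may be
    unbounded beyond -n^2.\<close>
  define g where "g = (\<lambda>t. \<Sum>i\<in>I. complex_of_real (c i) * (fact CARD('n) * kern_symbol (s i) t))"
  define B :: "(complex ^ 'n \<Rightarrow> complex) \<Rightarrow> complex ^ 'n \<Rightarrow> complex" where "B = (\<lambda>\<phi> z. \<Sum>i\<in>I. complex_of_real (c i) * kern_op (s i) \<phi> z)"
  have Gb: "bounded_borel (\<lambda>t. fact CARD('n) * kern_symbol (s i) t)" if "i \<in> I" for i
    using s[OF that] by (intro bounded_borel_scale bounded_borel_kern_symbol)
  have gb: "bounded_borel g" unfolding g_def by (intro bounded_borel_sum) (rule bounded_borel_scale[OF Gb])
  have gm: "g \<in> borel_measurable borel" using gb by (rule bounded_borel_measurable)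
  have fg: "f t = g t" if "t \<le> - (real CARD('n))\<^sup>2" for t using f(2)[OF that] by (simp add: g_def)
  have cg: "(\<lambda>t. cnj (g t)) = g" by (auto simp: g_def kern_symbol_def indicator_def)
  have spec_form: "spec_form f \<phi> \<eta> = spec_form g \<phi> \<eta>" if "\<phi> \<in> L2 BM" "\<eta> \<in> L2 BM" for \<phi> \<eta>
    using fg f(1) gm that by (rule spec_form_cong_AE)
  have dom: "spectral_domain BM E f = L2 BM"
  proof -
    have "integrable (spec_density \<phi>) (\<lambda>t. (cmod (f t))\<^sup>2)" if \<phi>: "\<phi> \<in> L2 BM" for \<phi>
    proof -
      interpret finite_measure "spec_density \<phi>" using \<phi> by (rule finite_spec_density)
      obtain C where C: "\<And>t. cmod (g t) \<le> C" using gb by (auto simp: bounded_borel_def)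
      have "AE t in spec_density \<phi>. norm ((cmod (f t))\<^sup>2) \<le> C\<^sup>2"
        using spec_density_upper_zero[OF \<phi>]
      proof eventually_elim
        case (elim t)
        then show ?case using C[of t] fg[of t] by (simp add: power_mono)
      qed
      then show ?thesis using f(1) by (intro integrable_const_bound) auto
    qed
    then show ?thesis by (auto simp: spectral_domain_def)
  qed
  have Bm: "B \<phi> \<in> borel_measurable BM" if "\<phi> \<in> L2 BM" for \<phi>
    unfolding B_def using kern_op_measurable[OF L2_measurable[OF that]] by measurable
  have BI: "integrable BM (\<lambda>z. B \<phi> z * cnj (\<theta> z))" if "\<theta> \<in> Cc" "\<phi> \<in> L2 BM" for \<theta> \<phi>
    unfolding B_def sum_distrib_right mult.assoc
    by (intro Bochner_Integration.integrable_sum integrable_mult_right kern_op_swap(1)[OF that] s)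
  have B: "L2_inner BM (B \<phi>) \<theta> = spec_form g \<phi> \<theta>" if \<theta>: "\<theta> \<in> Cc" and \<phi>: "\<phi> \<in> L2 BM" for \<theta> \<phi>
  proof -
    have L: "\<theta> \<in> L2 BM" using \<theta> by (rule Cc_L2)
    have 1: "L2_inner BM (kern_op (s i) \<phi>) \<theta> = spec_form (\<lambda>t. fact CARD('n) * kern_symbol (s i) t) \<phi> \<theta>" if i: "i \<in> I" for i
    proof -
      have "L2_inner BM (kern_op (s i) \<phi>) \<theta> = cnj (L2_inner BM (kern_op (s i) \<theta>) \<phi>)"
        using kern_op_swap(2)[OF \<theta> \<phi> s[OF i]] by (simp only: L2_inner_cnj[of BM \<phi>])
      also have "\<dots> = cnj (spec_form (\<lambda>t. fact CARD('n) * kern_symbol (s i) t) \<theta> \<phi>)"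
        using kern_op_calculus[OF \<theta> s[OF i] \<phi>] by simp
      also have "\<dots> = spec_form (\<lambda>t. cnj (fact CARD('n) * kern_symbol (s i) t)) \<phi> \<theta>"
        using spec_form_cnj[OF Gb[OF i] L \<phi>] by simp
      also have "(\<lambda>t. cnj (fact CARD('n) * kern_symbol (s i) t)) = (\<lambda>t. fact CARD('n) * kern_symbol (s i) t)"
        by (auto simp: kern_symbol_def indicator_def)
      finally show ?thesis .
    qed
    have "L2_inner BM (B \<phi>) \<theta> = (\<Sum>i\<in>I. of_real (c i) * L2_inner BM (kern_op (s i) \<phi>) \<theta>)"
      unfolding L2_inner_def B_def sum_distrib_right mult.assoc
      using kern_op_swap(1)[OF \<theta> \<phi>] s by (subst Bochner_Integration.integral_sum) auto
    also have "\<dots> = (\<Sum>i\<in>I. of_real (c i) * spec_form (\<lambda>t. fact CARD('n) * kern_symbol (s i) t) \<phi> \<theta>)"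
      by (intro sum.cong refl) (simp only: 1)
    also have "\<dots> = spec_form g \<phi> \<theta>" unfolding g_def using I Gb \<phi> L by (intro spec_form_sum[symmetric])
    finally show ?thesis .
  qed
  have calcB: "AE z in BM. \<psi> z = B \<phi> z" if c: "calculus g \<phi> \<psi>" and \<phi>: "\<phi> \<in> L2 BM" for \<phi> \<psi>
  proof -
    have \<psi>: "\<psi> \<in> L2 BM" using c by (simp add: calculus_def)
    have "AE z in BM. \<psi> z - B \<phi> z = 0"
    proof (rule Cc_test_zero)
      show "(\<lambda>z. \<psi> z - B \<phi> z) \<in> borel_measurable BM" using L2_measurable[OF \<psi>] Bm[OF \<phi>] by measurable
      fix \<theta> :: "complex ^ 'n \<Rightarrow> complex" assume \<theta>: "\<theta> \<in> Cc"
      note \<theta>' = Cc_cnj[OF \<theta>]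
      have i: "integrable BM (\<lambda>z. \<psi> z * \<theta> z)" "integrable BM (\<lambda>z. B \<phi> z * \<theta> z)"
        using BI[OF \<theta>' \<phi>] L2_prod_integrable[OF \<psi> Cc_L2[OF \<theta>]] by simp_all
      then show "integrable BM (\<lambda>z. (\<psi> z - B \<phi> z) * \<theta> z)"
        unfolding left_diff_distrib by (rule Bochner_Integration.integrable_diff)
      have "(LINT z|BM. \<psi> z * \<theta> z) = (LINT z|BM. B \<phi> z * \<theta> z)"
      proof -
        have "L2_inner BM \<psi> (\<lambda>z. cnj (\<theta> z)) = L2_inner BM (B \<phi>) (\<lambda>z. cnj (\<theta> z))"
          using B[OF \<theta>' \<phi>] c Cc_L2[OF \<theta>'] by (simp add: calculus_def)
        then show ?thesis by (simp add: L2_inner_def)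
      qed
      then show "(LINT z|BM. (\<psi> z - B \<phi> z) * \<theta> z) = 0"
        unfolding left_diff_distrib using i by (subst Bochner_Integration.integral_diff) auto
    qed
    then show ?thesis by eventually_elim simp
  qed
  have "calculus g \<phi> \<psi> \<longleftrightarrow> (AE z in BM. \<psi> z = B \<phi> z)" if L: "\<phi> \<in> L2 BM" "\<psi> \<in> L2 BM" for \<phi> \<psi>
  proof
    assume AE: "AE z in BM. \<psi> z = B \<phi> z"
    \<comment> \<open>The calculus supplies some representative; by \<open>calcB\<close> it agrees
      with \<psi> almost everywhere, so \<psi> is one too.\<close>
    obtain \<psi>' where \<psi>': "calculus g \<phi> \<psi>'" using calculus_exists[OF gb L(1)] by blast
    have L': "\<psi>' \<in> L2 BM" using \<psi>' by (simp add: calculus_def)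
    have "AE z in BM. \<psi> z = \<psi>' z" using AE calcB[OF \<psi>' L(1)] by eventually_elim simp
    then have "L2_inner BM \<psi> \<eta> = L2_inner BM \<psi>' \<eta>" if "\<eta> \<in> L2 BM" for \<eta>
      using that L(2) L' by (intro L2_inner_cong_AE L2_measurable) auto
    then show "calculus g \<phi> \<psi>" using \<psi>' L(2) by (simp add: calculus_def)
  qed (use calcB L in blast)
  moreover have "(\<phi>, \<psi>) \<in> spectral_integral BM E f \<longleftrightarrow> \<phi> \<in> L2 BM \<and> \<psi> \<in> L2 BM \<and> calculus g \<phi> \<psi>" for \<phi> \<psi>
    unfolding spectral_integral_def dom calculus_def using spec_form[of \<phi>] by (auto simp: spec_form_def)
  ultimately show ?thesis unfolding B_def by auto
qed

end

theorem theorem5p1: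
  fixes \<nu> :: real and n m :: nat
    and E :: "real set \<Rightarrow> (complex ^ 'n \<Rightarrow> complex) \<Rightarrow> (complex ^ 'n \<Rightarrow> complex)"
  assumes "n = CARD('n)"
    and "\<nu> > real n / 2"
    and "int m \<le> \<lfloor>\<nu> - real n / 2\<rfloor>"
    and "spectral_resolution bergman_measure laplace_beltrami_op E"
  shows "berezin_op \<nu> m =
    spectral_integral bergman_measure E
      (\<lambda>t. of_real ((cmod (Gamma (of_real (2 * (\<nu> - real m) - real n / 2)
                                 + \<i> / 2 * of_real (sqrt (- t - (real n)\<^sup>2)))))\<^sup>2) *
           (\<Sum>k\<le>2 * m. of_real (gamma_coeff \<nu> n m k) *
              wilson k (of_real (- t / 4 - (real n)\<^sup>2 / 4))
                (of_real (2 * (\<nu> - real m) - real n / 2))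
                (of_real (1 + real n / 2)) (of_real (real n / 2)) (of_real (real n / 2))))"
proof -
  interpret bergman_spectral E using assms(4) by unfold_locales
  define \<sigma> where "\<sigma> = 2 * (\<nu> - real m)"
  \<comment> \<open>The pairs (k, j) of the double sum, flattened into the one index set of
    \<open>kern_op_sum_graph\<close>.\<close>
  define I where "I = Sigma {..2 * m} (\<lambda>k. {..k})"
  let ?w = "\<lambda>p. kern_coeff \<nu> n m (fst p) (snd p)"
  let ?c = "\<lambda>p. berezin_const \<nu> n m * ?w p" and ?s = "\<lambda>p :: nat \<times> nat. \<sigma> + real (snd p)"
  \<comment> \<open>The bound on m gives \<sigma> \<ge> n > n/2, the range of exponents in which the
    kernels are square-integrable.\<close>
  have "real m \<le> \<nu> - real n / 2" using assms(3) by linarith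
  then have "real n \<le> \<sigma>" by (simp add: \<sigma>_def)
  moreover have "0 < real n" using assms(1) by simp
  ultimately have \<sigma>: "real n / 2 < \<sigma>" by simp
  then have s: "real CARD('n) / 2 < ?s p" for p using assms(1) by simp
  have SI: "(\<Sum>p\<in>I. h (fst p) (snd p)) = (\<Sum>k\<le>2 * m. \<Sum>j\<le>k. h k j)" for h :: "nat \<Rightarrow> nat \<Rightarrow> 'b :: comm_monoid_add"
    unfolding I_def by (subst sum.Sigma) (auto simp: split_beta)
  have graph: "spectral_integral bergman_measure E (berezin_symbol \<nu> n m) =
    {(\<phi>, \<psi>). \<phi> \<in> L2 BM \<and> \<psi> \<in> L2 BM \<and> (AE z in BM. \<psi> z = (\<Sum>p\<in>I. of_real (?c p) * kern_op (?s p) \<phi> z))}"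
  proof (rule kern_op_sum_graph)
    show "finite I" by (simp add: I_def)
    show "real CARD('n) / 2 < ?s p" for p by (rule s)
    show "berezin_symbol \<nu> n m \<in> borel_measurable borel"
      using \<sigma> unfolding \<sigma>_def by (rule berezin_symbol_measurable)
    fix t assume "t \<le> - (real CARD('n))\<^sup>2"
    then have t: "t \<le> - (real n)\<^sup>2" using assms(1) by simp
    have "kern_symbol s t = of_real (1 / inv_symbol (real n) s t)" for s
      using t assms(1) by (simp add: kern_symbol_def)
    then show "berezin_symbol \<nu> n m t = (\<Sum>p\<in>I. of_real (?c p) * (fact CARD('n) * kern_symbol (?s p) t))"
      using berezin_symbol_eq[OF \<sigma>[unfolded \<sigma>_def] t, folded \<sigma>_def]
      unfolding assms(1)[symmetric]
      unfolding SI[of "\<lambda>k j. of_real (berezin_const \<nu> n m * kern_coeff \<nu> n m k j) * (fact n * kern_symbol (\<sigma> + real j) t)"]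
      by simp
  qed
  \<comment> \<open>Holds at every point of the ball, as the kernel is square-integrable for each z;
    the integrability clause of \<open>berezin_op\<close> is thereby satisfied for all
    \<phi>.\<close>
  have B: "integrable BM (berezin_integrand \<nu> m \<phi> z) \<and> berezin \<nu> m \<phi> z = (\<Sum>p\<in>I. of_real (?c p) * kern_op (?s p) \<phi> z)"
    if \<phi>: "\<phi> \<in> L2 BM" and z: "z \<in> unit_ball" for \<phi> :: "complex ^ 'n \<Rightarrow> complex" and z
  proof -
    let ?k = "\<lambda>w. \<Sum>p\<in>I. of_real (?w p) * (of_real (kern (?s p) z w) * \<phi> w)"
    have eq: "berezin_integrand \<nu> m \<phi> z w = ?k w" if w: "w \<in> space BM" for w
    proof -
      have "w \<in> unit_ball" using w by simp
      note berezin_kernel[OF \<sigma>[unfolded assms(1) \<sigma>_def] z this]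
      then have "(jacobi m (real CARD('n) - 1) (2 * (\<nu> - real m) - real CARD('n))
                 (1 - 2 * (tanh (bergman_dist z w))\<^sup>2))\<^sup>2 / cosh (bergman_dist z w) powr (4 * (\<nu> - real m)) =
          (\<Sum>p\<in>I. ?w p * kern (?s p) z w)"
        unfolding SI[of "\<lambda>k j. kern_coeff \<nu> n m k j * kern (\<sigma> + real j) z w"] by (simp only: assms(1) \<sigma>_def)
      then show ?thesis
        unfolding berezin_integrand_def by (simp only: of_real_sum of_real_mult sum_distrib_right mult.assoc)
    qed
    have i: "integrable BM (\<lambda>w. of_real (?w p) * (of_real (kern (?s p) z w) * \<phi> w))" for p
      using kern_L2_integrable[OF s z \<phi>] by (rule integrable_mult_right)
    have "integrable BM ?k" using i by (rule Bochner_Integration.integrable_sum)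
    then have "integrable BM (berezin_integrand \<nu> m \<phi> z)"
      by (subst Bochner_Integration.integrable_cong[OF refl eq, of BM])
    moreover have "(LINT w|BM. berezin_integrand \<nu> m \<phi> z w) = (LINT w|BM. ?k w)"
      by (rule Bochner_Integration.integral_cong[OF refl eq])
    moreover have "(LINT w|BM. ?k w) = (\<Sum>p\<in>I. of_real (?w p) * kern_op (?s p) \<phi> z)"
      unfolding kern_op_def using i by (subst Bochner_Integration.integral_sum) auto
    ultimately show ?thesis
      unfolding berezin_def assms(1)[symmetric] by (simp add: sum_distrib_left mult.assoc)
  qed
  have "(AE z in BM. integrable BM (berezin_integrand \<nu> m \<phi> z) \<and> \<psi> z = berezin \<nu> m \<phi> z) \<longleftrightarrow>
      (AE z in BM. \<psi> z = (\<Sum>p\<in>I. of_real (?c p) * kern_op (?s p) \<phi> z))" if "\<phi> \<in> L2 BM" for \<phi> \<psi> :: "complex ^ 'n \<Rightarrow> complex"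
    by (rule AE_cong) (use B[OF that] in auto)
  then have "berezin_op \<nu> m = spectral_integral bergman_measure E (berezin_symbol \<nu> n m)"
    unfolding graph berezin_op_def by blast
  then show ?thesis unfolding berezin_symbol_def[abs_def] .
qed

end
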